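(* Let $(E,[\![\cdot,\cdot]\!],\rho,\alpha)$ be a Loday algebroid over $M$, $B$ a vector bundle over $M$ equipped with a fiberwise nondegenerate symmetric bilinear form $g$, $\nabla$ a flat nonlinear $E$-connection on $B$, and $\nabla^g$ its conjugated connection (which is then also flat). Let $\nabla_m$ be a metric nonlinear $E$-connection on $B$ compatible with $g$, in the sense that $\nabla_m^g=\nabla_m$. Let $p\ge1$ be an integer and $u_{2p-1}(E,B)=[\mathrm{cs}_p(\nabla,\nabla^g)]\in H^{2p-1}(\mathcal E)$. 1. If $p$ is even, then $u_{2p-1}(E,B)=0$. 2. If $p$ is odd, then $\mathrm{cs}_p(\nabla,\nabla_m)$ is $\partial_E$-closed and $u_{2p-1}(E,B)=2\,[\mathrm{cs}_p(\nabla,\nabla_m)]$.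
   Context: A Loday algebroid $(E,[\![\cdot,\cdot]\!],\rho,\alpha)$ over a smooth manifold $M$ consists of a vector bundle $E\to M$ of constant rank, an $\mathbb R$-bilinear bracket $[\![\cdot,\cdot]\!]$ on $\Gamma(E)$ (not necessarily skew-symmetric) with $[\![e_1,[\![e_2,e_3]\!]]\!]=[\![[\![e_1,e_2]\!],e_3]\!]+[\![e_2,[\![e_1,e_3]\!]]\!]$, and vector bundle morphisms over $\mathrm{id}_M$, $\rho:E\to TM$ and $\alpha:T^*M\otimes E\to\mathrm{End}(E)$, with $[\![e_1,fe_2]\!]=f[\![e_1,e_2]\!]+\rho(e_1)(f)e_2$ and $[\![fe_1,e_2]\!]=f[\![e_1,e_2]\!]-\rho(e_2)(f)e_1+\alpha(df\otimes e_1)(e_2)$. (Then $\rho([\![e_1,e_2]\!])=[\rho(e_1),\rho(e_2)]$.) Put $\mathcal E=\Gamma(E)$; $\mathrm{End}(\Gamma(B))$ denotes $C^\infty(M,\mathbb R)$-linear endomorphisms. $\mathcal D^p(\mathcal E)$ (resp. $\mathcal D^p(\mathcal E,\mathrm{End}(\Gamma(B)))$) is the space of $\mathbb R$-multilinear maps $\mathcal E^p\to C^\infty(M,\mathbb R)$ (resp. $\mathrm{End}(\Gamma(B))$) that are differential operators in each argument (degree $p$). The operator $\partial_E:\mathcal D^p(\mathcal E)\to\mathcal D^{p+1}(\mathcal E)$, $$\partial_ED(e_1,\dots,e_{p+1})=\sum_i(-1)^{i+1}\rho(e_i)D(\dots,\hat e_i,\dots)+\sum_{i<j}(-1)^iD(e_1,\dots,\hat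 e_i,\dots,\hat e_j,[\![e_i,e_j]\!],e_{j+1},\dots,e_{p+1}),$$ satisfies $\partial_E^2=0$; its cohomology is the Loday algebroid cohomology $H^\bullet(\mathcal E)$. A nonlinear $E$-connection on $B$ is an $\mathbb R$-bilinear map $\nabla:\Gamma(E)\times\Gamma(B)\to\Gamma(B)$ with $\nabla_e(fb)=f\nabla_eb+\rho(e)(f)b$ and $\nabla_{fe}b=f\nabla_eb+\sigma(df\otimes e)(b)$ for some vector bundle map $\sigma:T^*M\otimes E\to\mathrm{End}(B)$. Its curvature is $R^\nabla(e_1,e_2)=\nabla_{e_1}\nabla_{e_2}-\nabla_{e_2}\nabla_{e_1}-\nabla_{[\![e_1,e_2]\!]}$, and $\nabla$ is flat if $R^\nabla=0$. The conjugated connection $\nabla^g$ is defined by $\rho(e)g(b_1,b_2)=g(\nabla^g_eb_1,b_2)+g(b_1,\nabla_eb_2)$. For $\Delta\in\mathcal D^p(\mathcal E,\mathrm{End}(\Gamma(B)))$, $\Delta'\in\mathcal D^q(\mathcal E,\mathrm{End}(\Gamma(B)))$, $(\Delta\diamond\Delta')(e_1,\dots,e_{p+q})=\sum_\tau(-1)^{|\tau|}\Delta(e_{\tau(1)},\dots,e_{\tau(p)})\circ\Delta'(e_{\tau(p+1)},\dots,e_{\tau(p+q)})$ over $(p,q)$-shuffles. The product $\odot$ is its graded symmetrization: $\Delta_1\odot\dots\odot\Delta_n=\sum_{\tau\in S_n}\epsilon(\tau)\,\Delta_{\tau(1)}\diamond\dots\diamond\Delta_{\tau(n)}$, $\epsilon(\tau)$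 the Koszul sign (for $n=2$: $\Delta_1\diamond\Delta_2+(-1)^{p_1p_2}\Delta_2\diamond\Delta_1$). A power $(R^\nabla)^m$ in a $\odot$-product means $m$ factors $R^\nabla$. The trace is taken valuewise. For two nonlinear $E$-connections $\nabla^0,\nabla^1$ let $\nabla^{0,1}=(1-t)\nabla^0+t\nabla^1$ and $$\mathrm{cs}_p(\nabla^0,\nabla^1)=\int_0^1\mathrm{tr}\Big((\nabla^1-\nabla^0)\odot(R^{\nabla^{0,1}})^{p-1}\Big)dt\in\mathcal D^{2p-1}(\mathcal E).$$ For $\nabla$ flat, $\mathrm{cs}_p(\nabla,\nabla^g)$ is $\partial_E$-closed, and its class $u_{2p-1}(E,B)$ is called a secondary characteristic class of the representation $B$. *)

theory Defs
  imports
    "HOL-Analysis.Analysis"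
    "HOL-Combinatorics.Permutations"
    "HOL-Library.Function_Algebras"
begin

text \<open>Functions are added and multiplied pointwise (Function_Algebras); the following instance
  makes them a real vector space whenever the values form one.\<close>

instantiation "fun" :: (type, real_vector) real_vector
begin

definition scaleR_fun_def: "c *\<^sub>R f = (\<lambda>x. c *\<^sub>R f x)"

instance
  by standard (simp_all add: scaleR_fun_def fun_eq_iff scaleR_add_right scaleR_add_left)

end

definition linear_between ::
  "'v::real_vector set \<Rightarrow> 'w::real_vector set \<Rightarrow> ('v \<Rightarrow> 'w) \<Rightarrow> bool" where
  "linear_between V W f \<longleftrightarrow>
     (\<forall>u\<in>V. f u \<in> W) \<and>
     (\<forall>u\<in>V. \<forall>v\<in>V. f (u + v) = f u + f v) \<and>
     (\<forall>c. \<forall>u\<in>V. f (c *\<^sub>R u) = c *\<^sub>R f u)"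

definition trace_on :: "'v::real_vector set \<Rightarrow> ('v \<Rightarrow> 'v) \<Rightarrow> real" where
  "trace_on V f =
     (let B = (SOME B. independent B \<and> span B = V) in \<Sum>b\<in>B. representation B (f b) b)"


section \<open>Smooth manifolds\<close>

text \<open>\<open>Ck_on k S f\<close>: \<open>f\<close> is \<open>k\<close> times continuously differentiable on \<open>S\<close>, for \<open>S\<close> open in a
  finite-dimensional space.\<close>

primrec Ck_on ::
  "nat \<Rightarrow> 'a::real_normed_vector set \<Rightarrow> ('a \<Rightarrow> 'b::real_normed_vector) \<Rightarrow> bool" where
  "Ck_on 0 S f \<longleftrightarrow> continuous_on S f"
| "Ck_on (Suc k) S f \<longleftrightarrow>
     (\<forall>x\<in>S. f differentiable (at x)) \<and> (\<forall>v. Ck_on k S (\<lambda>x. frechet_derivative f (at x) v))"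

definition smooth_map_on ::
  "'a::real_normed_vector set \<Rightarrow> ('a \<Rightarrow> 'b::real_normed_vector) \<Rightarrow> bool" where
  "smooth_map_on S f \<longleftrightarrow> (\<forall>k. Ck_on k S f)"

text \<open>The model space is only required to be a finite-dimensional \<open>real_inner\<close> space, not a
  \<open>euclidean_space\<close>, so that manifolds of dimension \<open>0\<close> are included.\<close>

type_synonym ('m, 'd) chart = "'m set \<times> ('m \<Rightarrow> 'd)"

definition smooth_manifold ::
  "('m::{t2_space,second_countable_topology}, 'd::real_inner) chart set \<Rightarrow> bool" where
  "smooth_manifold A \<longleftrightarrow>
     (\<exists>B::'d set. finite B \<and> span B = UNIV) \<and>
     \<Union>(fst ` A) = UNIV \<and>
     (\<forall>(U, \<kappa>)\<in>A. open U \<and> open (\<kappa> ` U) \<and> homeomorphism U (\<kappa> ` U) \<kappa> (inv_into U \<kappa>)) \<and>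
     (\<forall>(U, \<kappa>)\<in>A. \<forall>(V, \<psi>)\<in>A. smooth_map_on (\<kappa> ` (U \<inter> V)) (\<psi> \<circ> inv_into U \<kappa>))"

definition smooth_fun_on ::
  "('m::topological_space, 'd::real_inner) chart set \<Rightarrow> 'm set \<Rightarrow> ('m \<Rightarrow> real) \<Rightarrow> bool" where
  "smooth_fun_on A W f \<longleftrightarrow> (\<forall>(U, \<kappa>)\<in>A. smooth_map_on (\<kappa> ` (U \<inter> W)) (f \<circ> inv_into U \<kappa>))"

definition Cinf ::
  "('m::topological_space, 'd::real_inner) chart set \<Rightarrow> ('m \<Rightarrow> real) set" where
  "Cinf A = {f. smooth_fun_on A UNIV f}"

text \<open>Tangent vectors at \<open>x\<close> are derivations at \<open>x\<close> of the algebra of smooth functions. Tangent and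
  cotangent vectors are set to \<open>0\<close> outside their domains, so that equality is equality on the
  domain.\<close>

type_synonym 'm tangent = "('m \<Rightarrow> real) \<Rightarrow> real"
type_synonym 'm cotangent = "'m tangent \<Rightarrow> real"

definition tangent_space ::
  "('m::topological_space, 'd::real_inner) chart set \<Rightarrow> 'm \<Rightarrow> 'm tangent set" where
  "tangent_space A x =
     {X. linear_between (Cinf A) UNIV X \<and>
         (\<forall>f\<in>Cinf A. \<forall>h\<in>Cinf A. X (f * h) = f x * X h + h x * X f) \<and>
         (\<forall>f. f \<notin> Cinf A \<longrightarrow> X f = 0)}"

definition cotangent_space ::
  "('m::topological_space, 'd::real_inner) chart set \<Rightarrow> 'm \<Rightarrow> 'm cotangent set" where
  "cotangent_space A x =
     {\<xi>. linear_between (tangent_space A x) UNIV \<xi> \<and> (\<forall>X. X \<notin> tangent_space A x \<longrightarrow> \<xi> X = 0)}"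

definition vector_fields ::
  "('m::topological_space, 'd::real_inner) chart set \<Rightarrow> ('m \<Rightarrow> 'm tangent) set" where
  "vector_fields A =
     {X. (\<forall>x. X x \<in> tangent_space A x) \<and> (\<forall>f\<in>Cinf A. (\<lambda>x. X x f) \<in> Cinf A)}"

definition one_forms ::
  "('m::topological_space, 'd::real_inner) chart set \<Rightarrow> ('m \<Rightarrow> 'm cotangent) set" where
  "one_forms A =
     {\<omega>. (\<forall>x. \<omega> x \<in> cotangent_space A x) \<and> (\<forall>X\<in>vector_fields A. (\<lambda>x. \<omega> x (X x)) \<in> Cinf A)}"

definition differential ::
  "('m::topological_space, 'd::real_inner) chart set \<Rightarrow> ('m \<Rightarrow> real) \<Rightarrow> 'm \<Rightarrow> 'm cotangent" where
  "differential A f x = (\<lambda>X. if X \<in> tangent_space A x then X f else 0)"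


section \<open>Vector bundles\<close>

text \<open>The fibres are subspaces, varying with the base point, of an ambient real vector space that
  carries no topology. A local trivialisation over \<open>U\<close> is given by linear isomorphisms
  \<open>\<phi> x\<close> (for \<open>x \<in> U\<close>) from the fibre onto \<open>coord_space r\<close>, a copy of \<open>r\<close>-dimensional
  coordinate space; the smooth structure comes from the smoothness of the transition functions.\<close>

definition coord_space :: "nat \<Rightarrow> (nat \<Rightarrow> real) set" where
  "coord_space r = {a. \<forall>i\<ge>r. a i = 0}"

record ('m, 'v) vbundle =
  vrank :: nat
  fibre :: "'m \<Rightarrow> 'v set"
  trivs :: "('m set \<times> ('m \<Rightarrow> 'v \<Rightarrow> nat \<Rightarrow> real)) set"

definition smooth_vector_bundle ::
  "('m::topological_space, 'd::real_inner) chart set \<Rightarrow> ('m, 'v::real_vector) vbundle \<Rightarrow> bool" where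
  "smooth_vector_bundle A E \<longleftrightarrow>
     (\<forall>x. subspace (fibre E x)) \<and>
     \<Union>(fst ` trivs E) = UNIV \<and>
     (\<forall>(U, \<phi>)\<in>trivs E. open U \<and>
        (\<forall>x\<in>U. linear_between (fibre E x) (coord_space (vrank E)) (\<phi> x) \<and>
               bij_betw (\<phi> x) (fibre E x) (coord_space (vrank E)))) \<and>
     (\<forall>(U, \<phi>)\<in>trivs E. \<forall>(V, \<psi>)\<in>trivs E. \<forall>a\<in>coord_space (vrank E). \<forall>i<vrank E.
        smooth_fun_on A (U \<inter> V) (\<lambda>x. \<psi> x (inv_into (fibre E x) (\<phi> x) a) i))"

definition sections ::
  "('m::topological_space, 'd::real_inner) chart set \<Rightarrow> ('m, 'v::real_vector) vbundle
    \<Rightarrow> ('m \<Rightarrow> 'v) set" where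
  "sections A E =
     {s. (\<forall>x. s x \<in> fibre E x) \<and>
         (\<forall>(U, \<phi>)\<in>trivs E. \<forall>i<vrank E. smooth_fun_on A U (\<lambda>x. \<phi> x (s x) i))}"

definition fscale :: "('m \<Rightarrow> real) \<Rightarrow> ('m \<Rightarrow> 'v::real_vector) \<Rightarrow> 'm \<Rightarrow> 'v"  (infixr "\<bullet>\<^sub>M" 75) where
  "f \<bullet>\<^sub>M s = (\<lambda>x. f x *\<^sub>R s x)"

definition bilinear_on_sections ::
  "('m \<Rightarrow> 'v::real_vector) set \<Rightarrow> ('m \<Rightarrow> 'w::real_vector) set
    \<Rightarrow> (('m \<Rightarrow> 'v) \<Rightarrow> ('m \<Rightarrow> 'w) \<Rightarrow> ('m \<Rightarrow> 'w)) \<Rightarrow> bool" where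
  "bilinear_on_sections S T N \<longleftrightarrow>
     (\<forall>s\<in>S. linear_between T T (N s)) \<and> (\<forall>t\<in>T. linear_between S T (\<lambda>s. N s t))"

text \<open>Vector bundle morphisms over the identity are fibrewise linear maps that send smooth sections
  to smooth sections; a morphism defined on a tensor product is given by the corresponding
  fibrewise multilinear map.\<close>

definition anchor_map ::
  "('m::topological_space, 'd::real_inner) chart set \<Rightarrow> ('m, 'e::real_vector) vbundle
    \<Rightarrow> ('m \<Rightarrow> 'e \<Rightarrow> 'm tangent) \<Rightarrow> bool" where
  "anchor_map A E \<rho> \<longleftrightarrow>
     (\<forall>x. linear_between (fibre E x) (tangent_space A x) (\<rho> x)) \<and>
     (\<forall>e\<in>sections A E. (\<lambda>x. \<rho> x (e x)) \<in> vector_fields A)"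

definition cotensor_End_map ::
  "('m::topological_space, 'd::real_inner) chart set \<Rightarrow> ('m, 'e::real_vector) vbundle
    \<Rightarrow> ('m, 'b::real_vector) vbundle \<Rightarrow> ('m \<Rightarrow> 'm cotangent \<Rightarrow> 'e \<Rightarrow> 'b \<Rightarrow> 'b) \<Rightarrow> bool" where
  "cotensor_End_map A E B \<sigma> \<longleftrightarrow>
     (\<forall>x. \<forall>v\<in>fibre E x. \<forall>w\<in>fibre B x.
        linear_between (cotangent_space A x) (fibre B x) (\<lambda>\<xi>. \<sigma> x \<xi> v w)) \<and>
     (\<forall>x. \<forall>\<xi>\<in>cotangent_space A x. \<forall>w\<in>fibre B x.
        linear_between (fibre E x) (fibre B x) (\<lambda>v. \<sigma> x \<xi> v w)) \<and>
     (\<forall>x. \<forall>\<xi>\<in>cotangent_space A x. \<forall>v\<in>fibre E x.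
        linear_between (fibre B x) (fibre B x) (\<sigma> x \<xi> v)) \<and>
     (\<forall>\<omega>\<in>one_forms A. \<forall>e\<in>sections A E. \<forall>b\<in>sections A B.
        (\<lambda>x. \<sigma> x (\<omega> x) (e x) (b x)) \<in> sections A B)"

definition bundle_metric ::
  "('m::topological_space, 'd::real_inner) chart set \<Rightarrow> ('m, 'b::real_vector) vbundle
    \<Rightarrow> ('m \<Rightarrow> 'b \<Rightarrow> 'b \<Rightarrow> real) \<Rightarrow> bool" where
  "bundle_metric A B g \<longleftrightarrow>
     (\<forall>x. \<forall>u\<in>fibre B x. linear_between (fibre B x) UNIV (g x u)) \<and>
     (\<forall>x. \<forall>u\<in>fibre B x. \<forall>v\<in>fibre B x. g x u v = g x v u) \<and>
     (\<forall>x. \<forall>u\<in>fibre B x. (\<forall>v\<in>fibre B x. g x u v = 0) \<longrightarrow> u = 0) \<and>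
     (\<forall>b\<in>sections A B. \<forall>c\<in>sections A B. (\<lambda>x. g x (b x) (c x)) \<in> Cinf A)"


section \<open>Loday algebroids\<close>

definition anchor_deriv ::
  "('m \<Rightarrow> 'e \<Rightarrow> 'm tangent) \<Rightarrow> ('m \<Rightarrow> 'e) \<Rightarrow> ('m \<Rightarrow> real) \<Rightarrow> 'm \<Rightarrow> real" where
  "anchor_deriv \<rho> e f = (\<lambda>x. \<rho> x (e x) f)"

definition loday_algebroid ::
  "('m::topological_space, 'd::real_inner) chart set \<Rightarrow> ('m, 'e::real_vector) vbundle
    \<Rightarrow> (('m \<Rightarrow> 'e) \<Rightarrow> ('m \<Rightarrow> 'e) \<Rightarrow> ('m \<Rightarrow> 'e)) \<Rightarrow> ('m \<Rightarrow> 'e \<Rightarrow> 'm tangent)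
    \<Rightarrow> ('m \<Rightarrow> 'm cotangent \<Rightarrow> 'e \<Rightarrow> 'e \<Rightarrow> 'e) \<Rightarrow> bool" where
  "loday_algebroid A E br \<rho> \<alpha> \<longleftrightarrow>
     smooth_vector_bundle A E \<and>
     bilinear_on_sections (sections A E) (sections A E) br \<and>
     anchor_map A E \<rho> \<and>
     cotensor_End_map A E E \<alpha> \<and>
     (\<forall>e1\<in>sections A E. \<forall>e2\<in>sections A E. \<forall>e3\<in>sections A E.
        br e1 (br e2 e3) = br (br e1 e2) e3 + br e2 (br e1 e3)) \<and>
     (\<forall>f\<in>Cinf A. \<forall>e1\<in>sections A E. \<forall>e2\<in>sections A E.
        br e1 (f \<bullet>\<^sub>M e2) = f \<bullet>\<^sub>M br e1 e2 + anchor_deriv \<rho> e1 f \<bullet>\<^sub>M e2) \<and>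
     (\<forall>f\<in>Cinf A. \<forall>e1\<in>sections A E. \<forall>e2\<in>sections A E.
        br (f \<bullet>\<^sub>M e1) e2 = f \<bullet>\<^sub>M br e1 e2 - anchor_deriv \<rho> e2 f \<bullet>\<^sub>M e1
                          + (\<lambda>x. \<alpha> x (differential A f x) (e1 x) (e2 x)))"


section \<open>Loday algebroid cohomology\<close>

text \<open>A \<open>k\<close>-cochain is a function on lists of sections, of which only the values on lists of length
  \<open>k\<close> with entries in the space of smooth sections matter.\<close>

definition tuples :: "nat \<Rightarrow> 's set \<Rightarrow> 's list set" where
  "tuples k S = {es. length es = k \<and> set es \<subseteq> S}"

text \<open>Linear differential operators of order at most \<open>k\<close>, by iterated commutators with
  multiplication by smooth functions.\<close>

primrec diff_op_le ::
  "nat \<Rightarrow> ('m::topological_space, 'd::real_inner) chart set \<Rightarrow> ('m, 'e::real_vector) vbundle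
    \<Rightarrow> (('m \<Rightarrow> 'e) \<Rightarrow> ('m \<Rightarrow> real)) \<Rightarrow> bool" where
  "diff_op_le 0 A E P \<longleftrightarrow> (\<forall>f\<in>Cinf A. \<forall>e\<in>sections A E. P (f \<bullet>\<^sub>M e) = f * P e)"
| "diff_op_le (Suc k) A E P \<longleftrightarrow> (\<forall>f\<in>Cinf A. diff_op_le k A E (\<lambda>e. P (f \<bullet>\<^sub>M e) - f * P e))"

definition cochains ::
  "('m::topological_space, 'd::real_inner) chart set \<Rightarrow> ('m, 'e::real_vector) vbundle \<Rightarrow> nat
    \<Rightarrow> (('m \<Rightarrow> 'e) list \<Rightarrow> 'm \<Rightarrow> real) set" where
  "cochains A E k =
     {D. \<forall>es\<in>tuples k (sections A E). D es \<in> Cinf A \<and>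
           (\<forall>i<k. linear_between (sections A E) (Cinf A) (\<lambda>e. D (es[i := e])) \<and>
                  (\<exists>n. diff_op_le n A E (\<lambda>e. D (es[i := e]))))}"

definition omit :: "nat \<Rightarrow> 'a list \<Rightarrow> 'a list" where
  "omit i xs = take i xs @ drop (Suc i) xs"

text \<open>List positions start at \<open>0\<close>, which shifts the exponents of the signs by one compared with the
  usual formula.\<close>

definition loday_d ::
  "(('m \<Rightarrow> 'e) \<Rightarrow> ('m \<Rightarrow> 'e) \<Rightarrow> ('m \<Rightarrow> 'e)) \<Rightarrow> ('m \<Rightarrow> 'e \<Rightarrow> 'm tangent)
    \<Rightarrow> (('m \<Rightarrow> 'e) list \<Rightarrow> 'm \<Rightarrow> real) \<Rightarrow> ('m \<Rightarrow> 'e) list \<Rightarrow> 'm \<Rightarrow> real" where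
  "loday_d br \<rho> D es =
     (\<Sum>i<length es. (-1) ^ i *\<^sub>R anchor_deriv \<rho> (es ! i) (D (omit i es))) +
     (\<Sum>i<length es. \<Sum>j\<in>{i<..<length es}.
        (-1) ^ (i + 1) *\<^sub>R D (omit i (es[j := br (es ! i) (es ! j)])))"

definition cocycles ::
  "('m::topological_space, 'd::real_inner) chart set \<Rightarrow> ('m, 'e::real_vector) vbundle
    \<Rightarrow> (('m \<Rightarrow> 'e) \<Rightarrow> ('m \<Rightarrow> 'e) \<Rightarrow> ('m \<Rightarrow> 'e)) \<Rightarrow> ('m \<Rightarrow> 'e \<Rightarrow> 'm tangent) \<Rightarrow> nat
    \<Rightarrow> (('m \<Rightarrow> 'e) list \<Rightarrow> 'm \<Rightarrow> real) set" where
  "cocycles A E br \<rho> k =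
     {D \<in> cochains A E k. \<forall>es\<in>tuples (Suc k) (sections A E). loday_d br \<rho> D es = 0}"

definition coboundaries ::
  "('m::topological_space, 'd::real_inner) chart set \<Rightarrow> ('m, 'e::real_vector) vbundle
    \<Rightarrow> (('m \<Rightarrow> 'e) \<Rightarrow> ('m \<Rightarrow> 'e) \<Rightarrow> ('m \<Rightarrow> 'e)) \<Rightarrow> ('m \<Rightarrow> 'e \<Rightarrow> 'm tangent) \<Rightarrow> nat
    \<Rightarrow> (('m \<Rightarrow> 'e) list \<Rightarrow> 'm \<Rightarrow> real) set" where
  "coboundaries A E br \<rho> k =
     (case k of
        0 \<Rightarrow> {D. \<forall>es\<in>tuples 0 (sections A E). D es = 0}
      | Suc l \<Rightarrow> {D. \<exists>C\<in>cochains A E l. \<forall>es\<in>tuples k (sections A E). D es = loday_d br \<rho> C es})"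

text \<open>Cohomology classes are cosets of the coboundaries in the space of cocycles. The coset of a
  cochain that is not closed is empty, and so is not a cohomology class.\<close>

definition coh_class ::
  "('m::topological_space, 'd::real_inner) chart set \<Rightarrow> ('m, 'e::real_vector) vbundle
    \<Rightarrow> (('m \<Rightarrow> 'e) \<Rightarrow> ('m \<Rightarrow> 'e) \<Rightarrow> ('m \<Rightarrow> 'e)) \<Rightarrow> ('m \<Rightarrow> 'e \<Rightarrow> 'm tangent) \<Rightarrow> nat
    \<Rightarrow> (('m \<Rightarrow> 'e) list \<Rightarrow> 'm \<Rightarrow> real) \<Rightarrow> (('m \<Rightarrow> 'e) list \<Rightarrow> 'm \<Rightarrow> real) set" where
  "coh_class A E br \<rho> k D = {D' \<in> cocycles A E br \<rho> k. D' - D \<in> coboundaries A E br \<rho> k}"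

definition coh_scale ::
  "('m::topological_space, 'd::real_inner) chart set \<Rightarrow> ('m, 'e::real_vector) vbundle
    \<Rightarrow> (('m \<Rightarrow> 'e) \<Rightarrow> ('m \<Rightarrow> 'e) \<Rightarrow> ('m \<Rightarrow> 'e)) \<Rightarrow> ('m \<Rightarrow> 'e \<Rightarrow> 'm tangent) \<Rightarrow> nat
    \<Rightarrow> real \<Rightarrow> (('m \<Rightarrow> 'e) list \<Rightarrow> 'm \<Rightarrow> real) set \<Rightarrow> (('m \<Rightarrow> 'e) list \<Rightarrow> 'm \<Rightarrow> real) set" where
  "coh_scale A E br \<rho> k c K = (\<Union>D\<in>K. coh_class A E br \<rho> k (c *\<^sub>R D))"


section \<open>Nonlinear connections\<close>

type_synonym ('m, 'e, 'b) conn = "('m \<Rightarrow> 'e) \<Rightarrow> ('m \<Rightarrow> 'b) \<Rightarrow> ('m \<Rightarrow> 'b)"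

definition nonlinear_connection ::
  "('m::topological_space, 'd::real_inner) chart set \<Rightarrow> ('m, 'e::real_vector) vbundle
    \<Rightarrow> ('m \<Rightarrow> 'e \<Rightarrow> 'm tangent) \<Rightarrow> ('m, 'b::real_vector) vbundle \<Rightarrow> ('m, 'e, 'b) conn \<Rightarrow> bool" where
  "nonlinear_connection A E \<rho> B nab \<longleftrightarrow>
     bilinear_on_sections (sections A E) (sections A B) nab \<and>
     (\<forall>f\<in>Cinf A. \<forall>e\<in>sections A E. \<forall>b\<in>sections A B.
        nab e (f \<bullet>\<^sub>M b) = f \<bullet>\<^sub>M nab e b + anchor_deriv \<rho> e f \<bullet>\<^sub>M b) \<and>
     (\<exists>\<sigma>. cotensor_End_map A E B \<sigma> \<and>
        (\<forall>f\<in>Cinf A. \<forall>e\<in>sections A E. \<forall>b\<in>sections A B.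
           nab (f \<bullet>\<^sub>M e) b = f \<bullet>\<^sub>M nab e b + (\<lambda>x. \<sigma> x (differential A f x) (e x) (b x))))"

definition curvature ::
  "(('m \<Rightarrow> 'e) \<Rightarrow> ('m \<Rightarrow> 'e) \<Rightarrow> ('m \<Rightarrow> 'e)) \<Rightarrow> ('m, 'e, 'b::real_vector) conn
    \<Rightarrow> ('m \<Rightarrow> 'e) \<Rightarrow> ('m \<Rightarrow> 'e) \<Rightarrow> ('m \<Rightarrow> 'b) \<Rightarrow> ('m \<Rightarrow> 'b)" where
  "curvature br nab e1 e2 b = nab e1 (nab e2 b) - nab e2 (nab e1 b) - nab (br e1 e2) b"

definition flat ::
  "('m::topological_space, 'd::real_inner) chart set \<Rightarrow> ('m, 'e::real_vector) vbundle
    \<Rightarrow> (('m \<Rightarrow> 'e) \<Rightarrow> ('m \<Rightarrow> 'e) \<Rightarrow> ('m \<Rightarrow> 'e)) \<Rightarrow> ('m, 'b::real_vector) vbundle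
    \<Rightarrow> ('m, 'e, 'b) conn \<Rightarrow> bool" where
  "flat A E br B nab \<longleftrightarrow>
     (\<forall>e1\<in>sections A E. \<forall>e2\<in>sections A E. \<forall>b\<in>sections A B. curvature br nab e1 e2 b = 0)"

definition conjugate ::
  "('m::topological_space, 'd::real_inner) chart set \<Rightarrow> ('m \<Rightarrow> 'e \<Rightarrow> 'm tangent)
    \<Rightarrow> ('m, 'b::real_vector) vbundle \<Rightarrow> ('m \<Rightarrow> 'b \<Rightarrow> 'b \<Rightarrow> real)
    \<Rightarrow> ('m, 'e, 'b) conn \<Rightarrow> ('m, 'e, 'b) conn" where
  "conjugate A \<rho> B g nab e b1 =
     (THE c. c \<in> sections A B \<and>
        (\<forall>b2\<in>sections A B. anchor_deriv \<rho> e (\<lambda>x. g x (b1 x) (b2 x)) =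
           (\<lambda>x. g x (c x) (b2 x)) + (\<lambda>x. g x (b1 x) (nab e b2 x))))"


section \<open>Chern--Simons cochains\<close>

text \<open>An \<open>End\<close>-valued cochain is paired with its degree. The permutations below act on positions
  starting at \<open>0\<close>.\<close>

type_synonym ('m, 'e, 'b) end_cochain = "('m \<Rightarrow> 'e) list \<Rightarrow> ('m \<Rightarrow> 'b) \<Rightarrow> ('m \<Rightarrow> 'b)"

definition unshuffles :: "nat \<Rightarrow> nat \<Rightarrow> (nat \<Rightarrow> nat) set" where
  "unshuffles p q =
     {\<tau>. \<tau> permutes {..<p + q} \<and> strict_mono_on {..<p} \<tau> \<and> strict_mono_on {p..<p + q} \<tau>}"

definition diamond ::
  "nat \<times> ('m, 'e, 'b::real_vector) end_cochain \<Rightarrow> nat \<times> ('m, 'e, 'b) end_cochain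
    \<Rightarrow> nat \<times> ('m, 'e, 'b) end_cochain" where
  "diamond = (\<lambda>(p, \<Delta>) (q, \<Delta>').
     (p + q,
      \<lambda>es. \<Sum>\<tau>\<in>unshuffles p q.
        of_int (sign \<tau>) *\<^sub>R
          (\<Delta> (map (\<lambda>i. es ! \<tau> i) [0..<p]) \<circ> \<Delta>' (map (\<lambda>i. es ! \<tau> i) [p..<p + q]))))"

definition diamonds ::
  "(nat \<times> ('m, 'e, 'b::real_vector) end_cochain) list \<Rightarrow> nat \<times> ('m, 'e, 'b) end_cochain" where
  "diamonds \<Delta>s = foldr diamond \<Delta>s (0, \<lambda>es. id)"

definition koszul_sign :: "(nat \<Rightarrow> nat) \<Rightarrow> nat \<Rightarrow> (nat \<Rightarrow> nat) \<Rightarrow> real" where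
  "koszul_sign deg n \<tau> =
     (\<Prod>(i, j)\<in>{(i, j). i < j \<and> j < n \<and> \<tau> j < \<tau> i}. (-1) ^ (deg (\<tau> i) * deg (\<tau> j)))"

definition odot ::
  "(nat \<times> ('m, 'e, 'b::real_vector) end_cochain) list \<Rightarrow> ('m, 'e, 'b) end_cochain" where
  "odot \<Delta>s = (\<lambda>es. \<Sum>\<tau>\<in>{\<tau>. \<tau> permutes {..<length \<Delta>s}}.
     koszul_sign (\<lambda>i. fst (\<Delta>s ! i)) (length \<Delta>s) \<tau> *\<^sub>R
       snd (diamonds (map (\<lambda>i. \<Delta>s ! \<tau> i) [0..<length \<Delta>s])) es)"

text \<open>An endomorphism of the module of sections of \<open>B\<close> acts on the fibre over \<open>x\<close>: extend a vector
  to a section, apply the endomorphism and evaluate at \<open>x\<close>.\<close>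

definition fibre_End ::
  "('m::topological_space, 'd::real_inner) chart set \<Rightarrow> ('m, 'b::real_vector) vbundle
    \<Rightarrow> (('m \<Rightarrow> 'b) \<Rightarrow> ('m \<Rightarrow> 'b)) \<Rightarrow> 'm \<Rightarrow> 'b \<Rightarrow> 'b" where
  "fibre_End A B T x v = T (SOME b. b \<in> sections A B \<and> b x = v) x"

definition trace_End ::
  "('m::topological_space, 'd::real_inner) chart set \<Rightarrow> ('m, 'b::real_vector) vbundle
    \<Rightarrow> (('m \<Rightarrow> 'b) \<Rightarrow> ('m \<Rightarrow> 'b)) \<Rightarrow> 'm \<Rightarrow> real" where
  "trace_End A B T x = trace_on (fibre B x) (fibre_End A B T x)"

definition interpolate ::
  "('m, 'e, 'b::real_vector) conn \<Rightarrow> ('m, 'e, 'b) conn \<Rightarrow> real \<Rightarrow> ('m, 'e, 'b) conn" where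
  "interpolate nab0 nab1 t = (1 - t) *\<^sub>R nab0 + t *\<^sub>R nab1"

definition cs ::
  "('m::topological_space, 'd::real_inner) chart set
    \<Rightarrow> (('m \<Rightarrow> 'e) \<Rightarrow> ('m \<Rightarrow> 'e) \<Rightarrow> ('m \<Rightarrow> 'e)) \<Rightarrow> ('m, 'b::real_vector) vbundle
    \<Rightarrow> nat \<Rightarrow> ('m, 'e, 'b) conn \<Rightarrow> ('m, 'e, 'b) conn \<Rightarrow> ('m \<Rightarrow> 'e) list \<Rightarrow> 'm \<Rightarrow> real" where
  "cs A br B p nab0 nab1 = (\<lambda>es x. integral {0..1} (\<lambda>t.
     trace_End A B
       (odot ((1, \<lambda>es. (nab1 - nab0) (es ! 0)) #
              replicate (p - 1)
                (2, \<lambda>es. curvature br (interpolate nab0 nab1 t) (es ! 0) (es ! 1))) es) x))"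

definition secondary_class ::
  "('m::topological_space, 'd::real_inner) chart set \<Rightarrow> ('m, 'e::real_vector) vbundle
    \<Rightarrow> (('m \<Rightarrow> 'e) \<Rightarrow> ('m \<Rightarrow> 'e) \<Rightarrow> ('m \<Rightarrow> 'e)) \<Rightarrow> ('m \<Rightarrow> 'e \<Rightarrow> 'm tangent)
    \<Rightarrow> ('m, 'b::real_vector) vbundle \<Rightarrow> ('m \<Rightarrow> 'b \<Rightarrow> 'b \<Rightarrow> real) \<Rightarrow> ('m, 'e, 'b) conn \<Rightarrow> nat
    \<Rightarrow> (('m \<Rightarrow> 'e) list \<Rightarrow> 'm \<Rightarrow> real) set" where
  "secondary_class A E br \<rho> B g nab p =
     coh_class A E br \<rho> (2 * p - 1) (cs A br B p nab (conjugate A \<rho> B g nab))"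

end

theory Submission
  imports Defs "HOL-Real_Asymp.Real_Asymp" "HOL-Computational_Algebra.Polynomial" "Jordan_Normal_Form.Determinant"
begin

text \<open>Shuffle products of cochains form an associative graded algebra in which the
  Loday differential acts as a derivation, so a nonlinear connection \<open>W\<close> has a curvature
  \<open>F = dW + W\<^sup>2\<close> satisfying the Bianchi identity, and traces of covariant differentials are differentials
  of traces. Chern--Weil transgression then works as for ordinary connections: the differential of
  \<open>cs\<^sub>p(\<nabla>\<^sup>0, \<nabla>\<^sup>1)\<close> is the difference of the traces of the \<open>p\<close>-th powers of the curvatures, and moving
  \<open>\<nabla>\<^sup>1\<close> along a segment changes \<open>cs\<^sub>p\<close> by an exact term and the integral of \<open>tr(D F\<^sup>p\<^sup>-\<^sup>1)\<close>, where \<open>D\<close>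
  is the direction of the segment.

  Taking \<open>g\<close>-adjoints reverses shuffle products up to sign, which gives
  \<open>f(1 - t) = (-1)\<^sup>p\<^sup>-\<^sup>1 f(t)\<close> for the integrand \<open>f\<close> of \<open>cs\<^sub>p(\<nabla>, \<nabla>\<^sup>g)\<close>. For even \<open>p\<close> the integral vanishes. For odd
  \<open>p\<close> it is twice the integral over \<open>[0, 1/2]\<close>, hence \<open>2 cs\<^sub>p(\<nabla>, (\<nabla> + \<nabla>\<^sup>g)/2)\<close>; the mean of \<open>\<nabla>\<close> and \<open>\<nabla>\<^sup>g\<close>
  is metric, and the segment from it to \<open>\<nabla>\<^sub>m\<close> consists of metric connections, along which
  \<open>tr(D F\<^sup>p\<^sup>-\<^sup>1)\<close> is zero.\<close>

section \<open>Calculus of \<open>C\<^sup>k\<close> functions\<close>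

text \<open>The bracket is not skew, so a cochain is an arbitrary function on lists. Product and
  differential are described here by their contractions with the first argument (Cartan's formula),
  which turns the algebraic identities into inductions on lists. The bracket part of the
  differential needs no action on values. The anchor returns under the trace, because the trace of a
  commutator with a connection operator is the anchor derivative of the trace. The differential of a
  trace is therefore computed by the covariant differential of any connection, and at each parameter
  the connection whose Bianchi identity is wanted may be chosen. Two obstacles shape the rest: the
  axioms hold on smooth sections only, while the algebra wants total operations; and a primitive
  counts only if it is a differential operator in each argument. The graded symmetrisation
  contributes only the factor p!, since all its terms have the same trace.\<close>

lemma Ck_on_subset: "Ck_on k S f \<Longrightarrow> T \<subseteq> S \<Longrightarrow> Ck_on k T f"
  by (induction k arbitrary: f) (auto intro: continuous_on_subset)

lemma Ck_on_cong:
  assumes "open S" "\<And>x. x \<in> S \<Longrightarrow> f x = g x"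
  shows "Ck_on k S f \<longleftrightarrow> Ck_on k S g"
proof -
  have "Ck_on k S g" if "Ck_on k S f" "\<And>x. x \<in> S \<Longrightarrow> f x = g x" for f g :: "'a \<Rightarrow> 'b"
    using that
  proof (induction k arbitrary: f g)
    case 0
    then show ?case using continuous_on_cong by force
  next
    case (Suc k)
    have d: "(g has_derivative frechet_derivative f (at x)) (at x)" if "x \<in> S" for x
    proof -
      have "(f has_derivative frechet_derivative f (at x)) (at x)"
        using Suc.prems(1) that by (simp add: frechet_derivative_works)
      then show ?thesis
        by (rule has_derivative_transform_within_open[OF _ assms(1) that]) (rule Suc.prems(2))
    qed
    have eq: "frechet_derivative f (at x) v = frechet_derivative g (at x) v" if "x \<in> S" for x v
      using frechet_derivative_at[OF d[OF that]] by simp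
    have "Ck_on k S (\<lambda>x. frechet_derivative g (at x) v)" for v
      by (rule Suc.IH[OF _ eq]) (use Suc.prems(1) in simp_all)
    moreover have "\<forall>x\<in>S. g differentiable (at x)" using d by (auto simp: differentiable_def)
    ultimately show ?case by simp
  qed
  from this[of f g] this[of g f] show ?thesis using assms(2) by auto
qed

text \<open>Replaces \<open>frechet_derivative\<close> by any explicit derivative; together with
  \<open>Ck_on_SucD\<close> it reduces the closure rules below to differentiation formulas.\<close>

lemma Ck_on_SucI:
  assumes "open S" "\<And>x. x \<in> S \<Longrightarrow> (f has_derivative D x) (at x)" "\<And>v. Ck_on k S (\<lambda>x. D x v)"
  shows "Ck_on (Suc k) S f"
proof -
  have "frechet_derivative f (at x) = D x" if "x \<in> S" for x
    using frechet_derivative_at[OF assms(2)[OF that]] by simp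
  then have "Ck_on k S (\<lambda>x. frechet_derivative f (at x) v)" for v
    using Ck_on_cong[OF assms(1), of "\<lambda>x. frechet_derivative f (at x) v" "\<lambda>x. D x v" k] assms(3)[of v]
    by simp
  then show ?thesis using assms(2) by (auto simp: differentiable_def)
qed

lemma Ck_on_SucD:
  "Ck_on (Suc k) S f \<Longrightarrow> \<exists>D. (\<forall>x\<in>S. (f has_derivative D x) (at x)) \<and> (\<forall>v. Ck_on k S (\<lambda>x. D x v))"
  by (intro exI[of _ "\<lambda>x. frechet_derivative f (at x)"]) (simp add: frechet_derivative_works)

lemma Ck_on_continuous: "Ck_on k S f \<Longrightarrow> continuous_on S f"
  by (cases k) (auto intro!: continuous_at_imp_continuous_on differentiable_imp_continuous_within)

lemma Ck_on_lower: "Ck_on (Suc k) S f \<Longrightarrow> Ck_on k S f"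
proof (induction k arbitrary: f)
  case 0
  then show ?case using Ck_on_continuous[OF 0] by simp
qed auto

lemma Ck_on_local:
  assumes "open S" "\<And>x. x \<in> S \<Longrightarrow> \<exists>N. open N \<and> x \<in> N \<and> Ck_on k (S \<inter> N) f"
  shows "Ck_on k S f"
  using assms(2)
proof (induction k arbitrary: f)
  case 0
  have "isCont f x" if x: "x \<in> S" for x
  proof -
    obtain N where "open N" "x \<in> N" "continuous_on (S \<inter> N) f" using 0 x by auto
    then show ?thesis using assms(1) x continuous_on_eq_continuous_at[of "S \<inter> N" f] by auto
  qed
  then show ?case by (simp add: continuous_at_imp_continuous_on)
next
  case (Suc k)
  have "f differentiable at x" if "x \<in> S" for x using Suc.prems[OF that] that by auto
  moreover have "Ck_on k S (\<lambda>x. frechet_derivative f (at x) v)" for v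
    by (rule Suc.IH) (use Suc.prems in fastforce)
  ultimately show ?case by simp
qed

lemma Ck_on_const: "Ck_on k S (\<lambda>x. c)"
  by (induction k arbitrary: c) (auto simp: continuous_on_const)

lemma Ck_on_linear_compose:
  assumes "open S" "bounded_linear h" "Ck_on k S f" shows "Ck_on k S (\<lambda>x. h (f x))"
  using assms(3)
proof (induction k arbitrary: f)
  case 0
  then show ?case using bounded_linear.continuous_on[OF assms(2)] by simp
next
  case (Suc k)
  from Ck_on_SucD[OF Suc.prems] obtain D where "\<And>x. x \<in> S \<Longrightarrow> (f has_derivative D x) (at x)" "\<And>v. Ck_on k S (\<lambda>x. D x v)"
    by blast
  then show ?case
    by (intro Ck_on_SucI[OF assms(1), where D = "\<lambda>x v. h (D x v)"])
      (auto intro: Suc.IH bounded_linear.has_derivative[OF assms(2)])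
qed

lemma Ck_on_add:
  assumes "open S" "Ck_on k S f" "Ck_on k S g" shows "Ck_on k S (\<lambda>x. f x + g x)"
  using assms(2,3)
proof (induction k arbitrary: f g)
  case 0
  then show ?case by (auto intro: continuous_on_add)
next
  case (Suc k)
  from Ck_on_SucD[OF Suc.prems(1)] obtain D where "\<And>x. x \<in> S \<Longrightarrow> (f has_derivative D x) (at x)" "\<And>v. Ck_on k S (\<lambda>x. D x v)"
    by blast
  moreover from Ck_on_SucD[OF Suc.prems(2)] obtain D' where "\<And>x. x \<in> S \<Longrightarrow> (g has_derivative D' x) (at x)" "\<And>v. Ck_on k S (\<lambda>x. D' x v)"
    by blast
  ultimately show ?case
    by (intro Ck_on_SucI[OF assms(1), where D = "\<lambda>x v. D x v + D' x v"])
      (auto intro: Suc.IH has_derivative_add)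
qed

lemma Ck_on_bilinear:
  assumes "open S" "bounded_bilinear pr" "Ck_on k S f" "Ck_on k S g"
  shows "Ck_on k S (\<lambda>x. pr (f x) (g x))"
  using assms(3,4)
proof (induction k arbitrary: f g)
  case 0
  then show ?case using bounded_bilinear.continuous_on[OF assms(2)] by auto
next
  case (Suc k)
  from Ck_on_SucD[OF Suc.prems(1)] obtain D where D: "\<And>x. x \<in> S \<Longrightarrow> (f has_derivative D x) (at x)" "\<And>v. Ck_on k S (\<lambda>x. D x v)"
    by blast
  from Ck_on_SucD[OF Suc.prems(2)] obtain D' where D': "\<And>x. x \<in> S \<Longrightarrow> (g has_derivative D' x) (at x)" "\<And>v. Ck_on k S (\<lambda>x. D' x v)"
    by blast
  show ?case
  proof (rule Ck_on_SucI[OF assms(1)])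
    show "((\<lambda>x. pr (f x) (g x)) has_derivative (\<lambda>v. pr (f x) (D' x v) + pr (D x v) (g x))) (at x)"
      if "x \<in> S" for x
      by (rule bounded_bilinear.FDERIV[OF assms(2) D(1)[OF that] D'(1)[OF that]])
    show "Ck_on k S (\<lambda>x. pr (f x) (D' x v) + pr (D x v) (g x))" for v
      using D(2) D'(2) Suc.prems[THEN Ck_on_lower]
      by (intro Ck_on_add[OF assms(1)] Suc.IH) auto
  qed
qed

lemmas Ck_on_mult = Ck_on_bilinear[OF _ bounded_bilinear_mult]
  and Ck_on_inner = Ck_on_bilinear[OF _ bounded_bilinear_inner]

lemma Ck_on_inverse:
  fixes f :: "'a::real_normed_vector \<Rightarrow> real"
  assumes "open S" "Ck_on k S f" "\<And>x. x \<in> S \<Longrightarrow> f x \<noteq> 0" shows "Ck_on k S (\<lambda>x. inverse (f x))"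
  using assms(2)
proof (induction k)
  case 0
  then show ?case using assms(3) by (auto intro: continuous_on_inverse)
next
  case (Suc k)
  from Ck_on_SucD[OF Suc.prems] obtain D where D: "\<And>x. x \<in> S \<Longrightarrow> (f has_derivative D x) (at x)" "\<And>v. Ck_on k S (\<lambda>x. D x v)"
    by blast
  show ?case
  proof (rule Ck_on_SucI[OF assms(1)])
    show "((\<lambda>x. inverse (f x)) has_derivative (\<lambda>v. - (inverse (f x) * D x v * inverse (f x)))) (at x)"
      if "x \<in> S" for x
      using Deriv.has_derivative_inverse[OF assms(3)[OF that] D(1)[OF that]] .
    have "Ck_on k S (\<lambda>x. inverse (f x))" using Suc Ck_on_lower by blast
    then have "Ck_on k S (\<lambda>x. inverse (f x) * D x v * inverse (f x))" for v
      using D(2) by (intro Ck_on_mult[OF assms(1)])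
    then show "Ck_on k S (\<lambda>x. - (inverse (f x) * D x v * inverse (f x)))" for v
      by (rule Ck_on_linear_compose[OF assms(1) bounded_linear_minus[OF bounded_linear_ident]])
  qed
qed

text \<open>The functions \<open>e\<^sub>n t = exp (-1/t) / t\<^sup>n\<close> (extended by \<open>0\<close>) satisfy
  \<open>e\<^sub>n' = e\<^sub>n\<^sub>+\<^sub>2 - n e\<^sub>n\<^sub>+\<^sub>1\<close>; handling them all at once gives the smoothness of \<open>e\<^sub>0\<close> by a
  single induction.\<close>

definition flat_exp :: "nat \<Rightarrow> real \<Rightarrow> real" where
  "flat_exp n t = (if t > 0 then exp (- inverse t) * inverse t ^ n else 0)"

lemma flat_exp_tendsto_0: "(flat_exp n \<longlongrightarrow> 0) (at 0)"
proof -
  have "((\<lambda>t::real. exp (- inverse t) * inverse t ^ n) \<longlongrightarrow> 0) (at_right 0)"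
    by real_asymp
  then have "(flat_exp n \<longlongrightarrow> 0) (at_right 0)"
    by (rule Lim_transform_eventually) (auto simp: eventually_at_right_field flat_exp_def intro!: exI[of _ 1])
  moreover have "(flat_exp n \<longlongrightarrow> 0) (at_left 0)"
    by (rule Lim_transform_eventually[OF tendsto_const])
      (auto simp: eventually_at_left_field flat_exp_def intro!: exI[of _ "-1"])
  ultimately show ?thesis by (simp add: filterlim_split_at)
qed

lemma flat_exp_derivative:
  "(flat_exp n has_real_derivative flat_exp (n + 2) t - real n * flat_exp (n + 1) t) (at t)"
proof (cases t "0::real" rule: linorder_cases)
  case less
  have "((\<lambda>t. 0) has_real_derivative 0) (at t)" by simp
  then have "(flat_exp n has_real_derivative 0) (at t)"
    by (rule has_field_derivative_transform_within_open[where S = "{..<0}"]) (use less in \<open>auto simp: flat_exp_def\<close>)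
  then show ?thesis using less by (simp add: flat_exp_def)
next
  case equal
  \<comment> \<open>At 0 the difference quotient of \<open>flat_exp n\<close> is
    \<open>flat_exp (Suc n)\<close>, whose limit is already known.\<close>
  have "((\<lambda>h. (flat_exp n (0 + h) - flat_exp n 0) / h) \<longlongrightarrow> 0) (at 0)"
    by (rule Lim_transform_eventually[OF flat_exp_tendsto_0[of "Suc n"]])
      (auto simp: flat_exp_def eventually_at_filter field_simps)
  then show ?thesis using equal by (simp add: DERIV_def flat_exp_def)
next
  case greater
  have "((\<lambda>t. exp (- inverse t) * inverse t ^ n) has_real_derivative flat_exp (n + 2) t - real n * flat_exp (n + 1) t) (at t)"
    using greater
    by (auto intro!: derivative_eq_intros simp: flat_exp_def power2_eq_square power_Suc[symmetric] simp del: power_Suc)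
      (cases n; simp add: field_simps power2_eq_square)
  then show ?thesis
    by (rule has_field_derivative_transform_within_open[where S = "{0<..}"]) (use greater in \<open>auto simp: flat_exp_def\<close>)
qed

lemma Ck_on_flat_exp:
  fixes u :: "'a::real_normed_vector \<Rightarrow> real"
  assumes "open S" "Ck_on k S u" shows "Ck_on k S (\<lambda>x. flat_exp n (u x))"
  using assms(2)
proof (induction k arbitrary: n)
  case 0
  have "continuous_on UNIV (flat_exp n)"
    using DERIV_isCont[OF flat_exp_derivative] by (simp add: continuous_at_imp_continuous_on)
  then show ?case using 0 continuous_on_compose2 by (metis Ck_on.simps(1) subset_UNIV)
next
  case (Suc k)
  from Ck_on_SucD[OF Suc.prems] obtain D where D: "\<And>x. x \<in> S \<Longrightarrow> (u has_derivative D x) (at x)" "\<And>v. Ck_on k S (\<lambda>x. D x v)"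
    by blast
  show ?case
  proof (rule Ck_on_SucI[OF assms(1)])
    show "((\<lambda>x. flat_exp n (u x)) has_derivative
        (\<lambda>v. (flat_exp (n + 2) (u x) + (- real n) * flat_exp (n + 1) (u x)) * D x v)) (at x)" if "x \<in> S" for x
      using has_derivative_compose[OF D(1)[OF that] flat_exp_derivative[unfolded has_field_derivative_def, of n "u x"]]
      by (simp add: mult.commute)
    have u: "Ck_on k S u" using Suc.prems Ck_on_lower by blast
    show "Ck_on k S (\<lambda>x. (flat_exp (n + 2) (u x) + (- real n) * flat_exp (n + 1) (u x)) * D x v)" for v
      by (intro Ck_on_mult Ck_on_add Ck_on_const Suc.IH u D(2) assms(1))
  qed
qed

section \<open>Smooth functions and bump functions\<close>

text \<open>Adding one generator writes the set as the continuous image of an interval times the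
  previous set.\<close>

lemma compact_bounded_combinations:
  fixes C :: "'d::real_normed_vector set"
  assumes "finite C" shows "compact {\<Sum>c\<in>C. a c *\<^sub>R c | a. \<forall>c\<in>C. \<bar>a c\<bar> \<le> M c}"
  using assms
proof (induction C)
  case empty
  then show ?case by simp
next
  case (insert c C)
  let ?K = "{\<Sum>c\<in>C. a c *\<^sub>R c | a. \<forall>c\<in>C. \<bar>a c\<bar> \<le> M c}"
  have "{\<Sum>c\<in>insert c C. a c *\<^sub>R c | a. \<forall>c\<in>insert c C. \<bar>a c\<bar> \<le> M c} = (\<lambda>(t, y). t *\<^sub>R c + y) ` ({- M c..M c} \<times> ?K)"
  proof (intro equalityI subsetI)
    fix z assume "z \<in> {\<Sum>c\<in>insert c C. a c *\<^sub>R c | a. \<forall>c\<in>insert c C. \<bar>a c\<bar> \<le> M c}"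
    then obtain a where a: "z = (\<Sum>c\<in>insert c C. a c *\<^sub>R c)" "\<forall>c\<in>insert c C. \<bar>a c\<bar> \<le> M c" by blast
    then have "z = (\<lambda>(t, y). t *\<^sub>R c + y) (a c, \<Sum>c\<in>C. a c *\<^sub>R c)" using insert.hyps by simp
    moreover have "(a c, \<Sum>c\<in>C. a c *\<^sub>R c) \<in> {- M c..M c} \<times> ?K" using a(2) by (auto simp: abs_le_iff)
    ultimately show "z \<in> (\<lambda>(t, y). t *\<^sub>R c + y) ` ({- M c..M c} \<times> ?K)" by blast
  next
    fix z assume "z \<in> (\<lambda>(t, y). t *\<^sub>R c + y) ` ({- M c..M c} \<times> ?K)"
    then obtain t a where ta: "z = t *\<^sub>R c + (\<Sum>c\<in>C. a c *\<^sub>R c)" "t \<in> {- M c..M c}" "\<forall>c\<in>C. \<bar>a c\<bar> \<le> M c" by auto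
    have "(\<Sum>d\<in>C. (a(c := t)) d *\<^sub>R d) = (\<Sum>c\<in>C. a c *\<^sub>R c)"
      using insert.hyps by (intro sum.cong) auto
    then have "z = (\<Sum>d\<in>insert c C. (a(c := t)) d *\<^sub>R d)" using ta(1) insert.hyps by simp
    moreover have "\<forall>d\<in>insert c C. \<bar>(a(c := t)) d\<bar> \<le> M d" using ta by (auto simp: abs_le_iff)
    ultimately show "z \<in> {\<Sum>c\<in>insert c C. a c *\<^sub>R c | a. \<forall>c\<in>insert c C. \<bar>a c\<bar> \<le> M c}" by blast
  qed
  moreover have "compact ((\<lambda>(t, y). t *\<^sub>R c + y) ` ({- M c..M c} \<times> ?K))"
    using insert.IH by (intro compact_continuous_image compact_Times)
      (auto simp: split_beta intro!: continuous_intros)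
  ultimately show ?case by simp
qed

text \<open>The model space is only a \<open>real_inner\<close> space with a finite spanning set.
  Coordinates with respect to an orthogonal spanning set are bounded on the ball by Cauchy-Schwarz,
  so the ball is a closed subset of a compact set of combinations.\<close>

lemma compact_cball_finite_dim:
  fixes x :: "'d::real_inner"
  assumes "finite B" "span B = (UNIV :: 'd set)"
  shows "compact (cball x r)"
proof -
  obtain C where C: "finite C" "span C = (UNIV :: 'd set)" "pairwise real_inner_class.orthogonal C"
    using basis_orthogonal[OF assms(1)] assms(2) by metis
  \<comment> \<open>The bound on the coefficient of c: the product of its modulus with the squared
    norm of c is at most norm y times norm c, and norm y is at most norm x plus the modulus of
    r.\<close>
  define M where "M c = (if c = 0 then 0 else (norm x + \<bar>r\<bar>) / norm c)" for c :: 'd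
  have "cball x r \<subseteq> {\<Sum>c\<in>C. a c *\<^sub>R c | a. \<forall>c\<in>C. \<bar>a c\<bar> \<le> M c}"
  proof
    fix y assume "y \<in> cball x r"
    then have ny: "norm y \<le> norm x + \<bar>r\<bar>"
      using norm_triangle_ineq2[of y x] by (simp add: dist_norm norm_minus_commute)
    have "y \<in> range (\<lambda>u. \<Sum>c\<in>C. u c *\<^sub>R c)"
      unfolding span_finite[OF C(1), symmetric] C(2) by (rule UNIV_I)
    then obtain a where a: "y = (\<Sum>c\<in>C. a c *\<^sub>R c)" by blast
    \<comment> \<open>The orthogonal set may contain 0, whose coefficient is unconstrained; it is
      set to 0 here.\<close>
    define b where "b c = (if c = 0 then 0 else a c)" for c
    have yb: "y = (\<Sum>c\<in>C. b c *\<^sub>R c)" unfolding a by (rule sum.cong) (simp_all add: b_def)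
    have "\<bar>b c\<bar> \<le> M c" if c: "c \<in> C" for c
    proof (cases "c = 0")
      case False
      have "y \<bullet> c = (\<Sum>d\<in>C. b d * (d \<bullet> c))" unfolding yb by (simp add: inner_sum_left)
      also have "\<dots> = (\<Sum>d\<in>C. if d = c then b c * (c \<bullet> c) else 0)"
        using C(3) c by (intro sum.cong) (auto simp: pairwise_def Linear_Algebra.orthogonal_def)
      finally have "y \<bullet> c = b c * (norm c)\<^sup>2" using C(1) c by (simp add: power2_norm_eq_inner)
      then have "\<bar>b c\<bar> * (norm c)\<^sup>2 \<le> norm y * norm c"
        using Cauchy_Schwarz_ineq2[of y c] by (simp add: abs_mult)
      then have "\<bar>b c\<bar> * norm c \<le> norm y" using False by (simp add: power2_eq_square)
      then show ?thesis using False ny by (simp add: M_def field_simps)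
    qed (simp add: b_def M_def)
    then show "y \<in> {\<Sum>c\<in>C. a c *\<^sub>R c | a. \<forall>c\<in>C. \<bar>a c\<bar> \<le> M c}"
      unfolding mem_Collect_eq by (intro exI[of _ b] conjI yb) blast
  qed
  then have "cball x r = cball x r \<inter> {\<Sum>c\<in>C. a c *\<^sub>R c | a. \<forall>c\<in>C. \<bar>a c\<bar> \<le> M c}" by (rule Int_absorb2[symmetric])
  then show ?thesis
    using closed_Int_compact[OF closed_cball[of x r] compact_bounded_combinations[OF C(1), of M]] by (rule ssubst)
qed

section \<open>Smooth functions on a manifold\<close>

context
  fixes A :: "('m::{t2_space,second_countable_topology}, 'd::real_inner) chart set"
  assumes A: "smooth_manifold A"
begin

lemma chart_facts:
  assumes "(U, \<kappa>) \<in> A"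
  shows "open U" "open (\<kappa> ` U)" "homeomorphism U (\<kappa> ` U) \<kappa> (inv_into U \<kappa>)" "inj_on \<kappa> U"
    "open W \<Longrightarrow> open (\<kappa> ` (U \<inter> W))"
proof -
  show *: "open U" "open (\<kappa> ` U)" "homeomorphism U (\<kappa> ` U) \<kappa> (inv_into U \<kappa>)"
    using A assms unfolding smooth_manifold_def by auto
  show "inj_on \<kappa> U" using *(3) by (meson homeomorphism_def inj_on_inverseI)
  show "open (\<kappa> ` (U \<inter> W))" if "open W"
  proof -
    have "openin (top_of_set (\<kappa> ` U)) (\<kappa> ` (U \<inter> W))"
      using homeomorphism_imp_open_map[OF *(3)] that by (simp add: openin_open_Int)
    then show ?thesis using *(2) openin_open_trans by blast
  qed
qed

lemma chart_at: obtains U \<kappa> where "(U, \<kappa>) \<in> A" "x \<in> U"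
proof -
  have "x \<in> \<Union>(fst ` A)" using A by (simp add: smooth_manifold_def)
  then obtain c where "c \<in> A" "x \<in> fst c" by blast
  then show ?thesis using that[of "fst c" "snd c"] by simp
qed

lemma smooth_fun_on_iff:
  "smooth_fun_on A W f \<longleftrightarrow> (\<forall>U \<kappa> k. (U, \<kappa>) \<in> A \<longrightarrow> Ck_on k (\<kappa> ` (U \<inter> W)) (\<lambda>y. f (inv_into U \<kappa> y)))"
  unfolding smooth_fun_on_def smooth_map_on_def o_def by blast

lemma smooth_fun_on_cong:
  assumes "open W" "\<And>x. x \<in> W \<Longrightarrow> f x = h x" "smooth_fun_on A W f"
  shows "smooth_fun_on A W h"
  unfolding smooth_fun_on_iff
proof (intro allI impI)
  fix U \<kappa> k assume c: "(U, \<kappa>) \<in> A"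
  have "f (inv_into U \<kappa> y) = h (inv_into U \<kappa> y)" if "y \<in> \<kappa> ` (U \<inter> W)" for y
    using that assms(2) chart_facts(4)[OF c] by auto
  then show "Ck_on k (\<kappa> ` (U \<inter> W)) (\<lambda>y. h (inv_into U \<kappa> y))"
    using assms(3) c Ck_on_cong[OF chart_facts(5)[OF c assms(1)],
        of "\<lambda>y. f (inv_into U \<kappa> y)" "\<lambda>y. h (inv_into U \<kappa> y)" k]
    unfolding smooth_fun_on_iff by simp
qed

lemma smooth_fun_on_subset: "smooth_fun_on A W f \<Longrightarrow> W' \<subseteq> W \<Longrightarrow> smooth_fun_on A W' f"
  unfolding smooth_fun_on_iff by (meson Ck_on_subset Int_mono image_mono subset_refl)

lemma smooth_fun_on_local:
  assumes "open W" "\<And>x. x \<in> W \<Longrightarrow> \<exists>N. open N \<and> x \<in> N \<and> smooth_fun_on A (W \<inter> N) f"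
  shows "smooth_fun_on A W f"
  unfolding smooth_fun_on_iff
proof (intro allI impI)
  fix U \<kappa> k assume c: "(U, \<kappa>) \<in> A"
  show "Ck_on k (\<kappa> ` (U \<inter> W)) (\<lambda>y. f (inv_into U \<kappa> y))"
  proof (rule Ck_on_local[OF chart_facts(5)[OF c assms(1)]])
    fix y assume "y \<in> \<kappa> ` (U \<inter> W)"
    then obtain x where x: "x \<in> U" "x \<in> W" "y = \<kappa> x" by auto
    then obtain N where N: "open N" "x \<in> N" "smooth_fun_on A (W \<inter> N) f" using assms(2) by blast
    have "\<kappa> ` (U \<inter> W) \<inter> \<kappa> ` (U \<inter> N) = \<kappa> ` (U \<inter> (W \<inter> N))"
      using inj_on_image_Int[OF chart_facts(4)[OF c], of "U \<inter> W" "U \<inter> N"] by (simp add: Int_ac)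
    then show "\<exists>N. open N \<and> y \<in> N \<and> Ck_on k (\<kappa> ` (U \<inter> W) \<inter> N) (\<lambda>y. f (inv_into U \<kappa> y))"
      using N x c chart_facts(5)[OF c N(1)] unfolding smooth_fun_on_iff
      by (intro exI[of _ "\<kappa> ` (U \<inter> N)"]) auto
  qed
qed

lemma smooth_fun_on_const: "smooth_fun_on A W (\<lambda>x. c)"
  by (simp add: smooth_fun_on_iff Ck_on_const)

lemma smooth_fun_on_add: "open W \<Longrightarrow> smooth_fun_on A W f \<Longrightarrow> smooth_fun_on A W h \<Longrightarrow> smooth_fun_on A W (\<lambda>x. f x + h x)"
  unfolding smooth_fun_on_iff by (intro allI impI Ck_on_add) (auto intro: chart_facts(5))

lemma smooth_fun_on_mult: "open W \<Longrightarrow> smooth_fun_on A W f \<Longrightarrow> smooth_fun_on A W h \<Longrightarrow> smooth_fun_on A W (\<lambda>x. f x * h x)"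
  unfolding smooth_fun_on_iff by (intro allI impI Ck_on_mult) (auto intro: chart_facts(5))

lemma smooth_fun_on_inverse:
  assumes "open W" "smooth_fun_on A W f" "\<And>x. x \<in> W \<Longrightarrow> f x \<noteq> 0" shows "smooth_fun_on A W (\<lambda>x. inverse (f x))"
  unfolding smooth_fun_on_iff
proof (intro allI impI)
  fix U \<kappa> k assume c: "(U, \<kappa>) \<in> A"
  show "Ck_on k (\<kappa> ` (U \<inter> W)) (\<lambda>y. inverse (f (inv_into U \<kappa> y)))"
    using assms chart_facts(4)[OF c] c
    by (intro Ck_on_inverse chart_facts(5)[OF c]) (auto simp: smooth_fun_on_iff)
qed

lemma smooth_fun_on_sum:
  "open W \<Longrightarrow> (\<And>i. i \<in> I \<Longrightarrow> smooth_fun_on A W (f i)) \<Longrightarrow> smooth_fun_on A W (\<lambda>x. \<Sum>i\<in>I. f i x)"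
  by (induction I rule: infinite_finite_induct) (auto intro: smooth_fun_on_const smooth_fun_on_add)

lemma smooth_fun_on_prod:
  "open W \<Longrightarrow> (\<And>i. i \<in> I \<Longrightarrow> smooth_fun_on A W (f i)) \<Longrightarrow> smooth_fun_on A W (\<lambda>x. \<Prod>i\<in>I. f i x)"
  by (induction I rule: infinite_finite_induct) (auto intro: smooth_fun_on_const smooth_fun_on_mult)

lemma Cinf_iff: "f \<in> Cinf A \<longleftrightarrow> smooth_fun_on A UNIV f"
  by (simp add: Cinf_def)

lemma Cinf_const: "(\<lambda>x. c) \<in> Cinf A"
  and Cinf_add: "f \<in> Cinf A \<Longrightarrow> h \<in> Cinf A \<Longrightarrow> f + h \<in> Cinf A"
  and Cinf_mult: "f \<in> Cinf A \<Longrightarrow> h \<in> Cinf A \<Longrightarrow> f * h \<in> Cinf A"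
  by (simp_all add: Cinf_iff plus_fun_def times_fun_def smooth_fun_on_const smooth_fun_on_add smooth_fun_on_mult)

lemma Cinf_scaleR: "f \<in> Cinf A \<Longrightarrow> c *\<^sub>R f \<in> Cinf A"
  using Cinf_mult[OF Cinf_const[of c]] by (simp add: times_fun_def scaleR_fun_def)

lemma subspace_Cinf: "subspace (Cinf A)"
  unfolding subspace_def using Cinf_const[of 0] Cinf_add Cinf_scaleR by (simp add: zero_fun_def)

lemma Cinf_smooth_on: "f \<in> Cinf A \<Longrightarrow> smooth_fun_on A W f"
  using smooth_fun_on_subset Cinf_iff by blast

text \<open>In a chart the bump is a normalised \<open>flat_exp 0\<close> of the squared radius
  minus the squared distance to x, extended by 0. The closed support K inside W is what makes the
  extension smooth across the edge of the chart domain.\<close>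

lemma bump_function:
  assumes "open W" "x \<in> W"
  obtains h K where "h \<in> Cinf A" "h x = 1" "closed K" "K \<subseteq> W" "\<And>y. y \<notin> K \<Longrightarrow> h y = 0"
proof -
  obtain U \<kappa> where c: "(U, \<kappa>) \<in> A" "x \<in> U" by (rule chart_at)
  note cf = chart_facts[OF c(1)]
  obtain r where r: "r > 0" "cball (\<kappa> x) r \<subseteq> \<kappa> ` (U \<inter> W)"
    using cf(5)[OF assms(1)] c(2) assms(2) open_contains_cball by (metis IntI image_eqI)
  define K where "K = inv_into U \<kappa> ` cball (\<kappa> x) r"
  define u where "u y = r\<^sup>2 + (- 1) * ((\<kappa> y - \<kappa> x) \<bullet> (\<kappa> y - \<kappa> x))" for y
  define h where "h y = (if y \<in> U then flat_exp 0 (u y) * inverse (flat_exp 0 (r\<^sup>2)) else 0)" for y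
  obtain B where B: "finite B" "span B = (UNIV :: 'd set)" using A unfolding smooth_manifold_def by auto
  have cont: "continuous_on (\<kappa> ` U) (inv_into U \<kappa>)" using cf(3) by (simp add: homeomorphism_def)
  \<comment> \<open>Compactness of the ball, combined with the Hausdorff property, makes K closed in
    the whole manifold and not merely in U.\<close>
  have "compact K" unfolding K_def
    using r(2) by (intro compact_continuous_image compact_cball_finite_dim[OF B] continuous_on_subset[OF cont]) auto
  then have Kc: "closed K" by (rule compact_imp_closed)
  have KW: "K \<subseteq> U \<inter> W"
  proof
    fix y assume "y \<in> K"
    then obtain z where "z \<in> \<kappa> ` (U \<inter> W)" "y = inv_into U \<kappa> z" using r(2) K_def by blast
    then show "y \<in> U \<inter> W" using cf(4) by auto
  qed
  have hK: "h y = 0" if "y \<notin> K" for y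
  proof (cases "y \<in> U")
    case True
    then have "\<kappa> y \<notin> cball (\<kappa> x) r"
      using that cf(4) unfolding K_def by (metis image_eqI inv_into_f_f)
    then have "r < norm (\<kappa> y - \<kappa> x)" by (simp add: dist_norm norm_minus_commute)
    then have "r\<^sup>2 < (norm (\<kappa> y - \<kappa> x))\<^sup>2" using r(1) by (intro power_strict_mono) auto
    then have "u y < 0" by (simp add: u_def power2_norm_eq_inner)
    then show ?thesis by (simp add: h_def flat_exp_def)
  qed (simp add: h_def)
  have "h \<in> Cinf A" unfolding Cinf_iff
  proof (rule smooth_fun_on_local)
    fix y :: 'm
    show "\<exists>N. open N \<and> y \<in> N \<and> smooth_fun_on A (UNIV \<inter> N) h"
    proof (cases "y \<in> U")
      case False
      have "smooth_fun_on A (- K) h"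
        by (rule smooth_fun_on_cong[OF _ _ smooth_fun_on_const[of _ 0]]) (use Kc hK in auto)
      then show ?thesis using False KW Kc by (intro exI[of _ "- K"]) auto
    next
      case True
      have "smooth_fun_on A U h" unfolding smooth_fun_on_iff
      proof (intro allI impI)
        fix V \<psi> k assume V: "(V, \<psi>) \<in> A"
        let ?S = "\<psi> ` (V \<inter> U)" and ?F = "\<lambda>z. \<kappa> (inv_into V \<psi> z)"
        have o: "open ?S" by (rule chart_facts(5)[OF V cf(1)])
        have F: "Ck_on k ?S ?F"
          using A V c(1) unfolding smooth_manifold_def smooth_map_on_def o_def by blast
        have "Ck_on k ?S (\<lambda>z. ?F z + - \<kappa> x)" by (intro Ck_on_add o F Ck_on_const)
        then have "Ck_on k ?S (\<lambda>z. (?F z - \<kappa> x) \<bullet> (?F z - \<kappa> x))"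
          using Ck_on_inner[OF o] by simp
        then have "Ck_on k ?S (\<lambda>z. flat_exp 0 (r\<^sup>2 + (- 1) * ((?F z - \<kappa> x) \<bullet> (?F z - \<kappa> x))) * inverse (flat_exp 0 (r\<^sup>2)))"
          by (intro Ck_on_mult Ck_on_flat_exp Ck_on_add Ck_on_const o)
        moreover have "flat_exp 0 (r\<^sup>2 + (- 1) * ((?F z - \<kappa> x) \<bullet> (?F z - \<kappa> x))) * inverse (flat_exp 0 (r\<^sup>2)) = h (inv_into V \<psi> z)"
          if "z \<in> ?S" for z
          using that chart_facts(4)[OF V] by (auto simp: h_def u_def)
        ultimately show "Ck_on k ?S (\<lambda>z. h (inv_into V \<psi> z))" by (rule iffD1[OF Ck_on_cong[OF o], rotated])
      qed
      then show ?thesis using True cf(1) by auto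
    qed
  qed simp
  moreover have "h x = 1" using c(2) r(1) by (simp add: h_def u_def flat_exp_def)
  ultimately show ?thesis using that Kc KW hK by blast
qed

end

section \<open>The shuffle algebra\<close>

text \<open>The grading involution. It replaces degrees in all signs, so cochains may be
  inhomogeneous functions on lists of every length.\<close>

definition grade_inv :: "('s list \<Rightarrow> 'r::real_vector) \<Rightarrow> 's list \<Rightarrow> 'r" where
  "grade_inv F es = (-1) ^ length es *\<^sub>R F es"

definition contr :: "'s \<Rightarrow> ('s list \<Rightarrow> 'r) \<Rightarrow> 's list \<Rightarrow> 'r" where
  "contr x F es = F (x # es)"

text \<open>The signed sum over unshuffles, sorted by the factor that receives the first argument.
  Moving that argument past those still to be given to F costs their parity, hence
  \<open>grade_inv\<close>. Equivalently, contraction is a graded derivation.\<close>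

fun shuf :: "('s list \<Rightarrow> 'r::real_algebra) \<Rightarrow> ('s list \<Rightarrow> 'r) \<Rightarrow> 's list \<Rightarrow> 'r" where
  "shuf F G [] = F [] * G []"
| "shuf F G (x # es) = shuf (contr x F) G es + shuf (grade_inv F) (contr x G) es"

text \<open>The Lie derivative along x on the arguments: the bracket with x is inserted in each
  position in turn.\<close>

primrec bder :: "('s \<Rightarrow> 's \<Rightarrow> 's) \<Rightarrow> 's \<Rightarrow> 's list \<Rightarrow> ('s list \<Rightarrow> 'r::real_vector) \<Rightarrow> 'r" where
  "bder br x [] F = 0"
| "bder br x (y # es) F = F (br x y # es) + bder br x es (contr y F)"

text \<open>The bracket part of the Loday differential, by Cartan's formula. The anchor terms are
  left out because they would need an action on the values; the commutator in \<open>covd\<close>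
  supplies their counterpart.\<close>

primrec ldiff :: "('s \<Rightarrow> 's \<Rightarrow> 's) \<Rightarrow> 's list \<Rightarrow> ('s list \<Rightarrow> 'r::real_vector) \<Rightarrow> 'r" where
  "ldiff br [] F = 0"
| "ldiff br (x # es) F = - bder br x es F - ldiff br es (contr x F)"

lemma contr_simps [simp]:
  "contr x (\<lambda>es. F es + G es) = (\<lambda>es. contr x F es + contr x G es)"
  "contr x (\<lambda>es. F es - G es) = (\<lambda>es. contr x F es - contr x G es)"
  "contr x (\<lambda>es. - F es) = (\<lambda>es. - contr x F es)"
  "contr x (\<lambda>es. c *\<^sub>R F es) = (\<lambda>es. c *\<^sub>R contr x F es)"
  "contr x (\<lambda>es. 0) = (\<lambda>es. 0)"
  by (auto simp: contr_def fun_eq_iff)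

lemma grade_inv_simps [simp]:
  "grade_inv (\<lambda>es. F es + G es) = (\<lambda>es. grade_inv F es + grade_inv G es)"
  "grade_inv (\<lambda>es. F es - G es) = (\<lambda>es. grade_inv F es - grade_inv G es)"
  "grade_inv (\<lambda>es. - F es) = (\<lambda>es. - grade_inv F es)"
  "grade_inv (\<lambda>es. c *\<^sub>R F es) = (\<lambda>es. c *\<^sub>R grade_inv F es)"
  "grade_inv (\<lambda>es. 0) = (\<lambda>es. 0)"
  "grade_inv (grade_inv F) = F"
  by (auto simp: grade_inv_def fun_eq_iff scaleR_add_right scaleR_diff_right
      simp flip: power_add mult_2)

lemma contr_grade_inv: "contr x (grade_inv F) = (\<lambda>es. - grade_inv (contr x F) es)"
  by (auto simp: grade_inv_def contr_def)

lemma contr_shuf: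
  "contr x (shuf F G) = (\<lambda>es. shuf (contr x F) G es + shuf (grade_inv F) (contr x G) es)"
  by (simp add: fun_eq_iff contr_def)

lemma shuf_add_left: "shuf (\<lambda>es. F es + F' es) G es = shuf F G es + shuf F' G es"
  by (induction es arbitrary: F F' G) (simp_all add: algebra_simps)

lemma shuf_add_right: "shuf F (\<lambda>es. G es + G' es) es = shuf F G es + shuf F G' es"
  by (induction es arbitrary: F G G') (simp_all add: algebra_simps)

lemma shuf_scaleR_left: "shuf (\<lambda>es. c *\<^sub>R F es) G es = c *\<^sub>R shuf F G es"
  by (induction es arbitrary: F G) (simp_all add: algebra_simps)

lemma shuf_scaleR_right: "shuf F (\<lambda>es. c *\<^sub>R G es) es = c *\<^sub>R shuf F G es"
  by (induction es arbitrary: F G) (simp_all add: algebra_simps)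

lemma shuf_minus_left: "shuf (\<lambda>es. - F es) G es = - shuf F G es"
  using shuf_scaleR_left[of "-1" F G es] by simp

lemma shuf_minus_right: "shuf F (\<lambda>es. - G es) es = - shuf F G es"
  using shuf_scaleR_right[of F "-1" G es] by simp

lemma shuf_diff_left: "shuf (\<lambda>es. F es - F' es) G es = shuf F G es - shuf F' G es"
  using shuf_add_left[of F "\<lambda>es. - F' es" G es] by (simp add: shuf_minus_left)

lemma shuf_diff_right: "shuf F (\<lambda>es. G es - G' es) es = shuf F G es - shuf F G' es"
  using shuf_add_right[of F G "\<lambda>es. - G' es" es] by (simp add: shuf_minus_right)

lemma shuf_zero [simp]: "shuf (\<lambda>es. 0) G es = 0" "shuf F (\<lambda>es. 0) es = 0"
  using shuf_scaleR_left[of 0 "\<lambda>es. 0" G es] shuf_scaleR_right[of F 0 "\<lambda>es. 0" es] by simp_all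

lemma grade_inv_shuf: "grade_inv (shuf F G) = shuf (grade_inv F) (grade_inv G)"
proof
  fix es show "grade_inv (shuf F G) es = shuf (grade_inv F) (grade_inv G) es"
  proof (induction es arbitrary: F G)
    case (Cons x es)
    have "grade_inv (shuf F G) (x # es) =
        - grade_inv (shuf (contr x F) G) es - grade_inv (shuf (grade_inv F) (contr x G)) es"
      by (simp add: grade_inv_def scaleR_add_right)
    also have "\<dots> = shuf (grade_inv F) (grade_inv G) (x # es)"
      unfolding Cons.IH by (simp add: contr_grade_inv shuf_minus_left shuf_minus_right)
    finally show ?case .
  qed (simp add: grade_inv_def)
qed

text \<open>By the Leibniz rule for contraction both sides expand into the same three terms.\<close>

lemma shuf_assoc: "shuf (shuf F G) H es = shuf F (shuf G H) es"
  by (induction es arbitrary: F G H)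
    (simp_all add: mult.assoc contr_shuf shuf_add_left shuf_add_right grade_inv_shuf)

lemma bder_add: "bder br x es (\<lambda>es. F es + G es) = bder br x es F + bder br x es G"
  by (induction es arbitrary: F G) (simp_all add: algebra_simps)

lemma bder_scaleR: "bder br x es (\<lambda>es. c *\<^sub>R F es) = c *\<^sub>R bder br x es F"
  by (induction es arbitrary: F) (simp_all add: algebra_simps)

lemma bder_minus: "bder br x es (\<lambda>es. - F es) = - bder br x es F"
  using bder_scaleR[of br x es "-1" F] by simp

lemma bder_grade_inv: "bder br x es (grade_inv F) = grade_inv (\<lambda>es. bder br x es F) es"
proof (induction es arbitrary: F)
  case (Cons y es)
  then show ?case
    by (simp add: contr_grade_inv bder_minus) (simp add: grade_inv_def algebra_simps)
qed (simp add: grade_inv_def)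

lemma contr_bder:
  "contr y (\<lambda>es. bder br x es F) = (\<lambda>es. contr (br x y) F es + bder br x es (contr y F))"
  by (simp add: fun_eq_iff contr_def)

lemma bder_shuf:
  "bder br x es (shuf F G) = shuf (\<lambda>es. bder br x es F) G es + shuf F (\<lambda>es. bder br x es G) es"
proof (induction es arbitrary: F G)
  case (Cons y es)
  have gi: "grade_inv (\<lambda>es. bder br x es F) = (\<lambda>es. bder br x es (grade_inv F))"
    by (simp add: fun_eq_iff bder_grade_inv)
  show ?case
    by (simp add: contr_shuf contr_bder bder_add Cons.IH shuf_add_left shuf_add_right gi)
qed simp

lemma ldiff_add: "ldiff br es (\<lambda>es. F es + G es) = ldiff br es F + ldiff br es G"
  by (induction es arbitrary: F G) (simp_all add: algebra_simps bder_add)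

lemma ldiff_scaleR: "ldiff br es (\<lambda>es. c *\<^sub>R F es) = c *\<^sub>R ldiff br es F"
  by (induction es arbitrary: F) (simp_all add: algebra_simps bder_scaleR)

lemma ldiff_minus: "ldiff br es (\<lambda>es. - F es) = - ldiff br es F"
  using ldiff_scaleR[of br es "-1" F] by simp

lemma ldiff_grade_inv: "ldiff br es (grade_inv F) = - grade_inv (\<lambda>es. ldiff br es F) es"
proof (induction es arbitrary: F)
  case (Cons y es)
  then show ?case
    by (simp add: contr_grade_inv ldiff_minus bder_grade_inv) (simp add: grade_inv_def algebra_simps)
qed (simp add: grade_inv_def)

lemma contr_ldiff:
  "contr x (\<lambda>es. ldiff br es F) = (\<lambda>es. - bder br x es F - ldiff br es (contr x F))"
  by (simp add: fun_eq_iff contr_def)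

text \<open>Cartan's formula reduces this graded Leibniz rule to those of contraction and of the Lie
  derivative \<open>bder\<close>.\<close>

lemma ldiff_shuf:
  fixes F G :: "'x list \<Rightarrow> 'y::real_algebra"
  shows "ldiff br es (shuf F G) =
     shuf (\<lambda>es. ldiff br es F) G es + shuf (grade_inv F) (\<lambda>es. ldiff br es G) es"
proof (induction es arbitrary: F G)
  case (Cons x es)
  have gi: "grade_inv (\<lambda>es. ldiff br es F) = (\<lambda>es. - ldiff br es (grade_inv F))"
    by (simp add: fun_eq_iff ldiff_grade_inv)
  show ?case
    by (simp add: contr_shuf contr_ldiff contr_grade_inv ldiff_add ldiff_minus bder_shuf Cons.IH gi
        shuf_add_left shuf_add_right shuf_minus_left shuf_minus_right shuf_diff_left shuf_diff_right)
qed simp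

definition unit_cochain :: "'s list \<Rightarrow> 'r::{zero,one}" where
  "unit_cochain es = (if es = [] then 1 else 0)"

lemma unit_cochain_simps [simp]:
  "contr x unit_cochain = (\<lambda>es. 0::'r::{real_vector,one})"
  "grade_inv unit_cochain = (unit_cochain :: 's list \<Rightarrow> 'r::{real_vector,one})"
  by (auto simp: contr_def unit_cochain_def grade_inv_def fun_eq_iff)

lemma shuf_unit:
  fixes F :: "'s list \<Rightarrow> 'r::{real_algebra,monoid_mult}"
  shows "shuf unit_cochain F es = F es" "shuf F unit_cochain es = F es"
   apply (induction es arbitrary: F; simp add: unit_cochain_def; simp add: contr_def)
  apply (induction es arbitrary: F; simp add: unit_cochain_def; simp add: contr_def)
  done

text \<open>A separate type, because functions already carry the pointwise product. Here
  multiplication becomes the shuffle product, and powers and ring normalisation are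
  available.\<close>

typedef ('s, 'r) shuffle_cochain = "UNIV :: ('s list \<Rightarrow> 'r) set"
  morphisms at_list Cochain ..

lemmas Cochain_inverse' [simp] = Cochain_inverse[OF UNIV_I]

lemma cochain_eqI: "(\<And>es. at_list X es = at_list Y es) \<Longrightarrow> X = Y"
  using at_list_inject by blast

instantiation shuffle_cochain :: (type, real_vector) real_vector
begin
definition "0 = Cochain (\<lambda>es. 0)"
definition "X + Y = Cochain (\<lambda>es. at_list X es + at_list Y es)"
definition "- X = Cochain (\<lambda>es. - at_list X es)"
definition "X - Y = Cochain (\<lambda>es. at_list X es - at_list Y es)"
definition "c *\<^sub>R X = Cochain (\<lambda>es. c *\<^sub>R at_list X es)"

lemma at_list_simps [simp]:
  "at_list (0 :: ('a,'b) shuffle_cochain) es = 0"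
  "at_list (X + Y) es = at_list X es + at_list Y es"
  "at_list (- X) es = - at_list X es"
  "at_list (X - Y) es = at_list X es - at_list Y es"
  "at_list (c *\<^sub>R X) es = c *\<^sub>R at_list X es" for X Y :: "('a,'b) shuffle_cochain"
  by (simp_all add: zero_shuffle_cochain_def plus_shuffle_cochain_def uminus_shuffle_cochain_def
      minus_shuffle_cochain_def scaleR_shuffle_cochain_def)

instance
  by standard (auto intro!: cochain_eqI simp: algebra_simps)
end

lemma at_list_eta:
  "at_list (X + Y) = (\<lambda>es. at_list X es + at_list Y es)"
  "at_list (- X) = (\<lambda>es. - at_list X es)"
  "at_list (X - Y) = (\<lambda>es. at_list X es - at_list Y es)"
  "at_list (c *\<^sub>R X) = (\<lambda>es. c *\<^sub>R at_list X es)" for X Y :: "('a,'b::real_vector) shuffle_cochain"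
  by (simp_all add: fun_eq_iff)

instantiation shuffle_cochain :: (type, real_algebra) real_algebra
begin
definition "X * Y = Cochain (shuf (at_list X) (at_list Y))"

lemma at_list_mult: "at_list (X * Y) = shuf (at_list X) (at_list Y)" for X Y :: "('a,'b) shuffle_cochain"
  by (simp add: times_shuffle_cochain_def)

instance
  by standard (auto intro!: cochain_eqI
      simp: at_list_mult at_list_eta shuf_assoc shuf_add_left shuf_add_right shuf_scaleR_left shuf_scaleR_right)
end

instantiation shuffle_cochain :: (type, "{real_algebra,monoid_mult}") monoid_mult
begin
definition "1 = Cochain unit_cochain"
instance
  by standard (auto intro!: cochain_eqI simp: at_list_mult one_shuffle_cochain_def shuf_unit mult.assoc)
end

lemma at_list_one [simp]:
  "at_list (1 :: ('s,'r::{real_algebra,monoid_mult}) shuffle_cochain) = unit_cochain"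
  by (simp add: one_shuffle_cochain_def)

lemma at_list_sum: "at_list (\<Sum>i\<in>I. X i) es = (\<Sum>i\<in>I. at_list (X i) es)"
  by (induction I rule: infinite_finite_induct) auto

definition grade :: "('s,'r::real_vector) shuffle_cochain \<Rightarrow> ('s,'r) shuffle_cochain" where
  "grade X = Cochain (grade_inv (at_list X))"

definition bdiff :: "('s \<Rightarrow> 's \<Rightarrow> 's) \<Rightarrow> ('s,'r::real_vector) shuffle_cochain \<Rightarrow> ('s,'r) shuffle_cochain" where
  "bdiff br X = Cochain (\<lambda>es. ldiff br es (at_list X))"

lemma at_list_grade: "at_list (grade X) = grade_inv (at_list X)"
  by (simp add: grade_def)

lemma at_list_bdiff: "at_list (bdiff br X) es = ldiff br es (at_list X)"
  by (simp add: bdiff_def)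

lemma grade_simps:
  "grade (X + Y) = grade X + grade Y" "grade (X - Y) = grade X - grade Y" "grade (- X) = - grade X"
  "grade (c *\<^sub>R X) = c *\<^sub>R grade X" "grade (grade X) = X"
  by (auto intro!: cochain_eqI simp: at_list_grade at_list_eta)

lemma grade_mult: "grade (X * Y) = grade X * grade Y"
  by (auto intro!: cochain_eqI simp: at_list_grade at_list_mult grade_inv_shuf)

lemma grade_one [simp]: "grade (1 :: ('s,'r::{real_algebra,monoid_mult}) shuffle_cochain) = 1"
  by (auto intro!: cochain_eqI simp: at_list_grade)

lemma bdiff_simps:
  "bdiff br (X + Y) = bdiff br X + bdiff br Y" "bdiff br (- X) = - bdiff br X"
  "bdiff br (c *\<^sub>R X) = c *\<^sub>R bdiff br X"
  by (auto intro!: cochain_eqI simp: at_list_bdiff at_list_eta ldiff_add ldiff_minus ldiff_scaleR)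

lemma bdiff_mult: "bdiff br (X * Y) = bdiff br X * Y + grade X * bdiff br Y"
proof (rule cochain_eqI)
  fix es
  have "at_list (bdiff br Z) = (\<lambda>es. ldiff br es (at_list Z))" for Z :: "('a,'b) shuffle_cochain"
    by (simp add: fun_eq_iff at_list_bdiff)
  then show "at_list (bdiff br (X * Y)) es = at_list (bdiff br X * Y + grade X * bdiff br Y) es"
    by (simp add: at_list_bdiff at_list_mult at_list_grade ldiff_shuf)
qed

definition one_cochain :: "('s \<Rightarrow> 'r::zero) \<Rightarrow> ('s, 'r) shuffle_cochain" where
  "one_cochain w = Cochain (\<lambda>es. case es of [x] \<Rightarrow> w x | _ \<Rightarrow> 0)"

lemma at_list_one_cochain [simp]:
  "at_list (one_cochain w) [] = 0" "at_list (one_cochain w) [x] = w x"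
  "at_list (one_cochain w) (x # y # es) = 0"
  by (simp_all add: one_cochain_def)

lemma contr_one_cochain:
  "contr x (at_list (one_cochain w)) = (\<lambda>es. if es = [] then w x else 0)"
  by (auto simp: contr_def one_cochain_def fun_eq_iff split: list.splits)

lemma grade_one_cochain: "grade (one_cochain w) = - one_cochain w"
  by (auto intro!: cochain_eqI simp: at_list_grade grade_inv_def one_cochain_def split: list.splits)

lemma bdiff_one_cochain:
  fixes w :: "'s \<Rightarrow> 'b::real_vector"
  shows "at_list (bdiff br (one_cochain w)) [] = 0" "at_list (bdiff br (one_cochain w)) [x] = 0"
  "at_list (bdiff br (one_cochain w)) [x, y] = - w (br x y)"
  "at_list (bdiff br (one_cochain w)) (x # y # z # es) = 0"
proof -
  have c: "contr u (\<lambda>es. if es = [] then a else (0::'b)) = (\<lambda>es. 0)" for u :: 's and a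
    by (simp add: contr_def fun_eq_iff)
  have b0: "bder br u vs (\<lambda>es. (0::'b)) = 0" for u vs
    using bder_scaleR[of br u vs 0 "\<lambda>es. 0"] by simp
  have l0: "ldiff br vs (\<lambda>es. (0::'b)) = 0" for vs
    using ldiff_scaleR[of br vs 0 "\<lambda>es. 0"] by simp
  show "at_list (bdiff br (one_cochain w)) [] = 0" "at_list (bdiff br (one_cochain w)) [x] = 0"
    "at_list (bdiff br (one_cochain w)) [x, y] = - w (br x y)"
    "at_list (bdiff br (one_cochain w)) (x # y # z # es) = 0"
    by (simp_all add: at_list_bdiff contr_one_cochain c b0 l0)
qed

section \<open>Connections and curvature in the shuffle algebra\<close>

text \<open>The graded commutator of d + W with X. The commutator with W plays the part of the
  anchor terms missing from \<open>bdiff\<close>; under the trace it becomes exactly those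
  terms.\<close>

definition covd :: "('s \<Rightarrow> 's \<Rightarrow> 's) \<Rightarrow> ('s,'r::real_algebra) shuffle_cochain
    \<Rightarrow> ('s,'r) shuffle_cochain \<Rightarrow> ('s,'r) shuffle_cochain" where
  "covd br W X = bdiff br X + W * X - grade X * W"

definition curv :: "('s \<Rightarrow> 's \<Rightarrow> 's) \<Rightarrow> ('s,'r::real_algebra) shuffle_cochain
    \<Rightarrow> ('s,'r) shuffle_cochain" where
  "curv br W = bdiff br W + W * W"

lemma covd_add: "covd br W (X + Y) = covd br W X + covd br W Y"
  by (simp add: covd_def bdiff_simps grade_simps algebra_simps)

lemma covd_scaleR: "covd br W (c *\<^sub>R X) = c *\<^sub>R covd br W X"
  by (simp add: covd_def bdiff_simps grade_simps algebra_simps)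

lemma covd_zero [simp]: "covd br W 0 = 0"
  using covd_scaleR[of br W 0 0] by simp

lemma covd_sum: "covd br W (\<Sum>i\<in>I. X i) = (\<Sum>i\<in>I. covd br W (X i))"
  by (induction I rule: infinite_finite_induct) (auto simp: covd_add)

lemma covd_mult: "covd br W (X * Y) = covd br W X * Y + grade X * covd br W Y"
  by (simp add: covd_def bdiff_mult grade_mult algebra_simps)

lemma covd_one: "covd br W (1 :: ('s,'r::{real_algebra,monoid_mult}) shuffle_cochain) = 0"
proof -
  have "bdiff br (1 :: ('s,'r) shuffle_cochain) = bdiff br 1 + bdiff br 1"
    using bdiff_mult[of br "1 :: ('s,'r) shuffle_cochain" 1] by simp
  then show ?thesis by (simp add: covd_def)
qed

text \<open>The square of the differential on a connection cochain enters the Bianchi identity. Only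
  lists of length three can give a nonzero value, and there it is w applied to the defect in the
  Leibniz identity of the bracket.\<close>

lemma bdiff_bdiff_one_cochain:
  assumes "linear w" and "\<And>x y z. br x (br y z) = br (br x y) z + br y (br x z)"
  shows "bdiff br (bdiff br (one_cochain w)) = 0"
proof (rule cochain_eqI)
  fix es :: "'a list"
  let ?W = "at_list (bdiff br (one_cochain w))"
  have c1: "contr x ?W = at_list (one_cochain (\<lambda>y. - w (br x y)))" for x
  proof
    fix es :: "'a list"
    show "contr x ?W es = at_list (one_cochain (\<lambda>y. - w (br x y))) es"
      by (cases es rule: remdups_adj.cases) (simp_all add: contr_def bdiff_one_cochain)
  qed
  have b0: "bder br u vs (\<lambda>es. 0) = 0" for u vs
    using bder_scaleR[of br u vs 0 "\<lambda>es. 0"] by simp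
  have c2: "contr y (contr x ?W) = (\<lambda>es. if es = [] then - w (br x y) else 0)" for x y
    by (simp add: c1 contr_one_cochain)
  have c0: "contr z (\<lambda>es. if es = [] then a else (0::'b)) = (\<lambda>es. 0)" for z :: 'a and a
    by (simp add: contr_def fun_eq_iff)
  have ld: "ldiff br vs (at_list (one_cochain v)) = at_list (bdiff br (one_cochain v)) vs" for vs v
    by (simp add: at_list_bdiff)
  have bd: "bder br x es ?W = (case es of [y, z] \<Rightarrow> - w (br (br x y) z) - w (br y (br x z)) | _ \<Rightarrow> 0)" for x es
  proof (cases es)
    case (Cons y es')
    show ?thesis
    proof (cases es')
      case (Cons z es'')
      have "bder br x es'' (contr z (contr y ?W)) = 0"
        unfolding c2 by (cases es'') (simp_all add: c0 b0)
      moreover have "contr y ?W (br x z # es'') = (if es'' = [] then - w (br y (br x z)) else 0)"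
        unfolding c1 by (cases es'') simp_all
      moreover have "?W (br x y # z # es'') = (if es'' = [] then - w (br (br x y) z) else 0)"
        by (cases es'') (simp_all add: bdiff_one_cochain)
      ultimately show ?thesis unfolding \<open>es = y # es'\<close> Cons by (simp split: list.split)
    qed (simp add: \<open>es = y # es'\<close> bdiff_one_cochain)
  qed simp
  have sub: "w (br x (br y z)) = w (br (br x y) z) + w (br y (br x z))" for x y z
    by (metis assms linear_add)
  show "at_list (bdiff br (bdiff br (one_cochain w))) es = at_list 0 es"
  proof (cases es)
    case (Cons x es')
    have "at_list (bdiff br (bdiff br (one_cochain w))) es =
        - bder br x es' ?W - at_list (bdiff br (one_cochain (\<lambda>y. - w (br x y)))) es'"
      unfolding Cons by (simp add: at_list_bdiff[of br "bdiff br _"] c1 ld)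
    also have "\<dots> = 0"
    proof (cases es')
      case (Cons y es'')
      show ?thesis
      proof (cases es'')
        case (Cons z l)
        then show ?thesis using \<open>es' = y # es''\<close> sub[of x y z]
          by (cases l) (simp_all add: bd bdiff_one_cochain del: bder.simps)
      qed (simp add: \<open>es' = y # es''\<close> bd bdiff_one_cochain del: bder.simps)
    qed (simp add: bdiff_one_cochain)
    finally show ?thesis by simp
  qed (simp add: at_list_bdiff)
qed

text \<open>Polynomial curves in a vector space without topology: F has at most n coefficients and
  F' is its formal derivative. The rules are Horner's scheme for F and the product rule for
  F'.\<close>

inductive pd :: "nat \<Rightarrow> (real \<Rightarrow> 'a::real_vector) \<Rightarrow> (real \<Rightarrow> 'a) \<Rightarrow> bool" where
  pd_zero: "pd n (\<lambda>t. 0) (\<lambda>t. 0)"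
| pd_step: "pd n F F' \<Longrightarrow> pd (Suc n) (\<lambda>t. c + t *\<^sub>R F t) (\<lambda>t. F t + t *\<^sub>R F' t)"

lemma pd_Suc: "pd n F F' \<Longrightarrow> pd (Suc n) F F'"
  by (induction rule: pd.induct) (auto intro: pd.intros)

lemma pd_mono: "pd n F F' \<Longrightarrow> n \<le> m \<Longrightarrow> pd m F F'"
  by (induction m) (auto simp: le_Suc_eq intro: pd_Suc)

lemma pd_const: "pd (Suc n) (\<lambda>t. c) (\<lambda>t. 0)"
  using pd_step[OF pd_zero, of n c] by simp

lemma pd_times_t: "pd n F F' \<Longrightarrow> pd (Suc n) (\<lambda>t. t *\<^sub>R F t) (\<lambda>t. F t + t *\<^sub>R F' t)"
  using pd_step[of n F F' 0] by simp

lemma pd_affine: "pd 2 (\<lambda>t. c + t *\<^sub>R d) (\<lambda>t. d)"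
  using pd_step[OF pd_const[of 0 d], of c] by (simp add: numeral_2_eq_2)

lemma pd_add: "pd n F F' \<Longrightarrow> pd n G G' \<Longrightarrow> pd n (\<lambda>t. F t + G t) (\<lambda>t. F' t + G' t)"
proof (induction arbitrary: G G' rule: pd.induct)
  case (pd_step n F F' c)
  from pd_step.prems show ?case
  proof cases
    case pd_zero
    then show ?thesis using pd.pd_step[OF pd_step.hyps] by simp
  next
    case (pd_step H H' d)
    have "pd (Suc n) (\<lambda>t. (c + d) + t *\<^sub>R (F t + H t)) (\<lambda>t. (F t + H t) + t *\<^sub>R (F' t + H' t))"
      using pd_step pd_step.IH by (intro pd.pd_step) simp
    then show ?thesis unfolding pd_step by (simp add: algebra_simps)
  qed
qed simp

lemma pd_linear:
  assumes "pd n F F'" "linear h" shows "pd n (\<lambda>t. h (F t)) (\<lambda>t. h (F' t))"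
  using assms(1)
proof (induction rule: pd.induct)
  case (pd_zero n)
  then show ?case using linear_0[OF assms(2)] by (simp add: pd.pd_zero)
next
  case (pd_step n F F' c)
  from pd.pd_step[OF pd_step.IH, of "h c"] show ?case
    using assms(2) by (simp add: linear_add linear_scale)
qed

lemma pd_mult:
  fixes F :: "real \<Rightarrow> 'a::real_algebra"
  assumes "pd n F F'" "pd m G G'"
  shows "pd (n + m) (\<lambda>t. F t * G t) (\<lambda>t. F' t * G t + F t * G' t)"
  using assms(1)
proof (induction rule: pd.induct)
  case (pd_zero n)
  then show ?case by (simp add: pd.pd_zero)
next
  case (pd_step n F F' c)
  have "linear ((*) c)" by (intro linearI) (simp_all add: algebra_simps)
  then have "pd (Suc n + m) (\<lambda>t. c * G t) (\<lambda>t. c * G' t)"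
    by (rule pd_mono[OF pd_linear[OF assms(2)]]) simp
  from pd_add[OF this pd_times_t[OF pd_step.IH, simplified, unfolded add_Suc[symmetric]]]
  show ?case by (simp add: algebra_simps)
qed

text \<open>The factors need not commute, so each summand keeps the derivative in its place. The
  extra \<open>Suc\<close> leaves room for the constant coefficient when k is 0.\<close>

lemma pd_power:
  fixes F :: "real \<Rightarrow> 'a::{real_algebra,monoid_mult}"
  assumes "pd n F F'"
  shows "pd (Suc (k * n)) (\<lambda>t. F t ^ k) (\<lambda>t. \<Sum>i<k. F t ^ i * F' t * F t ^ (k - Suc i))"
proof (induction k)
  case 0
  then show ?case by (simp add: pd_const)
next
  case (Suc k)
  have "(\<Sum>i<Suc k. F t ^ i * F' t * F t ^ (Suc k - Suc i)) =
      F' t * F t ^ k + F t * (\<Sum>i<k. F t ^ i * F' t * F t ^ (k - Suc i))" for t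
    by (simp add: sum.lessThan_Suc_shift sum_distrib_left mult.assoc del: sum.lessThan_Suc)
  with pd_mult[OF assms Suc] show ?case by (simp add: add.commute)
qed

lemma pd_poly: "pd n F F' \<Longrightarrow> \<exists>q. degree q \<le> n \<and> F = poly q \<and> F' = poly (pderiv q)"
proof (induction rule: pd.induct)
  case (pd_zero n)
  then show ?case by (intro exI[of _ 0]) auto
next
  case (pd_step n F F' c)
  then obtain q where "degree q \<le> n" "F = poly q" "F' = poly (pderiv q)" by blast
  then show ?case
    by (intro exI[of _ "pCons c q"]) (auto simp: pderiv_pCons intro!: order.trans[OF degree_pCons_le])
qed

lemma pd_fundamental:
  fixes F :: "real \<Rightarrow> real"
  assumes "pd n F F'" shows "integral {0..1} F' = F 1 - F 0"
proof -
  obtain q where q: "F = poly q" "F' = poly (pderiv q)"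
    using pd_poly[OF assms] by blast
  have "(poly q has_vector_derivative poly (pderiv q) x) (at x within {0..1})" for x
    using poly_DERIV[of q x]
    unfolding has_real_derivative_iff_has_vector_derivative by (rule has_vector_derivative_at_within)
  then have "(poly (pderiv q) has_integral (poly q 1 - poly q 0)) {0..1}"
    using fundamental_theorem_of_calculus[of 0 1 "poly q" "poly (pderiv q)"] by simp
  then show ?thesis using q by (simp add: integral_unique)
qed

text \<open>Lagrange interpolation at 0, ..., n reproduces polynomials of degree at most n, so the
  integrals of the Lagrange basis serve as weights. Nodes outside the unit interval are harmless for
  polynomials.\<close>

lemma quadrature_exists:
  "\<exists>w::nat \<Rightarrow> real. \<forall>q::real poly. degree q \<le> n \<longrightarrow>
      integral {0..1} (poly q) = (\<Sum>j\<le>n. w j * poly q (real j))"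
proof -
  define l :: "nat \<Rightarrow> real poly" where
    "l j = Polynomial.smult (inverse (\<Prod>i\<in>{..n}-{j}. (real j - real i))) (\<Prod>i\<in>{..n}-{j}. [:- real i, 1:])" for j
  have lval: "poly (l j) (real k) = (if k = j then 1 else 0)" if "j \<le> n" "k \<le> n" for j k
  proof (cases "k = j")
    case True
    have "(\<Prod>i\<in>{..n}-{j}. real j - real i) \<noteq> 0" by auto
    then show ?thesis using True by (simp add: l_def poly_prod)
  next
    case False
    then have "(\<Prod>i\<in>{..n}-{j}. (- real i) + real k) = 0" using that by (auto intro!: bexI[of _ k])
    then show ?thesis using False by (simp add: l_def poly_prod)
  qed
  have ldeg: "degree (l j) \<le> n" if "j \<le> n" for j
  proof -
    have "degree (\<Prod>i\<in>{..n}-{j}. [:- real i, 1:]) \<le> (\<Sum>i\<in>{..n}-{j}. degree [:- real i, 1:])"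
      by (rule degree_prod_sum_le[unfolded o_def]) simp
    also have "\<dots> = n" using that by simp
    finally show ?thesis unfolding l_def using degree_smult_le order.trans by blast
  qed
  have expand: "q = (\<Sum>j\<le>n. Polynomial.smult (poly q (real j)) (l j))" if "degree q \<le> n" for q
  proof (rule poly_eqI_degree[of "real ` {..n}"])
    show "poly q x = poly (\<Sum>j\<le>n. Polynomial.smult (poly q (real j)) (l j)) x" if x: "x \<in> real ` {..n}" for x
    proof -
      obtain k where k: "k \<le> n" "x = real k" using x by auto
      have "(\<Sum>j\<le>n. poly q (real j) * poly (l j) (real k)) = (\<Sum>j\<le>n. if k = j then poly q (real j) else 0)"
        using k by (intro sum.cong) (auto simp: lval)
      then show ?thesis using k by (simp add: poly_sum)
    qed
    have c: "card (real ` {..n}) = Suc n" by (simp add: card_image)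
    show "degree q < card (real ` {..n})" using that c by simp
    have "degree (\<Sum>j\<le>n. Polynomial.smult (poly q (real j)) (l j)) \<le> n"
      using ldeg by (intro degree_sum_le) (auto intro: order.trans[OF degree_smult_le])
    then show "degree (\<Sum>j\<le>n. Polynomial.smult (poly q (real j)) (l j)) < card (real ` {..n})" using c by simp
  qed
  have "integral {0..1} (poly q) = (\<Sum>j\<le>n. integral {0..1} (poly (l j)) * poly q (real j))"
    if "degree q \<le> n" for q
  proof -
    have "poly q x = (\<Sum>j\<le>n. poly q (real j) * poly (l j) x)" for x
      using arg_cong[OF expand[OF that], of "\<lambda>p. poly p x"] by (simp add: poly_sum)
    then have "integral {0..1} (poly q) = integral {0..1} (\<lambda>x. \<Sum>j\<le>n. poly q (real j) * poly (l j) x)"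
      by (intro integral_cong)
    also have "\<dots> = (\<Sum>j\<le>n. poly q (real j) * integral {0..1} (poly (l j)))"
      by (subst integral_sum) (auto intro!: integrable_continuous_real continuous_intros)
    finally show ?thesis by (simp add: mult.commute)
  qed
  then show ?thesis by (intro exI[of _ "\<lambda>j. integral {0..1} (poly (l j))"]) blast
qed

text \<open>The cochains in question depend polynomially on the parameter, so their integrals are finite
  combinations of their values at \<open>0, \<dots>, n\<close>. This keeps integration inside the algebra of cochains,
  which carries no topology.\<close>

definition quad_weight :: "nat \<Rightarrow> nat \<Rightarrow> real" where
  "quad_weight n = (SOME w. \<forall>q::real poly. degree q \<le> n \<longrightarrow>
      integral {0..1} (poly q) = (\<Sum>j\<le>n. w j * poly q (real j)))"

definition quad :: "nat \<Rightarrow> (real \<Rightarrow> 'a::real_vector) \<Rightarrow> 'a" where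
  "quad n F = (\<Sum>j\<le>n. quad_weight n j *\<^sub>R F (real j))"

lemma linear_quad: "linear h \<Longrightarrow> h (quad n F) = quad n (\<lambda>t. h (F t))"
  by (simp add: quad_def linear_sum linear_scale)

lemma quad_pd:
  fixes F :: "real \<Rightarrow> real"
  assumes "pd n F F'" shows "quad n F = integral {0..1} F"
proof -
  obtain q where q: "degree q \<le> n" "F = poly q" using pd_poly[OF assms] by blast
  show ?thesis unfolding q(2) quad_def quad_weight_def
    using someI_ex[OF quadrature_exists[of n]] q(1) by simp
qed

text \<open>The fundamental theorem of calculus for formal derivatives, applicable once a linear
  functional has sent a polynomial curve to the reals.\<close>

lemma quad_fundamental:
  fixes F :: "real \<Rightarrow> real"
  assumes "pd n F F'" shows "quad n F' = F 1 - F 0"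
proof -
  obtain q where q: "degree q \<le> n" "F = poly q" "F' = poly (pderiv q)"
    using pd_poly[OF assms] by blast
  have "degree (pderiv q) \<le> n" using q(1) by (simp add: degree_pderiv)
  then have "quad n F' = integral {0..1} F'"
    unfolding q(3) quad_def quad_weight_def using someI_ex[OF quadrature_exists[of n]] by simp
  then show ?thesis using pd_fundamental[OF assms] by simp
qed

lemma quad_swap: "quad n (\<lambda>s. quad n (\<lambda>t. F s t)) = quad n (\<lambda>t. quad n (\<lambda>s. F s t))"
  unfolding quad_def scaleR_sum_right by (subst sum.swap) (simp add: mult.commute)

lemma quad_diff: "quad n (\<lambda>t. F t - G t) = quad n F - quad n G"
  by (simp add: quad_def scaleR_diff_right sum_subtractf)

section \<open>Traces and transgression in the shuffle algebra\<close>

lemma eq_minus_self_zero: "x = - x \<Longrightarrow> x = 0" for x :: "'a::real_vector"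
  by (metis add.right_inverse scaleR_2 scaleR_eq_0_iff zero_neq_numeral)

text \<open>One induction with two uses: Q as equality of traces yields graded cyclicity, and Q as
  adjointness yields the reversal of products. The \<open>grade_inv\<close> hypotheses say that the
  cochains have parities p and q.\<close>

lemma shuf_swap:
  fixes Q :: "'r::real_algebra \<Rightarrow> 'r \<Rightarrow> bool"
  assumes Q_add: "\<And>a b c d. Q a b \<Longrightarrow> Q c d \<Longrightarrow> Q (a + c) (b + d)"
    and Q_scale: "\<And>r a b. Q a b \<Longrightarrow> Q (r *\<^sub>R a) (r *\<^sub>R b)"
  shows "(\<And>us vs. Q (F us * G vs) (G' vs * F' us)) \<Longrightarrow>
    grade_inv F = (\<lambda>es. (-1) ^ p *\<^sub>R F es) \<Longrightarrow> grade_inv F' = (\<lambda>es. (-1) ^ p *\<^sub>R F' es) \<Longrightarrow>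
    grade_inv G = (\<lambda>es. (-1) ^ q *\<^sub>R G es) \<Longrightarrow> grade_inv G' = (\<lambda>es. (-1) ^ q *\<^sub>R G' es) \<Longrightarrow>
    Q (shuf F G es) ((-1) ^ (p * q) *\<^sub>R shuf G' F' es)"
proof (induction es arbitrary: F F' G G' p q)
  case Nil
  \<comment> \<open>An odd cochain vanishes on the empty list, so for odd p and q the sign there
    causes no conflict.\<close>
  have "F [] = 0 \<and> F' [] = 0" if "odd p"
    using that fun_cong[OF Nil(2), of "[]"] fun_cong[OF Nil(3), of "[]"]
    by (auto simp: grade_inv_def intro: eq_minus_self_zero)
  then show ?case using Nil(1)[of "[]" "[]"] by (cases "even p") auto
next
  case (Cons x es)
  note prems = Cons.prems
  \<comment> \<open>Contraction lowers the degree by one and flips the parity.\<close>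
  have c: "grade_inv (contr x H) = (\<lambda>es. (-1) ^ Suc n *\<^sub>R contr x H es)"
    if "grade_inv H = (\<lambda>es. (-1) ^ n *\<^sub>R H es)" for H :: "'a list \<Rightarrow> 'r" and n
  proof
    fix es
    have "grade_inv (contr x H) es = - grade_inv H (x # es)" by (simp add: grade_inv_def contr_def)
    then show "grade_inv (contr x H) es = (-1) ^ Suc n *\<^sub>R contr x H es"
      unfolding that by (simp add: contr_def)
  qed
  have 1: "Q (shuf (contr x F) G es) ((-1) ^ (Suc p * q) *\<^sub>R shuf G' (contr x F') es)"
    by (rule Cons.IH[OF _ c[OF prems(2)] c[OF prems(3)] prems(4,5)])
      (simp add: contr_def prems(1))
  have 2: "Q (shuf F (contr x G) es) ((-1) ^ (p * Suc q) *\<^sub>R shuf (contr x G') F' es)"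
    by (rule Cons.IH[OF _ prems(2,3) c[OF prems(4)] c[OF prems(5)]])
      (simp add: contr_def prems(1))
  have "Q (shuf F G (x # es))
      ((-1) ^ (Suc p * q) *\<^sub>R shuf G' (contr x F') es
        + (-1) ^ p *\<^sub>R ((-1) ^ (p * Suc q) *\<^sub>R shuf (contr x G') F' es))"
    using Q_add[OF 1 Q_scale[OF 2, of "(-1) ^ p"]] by (simp add: prems(2) shuf_scaleR_left)
  also have "(-1) ^ (Suc p * q) *\<^sub>R shuf G' (contr x F') es
        + (-1) ^ p *\<^sub>R ((-1) ^ (p * Suc q) *\<^sub>R shuf (contr x G') F' es)
      = (-1) ^ (p * q) *\<^sub>R shuf G' F' (x # es)"
    by (cases "even p"; cases "even q") (simp_all add: prems(5) shuf_scaleR_left shuf_minus_left)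
  finally show ?case .
qed

text \<open>The full Loday differential for scalar-valued cochains, again by Cartan's formula, now
  with the anchor acting through \<open>rho\<close>.\<close>

primrec sdiff :: "('s \<Rightarrow> 's \<Rightarrow> 's) \<Rightarrow> ('s \<Rightarrow> 'f \<Rightarrow> 'f) \<Rightarrow> 's list \<Rightarrow> ('s list \<Rightarrow> 'f::real_vector) \<Rightarrow> 'f" where
  "sdiff br rho [] c = 0"
| "sdiff br rho (x # es) c = rho x (c es) - bder br x es c - sdiff br rho es (contr x c)"

text \<open>What transgression uses of the geometry. \<open>Cm\<close> models the bundle
  endomorphisms inside all linear operators; the values of a connection need not lie in it, and the
  trace is cyclic on \<open>Cm\<close>.\<close>

locale trace_algebra =
  fixes br :: "'s::real_vector \<Rightarrow> 's \<Rightarrow> 's"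
    and Cm :: "'r::{real_algebra,monoid_mult} set"
    and tr :: "'r \<Rightarrow> 'f::real_vector"
    and rho :: "'s \<Rightarrow> 'f \<Rightarrow> 'f"
  assumes loday: "br x (br y z) = br (br x y) z + br y (br x z)"
    and subspace_Cm: "subspace Cm"
    and Cm_mult: "S \<in> Cm \<Longrightarrow> T \<in> Cm \<Longrightarrow> S * T \<in> Cm"
    and Cm_one: "1 \<in> Cm"
    and linear_tr: "linear tr"
    and tr_commute: "S \<in> Cm \<Longrightarrow> T \<in> Cm \<Longrightarrow> tr (S * T) = tr (T * S)"
begin

definition Cmv :: "('s,'r) shuffle_cochain \<Rightarrow> bool" where
  "Cmv X \<longleftrightarrow> (\<forall>es. at_list X es \<in> Cm)"

text \<open>The Leibniz rule enters only through its consequences: curvature and commutators with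
  \<open>Cm\<close> are again \<open>Cm\<close>-valued, and the trace of such a commutator is the
  anchor derivative of the trace.\<close>

definition is_conn :: "('s,'r) shuffle_cochain \<Rightarrow> bool" where
  "is_conn W \<longleftrightarrow> Cmv (curv br W) \<and> (\<exists>w. W = one_cochain w \<and> linear w \<and>
     (\<forall>x. \<forall>T\<in>Cm. w x * T - T * w x \<in> Cm \<and> tr (w x * T - T * w x) = rho x (tr T)))"

definition is_form :: "('s,'r) shuffle_cochain \<Rightarrow> bool" where
  "is_form A \<longleftrightarrow> (\<exists>a. A = one_cochain a \<and> linear a \<and> range a \<subseteq> Cm)"

definition trl :: "('s,'r) shuffle_cochain \<Rightarrow> 's list \<Rightarrow> 'f" where
  "trl X es = tr (at_list X es)"

lemmas Cm_add = subspace_add[OF subspace_Cm]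
  and Cm_scale = subspace_scale[OF subspace_Cm]
  and Cm_zero = subspace_0[OF subspace_Cm]
  and Cm_diff = subspace_diff[OF subspace_Cm]

lemma shuf_Cm:
  "(\<And>us. F us \<in> Cm) \<Longrightarrow> (\<And>vs. G vs \<in> Cm) \<Longrightarrow> shuf F G es \<in> Cm"
proof (induction es arbitrary: F G)
  case (Cons x es)
  show ?case unfolding shuf.simps
    by (intro Cm_add Cons.IH) (auto simp: contr_def grade_inv_def Cons.prems Cm_scale)
qed (simp add: Cm_mult)

lemma Cmv_add: "Cmv X \<Longrightarrow> Cmv Y \<Longrightarrow> Cmv (X + Y)"
  and Cmv_scale: "Cmv X \<Longrightarrow> Cmv (c *\<^sub>R X)"
  and Cmv_zero: "Cmv 0"
  by (auto simp: Cmv_def Cm_add Cm_diff Cm_scale Cm_zero)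

lemma Cmv_mult: "Cmv X \<Longrightarrow> Cmv Y \<Longrightarrow> Cmv (X * Y)"
  by (auto simp: Cmv_def at_list_mult shuf_Cm)

lemma Cmv_one: "Cmv 1"
  by (auto simp: Cmv_def unit_cochain_def Cm_one Cm_zero)

lemma Cmv_power: "Cmv X \<Longrightarrow> Cmv (X ^ n)"
  by (induction n) (auto simp: Cmv_one Cmv_mult)

lemma Cmv_sum: "(\<And>i. i \<in> I \<Longrightarrow> Cmv (X i)) \<Longrightarrow> Cmv (\<Sum>i\<in>I. X i)"
  by (induction I rule: infinite_finite_induct) (auto intro: Cmv_add Cmv_zero)

lemma Cmv_form: "is_form A \<Longrightarrow> Cmv A"
  by (auto simp: is_form_def Cmv_def one_cochain_def Cm_zero image_subset_iff split: list.splits)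

lemma linear_trl: "linear (\<lambda>X. trl X es)"
  unfolding trl_def using linear_tr by (intro linearI) (simp_all add: linear_add linear_scale)

lemmas trl_scale = linear_scale[OF linear_trl] and trl_sum = linear_sum[OF linear_trl]
  and trl_zero = linear_0[OF linear_trl]

text \<open>Cyclicity with an even second factor, so that the Koszul sign is trivial.\<close>

lemma trl_commute:
  assumes "Cmv X" "Cmv Y" "grade X = (-1) ^ p *\<^sub>R X" "grade Y = Y"
  shows "trl (X * Y) es = trl (Y * X) es"
proof -
  let ?Q = "\<lambda>a b. tr a = tr b"
  have g: "grade_inv (at_list Z) = (\<lambda>es. c *\<^sub>R at_list Z es)" if "grade Z = c *\<^sub>R Z" for Z :: "('s,'r) shuffle_cochain" and c
    using that by (metis at_list_eta(4) at_list_grade)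
  have s: "tr (at_list X us * at_list Y vs) = tr (at_list Y vs * at_list X us)" for us vs
    using assms(1,2) by (intro tr_commute) (simp_all add: Cmv_def)
  have "?Q (shuf (at_list X) (at_list Y) es) ((-1) ^ (p * 0) *\<^sub>R shuf (at_list Y) (at_list X) es)"
    by (rule shuf_swap[of ?Q, OF _ _ s g[OF assms(3)] g[OF assms(3)]])
      (use g[of Y 1] assms(4) in \<open>simp_all add: linear_add[OF linear_tr] linear_scale[OF linear_tr]\<close>)
  then show ?thesis by (simp add: trl_def at_list_mult)
qed

text \<open>Contracting the covariant differential with x gives a commutator with w x, minus the Lie
  derivative, minus the covariant differential of the contraction. The trace turns the commutator
  into the anchor derivative, which is the recursion of \<open>sdiff\<close>.\<close>

lemma trace_covd_aux:
  assumes "linear w" "\<And>x T. T \<in> Cm \<Longrightarrow> w x * T - T * w x \<in> Cm"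
    "\<And>x T. T \<in> Cm \<Longrightarrow> tr (w x * T - T * w x) = rho x (tr T)" and "Cmv X"
  shows "at_list (covd br (one_cochain w) X) es \<in> Cm \<and>
    sdiff br rho es (trl X) = trl (covd br (one_cochain w) X) es"
  using assms(4)
proof (induction es arbitrary: X)
  case Nil
  have "at_list (covd br (one_cochain w) X) [] = 0"
    by (simp add: covd_def at_list_bdiff at_list_mult)
  then show ?case by (simp add: trl_def linear_0[OF linear_tr] Cm_zero)
next
  case (Cons x es)
  define Y where "Y = Cochain (contr x (at_list X))"
  have atY: "at_list Y = contr x (at_list X)" by (simp add: Y_def)
  have cY: "Cmv Y" using Cons.prems by (simp add: Cmv_def Y_def contr_def)
  have sh1: "shuf (\<lambda>es. if es = [] then v else 0) F es = v * F es" for v :: 'r and F :: "'s list \<Rightarrow> 'r" and es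
  proof (induction es arbitrary: F)
    case (Cons y es)
    have "contr y (\<lambda>es. if es = [] then v else 0) = (\<lambda>es. 0::'r)"
      "grade_inv (\<lambda>es. if es = [] then v else 0) = (\<lambda>es::'s list. if es = [] then v else 0)"
      by (auto simp: contr_def grade_inv_def fun_eq_iff)
    then show ?case using Cons by (simp add: contr_def)
  qed simp
  have sh2: "shuf F (\<lambda>es. if es = [] then v else 0) es = F es * v" for v :: 'r and F :: "'s list \<Rightarrow> 'r" and es
  proof (induction es arbitrary: F)
    case (Cons y es)
    have "contr y (\<lambda>es. if es = [] then v else 0) = (\<lambda>es. 0::'r)"
      by (auto simp: contr_def fun_eq_iff)
    then show ?case using Cons by (simp add: contr_def)
  qed simp
  have bC: "bder br x es F \<in> Cm" if "\<And>us. F us \<in> Cm" for F es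
    using that by (induction es arbitrary: F) (auto simp: Cm_zero contr_def intro!: Cm_add)
  have btr: "bder br x es (\<lambda>us. tr (F us)) = tr (bder br x es F)" for F es
  proof (induction es arbitrary: F)
    case (Cons y es)
    have "contr y (\<lambda>us. tr (F us)) = (\<lambda>us. tr (contr y F us))" by (simp add: contr_def fun_eq_iff)
    then show ?case by (simp add: linear_add[OF linear_tr] Cons.IH[of "contr y F"])
  qed (simp add: linear_0[OF linear_tr])
  have gW: "grade_inv (at_list (one_cochain w)) = (\<lambda>es. - at_list (one_cochain w) es)"
    by (metis at_list_eta(2) at_list_grade grade_one_cochain)
  \<comment> \<open>The covariant Cartan formula.\<close>
  have eq: "at_list (covd br (one_cochain w) X) (x # es) =
      (w x * at_list X es - at_list X es * w x) - bder br x es (at_list X)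
        - at_list (covd br (one_cochain w) Y) es"
    by (simp add: covd_def at_list_bdiff at_list_mult at_list_grade contr_one_cochain sh1 sh2 gW
        shuf_minus_left contr_grade_inv atY)
  have Xes: "at_list X es \<in> Cm" using Cons.prems by (simp add: Cmv_def)
  have ctr: "contr x (trl X) = trl Y" by (simp add: fun_eq_iff contr_def trl_def atY)
  have "bder br x es (trl X) = tr (bder br x es (at_list X))"
    unfolding trl_def[abs_def] by (rule btr)
  moreover have "sdiff br rho es (trl Y) = tr (at_list (covd br (one_cochain w) Y) es)"
    using Cons.IH[OF cY] by (simp add: trl_def[of "covd _ _ _"])
  ultimately have "sdiff br rho (x # es) (trl X) = trl (covd br (one_cochain w) X) (x # es)"
    using assms(3)[OF Xes, of x]
    unfolding trl_def[of "covd br (one_cochain w) X"] eq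
    by (simp add: ctr linear_diff[OF linear_tr] trl_def[of X es])
  moreover have "at_list (covd br (one_cochain w) X) (x # es) \<in> Cm"
    unfolding eq using Cons.IH[OF cY] assms(2)[OF Xes] Cons.prems
    by (intro Cm_diff[OF Cm_diff[OF _ bC]]) (simp_all add: Cmv_def)
  ultimately show ?case by blast
qed

lemma
  assumes "is_conn W" "Cmv X"
  shows Cmv_covd: "Cmv (covd br W X)" and sdiff_trl: "sdiff br rho es (trl X) = trl (covd br W X) es"
proof -
  obtain w where w: "W = one_cochain w" "linear w"
    "\<And>x T. T \<in> Cm \<Longrightarrow> w x * T - T * w x \<in> Cm"
    "\<And>x T. T \<in> Cm \<Longrightarrow> tr (w x * T - T * w x) = rho x (tr T)"
    using assms(1) unfolding is_conn_def by blast
  show "Cmv (covd br W X)" "sdiff br rho es (trl X) = trl (covd br W X) es"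
    using trace_covd_aux[OF w(2,3,4) assms(2)] by (simp_all add: Cmv_def w(1))
qed

lemma grade_form: "is_form A \<Longrightarrow> grade A = - A" and grade_conn: "is_conn W \<Longrightarrow> grade W = - W"
  by (auto simp: is_form_def is_conn_def grade_one_cochain)

lemma one_cochain_add: "one_cochain (\<lambda>x. a x + b x) = one_cochain a + one_cochain b"
  and one_cochain_scaleR: "one_cochain (\<lambda>x. c *\<^sub>R a x) = c *\<^sub>R one_cochain a"
  by (auto intro!: cochain_eqI simp: one_cochain_def split: list.splits)

lemma form_add:
  assumes "is_form A" "is_form A'" shows "is_form (A + A')"
proof -
  obtain a a' where "A = one_cochain a" "linear a" "range a \<subseteq> Cm" "A' = one_cochain a'" "linear a'" "range a' \<subseteq> Cm"
    using assms unfolding is_form_def by blast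
  then show ?thesis unfolding is_form_def
    by (intro exI[of _ "\<lambda>x. a x + a' x"])
      (auto simp: one_cochain_add linear_compose_add image_subset_iff intro!: Cm_add)
qed

lemma form_scale:
  assumes "is_form A" shows "is_form (c *\<^sub>R A)"
proof -
  obtain a where "A = one_cochain a" "linear a" "range a \<subseteq> Cm"
    using assms unfolding is_form_def by blast
  then show ?thesis unfolding is_form_def
    by (intro exI[of _ "\<lambda>x. c *\<^sub>R a x"])
      (auto simp: one_cochain_scaleR linear_compose_scale_right image_subset_iff intro!: Cm_scale)
qed

lemma curv_add:
  assumes "grade A = - A"
  shows "curv br (W + A) = curv br W + covd br W A + A * A"
  using assms by (simp add: curv_def covd_def bdiff_simps algebra_simps)

text \<open>A form alters the commutators by commutators inside \<open>Cm\<close>, which are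
  traceless, and the curvature by \<open>Cm\<close>-valued terms.\<close>

lemma conn_add:
  assumes "is_conn W" "is_form A"
  shows "is_conn (W + A)"
proof -
  obtain w where w: "W = one_cochain w" "linear w"
    "\<And>x T. T \<in> Cm \<Longrightarrow> w x * T - T * w x \<in> Cm"
    "\<And>x T. T \<in> Cm \<Longrightarrow> tr (w x * T - T * w x) = rho x (tr T)"
    using assms(1) unfolding is_conn_def by blast
  obtain a where a: "A = one_cochain a" "linear a" "\<And>x. a x \<in> Cm"
    using assms(2) unfolding is_form_def by blast
  have e: "(w x + a x) * T - T * (w x + a x) = (w x * T - T * w x) + (a x * T - T * a x)" for x T
    by (simp add: algebra_simps)
  have cc: "Cmv (curv br (W + A))"
    unfolding curv_add[OF grade_form[OF assms(2)]]
    by (intro Cmv_add Cmv_mult Cmv_covd Cmv_form[OF assms(2)] assms(1)) (use assms(1) in \<open>simp add: is_conn_def\<close>)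
  moreover have "linear (\<lambda>x. w x + a x)" using w a by (intro linear_compose_add)
  moreover have "(w x + a x) * T - T * (w x + a x) \<in> Cm"
    "tr ((w x + a x) * T - T * (w x + a x)) = rho x (tr T)" if "T \<in> Cm" for x T
    unfolding e
  proof -
    have "a x * T - T * a x \<in> Cm" by (intro Cm_diff Cm_mult a(3) that)
    moreover have "tr (a x * T - T * a x) = 0"
      by (simp add: linear_diff[OF linear_tr] tr_commute[OF a(3) that])
    ultimately show "w x * T - T * w x + (a x * T - T * a x) \<in> Cm"
      "tr (w x * T - T * w x + (a x * T - T * a x)) = rho x (tr T)"
      using w(3,4)[OF that, of x] by (simp_all only: Cm_add linear_add[OF linear_tr] add_0_right)
  qed
  ultimately show ?thesis
    using cc unfolding is_conn_def w(1) a(1) by (auto intro!: exI[of _ "\<lambda>x. w x + a x"] simp: one_cochain_add)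
qed

lemma grade_curv: "is_conn W \<Longrightarrow> grade (curv br W) = curv br W"
proof -
  assume "is_conn W"
  then obtain w where w: "W = one_cochain w" by (auto simp: is_conn_def)
  have "grade (bdiff br W) = bdiff br W"
  proof (rule cochain_eqI)
    fix es show "at_list (grade (bdiff br W)) es = at_list (bdiff br W) es"
      unfolding w by (cases es rule: remdups_adj.cases; cases "tl (tl es)")
        (auto simp: at_list_grade grade_inv_def bdiff_one_cochain)
  qed
  then show ?thesis using grade_conn[OF \<open>is_conn W\<close>] by (simp add: curv_def grade_simps grade_mult)
qed

lemma grade_power: "grade X = X \<Longrightarrow> grade (X ^ n) = X ^ n"
  by (induction n) (auto simp: grade_mult)

text \<open>As d d W = 0, what is left of the differential of the curvature is dW W - W dW, and the
  commutator of W with the curvature cancels it.\<close>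

lemma bianchi: "is_conn W \<Longrightarrow> covd br W (curv br W) = 0"
proof -
  assume c: "is_conn W"
  then obtain w where w: "W = one_cochain w" "linear w" by (auto simp: is_conn_def)
  have "bdiff br (bdiff br W) = 0" unfolding w(1) by (rule bdiff_bdiff_one_cochain[OF w(2) loday])
  then show ?thesis
    using grade_curv[OF c] grade_conn[OF c]
    by (simp add: covd_def) (simp add: curv_def bdiff_simps bdiff_mult algebra_simps)
qed

lemma covd_curv_power: "is_conn W \<Longrightarrow> covd br W (curv br W ^ n) = 0"
  by (induction n) (simp_all add: covd_one covd_mult bianchi)

lemma Cmv_curv: "is_conn W \<Longrightarrow> Cmv (curv br W)"
  by (simp add: is_conn_def)

text \<open>Both sides are the Loday differential of the trace, in which no connection occurs. This
  permits passing to the connection whose Bianchi identity applies.\<close>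

lemma trl_covd_conn:
  assumes "is_conn W" "is_conn W'" "Cmv X" shows "trl (covd br W X) es = trl (covd br W' X) es"
  using assms by (simp flip: sdiff_trl)

text \<open>The curvature is quadratic in t, hence three coefficients. Its derivative is the
  covariant differential of A at the moved connection W + tA, not at W.\<close>

lemma pd_curv:
  assumes "is_conn W" "is_form A"
  shows "pd 3 (\<lambda>t. curv br (W + t *\<^sub>R A)) (\<lambda>t. covd br (W + t *\<^sub>R A) A)"
proof -
  have g: "grade (t *\<^sub>R A) = - (t *\<^sub>R A)" for t
    using grade_form[OF assms(2)] by (simp add: grade_simps)
  have "pd 3 (\<lambda>t. curv br W + t *\<^sub>R (covd br W A + t *\<^sub>R (A * A)))
          (\<lambda>t. (covd br W A + t *\<^sub>R (A * A)) + t *\<^sub>R (A * A))"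
    using pd_step[OF pd_affine[of "covd br W A" "A * A"]] by (simp add: numeral_3_eq_3 numeral_2_eq_2)
  moreover have "curv br (W + t *\<^sub>R A) = curv br W + t *\<^sub>R (covd br W A + t *\<^sub>R (A * A))" for t
    by (simp add: curv_add[OF g] covd_scaleR algebra_simps)
  moreover have "covd br (W + t *\<^sub>R A) A = (covd br W A + t *\<^sub>R (A * A)) + t *\<^sub>R (A * A)" for t
    using grade_form[OF assms(2)] by (simp add: covd_def algebra_simps)
  ultimately show ?thesis by simp
qed

text \<open>Here n is p - 1, and the factor (n + 1)! from the graded symmetrisation is restored only
  in the comparison with \<open>cs\<close>. The order N stays free so that one value can serve
  several degree bounds.\<close>

definition cs_cochain :: "nat \<Rightarrow> nat \<Rightarrow> ('s,'r) shuffle_cochain \<Rightarrow> ('s,'r) shuffle_cochain \<Rightarrow> ('s,'r) shuffle_cochain" where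
  "cs_cochain N n W A = quad N (\<lambda>t. A * curv br (W + t *\<^sub>R A) ^ n)"

lemma Cmv_form_curv: "is_conn W \<Longrightarrow> is_form A \<Longrightarrow> Cmv (A * curv br W ^ n)"
  by (intro Cmv_mult Cmv_power Cmv_curv Cmv_form)

text \<open>Powers of the curvature are even, so cyclicity gathers them behind X without a
  sign.\<close>

lemma trl_cycle_power:
  assumes "is_conn W" "Cmv X" "grade X = (-1) ^ p *\<^sub>R X"
  shows "trl (curv br W ^ i * X * curv br W ^ j) es = trl (X * curv br W ^ (i + j)) es"
proof -
  have g: "grade (curv br W ^ k) = curv br W ^ k" for k
    by (rule grade_power[OF grade_curv[OF assms(1)]])
  have "trl (X * curv br W ^ j * curv br W ^ i) es = trl (curv br W ^ i * (X * curv br W ^ j)) es"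
    by (rule trl_commute[where p = p])
      (simp_all add: assms g grade_mult Cmv_mult Cmv_power Cmv_curv)
  then show ?thesis by (simp add: mult.assoc power_add[symmetric] add.commute)
qed

lemma grade_covd_form: "is_conn W \<Longrightarrow> is_form A \<Longrightarrow> grade (covd br W A) = covd br W A"
proof -
  assume a: "is_conn W" "is_form A"
  have "covd br W A = curv br (W + A) - curv br W - A * A"
    by (simp add: curv_add grade_form a)
  then show ?thesis
    by (simp add: grade_simps grade_mult grade_curv conn_add grade_form a)
qed

lemma covd_form_curv_power:
  assumes "is_conn W" shows "covd br W (A * curv br W ^ n) = covd br W A * curv br W ^ n"
  by (simp add: covd_mult covd_curv_power assms)

lemma linear_covd: "linear (covd br W)"
  by (intro linearI) (simp_all add: covd_add covd_scaleR)

text \<open>A two-parameter family of connections: t runs along the segment from W, and s moves its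
  far end from W + C to W + C + D.\<close>

definition form_family ::
  "('s,'r) shuffle_cochain \<Rightarrow> ('s,'r) shuffle_cochain \<Rightarrow> ('s,'r) shuffle_cochain \<Rightarrow> real \<Rightarrow> real \<Rightarrow> ('s,'r) shuffle_cochain" where
  "form_family W C D s t = W + t *\<^sub>R (C + s *\<^sub>R D)"

text \<open>A second transgression form. Under the trace, the covariant differential of the
  integrand is the s-derivative of A F^n minus the t-derivative of t D F^n, where A = C + sD and F
  is the curvature at (s, t).\<close>

definition homotopy_cochain ::
  "nat \<Rightarrow> nat \<Rightarrow> ('s,'r) shuffle_cochain \<Rightarrow> ('s,'r) shuffle_cochain \<Rightarrow> ('s,'r) shuffle_cochain \<Rightarrow> ('s,'r) shuffle_cochain" where
  "homotopy_cochain N n W C D = quad N (\<lambda>s. quad N (\<lambda>t. - t *\<^sub>R (\<Sum>i<n.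
     (C + s *\<^sub>R D) * curv br (form_family W C D s t) ^ i * D * curv br (form_family W C D s t) ^ (n - Suc i))))"

text \<open>A linear functional on the values of the trace, later evaluation at a point, brings the
  quadrature identities down to real polynomials.\<close>

context
  fixes \<phi> :: "'f \<Rightarrow> real"
  assumes \<phi>: "linear \<phi>"
begin

lemma linear_\<phi>_trl: "linear (\<lambda>X. \<phi> (trl X es))"
  using linear_compose[OF linear_trl \<phi>] by (simp add: o_def)

text \<open>Transgression: along the segment the derivative of tr F^(n+1) is n + 1 times the trace
  of the covariant differential of A F^n. The bound on N is the number of coefficients of F^(n+1)
  given by \<open>pd_power\<close>.\<close>

lemma trl_covd_cs:
  assumes W: "is_conn W" and A: "is_form A" and N: "N \<ge> 3 * n + 4"
  shows "real (Suc n) * \<phi> (trl (covd br W (cs_cochain N n W A)) es) =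
    \<phi> (trl (curv br (W + A) ^ Suc n) es) - \<phi> (trl (curv br W ^ Suc n) es)"
proof -
  let ?T = "\<lambda>X. \<phi> (trl X es)"
  define V where "V t = W + t *\<^sub>R A" for t
  define F where "F t = curv br (V t)" for t
  have V: "is_conn (V t)" for t unfolding V_def by (intro conn_add W form_scale A)
  have DA: "Cmv (covd br (V t) A)" "grade (covd br (V t) A) = covd br (V t) A" for t
    using Cmv_covd[OF V Cmv_form[OF A]] grade_covd_form[OF V A] by auto
  have "pd (3 * n + 4) (\<lambda>t. ?T (F t ^ Suc n))
      (\<lambda>t. ?T (\<Sum>i<Suc n. F t ^ i * covd br (V t) A * F t ^ (Suc n - Suc i)))"
    using pd_linear[OF pd_power[OF pd_curv[OF W A], where k = "Suc n"] linear_\<phi>_trl[of es]]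
    by (simp add: F_def V_def add.commute mult.commute del: sum.lessThan_Suc power_Suc)
  then have "quad N (\<lambda>t. ?T (\<Sum>i<Suc n. F t ^ i * covd br (V t) A * F t ^ (Suc n - Suc i))) =
      ?T (F 1 ^ Suc n) - ?T (F 0 ^ Suc n)"
    by (rule quad_fundamental[OF pd_mono[OF _ N]])
  moreover have "?T (\<Sum>i<Suc n. F t ^ i * covd br (V t) A * F t ^ (Suc n - Suc i)) =
      real (Suc n) * ?T (covd br (V t) A * F t ^ n)" for t
  proof -
    have "?T (F t ^ i * covd br (V t) A * F t ^ (n - i)) = ?T (covd br (V t) A * F t ^ n)" if "i \<le> n" for i
      using trl_cycle_power[OF V DA(1), where p = 0 and i = i and j = "n - i"] DA(2) that
      by (simp add: F_def)
    then show ?thesis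
      unfolding linear_sum[OF linear_\<phi>_trl] diff_Suc_Suc
      by (subst sum.cong[OF refl, where h = "\<lambda>i. ?T (covd br (V t) A * F t ^ n)"]) auto
  qed
  moreover have "?T (covd br W (cs_cochain N n W A)) = quad N (\<lambda>t. ?T (covd br (V t) A * F t ^ n))"
  proof -
    \<comment> \<open>The differential is moved from W to \<open>V t\<close>, where the curvature
      powers are covariantly constant.\<close>
    have "?T (covd br W (A * F t ^ n)) = ?T (covd br (V t) A * F t ^ n)" for t
    proof -
      have cAF: "Cmv (A * F t ^ n)" unfolding F_def by (rule Cmv_form_curv[OF V A])
      then show ?thesis
        using trl_covd_conn[OF W V[of t] cAF, of es] covd_form_curv_power[OF V[of t], of A n]
        by (simp add: F_def)
    qed
    then show ?thesis
      unfolding cs_cochain_def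
      by (simp add: linear_quad[OF linear_covd] linear_quad[OF linear_\<phi>_trl] F_def V_def)
  qed
  moreover have "F 1 = curv br (W + A)" "F 0 = curv br W" by (simp_all add: F_def V_def)
  ultimately show ?thesis
    by (simp add: quad_def sum_distrib_left mult.left_commute)
qed

text \<open>The primitive is integrated over the unit square. The edges s = 0 and s = 1 give the two
  Chern-Simons cochains, and the edge t = 1 gives the trace of D F^n along the moving endpoint. The
  bound on N counts two coefficients for A and 3n + 1 for F^n.\<close>

lemma cs_homotopy:
  assumes W: "is_conn W" and C: "is_form C" and D: "is_form D" and N: "N \<ge> 3 * n + 3"
  shows "\<phi> (trl (covd br W (homotopy_cochain N n W C D)) es) =
    \<phi> (trl (cs_cochain N n W (C + D)) es) - \<phi> (trl (cs_cochain N n W C) es)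
      - quad N (\<lambda>s. \<phi> (trl (D * curv br (W + (C + s *\<^sub>R D)) ^ n) es))"
proof -
  let ?T = "\<lambda>X. \<phi> (trl X es)"
  define A where "A s = C + s *\<^sub>R D" for s
  define V where "V s t = W + t *\<^sub>R A s" for s t
  define F where "F s t = curv br (V s t)" for s t
  have A: "is_form (A s)" for s unfolding A_def by (intro form_add form_scale C D)
  have V: "is_conn (V s t)" for s t unfolding V_def by (intro conn_add W form_scale A)
  have gF: "grade (F s t ^ i) = F s t ^ i" for s t i
    unfolding F_def by (intro grade_power grade_curv V)
  have cF: "Cmv (F s t ^ i)" for s t i unfolding F_def by (intro Cmv_power Cmv_curv V)
  define Us where "Us s t = D * F s t ^ n + A s * (\<Sum>i<n. F s t ^ i * covd br (V s t) (t *\<^sub>R D) * F s t ^ (n - Suc i))" for s t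
  define Vt where "Vt s t = D * F s t ^ n + (t *\<^sub>R D) * (\<Sum>i<n. F s t ^ i * covd br (V s t) (A s) * F s t ^ (n - Suc i))" for s t
  define K where "K s t = - t *\<^sub>R (\<Sum>i<n. A s * F s t ^ i * D * F s t ^ (n - Suc i))" for s t
  have cK: "Cmv (K s t)" for s t
    unfolding K_def by (intro Cmv_scale Cmv_sum Cmv_mult cF Cmv_form A D)
  have nn: "2 + Suc (n * 3) = 3 * n + 3" by simp
  have U: "pd (3 * n + 3) (\<lambda>s. ?T (A s * F s t ^ n)) (\<lambda>s. ?T (Us s t))" for t
  proof -
    \<comment> \<open>For fixed t the connection is affine in s with direction tD, so
      \<open>pd_curv\<close> applies in s as well.\<close>
    have e: "W + t *\<^sub>R C + s *\<^sub>R t *\<^sub>R D = V s t" for s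
      by (simp add: V_def A_def algebra_simps)
    have "pd 3 (\<lambda>s. F s t) (\<lambda>s. covd br (V s t) (t *\<^sub>R D))"
      using pd_curv[OF conn_add[OF W form_scale[OF C]] form_scale[OF D], of t t] unfolding e F_def .
    from pd_mult[OF pd_affine[of C D] pd_power[OF this, of n]]
    have "pd (3 * n + 3) (\<lambda>s. A s * F s t ^ n) (\<lambda>s. Us s t)"
      by (simp only: nn Us_def A_def)
    then show ?thesis by (rule pd_linear[OF _ linear_\<phi>_trl])
  qed
  have Vp: "pd (3 * n + 3) (\<lambda>t. ?T ((t *\<^sub>R D) * F s t ^ n)) (\<lambda>t. ?T (Vt s t))" for s
  proof -
    have "pd 3 (\<lambda>t. F s t) (\<lambda>t. covd br (V s t) (A s))"
      using pd_curv[OF W A, of s] by (simp add: F_def V_def)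
    from pd_mult[OF pd_affine[of 0 D] pd_power[OF this, of n]]
    have "pd (3 * n + 3) (\<lambda>t. (t *\<^sub>R D) * F s t ^ n) (\<lambda>t. Vt s t)"
      by (simp only: nn Vt_def add_0_left)
    then show ?thesis by (rule pd_linear[OF _ linear_\<phi>_trl])
  qed
  have key: "?T (covd br W (K s t)) = ?T (Us s t) - ?T (Vt s t)" for s t
  proof -
    let ?DA = "covd br (V s t) (A s)" and ?DD = "covd br (V s t) D" and ?F = "F s t"
    have "covd br (V s t) (K s t) = - t *\<^sub>R (\<Sum>i<n. ?DA * ?F ^ i * D * ?F ^ (n - Suc i)
        - A s * ?F ^ i * ?DD * ?F ^ (n - Suc i))"
    proof -
      have "covd br (V s t) (A s * ?F ^ i * D * ?F ^ j) = ?DA * ?F ^ i * D * ?F ^ j - A s * ?F ^ i * ?DD * ?F ^ j" for i j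
        using covd_curv_power[OF V]
        by (simp add: covd_mult grade_mult gF grade_form[OF A] F_def[symmetric] left_diff_distrib)
      then show ?thesis by (simp add: K_def covd_scaleR covd_sum del: scaleR_minus_left)
    qed
    moreover have "?T (covd br W (K s t)) = ?T (covd br (V s t) (K s t))"
      using trl_covd_conn[OF W V[of s t] cK[of s t], of es] by simp
    ultimately have 1: "?T (covd br W (K s t)) = - t * ((\<Sum>i<n. ?T (?DA * ?F ^ i * D * ?F ^ (n - Suc i)))
        - (\<Sum>i<n. ?T (A s * ?F ^ i * ?DD * ?F ^ (n - Suc i))))"
      by (simp add: linear_scale[OF linear_\<phi>_trl] linear_sum[OF linear_\<phi>_trl] linear_diff[OF linear_\<phi>_trl] sum_subtractf
          del: scaleR_minus_left)
    have "?T (?DA * ?F ^ i * D * ?F ^ j) = ?T (D * ?F ^ j * ?DA * ?F ^ i)" for i j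
    proof -
      have "trl ((D * ?F ^ j) * (?DA * ?F ^ i)) es = trl ((?DA * ?F ^ i) * (D * ?F ^ j)) es"
        by (rule trl_commute[where p = 1])
          (simp_all add: grade_mult gF grade_form[OF D] grade_covd_form[OF V A] Cmv_mult cF Cmv_form D A Cmv_covd[OF V])
      then show ?thesis by (simp add: mult.assoc)
    qed
    then have "(\<Sum>i<n. ?T (?DA * ?F ^ i * D * ?F ^ (n - Suc i))) = (\<Sum>i<n. ?T (D * ?F ^ (n - Suc i) * ?DA * ?F ^ i))"
      by simp
    \<comment> \<open>Cyclicity has exchanged the two powers of the curvature; reversing the
      summation index restores their order.\<close>
    also have "\<dots> = (\<Sum>i<n. ?T (D * ?F ^ i * ?DA * ?F ^ (n - Suc i)))"
      by (subst sum.nat_diff_reindex[symmetric]) (auto intro!: sum.cong)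
    finally have 2: "(\<Sum>i<n. ?T (?DA * ?F ^ i * D * ?F ^ (n - Suc i))) = (\<Sum>i<n. ?T (D * ?F ^ i * ?DA * ?F ^ (n - Suc i)))" .
    have "?T (Us s t) = ?T (D * ?F ^ n) + t * (\<Sum>i<n. ?T (A s * ?F ^ i * ?DD * ?F ^ (n - Suc i)))"
      by (simp add: Us_def linear_add[OF linear_\<phi>_trl] covd_scaleR sum_distrib_left mult.assoc
          linear_sum[OF linear_\<phi>_trl] linear_scale[OF linear_\<phi>_trl])
    moreover have "?T (Vt s t) = ?T (D * ?F ^ n) + t * (\<Sum>i<n. ?T (D * ?F ^ i * ?DA * ?F ^ (n - Suc i)))"
      by (simp add: Vt_def linear_add[OF linear_\<phi>_trl] sum_distrib_left mult.assoc
          linear_sum[OF linear_\<phi>_trl] linear_scale[OF linear_\<phi>_trl])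
    ultimately show ?thesis unfolding 1 2 by (simp add: algebra_simps)
  qed
  have "?T (covd br W (homotopy_cochain N n W C D)) = quad N (\<lambda>s. quad N (\<lambda>t. ?T (Us s t) - ?T (Vt s t)))"
    unfolding key[symmetric] homotopy_cochain_def K_def F_def V_def A_def form_family_def
    by (simp add: linear_quad[OF linear_covd] linear_quad[OF linear_\<phi>_trl])
  also have "\<dots> = quad N (\<lambda>t. quad N (\<lambda>s. ?T (Us s t))) - quad N (\<lambda>s. quad N (\<lambda>t. ?T (Vt s t)))"
    by (subst quad_swap) (simp add: quad_diff)
  also have "quad N (\<lambda>t. quad N (\<lambda>s. ?T (Us s t))) = quad N (\<lambda>t. ?T (A 1 * F 1 t ^ n) - ?T (A 0 * F 0 t ^ n))"
    by (simp add: quad_fundamental[OF pd_mono[OF U N]])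
  also have "\<dots> = ?T (cs_cochain N n W (C + D)) - ?T (cs_cochain N n W C)"
    by (simp add: cs_cochain_def linear_quad[OF linear_\<phi>_trl] quad_diff A_def F_def V_def)
  \<comment> \<open>On the edge t = 0 the factor tD vanishes, so only t = 1 contributes.\<close>
  also have "quad N (\<lambda>s. quad N (\<lambda>t. ?T (Vt s t))) = quad N (\<lambda>s. ?T (D * F s 1 ^ n))"
    by (simp add: quad_fundamental[OF pd_mono[OF Vp N]] linear_0[OF linear_\<phi>_trl])
  finally show ?thesis by (simp add: F_def V_def A_def)
qed

lemma pd_cs_integrand:
  assumes W: "is_conn W" and A: "is_form A"
  shows "\<exists>F'. pd (3 * n + 1) (\<lambda>t. \<phi> (trl (A * curv br (W + t *\<^sub>R A) ^ n) es)) F'"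
proof -
  have l: "linear (\<lambda>X. A * X)" by (intro linearI) (simp_all add: algebra_simps)
  show ?thesis
    using pd_linear[OF pd_linear[OF pd_power[OF pd_curv[OF W A], of n] l] linear_\<phi>_trl[of es]]
    by (auto simp: mult.commute)
qed

lemma cs_integral:
  assumes W: "is_conn W" and A: "is_form A" and N: "N \<ge> 3 * n + 1"
  shows "\<phi> (trl (cs_cochain N n W A) es) = integral {0..1} (\<lambda>t. \<phi> (trl (A * curv br (W + t *\<^sub>R A) ^ n) es))"
  unfolding cs_cochain_def linear_quad[OF linear_\<phi>_trl]
  using pd_cs_integrand[OF W A] quad_pd pd_mono N by blast

lemma continuous_cs_integrand:
  assumes "is_conn W" "is_form A"
  shows "continuous_on UNIV (\<lambda>t. \<phi> (trl (A * curv br (W + t *\<^sub>R A) ^ n) es))"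
  using pd_cs_integrand[OF assms] pd_poly continuous_on_poly[OF continuous_on_id] by (metis id_apply)

end

end

section \<open>Shuffle products as sums over unshuffles\<close>

definition lift_perm :: "(nat \<Rightarrow> nat) \<Rightarrow> nat \<Rightarrow> nat" where
  "lift_perm \<tau> i = (case i of 0 \<Rightarrow> 0 | Suc j \<Rightarrow> Suc (\<tau> j))"

lemma lift_perm_simps [simp]: "lift_perm \<tau> 0 = 0" "lift_perm \<tau> (Suc j) = Suc (\<tau> j)"
  by (simp_all add: lift_perm_def)

text \<open>The cycle sending position p to 0. An unshuffle that gives the first list entry to the
  second block is a lifted unshuffle composed with it, and its sign is the price of passing the p
  arguments of the first block.\<close>

definition front_cycle :: "nat \<Rightarrow> nat \<Rightarrow> nat" where
  "front_cycle p i = (if i < p then Suc i else if i = p then 0 else i)"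

lemma sign_lift_perm:
  assumes "\<tau> permutes {..<m}"
  shows "lift_perm \<tau> permutes {..<Suc m} \<and> sign (lift_perm \<tau>) = sign \<tau>"
  using assms finite_lessThan
proof (induction rule: permutes_induct)
  case id
  have "lift_perm id = id" by (auto simp: fun_eq_iff lift_perm_def split: nat.split)
  show ?case unfolding \<open>lift_perm id = id\<close> by (intro conjI permutes_id refl)
next
  case (swap a b \<tau>)
  have e: "lift_perm (Transposition.transpose a b \<circ> \<tau>) = Transposition.transpose (Suc a) (Suc b) \<circ> lift_perm \<tau>"
    by (auto simp: fun_eq_iff lift_perm_def Transposition.transpose_def split: nat.split)
  have t: "Transposition.transpose (Suc a) (Suc b) permutes {..<Suc m}"
    using swap by (intro permutes_swap_id) auto
  have p: "permutation (lift_perm \<tau>)" "permutation \<tau>"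
  proof -
    have "lift_perm \<tau> permutes {..<Suc m}" "\<tau> permutes {..<m}" using swap by simp_all
    then show "permutation (lift_perm \<tau>)" "permutation \<tau>"
      using permutes_imp_permutation[OF finite_lessThan] by blast+
  qed
  have l: "lift_perm \<tau> permutes {..<Suc m}" "sign (lift_perm \<tau>) = sign \<tau>" using swap by simp_all
  have "sign (Transposition.transpose (Suc a) (Suc b) \<circ> lift_perm \<tau>) = sign (Transposition.transpose a b \<circ> \<tau>)"
    unfolding sign_compose[OF permutation_swap_id p(1)] sign_compose[OF permutation_swap_id p(2)] l(2)
    by (simp add: sign_swap_id)
  then show ?case unfolding e using permutes_compose[OF l(1) t] by blast
qed

lemma front_cycle_permutes: "front_cycle p permutes {..<Suc p}"
  and sign_front_cycle: "sign (front_cycle p) = (-1) ^ p"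
proof (induction p)
  case 0
  have "front_cycle 0 = id" by (auto simp: front_cycle_def fun_eq_iff)
  then show "front_cycle 0 permutes {..<Suc 0}" "sign (front_cycle 0) = (-1) ^ 0"
    by (simp_all only: permutes_id sign_id power_0)
next
  case (Suc p)
  have e: "front_cycle (Suc p) = front_cycle p \<circ> Transposition.transpose p (Suc p)"
    by (auto simp: front_cycle_def fun_eq_iff Transposition.transpose_def)
  have 1: "front_cycle p permutes {..<Suc (Suc p)}"
    by (rule permutes_subset[OF Suc.IH(1)]) auto
  have 2: "Transposition.transpose p (Suc p) permutes {..<Suc (Suc p)}" by (rule permutes_swap_id) auto
  show "front_cycle (Suc p) permutes {..<Suc (Suc p)}" unfolding e by (rule permutes_compose[OF 2 1])
  have "permutation (front_cycle p)" using permutes_imp_permutation[OF finite_lessThan 1] .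
  then show "sign (front_cycle (Suc p)) = (-1) ^ Suc p"
    unfolding e using Suc.IH(2) by (simp add: sign_compose permutation_swap_id sign_swap_id)
qed

lemma unlift_perm:
  assumes "\<tau> permutes {..<Suc m}" "\<tau> 0 = 0"
  obtains \<sigma> where "\<sigma> permutes {..<m}" "\<tau> = lift_perm \<sigma>"
proof
  define \<sigma> where "\<sigma> i = \<tau> (Suc i) - 1" for i
  have inj: "inj \<tau>" using assms(1) permutes_inj by blast
  have pos: "\<tau> (Suc i) > 0" for i
    using injD[OF inj, of "Suc i" 0] assms(2) by (auto intro: gr0I)
  show e: "\<tau> = lift_perm \<sigma>"
    using pos assms(2) by (auto simp: fun_eq_iff lift_perm_def \<sigma>_def split: nat.split)
  show "\<sigma> permutes {..<m}"
  proof (rule bij_imp_permutes)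
    show "\<sigma> x = x" if "x \<notin> {..<m}" for x
      using assms(1) that by (auto simp: \<sigma>_def permutes_def)
    have "inj_on \<sigma> {..<m}"
    proof (rule inj_onI)
      fix x y assume "\<sigma> x = \<sigma> y"
      then have "\<tau> (Suc x) = \<tau> (Suc y)" by (simp add: e)
      then show "x = y" using injD[OF inj] by blast
    qed
    moreover have "\<sigma> ` {..<m} \<subseteq> {..<m}"
    proof
      fix y assume "y \<in> \<sigma> ` {..<m}"
      then obtain i where "i < m" "y = \<sigma> i" by auto
      moreover have "\<tau> (Suc i) < Suc m" using permutes_in_image[OF assms(1), of "Suc i"] \<open>i < m\<close> by simp
      ultimately show "y \<in> {..<m}" using e by simp
    qed
    ultimately show "bij_betw \<sigma> {..<m} {..<m}"
      by (simp add: bij_betw_def endo_inj_surj)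
  qed
qed

lemma inj_lift_perm: "inj lift_perm"
  by (rule injI) (metis ext lift_perm_simps(2) nat.inject)

lemma unshuffles_first:
  "{\<tau> \<in> unshuffles (Suc p) q. \<tau> 0 = 0} = lift_perm ` unshuffles p q"
proof (intro equalityI subsetI)
  fix \<tau> assume "\<tau> \<in> {\<tau> \<in> unshuffles (Suc p) q. \<tau> 0 = 0}"
  then have t: "\<tau> permutes {..<Suc (p + q)}" "strict_mono_on {..<Suc p} \<tau>" "strict_mono_on {Suc p..<Suc p + q} \<tau>" "\<tau> 0 = 0"
    by (auto simp: unshuffles_def)
  from unlift_perm[OF t(1,4)] obtain \<sigma> where s: "\<sigma> permutes {..<p + q}" "\<tau> = lift_perm \<sigma>" .
  have "strict_mono_on {..<p} \<sigma>" "strict_mono_on {p..<p + q} \<sigma>"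
    using strict_mono_onD[OF t(2), of "Suc _" "Suc _"] strict_mono_onD[OF t(3), of "Suc _" "Suc _"]
    by (auto simp: s intro!: strict_mono_onI)
  with s show "\<tau> \<in> lift_perm ` unshuffles p q" by (auto simp: unshuffles_def)
next
  fix \<tau> assume "\<tau> \<in> lift_perm ` unshuffles p q"
  then obtain \<sigma> where s: "\<sigma> permutes {..<p + q}" "strict_mono_on {..<p} \<sigma>" "strict_mono_on {p..<p + q} \<sigma>" "\<tau> = lift_perm \<sigma>"
    by (auto simp: unshuffles_def)
  have "strict_mono_on {..<Suc p} \<tau>"
    using strict_mono_onD[OF s(2)] by (auto simp: s(4) lift_perm_def intro!: strict_mono_onI split: nat.split)
  moreover have "strict_mono_on {Suc p..<Suc p + q} \<tau>"
    using strict_mono_onD[OF s(3)] by (auto simp: s(4) lift_perm_def intro!: strict_mono_onI split: nat.split)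
  ultimately show "\<tau> \<in> {\<tau> \<in> unshuffles (Suc p) q. \<tau> 0 = 0}"
    using sign_lift_perm[OF s(1)] by (auto simp: unshuffles_def s(4))
qed

lemma unshuffles_second:
  "{\<tau> \<in> unshuffles p (Suc q). \<tau> p = 0} = (\<lambda>\<sigma>. lift_perm \<sigma> \<circ> front_cycle p) ` unshuffles p q"
proof (intro equalityI subsetI)
  have fc: "front_cycle p permutes {..<Suc (p + q)}" by (rule permutes_subset[OF front_cycle_permutes]) auto
  {
    fix \<tau> assume "\<tau> \<in> {\<tau> \<in> unshuffles p (Suc q). \<tau> p = 0}"
    then have t: "\<tau> permutes {..<Suc (p + q)}" "strict_mono_on {..<p} \<tau>" "strict_mono_on {p..<Suc (p + q)} \<tau>" "\<tau> p = 0"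
      by (auto simp: unshuffles_def)
    have "(\<tau> \<circ> inv_into UNIV (front_cycle p)) permutes {..<Suc (p + q)}"
      by (rule permutes_compose[OF permutes_inv[OF fc] t(1)])
    moreover have "inv_into UNIV (front_cycle p) 0 = p"
      by (rule inv_f_eq[OF permutes_inj[OF fc]]) (simp add: front_cycle_def)
    ultimately obtain \<sigma> where s: "\<sigma> permutes {..<p + q}" "\<tau> \<circ> inv_into UNIV (front_cycle p) = lift_perm \<sigma>"
      using unlift_perm[of "\<tau> \<circ> inv_into UNIV (front_cycle p)" "p + q"] t(4) by auto
    have te: "\<tau> = lift_perm \<sigma> \<circ> front_cycle p"
      unfolding s(2)[symmetric] using permutes_inv_o(2)[OF fc] by (simp add: o_assoc[symmetric])
    have lo: "\<tau> i = Suc (\<sigma> i)" if "i < p" for i using that by (simp add: te front_cycle_def)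
    have hi: "\<tau> (Suc i) = Suc (\<sigma> i)" if "i \<ge> p" for i using that by (simp add: te front_cycle_def)
    have "strict_mono_on {..<p} \<sigma>"
      using strict_mono_onD[OF t(2)] lo by (intro strict_mono_onI) force
    moreover have "strict_mono_on {p..<p + q} \<sigma>"
    proof (rule strict_mono_onI)
      fix i j assume "i \<in> {p..<p + q}" "j \<in> {p..<p + q}" "i < j"
      then show "\<sigma> i < \<sigma> j" using strict_mono_onD[OF t(3), of "Suc i" "Suc j"] hi[of i] hi[of j] by simp
    qed
    ultimately show "\<tau> \<in> (\<lambda>\<sigma>. lift_perm \<sigma> \<circ> front_cycle p) ` unshuffles p q"
      using s te by (auto simp: unshuffles_def)
  next
    fix \<tau> assume "\<tau> \<in> (\<lambda>\<sigma>. lift_perm \<sigma> \<circ> front_cycle p) ` unshuffles p q"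
    then obtain \<sigma> where s: "\<sigma> permutes {..<p + q}" "strict_mono_on {..<p} \<sigma>" "strict_mono_on {p..<p + q} \<sigma>"
      and te: "\<tau> = lift_perm \<sigma> \<circ> front_cycle p"
      by (auto simp: unshuffles_def)
    have lo: "\<tau> i = Suc (\<sigma> i)" if "i < p" for i using that by (simp add: te front_cycle_def)
    have hi: "\<tau> i = Suc (\<sigma> (i - 1))" if "i > p" for i using that by (cases i) (auto simp add: te front_cycle_def)
    have p0: "\<tau> p = 0" by (simp add: te front_cycle_def)
    have "strict_mono_on {..<p} \<tau>"
      using strict_mono_onD[OF s(2)] lo by (auto intro!: strict_mono_onI)
    moreover have "strict_mono_on {p..<p + Suc q} \<tau>"
    proof (rule strict_mono_onI)
      fix i j assume ij: "i \<in> {p..<p + Suc q}" "j \<in> {p..<p + Suc q}" "i < j"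
      show "\<tau> i < \<tau> j"
      proof (cases "i = p")
        case True then show ?thesis using p0 hi[of j] ij by simp
      next
        case False
        then show ?thesis using ij hi[of i] hi[of j] strict_mono_onD[OF s(3), of "i - 1" "j - 1"] by auto
      qed
    qed
    ultimately show "\<tau> \<in> {\<tau> \<in> unshuffles p (Suc q). \<tau> p = 0}"
      using permutes_compose[OF fc] sign_lift_perm[OF s(1)] by (auto simp: unshuffles_def te front_cycle_def[of p p])
  }
qed

lemma finite_unshuffles: "finite (unshuffles p q)"
  unfolding unshuffles_def by (rule finite_subset[OF _ finite_permutations[of "{..<p + q}"]]) auto

text \<open>An unshuffle increases on both blocks, so the least index sits at the start of one of
  them. This is the case split behind the recursion of \<open>shuf\<close>.\<close>

lemma unshuffles_zero_cases:
  assumes "\<tau> \<in> unshuffles p q" "p + q > 0"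
  shows "(p > 0 \<and> \<tau> 0 = 0) \<or> (q > 0 \<and> \<tau> p = 0)"
proof -
  have t: "\<tau> permutes {..<p + q}" "strict_mono_on {..<p} \<tau>" "strict_mono_on {p..<p + q} \<tau>"
    using assms by (auto simp: unshuffles_def)
  have "0 \<in> \<tau> ` {..<p + q}" using permutes_image[OF t(1)] assms(2) by auto
  then obtain i where i: "i < p + q" "\<tau> i = 0" by auto
  show ?thesis
  proof (cases "i < p")
    case True
    then show ?thesis using i strict_mono_onD[OF t(2), of 0 i] by (cases i) auto
  next
    case False
    then show ?thesis using i strict_mono_onD[OF t(3), of p i] by (cases "i = p") auto
  qed
qed

section \<open>Comparison of the sum over unshuffles with the recursive product\<close>

definition unshuffle_sum :: "nat \<Rightarrow> nat \<Rightarrow> ('s list \<Rightarrow> 's list \<Rightarrow> 'v::real_vector) \<Rightarrow> 's list \<Rightarrow> 'v" where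
  "unshuffle_sum p q F es = (\<Sum>\<tau>\<in>unshuffles p q. of_int (sign \<tau>) *\<^sub>R
     F (map (\<lambda>i. es ! \<tau> i) [0..<p]) (map (\<lambda>i. es ! \<tau> i) [p..<p + q]))"

text \<open>The recursion of \<open>shuf\<close> for an arbitrary function of two sublists. It runs
  over splittings of all lengths; a fixed bidegree is imposed afterwards by a length test.\<close>

fun split_sum :: "('s list \<Rightarrow> 's list \<Rightarrow> 'v::real_vector) \<Rightarrow> 's list \<Rightarrow> 'v" where
  "split_sum F [] = F [] []"
| "split_sum F (x # es) =
     split_sum (\<lambda>us. F (x # us)) es + split_sum (\<lambda>us vs. (-1) ^ length us *\<^sub>R F us (x # vs)) es"

lemma shuf_eq_split_sum: "shuf X Y es = split_sum (\<lambda>us vs. X us * Y vs) es"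
  by (induction es arbitrary: X Y) (simp_all add: contr_def grade_inv_def)

lemma split_sum_linear: "linear h \<Longrightarrow> h (split_sum F es) = split_sum (\<lambda>us vs. h (F us vs)) es"
  by (induction es arbitrary: F) (simp_all add: linear_add linear_scale)

lemma split_sum_zero: "split_sum (\<lambda>us vs. 0) es = 0"
  by (induction es) auto

lemma split_sum_cong:
  "(\<And>us vs. length us + length vs = length es \<Longrightarrow> set us \<union> set vs \<subseteq> set es \<Longrightarrow> F us vs = G us vs)
    \<Longrightarrow> split_sum F es = split_sum G es"
proof (induction es arbitrary: F G)
  case (Cons x es)
  have "split_sum (\<lambda>us. F (x # us)) es = split_sum (\<lambda>us. G (x # us)) es"
    by (rule Cons.IH, rule Cons.prems) auto
  moreover have "split_sum (\<lambda>us vs. (-1) ^ length us *\<^sub>R F us (x # vs)) es = split_sum (\<lambda>us vs. (-1) ^ length us *\<^sub>R G us (x # vs)) es"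
    by (rule Cons.IH, subst Cons.prems) auto
  ultimately show ?case by simp
qed simp

lemma map_shift: "map f [Suc a..<Suc b] = map (\<lambda>i. f (Suc i)) [a..<b]"
  unfolding map_Suc_upt[symmetric] map_map o_def ..

text \<open>The unshuffles fall into two disjoint families according to the block that receives the
  head. The first is parametrised by \<open>lift_perm\<close>, the second by
  \<open>lift_perm\<close> after \<open>front_cycle\<close>.\<close>

lemma unshuffle_sum_Cons:
  assumes "p + q = Suc (length es)"
  shows "unshuffle_sum p q F (x # es) =
    (if p > 0 then unshuffle_sum (p - 1) q (\<lambda>us. F (x # us)) es else 0) +
    (if q > 0 then (-1) ^ p *\<^sub>R unshuffle_sum p (q - 1) (\<lambda>us vs. F us (x # vs)) es else 0)"
proof -
  let ?f = "\<lambda>\<tau>. real_of_int (sign \<tau>) *\<^sub>R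
     F (map (\<lambda>i. (x # es) ! \<tau> i) [0..<p]) (map (\<lambda>i. (x # es) ! \<tau> i) [p..<p + q])"
  let ?A = "{\<tau> \<in> unshuffles p q. p > 0 \<and> \<tau> 0 = 0}" and ?B = "{\<tau> \<in> unshuffles p q. q > 0 \<and> \<tau> p = 0}"
  have "p + q > 0" using assms by simp
  then have "unshuffles p q = ?A \<union> ?B" using unshuffles_zero_cases[of _ p q] by blast
  moreover have "?A \<inter> ?B = {}"
  proof (intro equalityI subsetI)
    fix \<tau> assume t: "\<tau> \<in> ?A \<inter> ?B"
    then have "\<tau> permutes {..<p + q}" by (simp add: unshuffles_def)
    then have "inj \<tau>" by (rule permutes_inj)
    then have "p = 0" using t by (intro injD[of \<tau> p 0]) simp_all
    then show "\<tau> \<in> {}" using t by simp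
  qed simp
  ultimately have "unshuffle_sum p q F (x # es) = sum ?f ?A + sum ?f ?B"
    unfolding unshuffle_sum_def using finite_unshuffles[of p q]
    by (metis (no_types, lifting) finite_Un sum.union_disjoint)
  moreover have "sum ?f ?A = (if p > 0 then unshuffle_sum (p - 1) q (\<lambda>us. F (x # us)) es else 0)"
  proof (cases p)
    case (Suc r)
    have A: "?A = lift_perm ` unshuffles r q" using unshuffles_first[of r q] Suc by simp
    have m1: "map (\<lambda>i. (x # es) ! lift_perm \<sigma> i) [0..<Suc r] = x # map (\<lambda>i. es ! \<sigma> i) [0..<r]" for \<sigma>
      by (simp add: upt_rec[of 0 "Suc r"] map_shift del: upt_Suc)
    have m2: "map (\<lambda>i. (x # es) ! lift_perm \<sigma> i) [Suc r..<Suc (r + q)] = map (\<lambda>i. es ! \<sigma> i) [r..<r + q]" for \<sigma>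
      by (simp add: map_shift del: upt_Suc)
    have sg: "sign (lift_perm \<sigma>) = sign \<sigma>" if "\<sigma> \<in> unshuffles r q" for \<sigma>
      using that sign_lift_perm by (auto simp: unshuffles_def)
    show ?thesis
      unfolding A unshuffle_sum_def using sg
      by (subst sum.reindex[OF inj_on_subset[OF inj_lift_perm subset_UNIV]])
        (auto simp: Suc m1 m2 simp del: upt_Suc intro!: sum.cong)
  qed simp
  moreover have "sum ?f ?B = (if q > 0 then (-1) ^ p *\<^sub>R unshuffle_sum p (q - 1) (\<lambda>us vs. F us (x # vs)) es else 0)"
  proof (cases q)
    case (Suc r)
    have B: "?B = (\<lambda>\<sigma>. lift_perm \<sigma> \<circ> front_cycle p) ` unshuffles p r" using unshuffles_second[of p r] Suc by simp
    have m1: "map (\<lambda>i. (x # es) ! (lift_perm \<sigma> \<circ> front_cycle p) i) [0..<p] = map (\<lambda>i. es ! \<sigma> i) [0..<p]" for \<sigma>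
      by (simp add: front_cycle_def)
    have m2: "map (\<lambda>i. (x # es) ! (lift_perm \<sigma> \<circ> front_cycle p) i) [p..<Suc (p + r)] = x # map (\<lambda>i. es ! \<sigma> i) [p..<p + r]" for \<sigma>
    proof -
      have "[p..<Suc (p + r)] = p # [Suc p..<Suc (p + r)]" by (simp add: upt_rec del: upt_Suc)
      moreover have "map (\<lambda>i. (x # es) ! (lift_perm \<sigma> \<circ> front_cycle p) i) [Suc p..<Suc (p + r)] = map (\<lambda>i. es ! \<sigma> i) [p..<p + r]"
        unfolding map_shift by (simp add: front_cycle_def)
      ultimately show ?thesis by (simp add: front_cycle_def del: upt_Suc)
    qed
    have sg: "sign (lift_perm \<sigma> \<circ> front_cycle p) = (-1) ^ p * sign \<sigma>" if "\<sigma> \<in> unshuffles p r" for \<sigma>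
    proof -
      have s: "\<sigma> permutes {..<p + r}" using that by (auto simp: unshuffles_def)
      have "permutation (lift_perm \<sigma>)" "permutation (front_cycle p)"
        using sign_lift_perm[OF s] front_cycle_permutes permutes_imp_permutation[OF finite_lessThan] by blast+
      then show ?thesis using sign_lift_perm[OF s] by (simp add: sign_compose sign_front_cycle)
    qed
    have inj: "inj_on (\<lambda>\<sigma>. lift_perm \<sigma> \<circ> front_cycle p) (unshuffles p r)"
    proof (rule inj_onI)
      fix \<sigma> \<sigma>' assume e: "lift_perm \<sigma> \<circ> front_cycle p = lift_perm \<sigma>' \<circ> front_cycle p"
      have "lift_perm \<sigma> y = lift_perm \<sigma>' y" for y
      proof -
        obtain z where "y = front_cycle p z" using permutes_surj[OF front_cycle_permutes] surjD by metis
        then show ?thesis using fun_cong[OF e, of z] by simp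
      qed
      then have "lift_perm \<sigma> = lift_perm \<sigma>'" by (rule ext)
      then show "\<sigma> = \<sigma>'" using inj_lift_perm by (simp add: inj_eq)
    qed
    show ?thesis
      unfolding B unshuffle_sum_def using sg
      by (subst sum.reindex[OF inj])
        (auto simp: Suc m1[unfolded o_def] m2[unfolded o_def] scaleR_sum_right simp del: upt_Suc intro!: sum.cong)
  qed simp
  ultimately show ?thesis by simp
qed

lemma unshuffle_sum_eq_split_sum:
  assumes "length es = p + q"
  shows "unshuffle_sum p q F es = split_sum (\<lambda>us vs. if length us = p \<and> length vs = q then F us vs else 0) es"
  using assms
proof (induction es arbitrary: p q F)
  case Nil
  have "unshuffles 0 0 = {id}" by (auto simp: unshuffles_def strict_mono_on_def)
  then show ?case using Nil by (simp add: unshuffle_sum_def)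
next
  case (Cons x es)
  have l: "linear (\<lambda>v. (-1) ^ p *\<^sub>R (v::'b))" by (intro linearI) (simp_all add: scaleR_add_right mult.commute)
  have 1: "(if p > 0 then unshuffle_sum (p - 1) q (\<lambda>us. F (x # us)) es else 0)
    = split_sum (\<lambda>us vs. if length (x # us) = p \<and> length vs = q then F (x # us) vs else 0) es"
  proof (cases p)
    case (Suc r)
    then show ?thesis using Cons.prems by (simp add: Cons.IH)
  qed (simp add: split_sum_zero)
  have 2: "(if q > 0 then (-1) ^ p *\<^sub>R unshuffle_sum p (q - 1) (\<lambda>us vs. F us (x # vs)) es else 0)
    = split_sum (\<lambda>us vs. (-1) ^ length us *\<^sub>R (if length us = p \<and> length (x # vs) = q then F us (x # vs) else 0)) es"
  proof (cases q)
    case (Suc r)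
    then have "(if q > 0 then (-1) ^ p *\<^sub>R unshuffle_sum p (q - 1) (\<lambda>us vs. F us (x # vs)) es else 0)
      = split_sum (\<lambda>us vs. (-1) ^ p *\<^sub>R (if length us = p \<and> length vs = r then F us (x # vs) else 0)) es"
      using Cons.prems by (simp add: Cons.IH split_sum_linear[OF l])
    also have "\<dots> = split_sum (\<lambda>us vs. (-1) ^ length us *\<^sub>R (if length us = p \<and> length (x # vs) = q then F us (x # vs) else 0)) es"
      by (rule split_sum_cong) (auto simp: Suc)
    finally show ?thesis .
  qed (simp add: split_sum_zero)
  show ?case
    using unshuffle_sum_Cons[of p q es F x] Cons.prems 1 2 by simp
qed

text \<open>Linear operators as a type, so that they form a ring with unit and can be the values of
  shuffle cochains.\<close>

typedef (overloaded) 'v endo = "{f :: 'v::real_vector \<Rightarrow> 'v. linear f}"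
  morphisms app Endo
  by (rule exI[of _ "\<lambda>x. 0"]) (simp add: linear_zero)

lemma linear_app: "linear (app T)"
  using app by blast

lemmas app_add = linear_add[OF linear_app]
  and app_scaleR = linear_scale[OF linear_app] and app_zero [simp] = linear_0[OF linear_app]

lemma app_Endo: "linear f \<Longrightarrow> app (Endo f) = f"
  by (simp add: Endo_inverse)

lemma endo_eqI: "(\<And>v. app S v = app T v) \<Longrightarrow> S = T"
  using app_inject by blast

instantiation endo :: (real_vector) real_vector
begin
definition "0 = Endo (\<lambda>v. 0)"
definition "S + T = Endo (\<lambda>v. app S v + app T v)"
definition "- T = Endo (\<lambda>v. - app T v)"
definition "S - T = Endo (\<lambda>v. app S v - app T v)"
definition "c *\<^sub>R T = Endo (\<lambda>v. c *\<^sub>R app T v)"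

lemma app_simps [simp]:
  "app 0 v = 0" "app (S + T) v = app S v + app T v" "app (- T) v = - app T v"
  "app (S - T) v = app S v - app T v" "app (c *\<^sub>R T) v = c *\<^sub>R app T v"
  by (simp_all add: zero_endo_def plus_endo_def uminus_endo_def minus_endo_def scaleR_endo_def
      app_Endo linear_iff app_add app_scaleR algebra_simps)

instance
  by standard (auto intro!: endo_eqI simp: algebra_simps)
end

instantiation endo :: (real_vector) real_algebra
begin
definition "S * T = Endo (\<lambda>v. app S (app T v))"

lemma app_mult [simp]: "app (S * T) v = app S (app T v)"
  by (simp add: times_endo_def app_Endo linear_iff app_add app_scaleR)

instance
  by standard (auto intro!: endo_eqI simp: app_add app_scaleR)
end

instantiation endo :: (real_vector) monoid_mult
begin
definition "1 = Endo (\<lambda>v::'a. v)"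

lemma app_one [simp]: "app 1 v = v"
  by (simp add: one_endo_def app_Endo linear_iff)

instance
  by standard (auto intro!: endo_eqI)
end

text \<open>Relates a cochain tagged with its degree, specified on sections only, to a total cochain
  that vanishes in all other degrees. Preservation of G is included because composition needs
  it.\<close>

definition represents ::
  "('m \<Rightarrow> 'e) set \<Rightarrow> ('m \<Rightarrow> 'b::real_vector) set \<Rightarrow> nat \<times> ('m, 'e, 'b) end_cochain
    \<Rightarrow> ('m \<Rightarrow> 'e, ('m \<Rightarrow> 'b) endo) shuffle_cochain \<Rightarrow> bool" where
  "represents S G D X \<longleftrightarrow> (\<forall>es. length es \<noteq> fst D \<longrightarrow> at_list X es = 0) \<and>
     (\<forall>es\<in>tuples (fst D) S. \<forall>b\<in>G. snd D es b = app (at_list X es) b \<and> snd D es b \<in> G)"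

lemma sum_apply: "(\<Sum>i\<in>I. f i) b = (\<Sum>i\<in>I. f i b)"
  by (induction I rule: infinite_finite_induct) auto

text \<open>Vanishing in the other degrees identifies the splittings of all lengths in the shuffle
  product with the unshuffles of bidegree (p, q).\<close>

lemma represents_diamond:
  assumes G: "subspace G" and X: "represents S G D X" and Y: "represents S G D' Y"
  shows "represents S G (diamond D D') (X * Y)"
proof -
  obtain p \<Delta> q \<Delta>' where D: "D = (p, \<Delta>)" "D' = (q, \<Delta>')" by (metis surj_pair)
  have X0: "at_list X es = 0" if "length es \<noteq> p" for es using X that by (auto simp: represents_def D)
  have Y0: "at_list Y es = 0" if "length es \<noteq> q" for es using Y that by (auto simp: represents_def D)
  have eq: "at_list (X * Y) es = split_sum (\<lambda>us vs. if length us = p \<and> length vs = q then at_list X us * at_list Y vs else 0) es" for es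
    unfolding at_list_mult shuf_eq_split_sum by (rule arg_cong[where f = "\<lambda>F. split_sum F es"]) (auto simp: fun_eq_iff X0 Y0)
  have r1: "at_list (X * Y) es = 0" if "length es \<noteq> p + q" for es
  proof -
    have "split_sum (\<lambda>us vs. if length us = p \<and> length vs = q then at_list X us * at_list Y vs else 0) es
        = split_sum (\<lambda>us vs. 0) es"
      using that by (intro split_sum_cong) auto
    then show ?thesis by (simp add: eq split_sum_zero)
  qed
  have r2: "snd (diamond D D') es b = app (at_list (X * Y) es) b \<and> snd (diamond D D') es b \<in> G"
    if es: "es \<in> tuples (p + q) S" and b: "b \<in> G" for es b
  proof
    have len: "length es = p + q" and sub: "set es \<subseteq> S" using es by (auto simp: tuples_def)
    have tup: "map (\<lambda>i. es ! \<tau> i) [0..<p] \<in> tuples p S" "map (\<lambda>i. es ! \<tau> i) [p..<p + q] \<in> tuples q S"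
      if "\<tau> \<in> unshuffles p q" for \<tau>
    proof -
      have t: "\<tau> permutes {..<p + q}" using that by (simp add: unshuffles_def)
      have "es ! \<tau> i \<in> S" if "i < p + q" for i
        using permutes_in_image[OF t, of i] that sub len nth_mem[of "\<tau> i" es] by auto
      then show "map (\<lambda>i. es ! \<tau> i) [0..<p] \<in> tuples p S" "map (\<lambda>i. es ! \<tau> i) [p..<p + q] \<in> tuples q S"
        by (auto simp: tuples_def)
    qed
    have val: "\<Delta> us (\<Delta>' vs b) = app (at_list X us * at_list Y vs) b \<and> \<Delta> us (\<Delta>' vs b) \<in> G"
      if "us \<in> tuples p S" "vs \<in> tuples q S" for us vs
    proof -
      have "\<Delta>' vs b = app (at_list Y vs) b" "\<Delta>' vs b \<in> G"
        using Y that(2) b unfolding represents_def D fst_conv snd_conv by blast+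
      moreover have "\<Delta> us c = app (at_list X us) c \<and> \<Delta> us c \<in> G" if "c \<in> G" for c
        using X \<open>us \<in> tuples p S\<close> that unfolding represents_def D fst_conv snd_conv by blast
      ultimately show ?thesis by (metis app_mult)
    qed
    have d: "snd (diamond D D') es b = unshuffle_sum p q (\<lambda>us vs. \<Delta> us (\<Delta>' vs b)) es"
      by (simp add: diamond_def D unshuffle_sum_def sum_apply scaleR_fun_def[of _ "_ \<circ> _"])
    also have "\<dots> = unshuffle_sum p q (\<lambda>us vs. app (at_list X us * at_list Y vs) b) es"
      unfolding unshuffle_sum_def using val tup by (intro sum.cong) auto
    also have "\<dots> = split_sum (\<lambda>us vs. if length us = p \<and> length vs = q then app (at_list X us * at_list Y vs) b else 0) es"
      by (rule unshuffle_sum_eq_split_sum[OF len])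
    also have "\<dots> = app (at_list (X * Y) es) b"
    proof -
      have l: "linear (\<lambda>T. app T b)" by (intro linearI) auto
      show ?thesis unfolding eq split_sum_linear[OF l] by (rule split_sum_cong) simp
    qed
    finally show "snd (diamond D D') es b = app (at_list (X * Y) es) b" .
    show "snd (diamond D D') es b \<in> G"
      unfolding d unshuffle_sum_def by (intro subspace_sum[OF G] subspace_scale[OF G] conjunct2[OF val] tup)
  qed
  have f: "fst (diamond D D') = p + q" by (simp add: diamond_def D)
  show ?thesis unfolding represents_def f using r1 r2 by blast
qed

lemma represents_diamonds:
  assumes G: "subspace G" and "list_all2 (represents S G) Ds Xs"
  shows "represents S G (diamonds Ds) (prod_list Xs)"
  using assms(2)
proof (induction rule: list_all2_induct)
  case Nil
  show ?case by (auto simp: represents_def diamonds_def unit_cochain_def tuples_def)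
next
  case (Cons D Ds X Xs)
  then show ?case using represents_diamond[OF G, of S D X "diamonds Ds"] by (simp add: diamonds_def)
qed

section \<open>Sections of vector bundles and fibrewise traces\<close>

lemma linear_between_0: "subspace V \<Longrightarrow> linear_between V W f \<Longrightarrow> f 0 = 0"
  unfolding linear_between_def by (metis scale_zero_left subspace_0)

lemma linear_between_sum:
  "subspace V \<Longrightarrow> linear_between V W f \<Longrightarrow> (\<And>i. i \<in> I \<Longrightarrow> v i \<in> V) \<Longrightarrow> f (\<Sum>i\<in>I. v i) = (\<Sum>i\<in>I. f (v i))"
proof (induction I rule: infinite_finite_induct)
  case (insert i I)
  then have "(\<Sum>i\<in>I. v i) \<in> V" by (intro subspace_sum) auto
  then show ?case using insert by (simp add: linear_between_def)
qed (auto simp: linear_between_0)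

text \<open>Exposes the basis chosen inside \<open>trace_on\<close>; it is the same for all
  operators on V, so traces can be compared coordinate by coordinate.\<close>

lemma trace_on_basis:
  fixes V :: "'v::real_vector set"
  assumes "subspace V" "finite F" "V \<subseteq> span F"
  shows "\<exists>S. finite S \<and> independent S \<and> span S = V \<and>
    (\<forall>f. trace_on V f = (\<Sum>b\<in>S. representation S (f b) b))"
proof -
  obtain S0 where "S0 \<subseteq> V" "independent S0" "V \<subseteq> span S0" by (rule basis_exists)
  then have "independent S0 \<and> span S0 = V" using assms(1) by (metis span_minimal subset_antisym)
  then have S: "independent (SOME S. independent S \<and> span S = V)" "span (SOME S. independent S \<and> span S = V) = V"
    by (metis (mono_tags, lifting) someI_ex)+
  have "finite (SOME S. independent S \<and> span S = V)"
    using independent_span_bound[OF assms(2) S(1)] S(2) assms(3) span_superset by blast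
  then show ?thesis using S unfolding trace_on_def Let_def by blast
qed

lemma trace_on_cong:
  assumes "subspace V" "finite F" "V \<subseteq> span F" "\<And>v. v \<in> V \<Longrightarrow> f v = g v"
  shows "trace_on V f = trace_on V g"
proof -
  obtain S where S: "finite S" "independent S" "span S = V"
    "\<And>f. trace_on V f = (\<Sum>b\<in>S. representation S (f b) b)" using trace_on_basis[OF assms(1-3)] by blast
  then show ?thesis using assms(4) span_superset[of S] by (auto intro!: sum.cong)
qed

lemma trace_on_add:
  assumes "subspace V" "finite F" "V \<subseteq> span F" "\<And>v. v \<in> V \<Longrightarrow> f v \<in> V" "\<And>v. v \<in> V \<Longrightarrow> g v \<in> V"
  shows "trace_on V (\<lambda>v. f v + g v) = trace_on V f + trace_on V g"
proof -
  obtain S where S: "finite S" "independent S" "span S = V"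
    "\<And>f. trace_on V f = (\<Sum>b\<in>S. representation S (f b) b)" using trace_on_basis[OF assms(1-3)] by blast
  have "b \<in> V" if "b \<in> S" for b using that S(3) span_base by blast
  then show ?thesis using assms(4,5) S(3) by (simp add: S(4) sum.distrib[symmetric] representation_add[OF S(2)])
qed

lemma trace_on_scale:
  assumes "subspace V" "finite F" "V \<subseteq> span F" "\<And>v. v \<in> V \<Longrightarrow> f v \<in> V"
  shows "trace_on V (\<lambda>v. c *\<^sub>R f v) = c * trace_on V f"
proof -
  obtain S where S: "finite S" "independent S" "span S = V"
    "\<And>f. trace_on V f = (\<Sum>b\<in>S. representation S (f b) b)" using trace_on_basis[OF assms(1-3)] by blast
  have "b \<in> V" if "b \<in> S" for b using that S(3) span_base by blast
  then show ?thesis using assms(4) S(3) by (simp add: S(4) sum_distrib_left representation_scale[OF S(2)])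
qed

lemma trace_on_commute:
  assumes V: "subspace V" "finite F" "V \<subseteq> span F" and f: "linear_between V V f" and g: "linear_between V V g"
  shows "trace_on V (\<lambda>v. f (g v)) = trace_on V (\<lambda>v. g (f v))"
proof -
  obtain S where S: "finite S" "independent S" "span S = V"
    "\<And>f. trace_on V f = (\<Sum>b\<in>S. representation S (f b) b)" using trace_on_basis[OF V] by blast
  have SV: "b \<in> V" if "b \<in> S" for b using that S(3) span_base by blast
  have exp: "representation S (f (g b)) b = (\<Sum>c\<in>S. representation S (g b) c * representation S (f c) b)"
    if f: "linear_between V V f" and g: "linear_between V V g" and b: "b \<in> S" for f g b
  proof -
    have gb: "g b \<in> span S" using g SV[OF b] S(3) by (simp add: linear_between_def)
    have "f (g b) = f (\<Sum>c\<in>S. representation S (g b) c *\<^sub>R c)"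
      by (simp add: sum_representation_eq[OF S(2) gb S(1)])
    also have "\<dots> = (\<Sum>c\<in>S. f (representation S (g b) c *\<^sub>R c))"
      by (rule linear_between_sum[OF V(1) f]) (use SV V(1) subspace_scale in blast)
    also have "\<dots> = (\<Sum>c\<in>S. representation S (g b) c *\<^sub>R f c)"
      using f SV by (simp add: linear_between_def)
    finally have "representation S (f (g b)) b = representation S (\<Sum>c\<in>S. representation S (g b) c *\<^sub>R f c) b" by simp
    also have "\<dots> = (\<Sum>c\<in>S. representation S (representation S (g b) c *\<^sub>R f c) b)"
      using f SV V(1) S(3) by (subst representation_sum[OF S(2)]) (auto simp: linear_between_def subspace_scale)
    also have "\<dots> = (\<Sum>c\<in>S. representation S (g b) c * representation S (f c) b)"
      using f SV S(3) by (intro sum.cong) (simp_all add: representation_scale[OF S(2)] linear_between_def)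
    finally show ?thesis .
  qed
  show ?thesis
    unfolding S(4) using exp[OF f g] exp[OF g f]
    by (simp, subst sum.swap) (simp add: mult.commute)
qed

text \<open>The trace of a sum of rank-one operators is the sum of the contractions. Since the
  vectors w need not form a basis, traces can be computed in arbitrary or cut-off frames.\<close>

lemma trace_on_rank_sum:
  assumes V: "subspace V" "finite F" "V \<subseteq> span F"
    and a: "\<And>i. i \<in> I \<Longrightarrow> linear_between V UNIV (a i)" and w: "\<And>i. i \<in> I \<Longrightarrow> w i \<in> V"
  shows "trace_on V (\<lambda>v. \<Sum>i\<in>I. a i v *\<^sub>R w i) = (\<Sum>i\<in>I. a i (w i) :: real)"
proof -
  obtain S where S: "finite S" "independent S" "span S = V"
    "\<And>f. trace_on V f = (\<Sum>b\<in>S. representation S (f b) b)" using trace_on_basis[OF V] by blast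
  have SV: "b \<in> V" if "b \<in> S" for b using that S(3) span_base by blast
  have "representation S (\<Sum>i\<in>I. a i b *\<^sub>R w i) b = (\<Sum>i\<in>I. a i b * representation S (w i) b)" for b
    using w S(3) V(1) by (subst representation_sum[OF S(2)]) (auto simp: subspace_scale representation_scale[OF S(2)])
  then have "trace_on V (\<lambda>v. \<Sum>i\<in>I. a i v *\<^sub>R w i) = (\<Sum>i\<in>I. \<Sum>b\<in>S. a i b * representation S (w i) b)"
    unfolding S(4) by (simp, subst sum.swap) simp
  also have "\<dots> = (\<Sum>i\<in>I. a i (w i))"
  proof (rule sum.cong[OF refl])
    fix i assume i: "i \<in> I"
    have wi: "w i \<in> span S" using w[OF i] S(3) by simp
    have "a i (w i) = a i (\<Sum>b\<in>S. representation S (w i) b *\<^sub>R b)"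
      by (simp add: sum_representation_eq[OF S(2) wi S(1)])
    also have "\<dots> = (\<Sum>b\<in>S. a i (representation S (w i) b *\<^sub>R b))"
      by (rule linear_between_sum[OF V(1) a[OF i]]) (use SV V(1) subspace_scale in blast)
    also have "\<dots> = (\<Sum>b\<in>S. a i b * representation S (w i) b)"
      using a[OF i] SV by (simp add: linear_between_def mult.commute)
    finally show "(\<Sum>b\<in>S. a i b * representation S (w i) b) = a i (w i)" by simp
  qed
  finally show ?thesis .
qed

section \<open>Local frames, cut-offs and global sections\<close>

definition unit_coord :: "nat \<Rightarrow> nat \<Rightarrow> real" where
  "unit_coord i j = (if j = i then 1 else 0)"

locale smooth_bundle =
  fixes A :: "('m::{t2_space,second_countable_topology}, 'd::real_inner) chart set"
    and B :: "('m, 'b::real_vector) vbundle"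
  assumes manifold: "smooth_manifold A" and vector_bundle: "smooth_vector_bundle A B"
begin

abbreviation \<Gamma> where "\<Gamma> \<equiv> sections A B"
abbreviation r where "r \<equiv> vrank B"

lemma subspace_fibre: "subspace (fibre B x)"
  using vector_bundle by (simp add: smooth_vector_bundle_def)

lemma triv_facts:
  assumes "(U, \<phi>) \<in> trivs B"
  shows "open U" "x \<in> U \<Longrightarrow> linear_between (fibre B x) (coord_space r) (\<phi> x)"
    "x \<in> U \<Longrightarrow> bij_betw (\<phi> x) (fibre B x) (coord_space r)"
    "(W, \<psi>) \<in> trivs B \<Longrightarrow> a \<in> coord_space r \<Longrightarrow> i < r \<Longrightarrow>
       smooth_fun_on A (U \<inter> W) (\<lambda>x. \<psi> x (inv_into (fibre B x) (\<phi> x) a) i)"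
  using vector_bundle assms unfolding smooth_vector_bundle_def by blast+

lemma triv_at: obtains U \<phi> where "(U, \<phi>) \<in> trivs B" "x \<in> U"
proof -
  have "x \<in> \<Union>(fst ` trivs B)" using vector_bundle by (simp add: smooth_vector_bundle_def)
  then obtain c where "c \<in> trivs B" "x \<in> fst c" by blast
  then show ?thesis using that[of "fst c" "snd c"] by simp
qed

lemma triv_add:
  assumes "(U, \<phi>) \<in> trivs B" "x \<in> U" "u \<in> fibre B x" "v \<in> fibre B x"
  shows "\<phi> x (u + v) i = \<phi> x u i + \<phi> x v i"
  using triv_facts(2)[OF assms(1,2)] assms(3,4) by (simp add: linear_between_def)

lemma triv_scale:
  assumes "(U, \<phi>) \<in> trivs B" "x \<in> U" "u \<in> fibre B x"
  shows "\<phi> x (c *\<^sub>R u) i = c * \<phi> x u i"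
  using triv_facts(2)[OF assms(1,2)] assms(3) by (simp add: linear_between_def scaleR_fun_def)

lemma triv_zero: "(U, \<phi>) \<in> trivs B \<Longrightarrow> x \<in> U \<Longrightarrow> \<phi> x 0 i = 0"
  using triv_scale[of U \<phi> x 0 0 i] subspace_0[OF subspace_fibre] by simp

definition frame_vec :: "('m \<Rightarrow> 'b \<Rightarrow> nat \<Rightarrow> real) \<Rightarrow> nat \<Rightarrow> 'm \<Rightarrow> 'b" where
  "frame_vec \<phi> i x = inv_into (fibre B x) (\<phi> x) (unit_coord i)"

lemma unit_coord_in: "i < r \<Longrightarrow> unit_coord i \<in> coord_space r"
  by (simp add: coord_space_def unit_coord_def)

lemma frame_vec:
  assumes "(U, \<phi>) \<in> trivs B" "x \<in> U" "i < r"
  shows "frame_vec \<phi> i x \<in> fibre B x" "\<phi> x (frame_vec \<phi> i x) j = (if j = i then 1 else 0)"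
proof -
  have im: "\<phi> x ` fibre B x = coord_space r" using triv_facts(3)[OF assms(1,2)] by (simp add: bij_betw_def)
  have "unit_coord i \<in> \<phi> x ` fibre B x" unfolding im by (rule unit_coord_in[OF assms(3)])
  then show "frame_vec \<phi> i x \<in> fibre B x" "\<phi> x (frame_vec \<phi> i x) j = (if j = i then 1 else 0)"
    unfolding frame_vec_def by (simp_all add: inv_into_into f_inv_into_f unit_coord_def)
qed

lemma frame_expansion:
  assumes "(U, \<phi>) \<in> trivs B" "x \<in> U" "v \<in> fibre B x"
  shows "v = (\<Sum>i<r. \<phi> x v i *\<^sub>R frame_vec \<phi> i x)"
proof -
  note V = subspace_fibre[of x]
  have lin: "linear_between (fibre B x) (coord_space r) (\<phi> x)" by (rule triv_facts(2)[OF assms(1,2)])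
  have fv: "\<phi> x v i *\<^sub>R frame_vec \<phi> i x \<in> fibre B x" if "i < r" for i
    by (rule subspace_scale[OF V frame_vec(1)[OF assms(1,2) that]])
  have "\<phi> x (\<Sum>i<r. \<phi> x v i *\<^sub>R frame_vec \<phi> i x) j = \<phi> x v j" for j
  proof -
    have "\<phi> x (\<Sum>i<r. \<phi> x v i *\<^sub>R frame_vec \<phi> i x) = (\<Sum>i<r. \<phi> x (\<phi> x v i *\<^sub>R frame_vec \<phi> i x))"
      by (rule linear_between_sum[OF V lin]) (use fv in auto)
    then have "\<phi> x (\<Sum>i<r. \<phi> x v i *\<^sub>R frame_vec \<phi> i x) j = (\<Sum>i<r. \<phi> x (\<phi> x v i *\<^sub>R frame_vec \<phi> i x) j)"
      by (simp add: sum_apply)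
    also have "\<dots> = (\<Sum>i<r. if j = i then \<phi> x v i else 0)"
      using frame_vec[OF assms(1,2)] by (intro sum.cong) (auto simp: triv_scale[OF assms(1,2)])
    also have "\<dots> = \<phi> x v j"
    proof (cases "j < r")
      case False
      have "\<phi> x v \<in> coord_space r" using lin assms(3) by (simp add: linear_between_def)
      then show ?thesis using False by (simp add: coord_space_def)
    qed simp
    finally show ?thesis .
  qed
  then have eq: "\<phi> x (\<Sum>i<r. \<phi> x v i *\<^sub>R frame_vec \<phi> i x) = \<phi> x v" by (rule ext)
  have "(\<Sum>i<r. \<phi> x v i *\<^sub>R frame_vec \<phi> i x) \<in> fibre B x" using fv by (intro subspace_sum[OF V]) auto
  then show ?thesis
    by (rule inj_onD[OF bij_betw_imp_inj_on[OF triv_facts(3)[OF assms(1,2)]] eq _ assms(3), symmetric])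
qed

lemma fibre_basis: "\<exists>F. finite F \<and> fibre B x \<subseteq> span F"
proof -
  obtain U \<phi> where t: "(U, \<phi>) \<in> trivs B" "x \<in> U" by (rule triv_at)
  have "fibre B x \<subseteq> span ((\<lambda>i. frame_vec \<phi> i x) ` {..<r})"
  proof
    fix v assume "v \<in> fibre B x"
    then have "v = (\<Sum>i<r. \<phi> x v i *\<^sub>R frame_vec \<phi> i x)" by (rule frame_expansion[OF t])
    also have "\<dots> \<in> span ((\<lambda>i. frame_vec \<phi> i x) ` {..<r})"
      by (intro span_sum span_scale span_base) auto
    finally show "v \<in> span ((\<lambda>i. frame_vec \<phi> i x) ` {..<r})" .
  qed
  then show ?thesis by (intro exI[of _ "(\<lambda>i. frame_vec \<phi> i x) ` {..<r}"]) simp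
qed

lemma sections_fibre: "s \<in> \<Gamma> \<Longrightarrow> s x \<in> fibre B x"
  by (simp add: sections_def)

lemma sections_smooth: "s \<in> \<Gamma> \<Longrightarrow> (U, \<phi>) \<in> trivs B \<Longrightarrow> i < r \<Longrightarrow> smooth_fun_on A U (\<lambda>x. \<phi> x (s x) i)"
  unfolding sections_def by blast

lemma sectionsI:
  "(\<And>x. s x \<in> fibre B x) \<Longrightarrow> (\<And>U \<phi> i. (U, \<phi>) \<in> trivs B \<Longrightarrow> i < r \<Longrightarrow> smooth_fun_on A U (\<lambda>x. \<phi> x (s x) i)) \<Longrightarrow> s \<in> \<Gamma>"
  unfolding sections_def by blast

lemma sections_add: "s \<in> \<Gamma> \<Longrightarrow> t \<in> \<Gamma> \<Longrightarrow> s + t \<in> \<Gamma>"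
proof (rule sectionsI)
  assume st: "s \<in> \<Gamma>" "t \<in> \<Gamma>"
  show "(s + t) x \<in> fibre B x" for x using st by (simp add: sections_fibre subspace_add[OF subspace_fibre])
  fix U \<phi> i assume U: "(U, \<phi>) \<in> trivs B" "i < r"
  show "smooth_fun_on A U (\<lambda>x. \<phi> x ((s + t) x) i)"
    by (rule smooth_fun_on_cong[OF manifold triv_facts(1)[OF U(1)] _
        smooth_fun_on_add[OF manifold triv_facts(1)[OF U(1)] sections_smooth[OF st(1) U] sections_smooth[OF st(2) U]]])
      (simp add: triv_add[OF U(1)] triv_scale[OF U(1)] sections_fibre st)
qed

lemma sections_fscale: "f \<in> Cinf A \<Longrightarrow> s \<in> \<Gamma> \<Longrightarrow> f \<bullet>\<^sub>M s \<in> \<Gamma>"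
proof (rule sectionsI)
  assume st: "f \<in> Cinf A" "s \<in> \<Gamma>"
  show "(f \<bullet>\<^sub>M s) x \<in> fibre B x" for x using st by (simp add: fscale_def sections_fibre subspace_scale[OF subspace_fibre])
  fix U \<phi> i assume U: "(U, \<phi>) \<in> trivs B" "i < r"
  show "smooth_fun_on A U (\<lambda>x. \<phi> x ((f \<bullet>\<^sub>M s) x) i)"
    by (rule smooth_fun_on_cong[OF manifold triv_facts(1)[OF U(1)] _
        smooth_fun_on_mult[OF manifold triv_facts(1)[OF U(1)] Cinf_smooth_on[OF manifold st(1)] sections_smooth[OF st(2) U]]])
      (simp add: triv_add[OF U(1)] triv_scale[OF U(1)] sections_fibre st fscale_def)
qed

lemma sections_scaleR: "s \<in> \<Gamma> \<Longrightarrow> c *\<^sub>R s \<in> \<Gamma>"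
  using sections_fscale[OF Cinf_const[OF manifold, of c]] by (simp add: fscale_def scaleR_fun_def)

lemma sections_0: "0 \<in> \<Gamma>"
  by (rule sectionsI)
    (auto simp: subspace_0[OF subspace_fibre] triv_facts(1) triv_zero
      intro!: smooth_fun_on_cong[OF manifold _ _ smooth_fun_on_const[OF manifold, of _ 0]])

lemma subspace_sections: "subspace \<Gamma>"
  unfolding subspace_def using sections_0 sections_add sections_scaleR by blast

text \<open>Frame vectors and coordinates are each multiplied by the cut-off, so that both become
  global and smooth; their products therefore reproduce a vector only up to the square of h.\<close>

definition cut_frame :: "'m set \<Rightarrow> ('m \<Rightarrow> 'b \<Rightarrow> nat \<Rightarrow> real) \<Rightarrow> ('m \<Rightarrow> real) \<Rightarrow> nat \<Rightarrow> 'm \<Rightarrow> 'b" where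
  "cut_frame U \<phi> h i x = (if x \<in> U then h x *\<^sub>R frame_vec \<phi> i x else 0)"

definition cut_coord :: "'m set \<Rightarrow> ('m \<Rightarrow> 'b \<Rightarrow> nat \<Rightarrow> real) \<Rightarrow> ('m \<Rightarrow> real) \<Rightarrow> nat \<Rightarrow> 'm \<Rightarrow> 'b \<Rightarrow> real" where
  "cut_coord U \<phi> h i x v = (if x \<in> U then h x * \<phi> x v i else 0)"

text \<open>W is covered by its intersections with U and with the complement of K, and on the latter
  f is zero.\<close>

lemma smooth_extend_zero:
  assumes "open U" "open W" "closed K" "K \<subseteq> U" "\<And>x. x \<in> W \<Longrightarrow> x \<notin> K \<Longrightarrow> f x = 0" "smooth_fun_on A (W \<inter> U) f"
  shows "smooth_fun_on A W f"
proof (rule smooth_fun_on_local[OF manifold assms(2)])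
  fix x assume x: "x \<in> W"
  show "\<exists>N. open N \<and> x \<in> N \<and> smooth_fun_on A (W \<inter> N) f"
  proof (cases "x \<in> U")
    case True
    then show ?thesis using assms by blast
  next
    case False
    have "smooth_fun_on A (W \<inter> - K) f"
      by (rule smooth_fun_on_cong[OF manifold _ _ smooth_fun_on_const[OF manifold, of _ 0]]) (use assms in auto)
    then show ?thesis using False assms(3,4) by (intro exI[of _ "- K"]) auto
  qed
qed

definition cutoff :: "'m set \<Rightarrow> ('m \<Rightarrow> real) \<Rightarrow> bool" where
  "cutoff U h \<longleftrightarrow> h \<in> Cinf A \<and> (\<exists>K. closed K \<and> K \<subseteq> U \<and> (\<forall>y. y \<notin> K \<longrightarrow> h y = 0))"

lemma cut_frame_section:
  assumes U: "(U, \<phi>) \<in> trivs B" and h: "cutoff U h" and i: "i < r"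
  shows "cut_frame U \<phi> h i \<in> \<Gamma>"
proof (rule sectionsI)
  obtain K where K: "closed K" "K \<subseteq> U" "\<And>y. y \<notin> K \<Longrightarrow> h y = 0" and hC: "h \<in> Cinf A" using h by (auto simp: cutoff_def)
  show "cut_frame U \<phi> h i x \<in> fibre B x" for x
    using frame_vec(1)[OF U _ i, of x] subspace_fibre[of x]
    by (auto simp: cut_frame_def intro: subspace_scale subspace_0)
  fix W \<psi> j assume W: "(W, \<psi>) \<in> trivs B" and j: "j < r"
  show "smooth_fun_on A W (\<lambda>x. \<psi> x (cut_frame U \<phi> h i x) j)"
  proof (rule smooth_extend_zero[OF triv_facts(1)[OF U] triv_facts(1)[OF W] K(1,2)])
    show "\<psi> x (cut_frame U \<phi> h i x) j = 0" if "x \<in> W" "x \<notin> K" for x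
      using that K(3) triv_zero[OF W] by (simp add: cut_frame_def)
    have o: "open (W \<inter> U)" using triv_facts(1) U W by blast
    have "smooth_fun_on A (W \<inter> U) (\<lambda>x. h x * \<psi> x (inv_into (fibre B x) (\<phi> x) (unit_coord i)) j)"
      using triv_facts(4)[OF U W unit_coord_in[OF i] j]
      by (intro smooth_fun_on_mult[OF manifold o] Cinf_smooth_on[OF manifold hC]) (simp add: Int_commute)
    then show "smooth_fun_on A (W \<inter> U) (\<lambda>x. \<psi> x (cut_frame U \<phi> h i x) j)"
      by (rule smooth_fun_on_cong[OF manifold o, rotated])
        (auto simp: cut_frame_def triv_scale[OF W] frame_vec(1)[OF U _ i] frame_vec_def[symmetric])
  qed
qed

lemma cut_coord_smooth:
  assumes U: "(U, \<phi>) \<in> trivs B" and h: "cutoff U h" and i: "i < r" and s: "s \<in> \<Gamma>"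
  shows "(\<lambda>x. cut_coord U \<phi> h i x (s x)) \<in> Cinf A"
  unfolding Cinf_iff[OF manifold]
proof -
  obtain K where K: "closed K" "K \<subseteq> U" "\<And>y. y \<notin> K \<Longrightarrow> h y = 0" and hC: "h \<in> Cinf A" using h by (auto simp: cutoff_def)
  show "smooth_fun_on A UNIV (\<lambda>x. cut_coord U \<phi> h i x (s x))"
  proof (rule smooth_extend_zero[OF triv_facts(1)[OF U] _ K(1,2)])
    show "smooth_fun_on A (UNIV \<inter> U) (\<lambda>x. cut_coord U \<phi> h i x (s x))"
      using smooth_fun_on_mult[OF manifold triv_facts(1)[OF U] Cinf_smooth_on[OF manifold hC] sections_smooth[OF s U i]]
      by (simp, rule smooth_fun_on_cong[OF manifold triv_facts(1)[OF U], rotated]) (simp_all add: cut_coord_def)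
  qed (use K in \<open>auto simp: cut_coord_def\<close>)
qed

lemma cut_coord_linear: "(U, \<phi>) \<in> trivs B \<Longrightarrow> linear_between (fibre B x) UNIV (cut_coord U \<phi> h i x)"
  by (auto simp: linear_between_def cut_coord_def triv_add triv_scale algebra_simps)

lemma cut_expansion:
  assumes U: "(U, \<phi>) \<in> trivs B" and h: "cutoff U h" and v: "v \<in> fibre B x"
  shows "(\<Sum>i<r. cut_coord U \<phi> h i x v *\<^sub>R cut_frame U \<phi> h i x) = (h x)\<^sup>2 *\<^sub>R v"
proof (cases "x \<in> U")
  case True
  then have "(\<Sum>i<r. cut_coord U \<phi> h i x v *\<^sub>R cut_frame U \<phi> h i x) = (h x)\<^sup>2 *\<^sub>R (\<Sum>i<r. \<phi> x v i *\<^sub>R frame_vec \<phi> i x)"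
    by (simp add: cut_coord_def cut_frame_def scaleR_sum_right power2_eq_square mult_ac)
  then show ?thesis using frame_expansion[OF U True v] by simp
next
  case False
  then have "h x = 0" using h by (auto simp: cutoff_def)
  then show ?thesis using False by (simp add: cut_coord_def cut_frame_def)
qed

text \<open>The polynomial \<open>3t\<^sup>2 - 2t\<^sup>3\<close> takes the value \<open>1\<close> with derivative \<open>0\<close> at \<open>t = 1\<close>, which makes the
  cut-off stationary at \<open>x\<close> in the sense of derivations.\<close>

lemma cutoff_exists:
  "\<exists>U \<phi> h. (U, \<phi>) \<in> trivs B \<and> x \<in> U \<and> cutoff U h \<and> h x = 1 \<and>
    (\<forall>X\<in>tangent_space A x. X (h * h) = 0)"
proof -
  obtain U \<phi> where t: "(U, \<phi>) \<in> trivs B" "x \<in> U" by (rule triv_at)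
  obtain k K where k: "k \<in> Cinf A" "k x = 1" "closed K" "K \<subseteq> U" "\<And>y. y \<notin> K \<Longrightarrow> k y = 0"
    using bump_function[OF manifold triv_facts(1)[OF t(1)] t(2)] by blast
  define h where "h = 3 *\<^sub>R (k * k) + (-2) *\<^sub>R (k * k * k)"
  have kk: "k * k \<in> Cinf A" "k * k * k \<in> Cinf A" using k(1) Cinf_mult[OF manifold] by blast+
  have hC: "h \<in> Cinf A" unfolding h_def by (intro Cinf_add[OF manifold] Cinf_scaleR[OF manifold] kk)
  have hx: "h x = 1" using k(2) by (simp add: h_def scaleR_fun_def)
  have "cutoff U h" unfolding cutoff_def using hC k(3-5) by (auto simp: h_def scaleR_fun_def)
  moreover have "X (h * h) = 0" if X: "X \<in> tangent_space A x" for X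
  proof -
    have lin: "linear_between (Cinf A) UNIV X" and leib: "\<And>f g. f \<in> Cinf A \<Longrightarrow> g \<in> Cinf A \<Longrightarrow> X (f * g) = f x * X g + g x * X f"
      using X by (auto simp: tangent_space_def)
    have "X h = X (3 *\<^sub>R (k * k)) + X ((-2) *\<^sub>R (k * k * k))"
      unfolding h_def using lin kk Cinf_scaleR[OF manifold] unfolding linear_between_def by blast
    also have "\<dots> = 3 * X (k * k) + (-2) * X (k * k * k)"
      using lin kk unfolding linear_between_def by (simp del: scaleR_minus_left)
    also have "\<dots> = 0" using leib[OF k(1) k(1)] leib[OF kk(1) k(1)] k(2) by simp
    finally show ?thesis using leib[OF hC hC] by simp
  qed
  ultimately show ?thesis using t hx by blast
qed

text \<open>The vector is extended with constant coefficients in a cut-off frame.\<close>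

lemma section_through:
  assumes "v \<in> fibre B x" shows "\<exists>s\<in>\<Gamma>. s x = v"
proof -
  obtain U \<phi> h where t: "(U, \<phi>) \<in> trivs B" "x \<in> U" "cutoff U h" "h x = 1"
    using cutoff_exists[of x] by blast
  let ?s = "\<Sum>i<r. \<phi> x v i *\<^sub>R cut_frame U \<phi> h i"
  have "?s \<in> \<Gamma>" by (intro subspace_sum[OF subspace_sections] sections_scaleR cut_frame_section t) simp
  moreover have "?s x = v"
    using frame_expansion[OF t(1,2) assms] t(2,4) by (simp add: sum_apply scaleR_fun_def cut_frame_def)
  ultimately show ?thesis by blast
qed

section \<open>Tensorial operators, their action on fibres and their traces\<close>

definition at_fibre :: "(('m \<Rightarrow> 'b) \<Rightarrow> 'm \<Rightarrow> 'w) \<Rightarrow> 'm \<Rightarrow> 'b \<Rightarrow> 'w" where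
  "at_fibre T x v = T (SOME b. b \<in> \<Gamma> \<and> b x = v) x"

definition tensorial :: "(('m \<Rightarrow> 'b) \<Rightarrow> 'm \<Rightarrow> 'w::real_vector) \<Rightarrow> bool" where
  "tensorial T \<longleftrightarrow> (\<forall>s\<in>\<Gamma>. \<forall>t\<in>\<Gamma>. T (s + t) = T s + T t) \<and> (\<forall>f\<in>Cinf A. \<forall>s\<in>\<Gamma>. T (f \<bullet>\<^sub>M s) = f \<bullet>\<^sub>M T s)"

lemma tensorial_scaleR: "tensorial T \<Longrightarrow> s \<in> \<Gamma> \<Longrightarrow> T (c *\<^sub>R s) = c *\<^sub>R T s"
  using Cinf_const[OF manifold, of c] unfolding tensorial_def by (auto simp: fscale_def scaleR_fun_def)

lemma tensorial_sum:
  "tensorial T \<Longrightarrow> (\<And>i. i \<in> I \<Longrightarrow> s i \<in> \<Gamma>) \<Longrightarrow> T (\<Sum>i\<in>I. s i) = (\<Sum>i\<in>I. T (s i))"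
proof (induction I rule: infinite_finite_induct)
  case (insert i I)
  have "(\<Sum>i\<in>I. s i) \<in> \<Gamma>" using insert by (intro subspace_sum[OF subspace_sections]) auto
  then have "T (s i + sum s I) = T (s i) + T (sum s I)"
    using insert.prems unfolding tensorial_def by blast
  moreover have "T (sum s I) = (\<Sum>i\<in>I. T (s i))" using insert by blast
  ultimately show ?case by (simp only: sum.insert[OF insert.hyps])
qed (use tensorial_scaleR[OF _ sections_0, of T 0] in auto)

text \<open>Near a point every section is a combination of a fixed finite family of sections whose
  coefficients depend pointwise on the section; so tensorial operators act fibrewise.\<close>

lemma section_expansion:
  assumes U: "(U, \<phi>) \<in> trivs B" and h: "cutoff U h" and s: "s \<in> \<Gamma>"
  shows "(h * h) \<bullet>\<^sub>M s = (\<Sum>i<r. (\<lambda>x. cut_coord U \<phi> h i x (s x)) \<bullet>\<^sub>M cut_frame U \<phi> h i)"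
  using cut_expansion[OF U h sections_fibre[OF s]]
  by (simp add: fun_eq_iff sum_apply fscale_def power2_eq_square)

lemma tensorial_expansion:
  assumes U: "(U, \<phi>) \<in> trivs B" and h: "cutoff U h" and s: "s \<in> \<Gamma>" and T: "tensorial T"
  shows "(h x)\<^sup>2 *\<^sub>R T s x = (\<Sum>i<r. cut_coord U \<phi> h i x (s x) *\<^sub>R T (cut_frame U \<phi> h i) x)"
proof -
  have hh: "h * h \<in> Cinf A" using h Cinf_mult[OF manifold] by (auto simp: cutoff_def)
  have "(h * h) \<bullet>\<^sub>M T s = T ((h * h) \<bullet>\<^sub>M s)" using T hh s by (simp add: tensorial_def)
  also have "\<dots> = (\<Sum>i<r. T ((\<lambda>x. cut_coord U \<phi> h i x (s x)) \<bullet>\<^sub>M cut_frame U \<phi> h i))"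
    unfolding section_expansion[OF U h s]
    by (intro tensorial_sum T sections_fscale cut_coord_smooth cut_frame_section U h s) auto
  also have "\<dots> = (\<Sum>i<r. (\<lambda>x. cut_coord U \<phi> h i x (s x)) \<bullet>\<^sub>M T (cut_frame U \<phi> h i))"
    using T cut_coord_smooth[OF U h _ s] cut_frame_section[OF U h] by (intro sum.cong) (auto simp: tensorial_def)
  finally show ?thesis by (simp add: fun_eq_iff fscale_def sum_apply power2_eq_square)
qed

lemma tensorial_pointwise:
  assumes T: "tensorial T" and s: "s \<in> \<Gamma>" "t \<in> \<Gamma>" "s x = t x"
  shows "T s x = T t x"
proof -
  obtain U \<phi> h where t: "(U, \<phi>) \<in> trivs B" "x \<in> U" "cutoff U h" "h x = 1"
    using cutoff_exists[of x] by blast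
  show ?thesis using tensorial_expansion[OF t(1,3) s(1) T, of x] tensorial_expansion[OF t(1,3) s(2) T, of x] s(3) t(4) by simp
qed

lemma at_fibre_eval:
  assumes "tensorial T" "s \<in> \<Gamma>" shows "at_fibre T x (s x) = T s x"
proof -
  have "(SOME b. b \<in> \<Gamma> \<and> b x = s x) \<in> \<Gamma> \<and> (SOME b. b \<in> \<Gamma> \<and> b x = s x) x = s x"
    using assms(2) by (intro someI[of "\<lambda>b. b \<in> \<Gamma> \<and> b x = s x" s]) auto
  then show ?thesis unfolding at_fibre_def using tensorial_pointwise[OF assms(1)] assms(2) by blast
qed

lemma at_fibre_linear:
  assumes "tensorial T" "\<And>s. s \<in> \<Gamma> \<Longrightarrow> T s x \<in> W"
  shows "linear_between (fibre B x) W (at_fibre T x)"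
  unfolding linear_between_def
proof (intro conjI ballI allI)
  fix u assume "u \<in> fibre B x"
  then obtain s where s: "s \<in> \<Gamma>" "s x = u" using section_through by blast
  then show "at_fibre T x u \<in> W" using at_fibre_eval[OF assms(1) s(1), of x] assms(2) by simp
  show "at_fibre T x (c *\<^sub>R u) = c *\<^sub>R at_fibre T x u" for c
    using at_fibre_eval[OF assms(1) sections_scaleR[OF s(1), of c], of x] at_fibre_eval[OF assms(1) s(1), of x]
      tensorial_scaleR[OF assms(1) s(1)] s(2) by (simp add: scaleR_fun_def)
  fix v assume "v \<in> fibre B x"
  then obtain t where t: "t \<in> \<Gamma>" "t x = v" using section_through by blast
  have "T (s + t) = T s + T t" using assms(1) s(1) t(1) unfolding tensorial_def by blast
  moreover have "at_fibre T x (u + v) = T (s + t) x"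
    using at_fibre_eval[OF assms(1) sections_add[OF s(1) t(1)], of x] s(2) t(2) by simp
  moreover have "at_fibre T x u = T s x" "at_fibre T x v = T t x"
    using at_fibre_eval[OF assms(1) s(1), of x] at_fibre_eval[OF assms(1) t(1), of x] s(2) t(2) by simp_all
  ultimately show "at_fibre T x (u + v) = at_fibre T x u + at_fibre T x v" by simp
qed

definition bundle_End :: "(('m \<Rightarrow> 'b) \<Rightarrow> 'm \<Rightarrow> 'b) set" where
  "bundle_End = {T. tensorial T \<and> (\<forall>s\<in>\<Gamma>. T s \<in> \<Gamma>)}"

lemma fibre_End_eq: "fibre_End A B T x = at_fibre T x"
  by (simp add: fun_eq_iff fibre_End_def at_fibre_def)

lemma at_fibre_End: "T \<in> bundle_End \<Longrightarrow> linear_between (fibre B x) (fibre B x) (at_fibre T x)"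
  by (rule at_fibre_linear) (auto simp: bundle_End_def sections_fibre)

lemma trace_End_cong:
  assumes "\<And>s. s \<in> \<Gamma> \<Longrightarrow> S s = T s" shows "trace_End A B S = trace_End A B T"
proof
  fix x
  obtain F where F: "finite F" "fibre B x \<subseteq> span F" using fibre_basis by blast
  have "at_fibre S x v = at_fibre T x v" if "v \<in> fibre B x" for v
  proof -
    have "(SOME b. b \<in> \<Gamma> \<and> b x = v) \<in> \<Gamma>" using section_through[OF that] by (metis (mono_tags, lifting) someI_ex)
    then show ?thesis using assms by (simp add: at_fibre_def)
  qed
  then show "trace_End A B S x = trace_End A B T x"
    unfolding trace_End_def fibre_End_eq by (rule trace_on_cong[OF subspace_fibre F])
qed

lemma trace_End_at:
  assumes "\<And>s. s \<in> \<Gamma> \<Longrightarrow> T s x = G (s x)" shows "trace_End A B T x = trace_on (fibre B x) G"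
proof -
  obtain F where F: "finite F" "fibre B x \<subseteq> span F" using fibre_basis by blast
  have "at_fibre T x v = G v" if "v \<in> fibre B x" for v
  proof -
    have "(SOME b. b \<in> \<Gamma> \<and> b x = v) \<in> \<Gamma> \<and> (SOME b. b \<in> \<Gamma> \<and> b x = v) x = v"
      using section_through[OF that] by (metis (mono_tags, lifting) someI_ex)
    then show ?thesis using assms by (simp add: at_fibre_def)
  qed
  then show ?thesis
    unfolding trace_End_def fibre_End_eq by (rule trace_on_cong[OF subspace_fibre F])
qed

lemma trace_End_add:
  assumes "S \<in> bundle_End" "T \<in> bundle_End"
  shows "trace_End A B (\<lambda>s. S s + T s) = trace_End A B S + trace_End A B T"
proof
  fix x
  obtain F where F: "finite F" "fibre B x \<subseteq> span F" using fibre_basis by blast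
  have "trace_End A B (\<lambda>s. S s + T s) x = trace_on (fibre B x) (\<lambda>v. at_fibre S x v + at_fibre T x v)"
    by (rule trace_End_at) (use assms in \<open>auto simp: at_fibre_eval bundle_End_def\<close>)
  also have "\<dots> = trace_on (fibre B x) (at_fibre S x) + trace_on (fibre B x) (at_fibre T x)"
    by (rule trace_on_add[OF subspace_fibre F]) (use at_fibre_End assms in \<open>auto simp: linear_between_def\<close>)
  finally show "trace_End A B (\<lambda>s. S s + T s) x = (trace_End A B S + trace_End A B T) x"
    by (simp add: trace_End_def fibre_End_eq)
qed

lemma trace_End_fscale:
  assumes "T \<in> bundle_End"
  shows "trace_End A B (\<lambda>s. f \<bullet>\<^sub>M T s) = f * trace_End A B T"
proof
  fix x
  obtain F where F: "finite F" "fibre B x \<subseteq> span F" using fibre_basis by blast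
  have "trace_End A B (\<lambda>s. f \<bullet>\<^sub>M T s) x = trace_on (fibre B x) (\<lambda>v. f x *\<^sub>R at_fibre T x v)"
    by (rule trace_End_at) (use assms in \<open>auto simp: at_fibre_eval bundle_End_def fscale_def\<close>)
  also have "\<dots> = f x * trace_on (fibre B x) (at_fibre T x)"
    by (rule trace_on_scale[OF subspace_fibre F]) (use at_fibre_End assms in \<open>auto simp: linear_between_def\<close>)
  finally show "trace_End A B (\<lambda>s. f \<bullet>\<^sub>M T s) x = (f * trace_End A B T) x"
    by (simp add: trace_End_def fibre_End_eq)
qed

lemma trace_End_commute:
  assumes "S \<in> bundle_End" "T \<in> bundle_End"
  shows "trace_End A B (\<lambda>s. S (T s)) = trace_End A B (\<lambda>s. T (S s))"
proof
  fix x
  obtain F where F: "finite F" "fibre B x \<subseteq> span F" using fibre_basis by blast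
  have *: "trace_End A B (\<lambda>s. S (T s)) x = trace_on (fibre B x) (\<lambda>v. at_fibre S x (at_fibre T x v))"
    if "S \<in> bundle_End" "T \<in> bundle_End" for S T
    by (rule trace_End_at) (use that in \<open>auto simp: at_fibre_eval bundle_End_def\<close>)
  show "trace_End A B (\<lambda>s. S (T s)) x = trace_End A B (\<lambda>s. T (S s)) x"
    unfolding *[OF assms] *[OF assms(2,1)]
    by (rule trace_on_commute[OF subspace_fibre F at_fibre_End[OF assms(1)] at_fibre_End[OF assms(2)]])
qed

text \<open>Multiplication by the squared cut-off turns T into a finite sum of rank-one operators,
  whose trace is a sum of contractions. The right-hand side consists of global smooth functions,
  which can be differentiated.\<close>

lemma trace_End_cut:
  assumes U: "(U, \<phi>) \<in> trivs B" and h: "cutoff U h" and T: "T \<in> bundle_End"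
  shows "(h x)\<^sup>2 * trace_End A B T x = (\<Sum>i<r. cut_coord U \<phi> h i x (T (cut_frame U \<phi> h i) x))"
proof -
  obtain F where F: "finite F" "fibre B x \<subseteq> span F" using fibre_basis by blast
  have tens: "tensorial T" and TG: "\<And>s. s \<in> \<Gamma> \<Longrightarrow> T s \<in> \<Gamma>" using T by (auto simp: bundle_End_def)
  have "trace_End A B (\<lambda>s. (h * h) \<bullet>\<^sub>M T s) x = trace_on (fibre B x) (\<lambda>v. \<Sum>i<r. cut_coord U \<phi> h i x v *\<^sub>R T (cut_frame U \<phi> h i) x)"
    by (rule trace_End_at) (use tensorial_expansion[OF U h _ tens] in \<open>simp add: fscale_def power2_eq_square\<close>)
  also have "\<dots> = (\<Sum>i<r. cut_coord U \<phi> h i x (T (cut_frame U \<phi> h i) x))"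
    by (rule trace_on_rank_sum[OF subspace_fibre F])
      (use cut_coord_linear[OF U] sections_fibre TG cut_frame_section[OF U h] in auto)
  finally show ?thesis using trace_End_fscale[OF T, of "h * h"] by (simp add: power2_eq_square)
qed

end

section \<open>Smoothness of the trace and its derivative along a connection\<close>

context smooth_bundle
begin

lemma Cinf_continuous: "f \<in> Cinf A \<Longrightarrow> continuous_on UNIV f"
proof -
  assume f: "f \<in> Cinf A"
  have "isCont f x" for x
  proof -
    obtain U \<kappa> where c: "(U, \<kappa>) \<in> A" "x \<in> U" by (rule chart_at[OF manifold])
    note cf = chart_facts[OF manifold c(1)]
    have "Ck_on 0 (\<kappa> ` (U \<inter> UNIV)) (\<lambda>y. f (inv_into U \<kappa> y))"
      using f c(1) unfolding Cinf_iff[OF manifold] smooth_fun_on_iff[OF manifold] by blast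
    then have "continuous_on (\<kappa> ` U) (\<lambda>y. f (inv_into U \<kappa> y))" by simp
    moreover have "continuous_on U \<kappa>" using cf(3) by (simp add: homeomorphism_def)
    ultimately have "continuous_on U (\<lambda>x. f (inv_into U \<kappa> (\<kappa> x)))"
      using continuous_on_compose2[of "\<kappa> ` U" "\<lambda>y. f (inv_into U \<kappa> y)" U \<kappa>] by blast
    then have "continuous_on U f" using cf(4) continuous_on_cong by (metis (no_types, lifting) inv_into_f_f)
    then show ?thesis using cf(1) c(2) continuous_on_eq_continuous_at by blast
  qed
  then show ?thesis by (simp add: continuous_at_imp_continuous_on)
qed

lemma open_nonzero: "f \<in> Cinf A \<Longrightarrow> open {x. f x \<noteq> 0}"
  by (intro open_Collect_neq Cinf_continuous continuous_on_const)

lemma smooth_divide: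
  assumes "h \<in> Cinf A" "smooth_fun_on A W f" "open W" "\<And>x. x \<in> W \<Longrightarrow> h x * u x = f x"
  shows "smooth_fun_on A (W \<inter> {x. h x \<noteq> 0}) u"
proof -
  have o: "open (W \<inter> {x. h x \<noteq> 0})" using assms(3) open_nonzero[OF assms(1)] by blast
  have "smooth_fun_on A (W \<inter> {x. h x \<noteq> 0}) (\<lambda>x. inverse (h x) * f x)"
    using assms by (intro smooth_fun_on_mult[OF manifold o] smooth_fun_on_inverse[OF manifold o]
        Cinf_smooth_on[OF manifold] smooth_fun_on_subset[OF manifold assms(2)]) auto
  then show ?thesis
    by (rule smooth_fun_on_cong[OF manifold o, rotated]) (use assms(4) in \<open>auto simp: field_simps\<close>)
qed

lemma trace_End_smooth:
  assumes "T \<in> bundle_End" shows "trace_End A B T \<in> Cinf A"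
  unfolding Cinf_iff[OF manifold]
proof (rule smooth_fun_on_local[OF manifold open_UNIV])
  fix x
  obtain U \<phi> h where t: "(U, \<phi>) \<in> trivs B" "x \<in> U" "cutoff U h" "h x = 1"
    using cutoff_exists[of x] by blast
  have hh: "h * h \<in> Cinf A" using t(3) Cinf_mult[OF manifold] by (auto simp: cutoff_def)
  have "smooth_fun_on A UNIV (\<lambda>x. \<Sum>i<r. cut_coord U \<phi> h i x (T (cut_frame U \<phi> h i) x))"
    using assms cut_coord_smooth[OF t(1,3)] cut_frame_section[OF t(1,3)]
    by (intro smooth_fun_on_sum[OF manifold open_UNIV]) (auto simp: bundle_End_def Cinf_iff[OF manifold])
  then have "smooth_fun_on A (UNIV \<inter> {x. (h * h) x \<noteq> 0}) (trace_End A B T)"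
    by (rule smooth_divide[OF hh _ open_UNIV]) (use trace_End_cut[OF t(1,3) assms] in \<open>simp add: power2_eq_square\<close>)
  then show "\<exists>N. open N \<and> x \<in> N \<and> smooth_fun_on A (UNIV \<inter> N) (trace_End A B T)"
    using open_nonzero[OF hh] t(4) by (intro exI[of _ "{x. (h * h) x \<noteq> 0}"]) auto
qed

text \<open>A connection frozen in one direction: D acts on sections, and the derivation R of the
  smooth functions is its symbol.\<close>

definition covariant :: "(('m \<Rightarrow> real) \<Rightarrow> 'm \<Rightarrow> real) \<Rightarrow> (('m \<Rightarrow> 'b) \<Rightarrow> 'm \<Rightarrow> 'b) \<Rightarrow> bool" where
  "covariant R D \<longleftrightarrow> (\<forall>x. (\<lambda>f. R f x) \<in> tangent_space A x) \<and> (\<forall>f\<in>Cinf A. R f \<in> Cinf A) \<and>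
     (\<forall>s\<in>\<Gamma>. D s \<in> \<Gamma>) \<and> (\<forall>s\<in>\<Gamma>. \<forall>t\<in>\<Gamma>. D (s + t) = D s + D t) \<and>
     (\<forall>f\<in>Cinf A. \<forall>s\<in>\<Gamma>. D (f \<bullet>\<^sub>M s) = f \<bullet>\<^sub>M D s + R f \<bullet>\<^sub>M s)"

lemma
  assumes "covariant R D"
  shows covariant_tangent: "(\<lambda>f. R f x) \<in> tangent_space A x"
    and covariant_Cinf: "f \<in> Cinf A \<Longrightarrow> R f \<in> Cinf A"
    and covariant_section: "s \<in> \<Gamma> \<Longrightarrow> D s \<in> \<Gamma>"
    and covariant_add: "s \<in> \<Gamma> \<Longrightarrow> t \<in> \<Gamma> \<Longrightarrow> D (s + t) = D s + D t"
    and covariant_fscale: "f \<in> Cinf A \<Longrightarrow> s \<in> \<Gamma> \<Longrightarrow> D (f \<bullet>\<^sub>M s) = f \<bullet>\<^sub>M D s + R f \<bullet>\<^sub>M s"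
    and covariant_R_add: "f \<in> Cinf A \<Longrightarrow> k \<in> Cinf A \<Longrightarrow> R (f + k) x = R f x + R k x"
    and covariant_R_mult: "f \<in> Cinf A \<Longrightarrow> k \<in> Cinf A \<Longrightarrow> R (f * k) x = f x * R k x + k x * R f x"
proof -
  show t: "(\<lambda>f. R f x) \<in> tangent_space A x" for x using assms unfolding covariant_def by blast
  show "f \<in> Cinf A \<Longrightarrow> R f \<in> Cinf A" "s \<in> \<Gamma> \<Longrightarrow> D s \<in> \<Gamma>" "s \<in> \<Gamma> \<Longrightarrow> t \<in> \<Gamma> \<Longrightarrow> D (s + t) = D s + D t"
    "f \<in> Cinf A \<Longrightarrow> s \<in> \<Gamma> \<Longrightarrow> D (f \<bullet>\<^sub>M s) = f \<bullet>\<^sub>M D s + R f \<bullet>\<^sub>M s"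
    using assms unfolding covariant_def by blast+
  show "f \<in> Cinf A \<Longrightarrow> k \<in> Cinf A \<Longrightarrow> R (f + k) x = R f x + R k x"
    "f \<in> Cinf A \<Longrightarrow> k \<in> Cinf A \<Longrightarrow> R (f * k) x = f x * R k x + k x * R f x"
    using t[of x] unfolding tangent_space_def linear_between_def by blast+
qed

lemma covariant_0: "covariant R D \<Longrightarrow> D 0 = 0"
  using covariant_add[of R D 0 0] sections_0 by simp

lemma covariant_sum:
  "covariant R D \<Longrightarrow> (\<And>i. i \<in> I \<Longrightarrow> s i \<in> \<Gamma>) \<Longrightarrow> D (\<Sum>i\<in>I. s i) = (\<Sum>i\<in>I. D (s i))"
proof (induction I rule: infinite_finite_induct)
  case (insert i I)
  have "sum s I \<in> \<Gamma>" using insert by (intro subspace_sum[OF subspace_sections]) auto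
  then have "D (s i + sum s I) = D (s i) + D (sum s I)"
    using covariant_add[OF insert.prems(1)] insert.prems(2) by blast
  moreover have "D (sum s I) = (\<Sum>i\<in>I. D (s i))" using insert by blast
  ultimately show ?case by (simp only: sum.insert[OF insert.hyps])
qed (use covariant_0 in auto)

lemma covariant_R_sum:
  assumes "covariant R D" "\<And>i. i \<in> I \<Longrightarrow> f i \<in> Cinf A" shows "R (\<Sum>i\<in>I. f i) x = (\<Sum>i\<in>I. R (f i) x)"
proof -
  have "linear_between (Cinf A) UNIV (\<lambda>f. R f x)" using covariant_tangent[OF assms(1), of x] by (simp add: tangent_space_def)
  then show ?thesis using linear_between_sum[OF subspace_Cinf[OF manifold]] assms(2) by blast
qed

lemma commutator_End:
  assumes D: "covariant R D" and T: "T \<in> bundle_End"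
  shows "(\<lambda>s. D (T s) - T (D s)) \<in> bundle_End"
proof -
  have TG: "\<And>s. s \<in> \<Gamma> \<Longrightarrow> T s \<in> \<Gamma>"
    and Ta: "\<And>s t. s \<in> \<Gamma> \<Longrightarrow> t \<in> \<Gamma> \<Longrightarrow> T (s + t) = T s + T t"
    and Tf: "\<And>f s. f \<in> Cinf A \<Longrightarrow> s \<in> \<Gamma> \<Longrightarrow> T (f \<bullet>\<^sub>M s) = f \<bullet>\<^sub>M T s"
    using T unfolding bundle_End_def tensorial_def by blast+
  note Dc = covariant_section[OF D] covariant_add[OF D] covariant_fscale[OF D] covariant_Cinf[OF D]
  have "D (T (s + t)) - T (D (s + t)) = (D (T s) - T (D s)) + (D (T t) - T (D t))" if "s \<in> \<Gamma>" "t \<in> \<Gamma>" for s t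
    unfolding Ta[OF that] Dc(2)[OF that] Ta[OF Dc(1)[OF that(1)] Dc(1)[OF that(2)]] Dc(2)[OF TG[OF that(1)] TG[OF that(2)]] by simp
  moreover have "D (T (f \<bullet>\<^sub>M s)) - T (D (f \<bullet>\<^sub>M s)) = f \<bullet>\<^sub>M (D (T s) - T (D s))" if "f \<in> Cinf A" "s \<in> \<Gamma>" for f s
    unfolding Tf[OF that] Dc(3)[OF that] Dc(3)[OF that(1) TG[OF that(2)]]
      Ta[OF sections_fscale[OF that(1) Dc(1)[OF that(2)]] sections_fscale[OF Dc(4)[OF that(1)] that(2)]]
      Tf[OF that(1) Dc(1)[OF that(2)]] Tf[OF Dc(4)[OF that(1)] that(2)]
    by (simp add: fscale_def fun_eq_iff algebra_simps)
  moreover have "D (T s) - T (D s) \<in> \<Gamma>" if "s \<in> \<Gamma>" for s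
    by (intro subspace_diff[OF subspace_sections] Dc TG that)
  ultimately show ?thesis unfolding bundle_End_def tensorial_def by blast
qed

text \<open>Near x the trace is the sum of c i (T (b i)) for a cut-off frame b with coordinates c.
  Differentiating it produces the derivatives c' i of the coordinates along D. Differentiating the
  frame expansion trades them for D (b i), which turns D T into the commutator. The cut-off is
  stationary at x, so its own derivative does not appear.\<close>

theorem trace_commutator:
  assumes D: "covariant R D" and T: "T \<in> bundle_End"
  shows "trace_End A B (\<lambda>s. D (T s) - T (D s)) = R (trace_End A B T)"
proof
  fix x
  obtain U \<phi> h where t: "(U, \<phi>) \<in> trivs B" "x \<in> U" "cutoff U h" "h x = 1" "\<forall>X\<in>tangent_space A x. X (h * h) = 0"
    using cutoff_exists[of x] by blast
  obtain F where F: "finite F" "fibre B x \<subseteq> span F" using fibre_basis by blast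
  have TG: "\<And>s. s \<in> \<Gamma> \<Longrightarrow> T s \<in> \<Gamma>" and tens: "tensorial T" using T unfolding bundle_End_def by blast+
  note Dc = covariant_section[OF D] covariant_add[OF D] covariant_fscale[OF D] covariant_Cinf[OF D]
  define b where "b i = cut_frame U \<phi> h i" for i
  define c where "c i s = (\<lambda>x. cut_coord U \<phi> h i x (s x))" for i s
  have bG: "b i \<in> \<Gamma>" if "i < r" for i unfolding b_def by (rule cut_frame_section[OF t(1,3) that])
  have cC: "c i s \<in> Cinf A" if "i < r" "s \<in> \<Gamma>" for i s unfolding c_def by (rule cut_coord_smooth[OF t(1,3) that])
  have hh: "h * h \<in> Cinf A" using t(3) Cinf_mult[OF manifold] by (auto simp: cutoff_def)
  have Rhh: "R (h * h) x = 0" using bspec[OF t(5) covariant_tangent[OF D, of x]] by simp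
  have exp: "(h * h) \<bullet>\<^sub>M s = (\<Sum>i<r. c i s \<bullet>\<^sub>M b i)" if "s \<in> \<Gamma>" for s
    unfolding c_def b_def by (rule section_expansion[OF t(1,3) that])
  have cadd: "c i (s + s') = c i s + c i s'" "c i (s - s') = c i s - c i s'" if "s \<in> \<Gamma>" "s' \<in> \<Gamma>" for i s s'
  proof -
    have l: "u \<in> fibre B y \<Longrightarrow> v \<in> fibre B y \<Longrightarrow> cut_coord U \<phi> h i y (u + v) = cut_coord U \<phi> h i y u + cut_coord U \<phi> h i y v"
      "u \<in> fibre B y \<Longrightarrow> cut_coord U \<phi> h i y (a *\<^sub>R u) = a * cut_coord U \<phi> h i y u" for u v a y
      using cut_coord_linear[OF t(1), of y h i] by (simp_all add: linear_between_def)
    have m: "s y \<in> fibre B y" "s' y \<in> fibre B y" "(-1) *\<^sub>R s' y \<in> fibre B y" for y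
      using sections_fibre that subspace_scale[OF subspace_fibre] by blast+
    have "cut_coord U \<phi> h i y (s y + s' y) = cut_coord U \<phi> h i y (s y) + cut_coord U \<phi> h i y (s' y)"
      "cut_coord U \<phi> h i y (s y - s' y) = cut_coord U \<phi> h i y (s y) - cut_coord U \<phi> h i y (s' y)" for y
      using l(1)[OF m(1,2), of y] l(1)[OF m(1,3), of y] l(2)[OF m(2), of y "-1"] by simp_all
    then show "c i (s + s') = c i s + c i s'" "c i (s - s') = c i s - c i s'"
      by (simp_all add: c_def fun_eq_iff)
  qed
  have cf: "c i (f \<bullet>\<^sub>M s) = f * c i s" if "s \<in> \<Gamma>" for i f s
    using cut_coord_linear[OF t(1)] sections_fibre[OF that]
    by (auto simp: c_def fun_eq_iff fscale_def linear_between_def)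
  \<comment> \<open>The dual connection applied to the coordinate functional; the Leibniz terms
    cancel, so it is tensorial.\<close>
  define c' where "c' i s = R (c i s) - c i (D s)" for i s
  have c'_tens: "tensorial (c' i)" if i: "i < r" for i
    unfolding tensorial_def
  proof (intro conjI ballI)
    fix s s' assume s: "s \<in> \<Gamma>" "s' \<in> \<Gamma>"
    have "R (c i s + c i s') = R (c i s) + R (c i s')"
      using covariant_R_add[OF D cC[OF i s(1)] cC[OF i s(2)]] by (simp add: fun_eq_iff)
    then show "c' i (s + s') = c' i s + c' i s'"
      unfolding c'_def cadd(1)[OF s] Dc(2)[OF s] cadd(1)[OF Dc(1)[OF s(1)] Dc(1)[OF s(2)]] by simp
  next
    fix f s assume s: "f \<in> Cinf A" "s \<in> \<Gamma>"
    have "R (f * c i s) = f * R (c i s) + c i s * R f"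
      using covariant_R_mult[OF D s(1) cC[OF i s(2)]] by (simp add: fun_eq_iff)
    then show "c' i (f \<bullet>\<^sub>M s) = f \<bullet>\<^sub>M c' i s"
      unfolding c'_def cf[OF s(2)] Dc(3)[OF s] cadd(1)[OF sections_fscale[OF s(1) Dc(1)[OF s(2)]] sections_fscale[OF Dc(4)[OF s(1)] s(2)]]
        cf[OF Dc(1)[OF s(2)]]
      by (simp add: fun_eq_iff fscale_def algebra_simps)
  qed
  \<comment> \<open>The derivative at x of the expansion of s in the frame: the sum of c' i times b
    i and c i times D (b i) is zero.\<close>
  have zero: "(\<Sum>i<r. at_fibre (c' i) x (s x) *\<^sub>R b i x) + (\<Sum>i<r. cut_coord U \<phi> h i x (s x) *\<^sub>R D (b i) x) = 0"
    if s: "s \<in> \<Gamma>" for s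
  proof -
    have "D ((h * h) \<bullet>\<^sub>M s) x = D s x"
      unfolding Dc(3)[OF hh s] using t(4) Rhh by (simp add: fscale_def)
    moreover have "D ((h * h) \<bullet>\<^sub>M s) = (\<Sum>i<r. D (c i s \<bullet>\<^sub>M b i))"
      unfolding exp[OF s] by (intro covariant_sum[OF D] sections_fscale cC bG s) auto
    moreover have "(\<Sum>i<r. D (c i s \<bullet>\<^sub>M b i)) = (\<Sum>i<r. c i s \<bullet>\<^sub>M D (b i) + R (c i s) \<bullet>\<^sub>M b i)"
      by (intro sum.cong refl Dc(3) cC bG s) auto
    moreover have "D s x = (\<Sum>i<r. c i (D s) x *\<^sub>R b i x)"
      using fun_cong[OF exp[OF Dc(1)[OF s]], of x] t(4) by (simp add: fscale_def sum_apply)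
    ultimately have "(\<Sum>i<r. c i (D s) x *\<^sub>R b i x) = (\<Sum>i<r. c i s x *\<^sub>R D (b i) x + R (c i s) x *\<^sub>R b i x)"
      by (simp add: fscale_def sum_apply)
    then have "(\<Sum>i<r. c' i s x *\<^sub>R b i x) + (\<Sum>i<r. c i s x *\<^sub>R D (b i) x) = 0"
      by (simp add: c'_def sum.distrib sum_subtractf scaleR_diff_left)
    then show ?thesis using at_fibre_eval[OF c'_tens s, of _ x] by (simp add: c_def)
  qed
  have tz: "trace_on (fibre B x) (\<lambda>v. 0) = 0"
    using trace_on_rank_sum[OF subspace_fibre F, of "{}" "\<lambda>i v. 0" "\<lambda>i. 0"] by simp
  have lc': "linear_between (fibre B x) UNIV (at_fibre (c' i) x)" if "i < r" for i
    by (rule at_fibre_linear[OF c'_tens[OF that]]) simp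
  have lc: "linear_between (fibre B x) UNIV (cut_coord U \<phi> h i x)" for i by (rule cut_coord_linear[OF t(1)])
  have TDb: "T (D (b i)) \<in> \<Gamma>" "T (b i) \<in> \<Gamma>" if "i < r" for i using TG Dc(1) bG[OF that] by blast+
  have inV: "(\<Sum>i<r. a i *\<^sub>R u i) \<in> fibre B x" if "\<And>i. i < r \<Longrightarrow> u i \<in> fibre B x" for a :: "nat \<Rightarrow> real" and u
    using that by (intro subspace_sum[OF subspace_fibre] subspace_scale[OF subspace_fibre]) auto
  \<comment> \<open>Applying T to the preceding identity and taking the trace contracts it to
    scalars.\<close>
  have "0 = trace_on (fibre B x) (\<lambda>v. (\<Sum>i<r. at_fibre (c' i) x v *\<^sub>R T (b i) x) + (\<Sum>i<r. cut_coord U \<phi> h i x v *\<^sub>R T (D (b i)) x))"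
    unfolding tz[symmetric]
  proof (rule trace_on_cong[OF subspace_fibre F, symmetric])
    fix v assume "v \<in> fibre B x"
    then obtain s where s: "s \<in> \<Gamma>" "s x = v" using section_through by blast
    have lT: "linear_between (fibre B x) (fibre B x) (at_fibre T x)" by (rule at_fibre_End[OF T])
    have mem: "b i x \<in> fibre B x" "D (b i) x \<in> fibre B x" if "i < r" for i
      using sections_fibre bG[OF that] Dc(1) by blast+
    have e: "at_fibre T x (\<Sum>i<r. a i *\<^sub>R u i x) = (\<Sum>i<r. a i *\<^sub>R T (u i) x)"
      if "\<And>i. i < r \<Longrightarrow> u i \<in> \<Gamma>" for a :: "nat \<Rightarrow> real" and u
    proof -
      have "at_fibre T x (\<Sum>i<r. a i *\<^sub>R u i x) = (\<Sum>i<r. at_fibre T x (a i *\<^sub>R u i x))"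
        by (rule linear_between_sum[OF subspace_fibre lT]) (use that sections_fibre subspace_scale[OF subspace_fibre] in auto)
      also have "\<dots> = (\<Sum>i<r. a i *\<^sub>R T (u i) x)"
        using lT sections_fibre that at_fibre_eval[OF tens] by (intro sum.cong) (auto simp: linear_between_def)
      finally show ?thesis .
    qed
    have "(\<Sum>i<r. at_fibre (c' i) x v *\<^sub>R T (b i) x) + (\<Sum>i<r. cut_coord U \<phi> h i x v *\<^sub>R T (D (b i)) x)
      = at_fibre T x (\<Sum>i<r. at_fibre (c' i) x v *\<^sub>R b i x) + at_fibre T x (\<Sum>i<r. cut_coord U \<phi> h i x v *\<^sub>R D (b i) x)"
      using e[of b] e[of "\<lambda>i. D (b i)"] bG Dc(1) by simp
    also have "\<dots> = at_fibre T x ((\<Sum>i<r. at_fibre (c' i) x v *\<^sub>R b i x) + (\<Sum>i<r. cut_coord U \<phi> h i x v *\<^sub>R D (b i) x))"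
      using lT inV mem unfolding linear_between_def by simp
    also have "\<dots> = 0"
      using zero[OF s(1)] linear_between_0[OF subspace_fibre lT] s(2) by simp
    finally show "(\<Sum>i<r. at_fibre (c' i) x v *\<^sub>R T (b i) x) + (\<Sum>i<r. cut_coord U \<phi> h i x v *\<^sub>R T (D (b i)) x) = 0" .
  qed
  also have "\<dots> = trace_on (fibre B x) (\<lambda>v. \<Sum>i<r. at_fibre (c' i) x v *\<^sub>R T (b i) x)
      + trace_on (fibre B x) (\<lambda>v. \<Sum>i<r. cut_coord U \<phi> h i x v *\<^sub>R T (D (b i)) x)"
    by (rule trace_on_add[OF subspace_fibre F]) (use inV TDb sections_fibre in auto)
  also have "\<dots> = (\<Sum>i<r. at_fibre (c' i) x (T (b i) x)) + (\<Sum>i<r. cut_coord U \<phi> h i x (T (D (b i)) x))"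
    using trace_on_rank_sum[OF subspace_fibre F, of "{..<r}" "\<lambda>i. at_fibre (c' i) x" "\<lambda>i. T (b i) x"]
      trace_on_rank_sum[OF subspace_fibre F, of "{..<r}" "\<lambda>i. cut_coord U \<phi> h i x" "\<lambda>i. T (D (b i)) x"]
      lc lc' TDb sections_fibre by simp
  finally have key: "(\<Sum>i<r. c' i (T (b i)) x) + (\<Sum>i<r. c i (T (D (b i))) x) = 0"
    using at_fibre_eval[OF c'_tens TDb(2), of _ _ x] by (simp add: c_def)
  let ?t = "trace_End A B T"
  have tC: "?t \<in> Cinf A" by (rule trace_End_smooth[OF T])
  have "(h * h) * ?t = (\<Sum>i<r. c i (T (b i)))"
    using trace_End_cut[OF t(1,3) T] by (simp add: fun_eq_iff c_def b_def sum_apply power2_eq_square)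
  then have "R ((h * h) * ?t) x = (\<Sum>i<r. R (c i (T (b i))) x)"
    using covariant_R_sum[OF D, of "{..<r}" "\<lambda>i. c i (T (b i))" x] cC TDb by simp
  moreover have "R ((h * h) * ?t) x = R ?t x"
    using covariant_R_mult[OF D hh tC, of x] Rhh t(4) by simp
  ultimately have "R ?t x = (\<Sum>i<r. c' i (T (b i)) x + c i (D (T (b i))) x)"
    by (simp add: c'_def)
  also have "\<dots> = (\<Sum>i<r. c i (D (T (b i)) - T (D (b i))) x)"
    using key cadd(2)[OF Dc(1)[OF TDb(2)] TDb(1)] by (simp add: sum.distrib sum_subtractf)
  also have "\<dots> = trace_End A B (\<lambda>s. D (T s) - T (D s)) x"
    using trace_End_cut[OF t(1,3) commutator_End[OF D T], of x] t(4) by (simp add: c_def b_def)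
  finally show "trace_End A B (\<lambda>s. D (T s) - T (D s)) x = R ?t x" by simp
qed

end

section \<open>Smooth inverses of matrices of functions\<close>

definition matrix_of :: "nat \<Rightarrow> (nat \<Rightarrow> nat \<Rightarrow> real) \<Rightarrow> real Matrix.mat" where
  "matrix_of n G = Matrix.mat n n (\<lambda>(i, j). G i j)"

text \<open>Cramer's rule: the entries of the inverse are rational in those of G, so smoothness is
  visible. Matrices of variable size are used because the rank is a number and not a type.\<close>

definition inverse_entry :: "nat \<Rightarrow> (nat \<Rightarrow> nat \<Rightarrow> real) \<Rightarrow> nat \<Rightarrow> nat \<Rightarrow> real" where
  "inverse_entry n G i j = inverse (Determinant.det (matrix_of n G)) * adj_mat (matrix_of n G) $$ (i, j)"

lemma inverse_entry:
  assumes "Determinant.det (matrix_of n G) \<noteq> 0" "i < n" "k < n"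
  shows "(\<Sum>j<n. G i j * inverse_entry n G j k) = (if i = k then 1 else 0)"
    "(\<Sum>j<n. inverse_entry n G i j * G j k) = (if i = k then 1 else 0)"
proof -
  let ?M = "matrix_of n G"
  have M: "?M \<in> carrier_mat n n" by (simp add: matrix_of_def)
  note adj = adj_mat[OF M]
  have "(?M * adj_mat ?M) $$ (i, k) = (\<Sum>j<n. G i j * adj_mat ?M $$ (j, k))"
    "(adj_mat ?M * ?M) $$ (i, k) = (\<Sum>j<n. adj_mat ?M $$ (i, j) * G j k)"
    using assms(2,3) M adj(1) by (auto simp: times_mat_def scalar_prod_def matrix_of_def atLeast0LessThan intro!: sum.cong)
  then have "(\<Sum>j<n. G i j * adj_mat ?M $$ (j, k)) = Determinant.det ?M * (if i = k then 1 else 0)"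
    "(\<Sum>j<n. adj_mat ?M $$ (i, j) * G j k) = Determinant.det ?M * (if i = k then 1 else 0)"
    unfolding adj(2,3) using assms(2,3) by simp_all
  moreover have "(\<Sum>j<n. G i j * inverse_entry n G j k) = inverse (Determinant.det ?M) * (\<Sum>j<n. G i j * adj_mat ?M $$ (j, k))"
    "(\<Sum>j<n. inverse_entry n G i j * G j k) = inverse (Determinant.det ?M) * (\<Sum>j<n. adj_mat ?M $$ (i, j) * G j k)"
    by (simp_all add: inverse_entry_def sum_distrib_left mult_ac)
  ultimately show "(\<Sum>j<n. G i j * inverse_entry n G j k) = (if i = k then 1 else 0)"
    "(\<Sum>j<n. inverse_entry n G i j * G j k) = (if i = k then 1 else 0)"
    using assms(1) by simp_all
qed

lemma det_matrix_of_nonzero: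
  assumes "\<And>c. (\<And>i. i < n \<Longrightarrow> (\<Sum>j<n. G i j * c j) = 0) \<Longrightarrow> (\<And>j. j < n \<Longrightarrow> c j = 0)"
  shows "Determinant.det (matrix_of n G) \<noteq> 0"
proof
  have M: "matrix_of n G \<in> carrier_mat n n" by (simp add: matrix_of_def)
  assume "Determinant.det (matrix_of n G) = 0"
  then obtain v where v: "v \<in> carrier_vec n" "v \<noteq> 0\<^sub>v n" "matrix_of n G *\<^sub>v v = 0\<^sub>v n"
    using det_0_iff_vec_prod_zero[OF M] by blast
  have "(\<Sum>j<n. G i j * (v $ j)) = 0" if "i < n" for i
  proof -
    have "(matrix_of n G *\<^sub>v v) $ i = (\<Sum>j<n. G i j * (v $ j))"
      using that v(1) by (auto simp: mult_mat_vec_def scalar_prod_def matrix_of_def atLeast0LessThan intro!: sum.cong)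
    then show ?thesis using v(3) that by simp
  qed
  then have "v $ j = 0" if "j < n" for j using assms that by blast
  then have "v = 0\<^sub>v n" using v(1) by (intro eq_vecI) auto
  then show False using v(2) by simp
qed

context smooth_bundle
begin

lemma smooth_det:
  assumes "open W" "\<And>i j. i < n \<Longrightarrow> j < n \<Longrightarrow> smooth_fun_on A W (\<lambda>x. G x i j)"
  shows "smooth_fun_on A W (\<lambda>x. Determinant.det (matrix_of n (G x)))"
proof -
  have "Determinant.det (matrix_of n (G x)) = (\<Sum>p\<in>{p. p permutes {0..<n}}. of_int (sign p) * (\<Prod>i\<in>{0..<n}. G x i (p i)))" for x
  proof -
    have "(\<Prod>i = 0..<n. matrix_of n (G x) $$ (i, p i)) = (\<Prod>i\<in>{0..<n}. G x i (p i))" if "p permutes {0..<n}" for p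
      using permutes_in_image[OF that] by (intro prod.cong) (auto simp: matrix_of_def)
    then show ?thesis by (auto simp: Determinant.det_def matrix_of_def intro!: sum.cong)
  qed
  moreover have "smooth_fun_on A W (\<lambda>x. \<Sum>p\<in>{p. p permutes {0..<n}}. of_int (sign p) * (\<Prod>i\<in>{0..<n}. G x i (p i)))"
  proof (intro smooth_fun_on_sum[OF manifold assms(1)] smooth_fun_on_mult[OF manifold assms(1)]
      smooth_fun_on_prod[OF manifold assms(1)] smooth_fun_on_const[OF manifold])
    fix p i assume "p \<in> {p. p permutes {0..<n}}" "i \<in> {0..<n}"
    then show "smooth_fun_on A W (\<lambda>x. G x i (p i))"
      using permutes_in_image[of p "{0..<n}" i] by (intro assms(2)) auto
  qed
  ultimately show ?thesis by presburger
qed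

lemma smooth_inverse_entry:
  assumes "open W" "\<And>i j. i < n \<Longrightarrow> j < n \<Longrightarrow> smooth_fun_on A W (\<lambda>x. G x i j)"
    and "\<And>x. x \<in> W \<Longrightarrow> Determinant.det (matrix_of n (G x)) \<noteq> 0" and ij: "i < n" "j < n"
  shows "smooth_fun_on A W (\<lambda>x. inverse_entry n (G x) i j)"
proof -
  \<comment> \<open>The minor omits row j and column i, since the adjugate transposes the
    cofactors.\<close>
  define H where "H x i' j' = G x (if i' < j then i' else Suc i') (if j' < i then j' else Suc j')" for x i' j'
  have adj: "adj_mat (matrix_of n (G x)) $$ (i, j) = (-1) ^ (j + i) * Determinant.det (matrix_of (n - 1) (H x))" for x
  proof -
    have "mat_delete (matrix_of n (G x)) j i = matrix_of (n - 1) (H x)"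
      using ij by (intro eq_matI) (auto simp: mat_delete_def matrix_of_def H_def)
    then show ?thesis using ij by (simp add: adj_mat_def matrix_of_def[of n] cofactor_def)
  qed
  show ?thesis
    unfolding inverse_entry_def adj
    by (intro smooth_fun_on_mult[OF manifold assms(1)] smooth_fun_on_inverse[OF manifold assms(1)] smooth_det
        smooth_fun_on_const[OF manifold] assms)
      (auto simp: H_def intro!: assms(2))
qed

end

section \<open>Bundle metrics and conjugate connections\<close>

locale metric_bundle = smooth_bundle A B
  for A :: "('m::{t2_space,second_countable_topology}, 'd::real_inner) chart set"
    and B :: "('m, 'b::real_vector) vbundle" +
  fixes g :: "'m \<Rightarrow> 'b \<Rightarrow> 'b \<Rightarrow> real"
  assumes metric: "bundle_metric A B g"
begin

lemma g_linear: "u \<in> fibre B x \<Longrightarrow> linear_between (fibre B x) UNIV (g x u)"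
  and g_sym: "u \<in> fibre B x \<Longrightarrow> v \<in> fibre B x \<Longrightarrow> g x u v = g x v u"
  and g_nondegenerate: "u \<in> fibre B x \<Longrightarrow> (\<And>v. v \<in> fibre B x \<Longrightarrow> g x u v = 0) \<Longrightarrow> u = 0"
  and g_smooth: "s \<in> \<Gamma> \<Longrightarrow> t \<in> \<Gamma> \<Longrightarrow> (\<lambda>x. g x (s x) (t x)) \<in> Cinf A"
proof -
  note m = metric[unfolded bundle_metric_def]
  show "u \<in> fibre B x \<Longrightarrow> linear_between (fibre B x) UNIV (g x u)"
    "u \<in> fibre B x \<Longrightarrow> v \<in> fibre B x \<Longrightarrow> g x u v = g x v u"
    "s \<in> \<Gamma> \<Longrightarrow> t \<in> \<Gamma> \<Longrightarrow> (\<lambda>x. g x (s x) (t x)) \<in> Cinf A"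
    using m by simp_all
  show "u = 0" if "u \<in> fibre B x" "\<And>v. v \<in> fibre B x \<Longrightarrow> g x u v = 0"
    using m that by auto
qed

lemma g_simps:
  assumes "u \<in> fibre B x" "v \<in> fibre B x" "w \<in> fibre B x"
  shows "g x u (v + w) = g x u v + g x u w" "g x (v + w) u = g x v u + g x w u"
    "g x u (c *\<^sub>R v) = c * g x u v" "g x (c *\<^sub>R v) u = c * g x v u"
    "g x u (v - w) = g x u v - g x u w" "g x (v - w) u = g x v u - g x w u"
proof -
  note V = subspace_fibre[of x]
  have s: "v + w \<in> fibre B x" "c *\<^sub>R v \<in> fibre B x" "v - w \<in> fibre B x" "(-1) *\<^sub>R w \<in> fibre B x"
    using assms subspace_add[OF V] subspace_scale[OF V] subspace_diff[OF V] by blast+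
  have l: "g x u (a + b) = g x u a + g x u b" "g x u (c *\<^sub>R a) = c * g x u a"
    if "a \<in> fibre B x" "b \<in> fibre B x" for a b c
    using g_linear[OF assms(1)] that unfolding linear_between_def by auto
  show 1: "g x u (v + w) = g x u v + g x u w" "g x u (c *\<^sub>R v) = c * g x u v" using l assms by auto
  show 2: "g x u (v - w) = g x u v - g x u w" using l(1)[OF assms(2) s(4)] l(2)[OF assms(3,3), of "-1"] by simp
  show "g x (v + w) u = g x v u + g x w u" "g x (c *\<^sub>R v) u = c * g x v u" "g x (v - w) u = g x v u - g x w u"
    using 1 2 g_sym[OF _ assms(1)] s assms by auto
qed

lemma g_sum:
  assumes "u \<in> fibre B x" "\<And>i. i \<in> I \<Longrightarrow> v i \<in> fibre B x"
  shows "g x u (\<Sum>i\<in>I. a i *\<^sub>R v i) = (\<Sum>i\<in>I. a i * g x u (v i))"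
proof -
  have "g x u (\<Sum>i\<in>I. a i *\<^sub>R v i) = (\<Sum>i\<in>I. g x u (a i *\<^sub>R v i))"
    by (rule linear_between_sum[OF subspace_fibre g_linear[OF assms(1)]]) (use assms(2) subspace_scale[OF subspace_fibre] in auto)
  then show ?thesis using g_linear[OF assms(1)] assms(2) by (simp add: linear_between_def)
qed

definition gram :: "('m \<Rightarrow> 'b \<Rightarrow> nat \<Rightarrow> real) \<Rightarrow> 'm \<Rightarrow> nat \<Rightarrow> nat \<Rightarrow> real" where
  "gram \<phi> x i j = g x (frame_vec \<phi> i x) (frame_vec \<phi> j x)"

text \<open>A kernel vector of the Gram matrix gives a combination of frame vectors orthogonal to
  the whole fibre, hence 0; reading off coordinates shows that its coefficients vanish.\<close>

lemma gram_nonsingular: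
  assumes U: "(U, \<phi>) \<in> trivs B" "x \<in> U"
  shows "Determinant.det (matrix_of r (gram \<phi> x)) \<noteq> 0"
proof (rule det_matrix_of_nonzero)
  fix c j assume c: "\<And>i. i < r \<Longrightarrow> (\<Sum>j<r. gram \<phi> x i j * c j) = 0" and j: "j < r"
  note f = frame_vec(1)[OF U]
  define w where "w = (\<Sum>j<r. c j *\<^sub>R frame_vec \<phi> j x)"
  have w: "w \<in> fibre B x" unfolding w_def using f by (intro subspace_sum[OF subspace_fibre] subspace_scale[OF subspace_fibre]) auto
  have fw: "g x (frame_vec \<phi> i x) w = 0" if "i < r" for i
  proof -
    have "g x (frame_vec \<phi> i x) w = (\<Sum>j<r. c j * g x (frame_vec \<phi> i x) (frame_vec \<phi> j x))"
      unfolding w_def by (rule g_sum) (use f that in auto)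
    then show ?thesis using c[OF that] by (simp add: gram_def mult.commute)
  qed
  have "w = 0"
  proof (rule g_nondegenerate[OF w])
    fix v assume v: "v \<in> fibre B x"
    have "g x w v = g x w (\<Sum>i<r. \<phi> x v i *\<^sub>R frame_vec \<phi> i x)" using frame_expansion[OF U v] by simp
    also have "\<dots> = (\<Sum>i<r. \<phi> x v i * g x w (frame_vec \<phi> i x))" using f by (intro g_sum[OF w]) auto
    also have "\<dots> = 0" using fw g_sym[OF w f] by (intro sum.neutral) auto
    finally show "g x w v = 0" .
  qed
  moreover have "\<phi> x w j = (\<Sum>i<r. c i * \<phi> x (frame_vec \<phi> i x) j)"
  proof -
    have "\<phi> x w = (\<Sum>i<r. \<phi> x (c i *\<^sub>R frame_vec \<phi> i x))"
      unfolding w_def by (rule linear_between_sum[OF subspace_fibre triv_facts(2)[OF U]])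
        (use f subspace_scale[OF subspace_fibre] in auto)
    then show ?thesis using f by (simp add: sum_apply triv_scale[OF U])
  qed
  moreover have "(\<Sum>i<r. c i * \<phi> x (frame_vec \<phi> i x) j) = (\<Sum>i<r. if j = i then c i else 0)"
    using frame_vec(2)[OF U] by (intro sum.cong) auto
  ultimately show "c j = 0" using triv_zero[OF U] j by simp
qed

text \<open>Raising an index with the inverse Gram matrix; the formula carries smoothness from the
  functional paired with w to the coordinates of w.\<close>

lemma musical_coordinates:
  assumes U: "(U, \<phi>) \<in> trivs B" "x \<in> U" and w: "w \<in> fibre B x" and i: "i < r"
  shows "\<phi> x w i = (\<Sum>k<r. inverse_entry r (gram \<phi> x) i k * g x w (frame_vec \<phi> k x))"
proof -
  note f = frame_vec(1)[OF U]
  have "g x w (frame_vec \<phi> k x) = (\<Sum>j<r. gram \<phi> x k j * \<phi> x w j)" if k: "k < r" for k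
  proof -
    have "g x w (frame_vec \<phi> k x) = g x (frame_vec \<phi> k x) (\<Sum>j<r. \<phi> x w j *\<^sub>R frame_vec \<phi> j x)"
      using frame_expansion[OF U w] g_sym[OF w f[OF k]] by simp
    also have "\<dots> = (\<Sum>j<r. \<phi> x w j * g x (frame_vec \<phi> k x) (frame_vec \<phi> j x))"
      using f by (intro g_sum f k) auto
    finally show ?thesis by (simp add: gram_def mult.commute)
  qed
  then have "(\<Sum>k<r. inverse_entry r (gram \<phi> x) i k * g x w (frame_vec \<phi> k x)) =
      (\<Sum>k<r. \<Sum>j<r. inverse_entry r (gram \<phi> x) i k * gram \<phi> x k j * \<phi> x w j)"
    by (simp add: sum_distrib_left mult.assoc)
  also have "\<dots> = (\<Sum>j<r. (\<Sum>k<r. inverse_entry r (gram \<phi> x) i k * gram \<phi> x k j) * \<phi> x w j)"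
    by (subst sum.swap) (simp add: sum_distrib_right)
  also have "\<dots> = (\<Sum>j<r. if i = j then \<phi> x w j else 0)"
    using inverse_entry(2)[OF gram_nonsingular[OF U] i] by (intro sum.cong) auto
  finally show ?thesis using i by simp
qed

lemma musical_exists:
  assumes a: "linear_between (fibre B x) UNIV a"
  shows "\<exists>w\<in>fibre B x. \<forall>v\<in>fibre B x. g x w v = a v"
proof -
  obtain U \<phi> where U: "(U, \<phi>) \<in> trivs B" "x \<in> U" by (rule triv_at)
  note f = frame_vec(1)[OF U]
  define c where "c j = (\<Sum>k<r. inverse_entry r (gram \<phi> x) j k * a (frame_vec \<phi> k x))" for j
  define w where "w = (\<Sum>j<r. c j *\<^sub>R frame_vec \<phi> j x)"
  have w: "w \<in> fibre B x" unfolding w_def using f by (intro subspace_sum[OF subspace_fibre] subspace_scale[OF subspace_fibre]) auto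
  have fw: "g x w (frame_vec \<phi> i x) = a (frame_vec \<phi> i x)" if i: "i < r" for i
  proof -
    have "g x w (frame_vec \<phi> i x) = (\<Sum>j<r. gram \<phi> x i j * c j)"
    proof -
      have "g x (frame_vec \<phi> i x) w = (\<Sum>j<r. c j * g x (frame_vec \<phi> i x) (frame_vec \<phi> j x))"
        unfolding w_def by (rule g_sum) (use f i in auto)
      then show ?thesis using g_sym[OF w f[OF i]] by (simp add: gram_def mult.commute)
    qed
    also have "\<dots> = (\<Sum>j<r. \<Sum>k<r. gram \<phi> x i j * inverse_entry r (gram \<phi> x) j k * a (frame_vec \<phi> k x))"
      by (simp add: c_def sum_distrib_left mult.assoc)
    also have "\<dots> = (\<Sum>k<r. (\<Sum>j<r. gram \<phi> x i j * inverse_entry r (gram \<phi> x) j k) * a (frame_vec \<phi> k x))"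
      by (subst sum.swap) (simp add: sum_distrib_right)
    also have "\<dots> = (\<Sum>k<r. if i = k then a (frame_vec \<phi> k x) else 0)"
      using inverse_entry(1)[OF gram_nonsingular[OF U] i] by (intro sum.cong) auto
    finally show ?thesis using i by simp
  qed
  have "g x w v = a v" if v: "v \<in> fibre B x" for v
  proof -
    have "a v = a (\<Sum>i<r. \<phi> x v i *\<^sub>R frame_vec \<phi> i x)" using frame_expansion[OF U v] by simp
    also have "\<dots> = (\<Sum>i<r. a (\<phi> x v i *\<^sub>R frame_vec \<phi> i x))"
      by (rule linear_between_sum[OF subspace_fibre a]) (use f subspace_scale[OF subspace_fibre] in auto)
    also have "\<dots> = (\<Sum>i<r. \<phi> x v i * a (frame_vec \<phi> i x))" using a f by (simp add: linear_between_def)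
    also have "\<dots> = (\<Sum>i<r. \<phi> x v i * g x w (frame_vec \<phi> i x))" using fw by simp
    also have "\<dots> = g x w v" using g_sum[OF w, of "{..<r}" "\<lambda>i. frame_vec \<phi> i x" "\<phi> x v"] f frame_expansion[OF U v] by simp
    finally show ?thesis by simp
  qed
  then show ?thesis using w by blast
qed

lemma cutoff_in:
  assumes "(U, \<phi>) \<in> trivs B" "x \<in> U" shows "\<exists>h. cutoff U h \<and> h x = 1"
  unfolding cutoff_def using bump_function[OF manifold triv_facts(1)[OF assms(1)] assms(2)] by metis

text \<open>Each fibre has a unique representing vector by nondegeneracy. Its coordinates are the
  inverse Gram matrix applied to the values of the functional on the frame, and Cramer's rule makes
  them smooth.\<close>

lemma riesz:
  assumes lam: "tensorial lam" and lamC: "\<And>s. s \<in> \<Gamma> \<Longrightarrow> lam s \<in> Cinf A"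
  shows "\<exists>c\<in>\<Gamma>. \<forall>s\<in>\<Gamma>. (\<lambda>x. g x (c x) (s x)) = lam s"
proof -
  have "\<exists>w. w \<in> fibre B x \<and> (\<forall>v\<in>fibre B x. g x w v = at_fibre lam x v)" for x
    using musical_exists[OF at_fibre_linear[OF lam UNIV_I]] by blast
  then obtain c where c: "\<And>x. c x \<in> fibre B x" "\<And>x v. v \<in> fibre B x \<Longrightarrow> g x (c x) v = at_fibre lam x v" by metis
  have "c \<in> \<Gamma>"
  proof (rule sectionsI)
    show "c x \<in> fibre B x" for x by (rule c(1))
    fix U \<phi> i assume U: "(U, \<phi>) \<in> trivs B" and i: "i < r"
    show "smooth_fun_on A U (\<lambda>x. \<phi> x (c x) i)"
    proof (rule smooth_fun_on_local[OF manifold triv_facts(1)[OF U]])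
      fix x assume x: "x \<in> U"
      obtain h where h: "cutoff U h" "h x = 1" using cutoff_in[OF U x] by blast
      have hC: "h \<in> Cinf A" using h(1) by (simp add: cutoff_def)
      have hh: "h * h \<in> Cinf A" by (rule Cinf_mult[OF manifold hC hC])
      let ?N = "{x. (h * h) x \<noteq> 0}"
      have oU: "open U" by (rule triv_facts(1)[OF U])
      have oN: "open (U \<inter> ?N)" using oU open_nonzero[OF hh] by blast
      \<comment> \<open>The frame is only local, but its pairings times the squared cut-off are
        pairings of global sections; dividing by that square gives smoothness near x.\<close>
      have G: "smooth_fun_on A (U \<inter> ?N) (\<lambda>x. gram \<phi> x j k)" if "j < r" "k < r" for j k
      proof (rule smooth_divide[OF hh _ oU])
        show "smooth_fun_on A U (\<lambda>x. g x (cut_frame U \<phi> h j x) (cut_frame U \<phi> h k x))"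
          by (rule Cinf_smooth_on[OF manifold g_smooth[OF cut_frame_section[OF U h(1) that(1)] cut_frame_section[OF U h(1) that(2)]]])
        fix y assume y: "y \<in> U"
        have "frame_vec \<phi> j y \<in> fibre B y" "frame_vec \<phi> k y \<in> fibre B y" using frame_vec(1)[OF U y] that by auto
        then show "(h * h) y * gram \<phi> y j k = g y (cut_frame U \<phi> h j y) (cut_frame U \<phi> h k y)"
          using y subspace_scale[OF subspace_fibre] by (simp add: cut_frame_def gram_def g_simps)
      qed
      have a: "smooth_fun_on A (U \<inter> ?N) (\<lambda>x. at_fibre lam x (frame_vec \<phi> k x))" if k: "k < r" for k
      proof -
        have sec: "cut_frame U \<phi> h k \<in> \<Gamma>" by (rule cut_frame_section[OF U h(1) k])
        have "smooth_fun_on A (U \<inter> ?N) (\<lambda>x. at_fibre lam x (frame_vec \<phi> k x))"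
        proof (rule smooth_divide[OF hh _ oU])
          show "smooth_fun_on A U (\<lambda>x. h x * lam (cut_frame U \<phi> h k) x)"
            by (intro smooth_fun_on_mult[OF manifold oU] Cinf_smooth_on[OF manifold] hC lamC sec)
          fix y assume y: "y \<in> U"
          have "lam (cut_frame U \<phi> h k) y = at_fibre lam y (h y *\<^sub>R frame_vec \<phi> k y)"
            using at_fibre_eval[OF lam sec, of y] y by (simp add: cut_frame_def)
          then show "(h * h) y * at_fibre lam y (frame_vec \<phi> k y) = h y * lam (cut_frame U \<phi> h k) y"
            using at_fibre_linear[OF lam UNIV_I, of y] frame_vec(1)[OF U y k] by (simp add: linear_between_def)
        qed
        then show ?thesis .
      qed
      have "smooth_fun_on A (U \<inter> ?N) (\<lambda>x. \<Sum>k<r. inverse_entry r (gram \<phi> x) i k * at_fibre lam x (frame_vec \<phi> k x))"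
        by (intro smooth_fun_on_sum[OF manifold oN] smooth_fun_on_mult[OF manifold oN] smooth_inverse_entry[OF oN])
          (use G a gram_nonsingular[OF U] i in auto)
      then have "smooth_fun_on A (U \<inter> ?N) (\<lambda>x. \<phi> x (c x) i)"
        by (rule smooth_fun_on_cong[OF manifold oN, rotated])
          (use musical_coordinates[OF U _ c(1) i] c(2) frame_vec(1)[OF U] in auto)
      then show "\<exists>N. open N \<and> x \<in> N \<and> smooth_fun_on A (U \<inter> N) (\<lambda>x. \<phi> x (c x) i)"
        using open_nonzero[OF hh] h(2) by (intro exI[of _ ?N]) auto
    qed
  qed
  moreover have "(\<lambda>x. g x (c x) (s x)) = lam s" if "s \<in> \<Gamma>" for s
    using c(2)[OF sections_fibre[OF that]] at_fibre_eval[OF lam that] by auto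
  ultimately show ?thesis by blast
qed

lemma section_eqI:
  assumes "c \<in> \<Gamma>" "c' \<in> \<Gamma>" "\<And>s. s \<in> \<Gamma> \<Longrightarrow> (\<lambda>x. g x (c x) (s x)) = (\<lambda>x. g x (c' x) (s x))"
  shows "c = c'"
proof
  fix x
  have "c x - c' x = 0"
  proof (rule g_nondegenerate[of _ x])
    show "c x - c' x \<in> fibre B x" using assms sections_fibre subspace_diff[OF subspace_fibre] by blast
    fix v assume v: "v \<in> fibre B x"
    then obtain s where s: "s \<in> \<Gamma>" "s x = v" using section_through by blast
    have "g x (c x) v = g x (c' x) v" using fun_cong[OF assms(3)[OF s(1)], of x] s(2) by simp
    then show "g x (c x - c' x) v = 0" using g_simps(6)[OF v sections_fibre[OF assms(1)] sections_fibre[OF assms(2)]] by simp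
  qed
  then show "c x = c' x" by simp
qed

definition conj_op :: "(('m \<Rightarrow> real) \<Rightarrow> 'm \<Rightarrow> real) \<Rightarrow> (('m \<Rightarrow> 'b) \<Rightarrow> 'm \<Rightarrow> 'b) \<Rightarrow> ('m \<Rightarrow> 'b) \<Rightarrow> 'm \<Rightarrow> 'b" where
  "conj_op R D s = (THE c. c \<in> \<Gamma> \<and>
     (\<forall>t\<in>\<Gamma>. R (\<lambda>x. g x (s x) (t x)) = (\<lambda>x. g x (c x) (t x)) + (\<lambda>x. g x (s x) (D t x))))"

lemma conj_op_unique:
  assumes D: "covariant R D" and s: "s \<in> \<Gamma>" and c: "c \<in> \<Gamma>"
    "\<And>t. t \<in> \<Gamma> \<Longrightarrow> R (\<lambda>x. g x (s x) (t x)) = (\<lambda>x. g x (c x) (t x)) + (\<lambda>x. g x (s x) (D t x))"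
  shows "conj_op R D s = c"
  unfolding conj_op_def
proof (rule the_equality)
  show "c \<in> \<Gamma> \<and> (\<forall>t\<in>\<Gamma>. R (\<lambda>x. g x (s x) (t x)) = (\<lambda>x. g x (c x) (t x)) + (\<lambda>x. g x (s x) (D t x)))" using c by blast
  fix c' assume c': "c' \<in> \<Gamma> \<and> (\<forall>t\<in>\<Gamma>. R (\<lambda>x. g x (s x) (t x)) = (\<lambda>x. g x (c' x) (t x)) + (\<lambda>x. g x (s x) (D t x)))"
  show "c' = c"
  proof (rule section_eqI)
    fix t assume t: "t \<in> \<Gamma>"
    show "(\<lambda>x. g x (c' x) (t x)) = (\<lambda>x. g x (c x) (t x))"
      using c(2)[OF t] c' t by (metis add_right_cancel)
  qed (use c c' in auto)
qed

text \<open>The difference between R of the pairing of s and t and the pairing of s with D t is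
  linear over smooth functions in t, because the two Leibniz terms cancel; the representing section
  exists by \<open>riesz\<close>.\<close>

lemma conj_op_spec:
  assumes D: "covariant R D" and s: "s \<in> \<Gamma>"
  shows "conj_op R D s \<in> \<Gamma>"
    "t \<in> \<Gamma> \<Longrightarrow> R (\<lambda>x. g x (s x) (t x)) = (\<lambda>x. g x (conj_op R D s x) (t x)) + (\<lambda>x. g x (s x) (D t x))"
proof -
  define lam where "lam t = R (\<lambda>x. g x (s x) (t x)) - (\<lambda>x. g x (s x) (D t x))" for t
  note Dc = covariant_section[OF D] covariant_add[OF D] covariant_fscale[OF D] covariant_Cinf[OF D]
  note sf = sections_fibre[OF s]
  have gfun: "(\<lambda>x. g x (s x) ((t + u) x)) = (\<lambda>x. g x (s x) (t x)) + (\<lambda>x. g x (s x) (u x))"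
    if "t \<in> \<Gamma>" "u \<in> \<Gamma>" for t u
    using that sf by (simp add: fun_eq_iff g_simps sections_fibre)
  have gmul: "(\<lambda>x. g x (s x) ((f \<bullet>\<^sub>M t) x)) = f * (\<lambda>x. g x (s x) (t x))" if "t \<in> \<Gamma>" for t f
    using that sf by (simp add: fun_eq_iff fscale_def g_simps(3)[OF sf sections_fibre[OF that] sections_fibre[OF that]])
  have "tensorial lam"
    unfolding tensorial_def
  proof (intro conjI ballI)
    fix t u assume tu: "t \<in> \<Gamma>" "u \<in> \<Gamma>"
    have "R (\<lambda>x. g x (s x) ((t + u) x)) = R (\<lambda>x. g x (s x) (t x)) + R (\<lambda>x. g x (s x) (u x))"
      unfolding gfun[OF tu] using covariant_R_add[OF D g_smooth[OF s tu(1)] g_smooth[OF s tu(2)]] by (simp add: fun_eq_iff)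
    then show "lam (t + u) = lam t + lam u"
      unfolding lam_def Dc(2)[OF tu] gfun[OF Dc(1)[OF tu(1)] Dc(1)[OF tu(2)]] by simp
  next
    fix f t assume ft: "f \<in> Cinf A" "t \<in> \<Gamma>"
    have "R (\<lambda>x. g x (s x) ((f \<bullet>\<^sub>M t) x)) = f * R (\<lambda>x. g x (s x) (t x)) + (\<lambda>x. g x (s x) (t x)) * R f"
      unfolding gmul[OF ft(2)] using covariant_R_mult[OF D ft(1) g_smooth[OF s ft(2)]] by (simp add: fun_eq_iff)
    moreover have "(\<lambda>x. g x (s x) (D (f \<bullet>\<^sub>M t) x)) = f * (\<lambda>x. g x (s x) (D t x)) + R f * (\<lambda>x. g x (s x) (t x))"
      unfolding Dc(3)[OF ft] gfun[OF sections_fscale[OF ft(1) Dc(1)[OF ft(2)]] sections_fscale[OF Dc(4)[OF ft(1)] ft(2)]]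
        gmul[OF Dc(1)[OF ft(2)]] gmul[OF ft(2)] ..
    ultimately show "lam (f \<bullet>\<^sub>M t) = f \<bullet>\<^sub>M lam t"
      unfolding lam_def by (simp add: fun_eq_iff fscale_def algebra_simps)
  qed
  moreover have "lam t \<in> Cinf A" if "t \<in> \<Gamma>" for t
    unfolding lam_def by (intro subspace_diff[OF subspace_Cinf[OF manifold]] Dc(1) Dc(4) g_smooth s that)
  ultimately obtain c where c: "c \<in> \<Gamma>" "\<And>t. t \<in> \<Gamma> \<Longrightarrow> (\<lambda>x. g x (c x) (t x)) = lam t" using riesz by blast
  have cc: "R (\<lambda>x. g x (s x) (t x)) = (\<lambda>x. g x (c x) (t x)) + (\<lambda>x. g x (s x) (D t x))" if "t \<in> \<Gamma>" for t
    unfolding c(2)[OF that] lam_def by simp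
  have "conj_op R D s = c" by (rule conj_op_unique[OF D s c(1) cc])
  then show "conj_op R D s \<in> \<Gamma>"
    "t \<in> \<Gamma> \<Longrightarrow> R (\<lambda>x. g x (s x) (t x)) = (\<lambda>x. g x (conj_op R D s x) (t x)) + (\<lambda>x. g x (s x) (D t x))"
    using c(1) cc by auto
qed

definition adjoint_pair :: "(('m \<Rightarrow> 'b) \<Rightarrow> 'm \<Rightarrow> 'b) \<Rightarrow> (('m \<Rightarrow> 'b) \<Rightarrow> 'm \<Rightarrow> 'b) \<Rightarrow> bool" where
  "adjoint_pair S T \<longleftrightarrow> (\<forall>s\<in>\<Gamma>. \<forall>t\<in>\<Gamma>. \<forall>x. g x (S s x) (t x) = g x (s x) (T t x))"

text \<open>With w the g-dual frame of f, the trace of T is the sum of g (f i) (T (w i)). Moving T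
  across g turns this into the coordinates of S (f i) summed along the diagonal. No sign of g
  enters, so indefinite metrics are covered.\<close>

lemma trace_adjoint:
  assumes S: "S \<in> bundle_End" and T: "T \<in> bundle_End" and adj: "adjoint_pair S T"
  shows "trace_End A B S = trace_End A B T"
proof
  fix x
  obtain U \<phi> where U: "(U, \<phi>) \<in> trivs B" "x \<in> U" by (rule triv_at)
  obtain F where F: "finite F" "fibre B x \<subseteq> span F" using fibre_basis by blast
  let ?V = "fibre B x" and ?f = "\<lambda>i. frame_vec \<phi> i x"
  note f = frame_vec(1)[OF U]
  have lS: "linear_between ?V ?V (at_fibre S x)" and lT: "linear_between ?V ?V (at_fibre T x)"
    using at_fibre_End S T by auto
  have adjx: "g x (at_fibre S x u) v = g x u (at_fibre T x v)" if uv: "u \<in> ?V" "v \<in> ?V" for u v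
  proof -
    obtain s t where st: "s \<in> \<Gamma>" "s x = u" "t \<in> \<Gamma>" "t x = v" using section_through uv by metis
    have "g x (S s x) (t x) = g x (s x) (T t x)" using adj st unfolding adjoint_pair_def by blast
    then show ?thesis using at_fibre_eval[of S s x] at_fibre_eval[of T t x] S T st by (simp add: bundle_End_def)
  qed
  have cl: "linear_between ?V UNIV (\<lambda>v. \<phi> x v i)" for i
    using triv_add[OF U] triv_scale[OF U] by (simp add: linear_between_def)
  have "\<exists>w. w \<in> ?V \<and> (\<forall>v\<in>?V. g x w v = \<phi> x v i)" for i using musical_exists[OF cl] by blast
  \<comment> \<open>The g-dual frame: pairing with w i reads off the coordinate i.\<close>
  then obtain w where w: "\<And>i. w i \<in> ?V" "\<And>i v. v \<in> ?V \<Longrightarrow> g x (w i) v = \<phi> x v i" by metis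
  have lsum: "at_fibre S x (\<Sum>i<r. a i *\<^sub>R u i) = (\<Sum>i<r. a i *\<^sub>R at_fibre S x (u i))"
    if "linear_between ?V ?V (at_fibre S x)" "\<And>i. i < r \<Longrightarrow> u i \<in> ?V" for a :: "nat \<Rightarrow> real" and u S
  proof -
    have "at_fibre S x (\<Sum>i<r. a i *\<^sub>R u i) = (\<Sum>i<r. at_fibre S x (a i *\<^sub>R u i))"
      by (rule linear_between_sum[OF subspace_fibre that(1)]) (use that(2) subspace_scale[OF subspace_fibre] in auto)
    then show ?thesis using that by (simp add: linear_between_def)
  qed
  have St: "at_fibre S x v \<in> ?V" "at_fibre T x v \<in> ?V" if "v \<in> ?V" for v
    using lS lT that by (auto simp: linear_between_def)
  have trS: "trace_on ?V (at_fibre S x) = (\<Sum>i<r. \<phi> x (at_fibre S x (?f i)) i)"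
  proof -
    have "trace_on ?V (at_fibre S x) = trace_on ?V (\<lambda>v. \<Sum>i<r. \<phi> x v i *\<^sub>R at_fibre S x (?f i))"
    proof (rule trace_on_cong[OF subspace_fibre F])
      fix v assume v: "v \<in> ?V"
      show "at_fibre S x v = (\<Sum>i<r. \<phi> x v i *\<^sub>R at_fibre S x (?f i))"
        using lsum[of S ?f "\<phi> x v", OF lS f] frame_expansion[OF U v, symmetric] by simp
    qed
    then show ?thesis
      using trace_on_rank_sum[OF subspace_fibre F, of "{..<r}" "\<lambda>i v. \<phi> x v i" "\<lambda>i. at_fibre S x (?f i)"] cl f St by simp
  qed
  have expand: "v = (\<Sum>i<r. g x (?f i) v *\<^sub>R w i)" if v: "v \<in> ?V" for v
  proof -
    let ?z = "\<Sum>i<r. g x (?f i) v *\<^sub>R w i"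
    have z: "?z \<in> ?V" using w by (intro subspace_sum[OF subspace_fibre] subspace_scale[OF subspace_fibre]) auto
    have "v - ?z = 0"
    proof (rule g_nondegenerate[of _ x])
      show "v - ?z \<in> ?V" using v z subspace_diff[OF subspace_fibre] by blast
      fix u assume u: "u \<in> ?V"
      have "g x u ?z = (\<Sum>i<r. g x (?f i) v * \<phi> x u i)"
        using g_sum[OF u, of "{..<r}" w "\<lambda>i. g x (?f i) v"] w g_sym[OF u w(1)] u by simp
      also have "\<dots> = g x v (\<Sum>i<r. \<phi> x u i *\<^sub>R ?f i)"
        using g_sum[OF v, of "{..<r}" ?f "\<phi> x u"] f g_sym[OF v f] by (simp add: mult.commute)
      also have "\<dots> = g x u v" using frame_expansion[OF U u] g_sym[OF v u] by simp
      finally show "g x (v - ?z) u = 0" using g_simps(6)[OF u v z] g_sym[OF u v] g_sym[OF u z] by simp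
    qed
    then show ?thesis by simp
  qed
  have "trace_on ?V (at_fibre T x) = trace_on ?V (\<lambda>v. \<Sum>i<r. g x (?f i) v *\<^sub>R at_fibre T x (w i))"
  proof (rule trace_on_cong[OF subspace_fibre F])
    fix v assume v: "v \<in> ?V"
    show "at_fibre T x v = (\<Sum>i<r. g x (?f i) v *\<^sub>R at_fibre T x (w i))"
      using lsum[of T w "\<lambda>i. g x (?f i) v", OF lT w(1)] expand[OF v, symmetric] by simp
  qed
  also have "\<dots> = (\<Sum>i<r. g x (?f i) (at_fibre T x (w i)))"
    using trace_on_rank_sum[OF subspace_fibre F, of "{..<r}" "\<lambda>i. g x (?f i)" "\<lambda>i. at_fibre T x (w i)"] g_linear[OF f] w(1) St by simp
  also have "\<dots> = (\<Sum>i<r. \<phi> x (at_fibre S x (?f i)) i)"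
    using adjx[OF f w(1)] w(2)[OF St(1)[OF f]] g_sym[OF St(1)[OF f] w(1)] by simp
  finally show "trace_End A B S x = trace_End A B T x"
    unfolding trace_End_def fibre_End_eq trS by simp
qed

end

section \<open>Globalised operators of a Loday algebroid\<close>

text \<open>A purely algebraic projection, chosen along some complement; it extends operations from
  smooth sections to all functions.\<close>

lemma subspace_projection:
  fixes V :: "'v::real_vector set"
  assumes "subspace V" shows "\<exists>P. linear P \<and> (\<forall>v. P v \<in> V) \<and> (\<forall>v\<in>V. P v = v)"
proof -
  have "\<exists>h. h ` UNIV \<subseteq> V \<and> linear h \<and> (\<forall>v\<in>V. h (id v) = v)"
    by (rule linear_exists_left_inverse_on[OF linear_id[folded id_def] assms]) simp
  then show ?thesis by auto
qed

definition proj_on :: "'v::real_vector set \<Rightarrow> 'v \<Rightarrow> 'v" where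
  "proj_on V = (SOME P. linear P \<and> (\<forall>v. P v \<in> V) \<and> (\<forall>v\<in>V. P v = v))"

lemma
  assumes "subspace V"
  shows linear_proj_on: "linear (proj_on V)" and proj_on_in: "proj_on V v \<in> V" and proj_on_id: "v \<in> V \<Longrightarrow> proj_on V v = v"
  using someI_ex[OF subspace_projection[OF assms]] unfolding proj_on_def by blast+

lemma fscale_simps:
  "f \<bullet>\<^sub>M (s + t) = f \<bullet>\<^sub>M s + f \<bullet>\<^sub>M t" "f \<bullet>\<^sub>M (s - t) = f \<bullet>\<^sub>M s - f \<bullet>\<^sub>M t" "(f + h) \<bullet>\<^sub>M s = f \<bullet>\<^sub>M s + h \<bullet>\<^sub>M s"
  "(f - h) \<bullet>\<^sub>M s = f \<bullet>\<^sub>M s - h \<bullet>\<^sub>M s" "f \<bullet>\<^sub>M (c *\<^sub>R s) = c *\<^sub>R (f \<bullet>\<^sub>M s)" "(f * h) \<bullet>\<^sub>M s = f \<bullet>\<^sub>M (h \<bullet>\<^sub>M s)"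
  "f \<bullet>\<^sub>M 0 = 0" "0 \<bullet>\<^sub>M s = 0" "f \<bullet>\<^sub>M (- s) = - (f \<bullet>\<^sub>M s)"
  by (simp_all add: fscale_def fun_eq_iff algebra_simps scaleR_fun_def)

lemma fscale_left_commute: "f \<bullet>\<^sub>M h \<bullet>\<^sub>M s = h \<bullet>\<^sub>M f \<bullet>\<^sub>M s"
  by (simp add: fscale_def fun_eq_iff mult.commute)

locale loday_setup = metric_bundle A B g
  for A :: "('m::{t2_space,second_countable_topology}, 'd::real_inner) chart set"
    and B :: "('m, 'b::real_vector) vbundle" and g :: "'m \<Rightarrow> 'b \<Rightarrow> 'b \<Rightarrow> real" +
  fixes E :: "('m, 'e::real_vector) vbundle"
    and br :: "('m \<Rightarrow> 'e) \<Rightarrow> ('m \<Rightarrow> 'e) \<Rightarrow> ('m \<Rightarrow> 'e)"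
    and \<rho> :: "'m \<Rightarrow> 'e \<Rightarrow> 'm tangent"
    and \<alpha> :: "'m \<Rightarrow> 'm cotangent \<Rightarrow> 'e \<Rightarrow> 'e \<Rightarrow> 'e"
  assumes loday_algebroid: "loday_algebroid A E br \<rho> \<alpha>"
begin

sublocale EB: smooth_bundle A E
  using manifold loday_algebroid by unfold_locales (auto simp: loday_algebroid_def)

abbreviation S where "S \<equiv> sections A E"

lemmas loday = loday_algebroid[unfolded loday_algebroid_def]

lemma br_section: "x \<in> S \<Longrightarrow> y \<in> S \<Longrightarrow> br x y \<in> S"
  and br_add: "x \<in> S \<Longrightarrow> x' \<in> S \<Longrightarrow> y \<in> S \<Longrightarrow> br (x + x') y = br x y + br x' y"
    "x \<in> S \<Longrightarrow> y \<in> S \<Longrightarrow> y' \<in> S \<Longrightarrow> br x (y + y') = br x y + br x y'"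
  and br_scaleR: "x \<in> S \<Longrightarrow> y \<in> S \<Longrightarrow> br (c *\<^sub>R x) y = c *\<^sub>R br x y"
    "x \<in> S \<Longrightarrow> y \<in> S \<Longrightarrow> br x (c *\<^sub>R y) = c *\<^sub>R br x y"
  using loday[THEN conjunct2, THEN conjunct1] unfolding bilinear_on_sections_def linear_between_def by simp_all

lemma br_leibniz: "f \<in> Cinf A \<Longrightarrow> x \<in> S \<Longrightarrow> y \<in> S \<Longrightarrow> br x (f \<bullet>\<^sub>M y) = f \<bullet>\<^sub>M br x y + anchor_deriv \<rho> x f \<bullet>\<^sub>M y"
  using loday[THEN conjunct2, THEN conjunct2, THEN conjunct2, THEN conjunct2, THEN conjunct2, THEN conjunct1] by blast

lemma br_leibniz_left: "f \<in> Cinf A \<Longrightarrow> x \<in> S \<Longrightarrow> y \<in> S \<Longrightarrow>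
    br (f \<bullet>\<^sub>M x) y = f \<bullet>\<^sub>M br x y - anchor_deriv \<rho> y f \<bullet>\<^sub>M x + (\<lambda>p. \<alpha> p (differential A f p) (x p) (y p))"
  using loday[THEN conjunct2, THEN conjunct2, THEN conjunct2, THEN conjunct2, THEN conjunct2, THEN conjunct2] by blast

lemma br_jacobi: "x \<in> S \<Longrightarrow> y \<in> S \<Longrightarrow> z \<in> S \<Longrightarrow> br x (br y z) = br (br x y) z + br y (br x z)"
  using loday[THEN conjunct2, THEN conjunct2, THEN conjunct2, THEN conjunct2, THEN conjunct1] by blast

lemma anchor_linear: "linear_between (fibre E x) (tangent_space A x) (\<rho> x)"
  and anchor_vector_field: "e \<in> S \<Longrightarrow> (\<lambda>x. \<rho> x (e x)) \<in> vector_fields A"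
  using loday[THEN conjunct2, THEN conjunct2, THEN conjunct1] unfolding anchor_map_def by simp_all

lemma anchor_tangent: "e \<in> S \<Longrightarrow> (\<lambda>f. anchor_deriv \<rho> e f x) \<in> tangent_space A x"
  using anchor_vector_field[of e] by (simp add: vector_fields_def anchor_deriv_def)

lemma anchor_Cinf: "e \<in> S \<Longrightarrow> f \<in> Cinf A \<Longrightarrow> anchor_deriv \<rho> e f \<in> Cinf A"
  using anchor_vector_field[of e] by (simp add: vector_fields_def anchor_deriv_def)

lemma anchor_add: "e \<in> S \<Longrightarrow> e' \<in> S \<Longrightarrow> anchor_deriv \<rho> (e + e') f = anchor_deriv \<rho> e f + anchor_deriv \<rho> e' f"
  using anchor_linear EB.sections_fibre by (auto simp: anchor_deriv_def linear_between_def fun_eq_iff)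

lemma anchor_fscale: "e \<in> S \<Longrightarrow> anchor_deriv \<rho> (h \<bullet>\<^sub>M e) f = h * anchor_deriv \<rho> e f"
  using anchor_linear EB.sections_fibre by (auto simp: anchor_deriv_def linear_between_def fun_eq_iff fscale_def scaleR_fun_def)

text \<open>The Leibniz identity of the bracket is evaluated with third argument f z, and
  coefficients of z are compared at a point where z does not vanish. Over a zero fibre the anchor is
  zero and both sides vanish.\<close>

lemma anchor_bracket:
  assumes x: "x \<in> S" and y: "y \<in> S" and f: "f \<in> Cinf A"
  shows "anchor_deriv \<rho> (br x y) f = anchor_deriv \<rho> x (anchor_deriv \<rho> y f) - anchor_deriv \<rho> y (anchor_deriv \<rho> x f)"
proof
  fix p
  let ?r = "anchor_deriv \<rho>"
  note xy = br_section[OF x y]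
  show "?r (br x y) f p = (?r x (?r y f) - ?r y (?r x f)) p"
  proof (cases "\<exists>v\<in>fibre E p. v \<noteq> 0")
    case False
    have "\<rho> p (e p) = 0" if "e \<in> S" for e
    proof -
      have "e p = 0" using False EB.sections_fibre[OF that] by blast
      then show ?thesis using linear_between_0[OF EB.subspace_fibre anchor_linear, of p] by simp
    qed
    then show ?thesis using x y xy by (simp add: anchor_deriv_def)
  next
    case True
    then obtain v z where v: "v \<in> fibre E p" "v \<noteq> 0" and z: "z \<in> S" "z p = v" using EB.section_through by blast
    note fC = f anchor_Cinf[OF x f] anchor_Cinf[OF y f]
    note s = br_section[OF x z(1)] br_section[OF y z(1)] EB.sections_fscale[OF f z(1)]
    have 1: "br x (br y (f \<bullet>\<^sub>M z)) = f \<bullet>\<^sub>M br x (br y z) + ?r x f \<bullet>\<^sub>M br y z + (?r y f \<bullet>\<^sub>M br x z + ?r x (?r y f) \<bullet>\<^sub>M z)"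
      unfolding br_leibniz[OF f y z(1)]
        br_add(2)[OF x EB.sections_fscale[OF f s(2)] EB.sections_fscale[OF fC(3) z(1)]]
        br_leibniz[OF f x s(2)] br_leibniz[OF fC(3) x z(1)] ..
    have 2: "br y (br x (f \<bullet>\<^sub>M z)) = f \<bullet>\<^sub>M br y (br x z) + ?r y f \<bullet>\<^sub>M br x z + (?r x f \<bullet>\<^sub>M br y z + ?r y (?r x f) \<bullet>\<^sub>M z)"
      unfolding br_leibniz[OF f x z(1)]
        br_add(2)[OF y EB.sections_fscale[OF f s(1)] EB.sections_fscale[OF fC(2) z(1)]]
        br_leibniz[OF f y s(1)] br_leibniz[OF fC(2) y z(1)] ..
    have 3: "br (br x y) (f \<bullet>\<^sub>M z) = f \<bullet>\<^sub>M br (br x y) z + ?r (br x y) f \<bullet>\<^sub>M z"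
      by (rule br_leibniz[OF f xy z(1)])
    have "?r x (?r y f) \<bullet>\<^sub>M z = ?r (br x y) f \<bullet>\<^sub>M z + ?r y (?r x f) \<bullet>\<^sub>M z"
      using br_jacobi[OF x y s(3)] unfolding 1 2 3 br_jacobi[OF x y z(1)] fscale_simps by (simp add: algebra_simps)
    then have "?r x (?r y f) p *\<^sub>R v = (?r (br x y) f p + ?r y (?r x f) p) *\<^sub>R v"
      using z(2) by (auto simp: fun_eq_iff fscale_def scaleR_add_left dest!: spec[of _ p])
    then show ?thesis using v(2) by simp
  qed
qed

text \<open>In place of a bundle map for the defect in the first argument, this only asks that the
  defect be linear over smooth functions. The conjugate connection can then be treated without
  constructing such a bundle map for it.\<close>

definition nlc :: "('m, 'e, 'b) conn \<Rightarrow> bool" where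
  "nlc nab \<longleftrightarrow> bilinear_on_sections S \<Gamma> nab \<and>
     (\<forall>f\<in>Cinf A. \<forall>e\<in>S. \<forall>b\<in>\<Gamma>. nab e (f \<bullet>\<^sub>M b) = f \<bullet>\<^sub>M nab e b + anchor_deriv \<rho> e f \<bullet>\<^sub>M b) \<and>
     (\<forall>f\<in>Cinf A. \<forall>h\<in>Cinf A. \<forall>e\<in>S. \<forall>b\<in>\<Gamma>.
        nab (f \<bullet>\<^sub>M h \<bullet>\<^sub>M e) b - f \<bullet>\<^sub>M nab (h \<bullet>\<^sub>M e) b = h \<bullet>\<^sub>M (nab (f \<bullet>\<^sub>M e) b - f \<bullet>\<^sub>M nab e b))"

lemma differential_cotangent: "f \<in> Cinf A \<Longrightarrow> differential A f x \<in> cotangent_space A x"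
  unfolding cotangent_space_def linear_between_def differential_def
proof (intro CollectI conjI ballI allI impI)
  fix X Y c assume X: "X \<in> tangent_space A x" and Y: "Y \<in> tangent_space A x"
  have "X + Y \<in> tangent_space A x" "c *\<^sub>R X \<in> tangent_space A x"
    using X Y unfolding tangent_space_def linear_between_def by (auto simp: scaleR_fun_def algebra_simps)
  then show "(if X + Y \<in> tangent_space A x then (X + Y) f else 0) =
    (if X \<in> tangent_space A x then X f else 0) + (if Y \<in> tangent_space A x then Y f else 0)"
    using X Y by simp
next
  fix X c assume X: "X \<in> tangent_space A x"
  have "c *\<^sub>R X \<in> tangent_space A x"
    using X unfolding tangent_space_def linear_between_def by (auto simp: scaleR_fun_def algebra_simps)
  then show "(if c *\<^sub>R X \<in> tangent_space A x then (c *\<^sub>R X) f else 0) = c *\<^sub>R (if X \<in> tangent_space A x then X f else 0)"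
    using X by (simp add: scaleR_fun_def)
qed auto

lemma nonlinear_connection_nlc:
  assumes "nonlinear_connection A E \<rho> B nab" shows "nlc nab"
proof -
  obtain \<sigma> where bl: "bilinear_on_sections S \<Gamma> nab"
    and lb: "\<And>f e b. f \<in> Cinf A \<Longrightarrow> e \<in> S \<Longrightarrow> b \<in> \<Gamma> \<Longrightarrow> nab e (f \<bullet>\<^sub>M b) = f \<bullet>\<^sub>M nab e b + anchor_deriv \<rho> e f \<bullet>\<^sub>M b"
    and ct: "cotensor_End_map A E B \<sigma>"
    and sg: "\<And>f e b. f \<in> Cinf A \<Longrightarrow> e \<in> S \<Longrightarrow> b \<in> \<Gamma> \<Longrightarrow> nab (f \<bullet>\<^sub>M e) b = f \<bullet>\<^sub>M nab e b + (\<lambda>x. \<sigma> x (differential A f x) (e x) (b x))"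
    using assms unfolding nonlinear_connection_def by blast
  have "nab (f \<bullet>\<^sub>M h \<bullet>\<^sub>M e) b - f \<bullet>\<^sub>M nab (h \<bullet>\<^sub>M e) b = h \<bullet>\<^sub>M (nab (f \<bullet>\<^sub>M e) b - f \<bullet>\<^sub>M nab e b)"
    if f: "f \<in> Cinf A" and h: "h \<in> Cinf A" and e: "e \<in> S" and b: "b \<in> \<Gamma>" for f h e b
  proof -
    have "\<sigma> x (differential A f x) (h x *\<^sub>R e x) (b x) = h x *\<^sub>R \<sigma> x (differential A f x) (e x) (b x)" for x
      using ct differential_cotangent[OF f, of x] sections_fibre[OF b, of x] EB.sections_fibre[OF e, of x]
      unfolding cotensor_End_map_def linear_between_def by blast
    then show ?thesis
      unfolding sg[OF f EB.sections_fscale[OF h e] b] sg[OF f e b] by (simp add: fscale_def fun_eq_iff)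
  qed
  then show ?thesis unfolding nlc_def using bl lb by blast
qed

lemma alpha_tensorial:
  assumes f: "f \<in> Cinf A" and h: "h \<in> Cinf A" and x: "x \<in> S" and y: "y \<in> S"
  shows "(\<lambda>p. \<alpha> p (differential A f p) ((h \<bullet>\<^sub>M x) p) (y p)) = h \<bullet>\<^sub>M (\<lambda>p. \<alpha> p (differential A f p) (x p) (y p))"
proof -
  have ct: "cotensor_End_map A E E \<alpha>" using loday[THEN conjunct2, THEN conjunct2, THEN conjunct2, THEN conjunct1] .
  have "\<alpha> p (differential A f p) (h p *\<^sub>R x p) (y p) = h p *\<^sub>R \<alpha> p (differential A f p) (x p) (y p)" for p
    using ct differential_cotangent[OF f, of p] EB.sections_fibre[OF x, of p] EB.sections_fibre[OF y, of p]
    unfolding cotensor_End_map_def linear_between_def by blast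
  then show "(\<lambda>p. \<alpha> p (differential A f p) ((h \<bullet>\<^sub>M x) p) (y p)) = h \<bullet>\<^sub>M (\<lambda>p. \<alpha> p (differential A f p) (x p) (y p))"
    by (simp add: fscale_def fun_eq_iff)
qed

lemma alpha_section:
  assumes f: "f \<in> Cinf A" and x: "x \<in> S" and y: "y \<in> S"
  shows "(\<lambda>p. \<alpha> p (differential A f p) (x p) (y p)) \<in> S"
proof -
  have "(\<lambda>p. \<alpha> p (differential A f p) (x p) (y p)) = br (f \<bullet>\<^sub>M x) y - (f \<bullet>\<^sub>M br x y - anchor_deriv \<rho> y f \<bullet>\<^sub>M x)"
    unfolding br_leibniz_left[OF f x y] by simp
  also have "\<dots> \<in> S"
    by (intro subspace_diff[OF EB.subspace_sections] br_section EB.sections_fscale anchor_Cinf f x y)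
  finally show "(\<lambda>p. \<alpha> p (differential A f p) (x p) (y p)) \<in> S" .
qed

lemma
  assumes "nlc nab"
  shows nlc_section: "e \<in> S \<Longrightarrow> b \<in> \<Gamma> \<Longrightarrow> nab e b \<in> \<Gamma>"
    and nlc_add: "e \<in> S \<Longrightarrow> b \<in> \<Gamma> \<Longrightarrow> b' \<in> \<Gamma> \<Longrightarrow> nab e (b + b') = nab e b + nab e b'"
      "e \<in> S \<Longrightarrow> e' \<in> S \<Longrightarrow> b \<in> \<Gamma> \<Longrightarrow> nab (e + e') b = nab e b + nab e' b"
    and nlc_scaleR: "e \<in> S \<Longrightarrow> b \<in> \<Gamma> \<Longrightarrow> nab e (c *\<^sub>R b) = c *\<^sub>R nab e b"
      "e \<in> S \<Longrightarrow> b \<in> \<Gamma> \<Longrightarrow> nab (c *\<^sub>R e) b = c *\<^sub>R nab e b"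
    and nlc_leibniz: "f \<in> Cinf A \<Longrightarrow> e \<in> S \<Longrightarrow> b \<in> \<Gamma> \<Longrightarrow> nab e (f \<bullet>\<^sub>M b) = f \<bullet>\<^sub>M nab e b + anchor_deriv \<rho> e f \<bullet>\<^sub>M b"
    and nlc_order: "f \<in> Cinf A \<Longrightarrow> h \<in> Cinf A \<Longrightarrow> e \<in> S \<Longrightarrow> b \<in> \<Gamma> \<Longrightarrow>
      nab (f \<bullet>\<^sub>M h \<bullet>\<^sub>M e) b - f \<bullet>\<^sub>M nab (h \<bullet>\<^sub>M e) b = h \<bullet>\<^sub>M (nab (f \<bullet>\<^sub>M e) b - f \<bullet>\<^sub>M nab e b)"
  using assms unfolding nlc_def bilinear_on_sections_def linear_between_def by simp_all

lemma nlc_covariant: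
  assumes n: "nlc nab" and e: "e \<in> S" shows "covariant (anchor_deriv \<rho> e) (nab e)"
  unfolding covariant_def
  using anchor_tangent[OF e] anchor_Cinf[OF e] nlc_section[OF n e] nlc_add(1)[OF n e] nlc_leibniz[OF n _ e]
  by blast

text \<open>The bracket and the connections satisfy their axioms only on smooth sections. Composing them with
  linear projections of all functions onto the sections makes the identities hold unconditionally, as
  \<open>trace_algebra\<close> requires.\<close>

definition PE where "PE = proj_on S"
definition PB where "PB = proj_on \<Gamma>"

lemma PE: "linear PE" "PE x \<in> S" "x \<in> S \<Longrightarrow> PE x = x"
  unfolding PE_def using linear_proj_on proj_on_in proj_on_id EB.subspace_sections by blast+

lemma PB: "linear PB" "PB v \<in> \<Gamma>" "v \<in> \<Gamma> \<Longrightarrow> PB v = v"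
  unfolding PB_def using linear_proj_on proj_on_in proj_on_id subspace_sections by blast+

definition brP where "brP x y = br (PE x) (PE y)"
definition rhoP where "rhoP x f = anchor_deriv \<rho> (PE x) f"
definition Mf where "Mf f = Endo (\<lambda>v. f \<bullet>\<^sub>M PB v)"
definition lift_conn where "lift_conn nab x = Endo (\<lambda>v. nab (PE x) (PB v))"

text \<open>Operators that commute with the projection onto sections and are linear over smooth
  functions there. Commuting with \<open>PB\<close>, rather than factoring through it, keeps the
  identity in the algebra.\<close>

definition Cm :: "('m \<Rightarrow> 'b) endo set" where
  "Cm = {T. (\<forall>v. app T (PB v) = PB (app T v)) \<and> (\<forall>f\<in>Cinf A. \<forall>b\<in>\<Gamma>. app T (f \<bullet>\<^sub>M b) = f \<bullet>\<^sub>M app T b)}"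

text \<open>\<open>trace_algebra\<close> wants the trace to be linear on all operators; the
  projection onto \<open>Cm\<close> extends it from the operators where it has geometric
  meaning.\<close>

definition tr :: "('m \<Rightarrow> 'b) endo \<Rightarrow> 'm \<Rightarrow> real" where
  "tr T = trace_End A B (app (proj_on Cm T))"

lemma app_Mf: "app (Mf f) v = f \<bullet>\<^sub>M PB v"
  unfolding Mf_def by (subst app_Endo) (auto intro!: linearI simp: linear_add[OF PB(1)] linear_scale[OF PB(1)] fscale_simps)

lemma app_lift_conn: "nlc nab \<Longrightarrow> app (lift_conn nab x) v = nab (PE x) (PB v)"
  unfolding lift_conn_def by (subst app_Endo)
    (auto intro!: linearI simp: linear_add[OF PB(1)] linear_scale[OF PB(1)] nlc_add(1) nlc_scaleR(1) PE PB)

lemma linear_lift_conn: "nlc nab \<Longrightarrow> linear (lift_conn nab)"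
  by (intro linearI endo_eqI)
    (simp_all add: app_lift_conn linear_add[OF PE(1)] linear_scale[OF PE(1)] nlc_add(2) nlc_scaleR(2) PE PB fun_eq_iff)

lemma Cm_section: "T \<in> Cm \<Longrightarrow> b \<in> \<Gamma> \<Longrightarrow> app T b \<in> \<Gamma>"
  using PB(2,3) unfolding Cm_def by (metis (mono_tags, lifting) mem_Collect_eq)

lemma Cm_bundle_End: "T \<in> Cm \<Longrightarrow> app T \<in> bundle_End"
  using Cm_section unfolding bundle_End_def tensorial_def by (auto simp: Cm_def linear_add[OF linear_app])

lemma CmI:
  assumes "\<And>v. app T v = app T (PB v)" "\<And>b. b \<in> \<Gamma> \<Longrightarrow> app T b \<in> \<Gamma>"
    "\<And>f b. f \<in> Cinf A \<Longrightarrow> b \<in> \<Gamma> \<Longrightarrow> app T (f \<bullet>\<^sub>M b) = f \<bullet>\<^sub>M app T b"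
  shows "T \<in> Cm"
proof -
  have "app T (PB v) = PB (app T v)" for v
    using assms(1)[of v] assms(2)[OF PB(2)[of v]] PB(3) by simp
  then show ?thesis using assms(3) by (simp add: Cm_def)
qed

lemma subspace_Cm: "subspace Cm"
  unfolding subspace_def Cm_def
  by (auto simp: linear_add[OF PB(1)] linear_scale[OF PB(1)] linear_0[OF PB(1)] fscale_simps)

lemma tr_Cm: "T \<in> Cm \<Longrightarrow> tr T = trace_End A B (app T)"
  unfolding tr_def by (simp add: proj_on_id[OF subspace_Cm])

lemma linear_tr: "linear tr"
proof (rule linearI)
  note P = linear_proj_on[OF subspace_Cm] and Pin = proj_on_in[OF subspace_Cm, THEN Cm_bundle_End]
  fix T U :: "('m \<Rightarrow> 'b) endo" and c :: real
  show "tr (T + U) = tr T + tr U"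
  proof -
    have "app (proj_on Cm (T + U)) = (\<lambda>s. app (proj_on Cm T) s + app (proj_on Cm U) s)"
      by (rule ext) (simp add: linear_add[OF P])
    then show ?thesis unfolding tr_def by (simp only: trace_End_add[OF Pin Pin])
  qed
  show "tr (c *\<^sub>R T) = c *\<^sub>R tr T"
  proof -
    have "app (proj_on Cm (c *\<^sub>R T)) = (\<lambda>s. (\<lambda>x. c) \<bullet>\<^sub>M app (proj_on Cm T) s)"
      by (rule ext) (simp add: linear_scale[OF P], simp add: fscale_def scaleR_fun_def)
    then show ?thesis unfolding tr_def
      by (simp only: trace_End_fscale[OF Pin, of "\<lambda>x. c"]) (simp add: fun_eq_iff scaleR_fun_def)
  qed
qed

sublocale TA: trace_algebra brP Cm tr rhoP
proof (rule trace_algebra.intro)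
  show "brP x (brP y z) = brP (brP x y) z + brP y (brP x z)" for x y z
    unfolding brP_def PE(3)[OF br_section[OF PE(2) PE(2)]] by (rule br_jacobi[OF PE(2) PE(2) PE(2)])
  show "subspace Cm" by (rule subspace_Cm)
  show "T * U \<in> Cm" if "T \<in> Cm" "U \<in> Cm" for T U
    using that Cm_section[OF that(2)] by (auto simp: Cm_def)
  show "1 \<in> Cm" by (simp add: Cm_def)
  show "linear tr" by (rule linear_tr)
  show "tr (T * U) = tr (U * T)" if "T \<in> Cm" "U \<in> Cm" for T U
  proof -
    have "T * U \<in> Cm" "U * T \<in> Cm" using that Cm_section[OF that(1)] Cm_section[OF that(2)] by (auto simp: Cm_def)
    moreover have "app (T * U) = (\<lambda>s. app T (app U s))" "app (U * T) = (\<lambda>s. app U (app T s))" by (auto simp: fun_eq_iff)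
    ultimately show ?thesis
      using trace_End_commute[OF Cm_bundle_End[OF that(1)] Cm_bundle_End[OF that(2)]] by (simp add: tr_Cm)
  qed
qed

lemma at_list_curv:
  "at_list (curv brP (one_cochain w)) [] = 0" "at_list (curv brP (one_cochain w)) [x] = 0"
  "at_list (curv brP (one_cochain w)) [x, y] = w x * w y - w y * w x - w (brP x y)"
  "at_list (curv brP (one_cochain w)) (x # y # z # es) = (0 :: ('m \<Rightarrow> 'b) endo)"
proof -
  let ?W = "at_list (one_cochain w)"
  have gW: "grade_inv ?W = (\<lambda>es. - ?W es)"
    by (metis at_list_eta(2) at_list_grade grade_one_cochain)
  have c: "contr u (\<lambda>es. if es = [] then a else (0 :: ('m \<Rightarrow> 'b) endo)) = (\<lambda>es. 0)" for u :: "'m \<Rightarrow> 'e" and a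
    by (simp add: contr_def fun_eq_iff)
  have gi: "grade_inv (\<lambda>es. if es = [] then a else (0 :: ('m \<Rightarrow> 'b) endo)) = (\<lambda>es::('m \<Rightarrow> 'e) list. if es = [] then a else 0)" for a
    by (simp add: grade_inv_def fun_eq_iff)
  show "at_list (curv brP (one_cochain w)) [] = 0" "at_list (curv brP (one_cochain w)) [x] = 0"
    "at_list (curv brP (one_cochain w)) [x, y] = w x * w y - w y * w x - w (brP x y)"
    "at_list (curv brP (one_cochain w)) (x # y # z # es) = 0"
    by (simp_all add: curv_def bdiff_one_cochain at_list_mult contr_one_cochain gW shuf_minus_left c gi)
qed

lemma commutator_Cm:
  assumes n: "nlc nab" and T: "T \<in> Cm"
  shows "lift_conn nab x * T - T * lift_conn nab x \<in> Cm"
    "tr (lift_conn nab x * T - T * lift_conn nab x) = rhoP x (tr T)"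
proof -
  let ?K = "lift_conn nab x * T - T * lift_conn nab x"
  note cov = nlc_covariant[OF n PE(2)[of x]]
  have TP: "PB (app T v) = app T (PB v)" for v using T by (simp add: Cm_def)
  have K: "app ?K v = nab (PE x) (app T (PB v)) - app T (nab (PE x) (PB v))" for v
    by (simp add: app_lift_conn[OF n] TP)
  have Ks: "app ?K b = nab (PE x) (app T b) - app T (nab (PE x) b)" if "b \<in> \<Gamma>" for b
    using K[of b] PB(3)[OF that] by simp
  have End: "(\<lambda>s. nab (PE x) (app T s) - app T (nab (PE x) s)) \<in> bundle_End"
    by (rule commutator_End[OF cov Cm_bundle_End[OF T]])
  show KC: "?K \<in> Cm"
  proof (rule CmI)
    show "app ?K v = app ?K (PB v)" for v unfolding K by (simp add: PB)
    show "app ?K b \<in> \<Gamma>" if "b \<in> \<Gamma>" for b using End that unfolding Ks[OF that] bundle_End_def by blast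
    show "app ?K (f \<bullet>\<^sub>M b) = f \<bullet>\<^sub>M app ?K b" if "f \<in> Cinf A" "b \<in> \<Gamma>" for f b
      using End that unfolding Ks[OF that(2)] Ks[OF sections_fscale[OF that]] bundle_End_def tensorial_def by blast
  qed
  have "tr ?K = trace_End A B (\<lambda>s. nab (PE x) (app T s) - app T (nab (PE x) s))"
    unfolding tr_Cm[OF KC] by (rule trace_End_cong) (rule Ks)
  also have "\<dots> = anchor_deriv \<rho> (PE x) (trace_End A B (app T))"
    by (rule trace_commutator[OF cov Cm_bundle_End[OF T]])
  finally show "tr ?K = rhoP x (tr T)" by (simp add: rhoP_def tr_Cm[OF T])
qed

lemma curvature_value:
  assumes n: "nlc nab"
  shows "app (at_list (curv brP (one_cochain (lift_conn nab))) [x, y]) v = curvature br nab (PE x) (PE y) (PB v)"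
  unfolding at_list_curv curvature_def
  by (simp add: app_lift_conn[OF n] PB nlc_section[OF n PE(2)] brP_def PE br_section)

text \<open>The curvature is linear over smooth functions in the section because the anchor respects
  brackets, which cancels the derivatives of f.\<close>

lemma curvature_Cm:
  assumes n: "nlc nab"
  shows "TA.Cmv (curv brP (one_cochain (lift_conn nab)))"
  unfolding TA.Cmv_def
proof
  fix es
  have "at_list (curv brP (one_cochain (lift_conn nab))) [x, y] \<in> Cm" for x y
  proof (rule CmI)
    let ?R = "at_list (curv brP (one_cochain (lift_conn nab))) [x, y]"
    show "app ?R v = app ?R (PB v)" for v unfolding curvature_value[OF n] by (simp add: PB)
    note s = PE(2)[of x] PE(2)[of y] br_section[OF PE(2)[of x] PE(2)[of y]]
    show "app ?R b \<in> \<Gamma>" if "b \<in> \<Gamma>" for b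
      unfolding curvature_value[OF n] curvature_def
      by (intro subspace_diff[OF subspace_sections] nlc_section[OF n] s PB(2))
    fix f b assume f: "f \<in> Cinf A" and b: "b \<in> \<Gamma>"
    let ?r = "anchor_deriv \<rho>"
    have two: "nab u (nab w (f \<bullet>\<^sub>M b)) = f \<bullet>\<^sub>M nab u (nab w b) + ?r u f \<bullet>\<^sub>M nab w b + (?r w f \<bullet>\<^sub>M nab u b + ?r u (?r w f) \<bullet>\<^sub>M b)"
      if "u \<in> S" "w \<in> S" for u w
      unfolding nlc_leibniz[OF n f that(2) b]
        nlc_add(1)[OF n that(1) sections_fscale[OF f nlc_section[OF n that(2) b]] sections_fscale[OF anchor_Cinf[OF that(2) f] b]]
        nlc_leibniz[OF n f that(1) nlc_section[OF n that(2) b]] nlc_leibniz[OF n anchor_Cinf[OF that(2) f] that(1) b] ..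
    show "app ?R (f \<bullet>\<^sub>M b) = f \<bullet>\<^sub>M app ?R b"
      unfolding curvature_value[OF n] PB(3)[OF b] PB(3)[OF sections_fscale[OF f b]] curvature_def
        two[OF s(1,2)] two[OF s(2,1)] nlc_leibniz[OF n f s(3) b] anchor_bracket[OF s(1,2) f] fscale_simps
      by (simp add: algebra_simps)
  qed
  then show "at_list (curv brP (one_cochain (lift_conn nab))) es \<in> Cm"
    using subspace_0[OF subspace_Cm]
    by (cases es rule: remdups_adj.cases; cases "tl (tl es)") (auto simp: at_list_curv)
qed

abbreviation conn_cochain where "conn_cochain nab \<equiv> one_cochain (lift_conn nab)"

lemma is_conn: "nlc nab \<Longrightarrow> TA.is_conn (conn_cochain nab)"
  unfolding TA.is_conn_def using curvature_Cm linear_lift_conn commutator_Cm by blast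

lemma is_form_diff:
  assumes "nlc nab0" "nlc nab1"
  shows "TA.is_form (conn_cochain nab1 - conn_cochain nab0)"
proof -
  let ?a = "\<lambda>x. lift_conn nab1 x - lift_conn nab0 x"
  have "conn_cochain nab1 - conn_cochain nab0 = one_cochain ?a"
    by (intro cochain_eqI) (auto simp: one_cochain_def split: list.splits)
  moreover have "linear ?a" using assms by (intro linear_compose_sub linear_lift_conn)
  moreover have "?a x \<in> Cm" for x
  proof (rule CmI)
    show "app (?a x) v = app (?a x) (PB v)" for v by (simp add: app_lift_conn assms PB)
    show "app (?a x) b \<in> \<Gamma>" if "b \<in> \<Gamma>" for b
      by (simp add: app_lift_conn assms nlc_section PE PB subspace_diff[OF subspace_sections])
    show "app (?a x) (f \<bullet>\<^sub>M b) = f \<bullet>\<^sub>M app (?a x) b" if "f \<in> Cinf A" "b \<in> \<Gamma>" for f b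
      using that by (simp add: app_lift_conn assms PB sections_fscale nlc_leibniz PE fscale_simps fun_eq_iff)
  qed
  ultimately show ?thesis unfolding TA.is_form_def by blast
qed

end

section \<open>Differential operators with values in endomorphisms\<close>

context loday_setup
begin

text \<open>Differential operators in an algebroid argument with operators on sections of B as
  values. The values need not be bundle endomorphisms, so that connections themselves
  qualify.\<close>

primrec opd :: "nat \<Rightarrow> (('m \<Rightarrow> 'e) \<Rightarrow> ('m \<Rightarrow> 'b) endo) \<Rightarrow> bool" where
  "opd 0 Q \<longleftrightarrow> (\<forall>f\<in>Cinf A. \<forall>e\<in>S. Q (f \<bullet>\<^sub>M e) = Mf f * Q e)"
| "opd (Suc n) Q \<longleftrightarrow> (\<forall>f\<in>Cinf A. opd n (\<lambda>e. Q (f \<bullet>\<^sub>M e) - Mf f * Q e))"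

lemma Mf_commute: "f \<in> Cinf A \<Longrightarrow> h \<in> Cinf A \<Longrightarrow> Mf f * Mf h = Mf h * Mf f"
  by (rule endo_eqI) (simp add: app_Mf PB sections_fscale fscale_left_commute)

lemma Mf_Cm: "f \<in> Cinf A \<Longrightarrow> T \<in> Cm \<Longrightarrow> Mf f * T = T * Mf f"
  by (rule endo_eqI) (simp add: app_Mf Cm_def PB)

lemma Mf_mult_Cm: "f \<in> Cinf A \<Longrightarrow> T \<in> Cm \<Longrightarrow> Mf f * T \<in> Cm"
proof (rule CmI)
  assume f: "f \<in> Cinf A" and T: "T \<in> Cm"
  have PT: "PB (app T v) = app T (PB v)" for v using T by (simp add: Cm_def)
  show "app (Mf f * T) v = app (Mf f * T) (PB v)" for v by (simp add: app_Mf PT PB)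
  show "app (Mf f * T) b \<in> \<Gamma>" if "b \<in> \<Gamma>" for b by (simp add: app_Mf sections_fscale f PB)
  show "app (Mf f * T) (h \<bullet>\<^sub>M b) = h \<bullet>\<^sub>M app (Mf f * T) b" if "h \<in> Cinf A" "b \<in> \<Gamma>" for h b
  proof -
    have "app T (h \<bullet>\<^sub>M b) = h \<bullet>\<^sub>M app T b" using T that by (simp add: Cm_def)
    then show ?thesis using Cm_section[OF T that(2)] that(1) sections_fscale
      by (simp add: app_Mf PB fscale_left_commute)
  qed
qed

lemma tr_Mf: "f \<in> Cinf A \<Longrightarrow> T \<in> Cm \<Longrightarrow> tr (Mf f * T) = f * tr T"
proof -
  assume f: "f \<in> Cinf A" and T: "T \<in> Cm"
  have "tr (Mf f * T) = trace_End A B (\<lambda>s. f \<bullet>\<^sub>M app T s)"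
    unfolding tr_Cm[OF Mf_mult_Cm[OF f T]] by (rule trace_End_cong) (simp add: app_Mf PB Cm_section[OF T])
  then show ?thesis by (simp add: trace_End_fscale[OF Cm_bundle_End[OF T]] tr_Cm[OF T])
qed

lemma opd_cong: "(\<And>e. e \<in> S \<Longrightarrow> Q e = Q' e) \<Longrightarrow> opd n Q \<Longrightarrow> opd n Q'"
proof (induction n arbitrary: Q Q')
  case 0
  then show ?case by (simp add: EB.sections_fscale)
next
  case (Suc n)
  show ?case unfolding opd.simps
  proof
    fix f assume f: "f \<in> Cinf A"
    show "opd n (\<lambda>e. Q' (f \<bullet>\<^sub>M e) - Mf f * Q' e)"
      by (rule Suc.IH[of "\<lambda>e. Q (f \<bullet>\<^sub>M e) - Mf f * Q e"]) (use Suc.prems f EB.sections_fscale in auto)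
  qed
qed

lemma opd_add: "opd n Q \<Longrightarrow> opd n Q' \<Longrightarrow> opd n (\<lambda>e. Q e + Q' e)"
proof (induction n arbitrary: Q Q')
  case (Suc n)
  have "opd n (\<lambda>e. (Q (f \<bullet>\<^sub>M e) - Mf f * Q e) + (Q' (f \<bullet>\<^sub>M e) - Mf f * Q' e))" if "f \<in> Cinf A" for f
    using Suc that by simp
  then show ?case by (simp add: algebra_simps)
qed (simp add: algebra_simps)

lemma opd_scaleR: "opd n Q \<Longrightarrow> opd n (\<lambda>e. c *\<^sub>R Q e)"
proof (induction n arbitrary: Q)
  case (Suc n)
  have "opd n (\<lambda>e. c *\<^sub>R (Q (f \<bullet>\<^sub>M e) - Mf f * Q e))" if "f \<in> Cinf A" for f
    using Suc that by simp
  then show ?case by (simp add: algebra_simps)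
qed simp

lemma opd_diff: "opd n Q \<Longrightarrow> opd n Q' \<Longrightarrow> opd n (\<lambda>e. Q e - Q' e)"
  using opd_add[of n Q "\<lambda>e. (-1) *\<^sub>R Q' e"] opd_scaleR[of n Q' "-1"] by simp

lemma opd_zero: "opd n (\<lambda>e. 0)"
  by (induction n) auto

lemma opd_Suc: "opd n Q \<Longrightarrow> opd (Suc n) Q"
proof (induction n arbitrary: Q)
  case 0
  then show ?case by (auto simp: EB.sections_fscale)
qed auto

lemma opd_mono: "opd n Q \<Longrightarrow> n \<le> m \<Longrightarrow> opd m Q"
  by (induction m) (auto simp: le_Suc_eq intro: opd_Suc simp del: opd.simps)

lemma opd_right: "opd n Q \<Longrightarrow> opd n (\<lambda>e. Q e * T)"
proof (induction n arbitrary: Q)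
  case (Suc n)
  have "opd n (\<lambda>e. (Q (f \<bullet>\<^sub>M e) - Mf f * Q e) * T)" if "f \<in> Cinf A" for f
    using Suc that by simp
  then show ?case by (simp add: algebra_simps)
qed (simp add: mult.assoc)

lemma opd_left:
  assumes "\<And>f. f \<in> Cinf A \<Longrightarrow> Mf f * T = T * Mf f"
  shows "opd n Q \<Longrightarrow> opd n (\<lambda>e. T * Q e)"
proof (induction n arbitrary: Q)
  case 0
  have "T * (Mf f * X) = Mf f * (T * X)" if "f \<in> Cinf A" for f X
    using assms[OF that] by (metis mult.assoc)
  then show ?case using 0 by simp
next
  case (Suc n)
  have "opd n (\<lambda>e. T * Q (f \<bullet>\<^sub>M e) - Mf f * (T * Q e))" if f: "f \<in> Cinf A" for f
  proof -
    have "Mf f * (T * X) = T * (Mf f * X)" for X using assms[OF f] by (metis mult.assoc)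
    then show ?thesis using Suc.IH[of "\<lambda>e. Q (f \<bullet>\<^sub>M e) - Mf f * Q e"] Suc.prems f by (simp add: right_diff_distrib)
  qed
  then show ?case by simp
qed

lemma opd_comp:
  assumes "\<And>e. e \<in> S \<Longrightarrow> K e \<in> S" "\<And>f e. f \<in> Cinf A \<Longrightarrow> e \<in> S \<Longrightarrow> K (f \<bullet>\<^sub>M e) = f \<bullet>\<^sub>M K e"
  shows "opd n Q \<Longrightarrow> opd n (\<lambda>e. Q (K e))"
proof (induction n arbitrary: Q)
  case 0
  then show ?case using assms by simp
next
  case (Suc n)
  show ?case unfolding opd.simps
  proof
    fix f assume f: "f \<in> Cinf A"
    have "opd n (\<lambda>e. Q (f \<bullet>\<^sub>M K e) - Mf f * Q (K e))"
      using Suc.IH[of "\<lambda>e. Q (f \<bullet>\<^sub>M e) - Mf f * Q e"] Suc.prems f by simp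
    then show "opd n (\<lambda>e. Q (K (f \<bullet>\<^sub>M e)) - Mf f * Q (K e))"
      by (rule opd_cong[rotated]) (simp add: assms(2)[OF f])
  qed
qed

lemma conn_Mf:
  assumes n: "nlc nab" and f: "f \<in> Cinf A"
  shows "lift_conn nab x * Mf f = Mf f * lift_conn nab x + Mf (anchor_deriv \<rho> (PE x) f)"
  by (rule endo_eqI)
    (simp add: app_lift_conn[OF n] app_Mf PB PE sections_fscale f nlc_leibniz[OF n] nlc_section[OF n])

text \<open>A connection operator fails to commute with multiplication by f only by multiplication
  with the anchor derivative of f, which costs one order.\<close>

lemma opd_conn_left:
  assumes n: "nlc nab" shows "opd k Q \<Longrightarrow> opd (Suc k) (\<lambda>e. lift_conn nab x * Q e)"
proof (induction k arbitrary: Q)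
  case 0
  show ?case unfolding opd.simps
  proof (intro ballI)
    fix f h e assume f: "f \<in> Cinf A" and h: "h \<in> Cinf A" and e: "e \<in> S"
    let ?w = "lift_conn nab x" and ?M = "Mf (anchor_deriv \<rho> (PE x) f)"
    have Q: "Q (u \<bullet>\<^sub>M e') = Mf u * Q e'" if "u \<in> Cinf A" "e' \<in> S" for u e' using 0 that by simp
    have c: "?w * Q (f \<bullet>\<^sub>M e') - Mf f * (?w * Q e') = ?M * Q e'" if "e' \<in> S" for e'
      unfolding Q[OF f that] mult.assoc[symmetric] conn_Mf[OF n f] by (simp add: distrib_right)
    have comm: "?M * Mf h = Mf h * ?M" by (rule Mf_commute[OF anchor_Cinf[OF PE(2) f] h])
    have "?M * (Mf h * Q e) = Mf h * (?M * Q e)" by (simp only: mult.assoc[symmetric] comm)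
    then show "?w * Q (f \<bullet>\<^sub>M h \<bullet>\<^sub>M e) - Mf f * (?w * Q (h \<bullet>\<^sub>M e)) = Mf h * (?w * Q (f \<bullet>\<^sub>M e) - Mf f * (?w * Q e))"
      unfolding c[OF EB.sections_fscale[OF h e]] c[OF e] unfolding Q[OF h e] .
  qed
next
  case (Suc k)
  show ?case unfolding opd.simps(2)[of "Suc k"]
  proof
    fix f assume f: "f \<in> Cinf A"
    let ?w = "lift_conn nab x" and ?M = "Mf (anchor_deriv \<rho> (PE x) f)"
    have "opd (Suc k) (\<lambda>e. ?w * (Q (f \<bullet>\<^sub>M e) - Mf f * Q e))"
      using Suc.prems f by (intro Suc.IH) simp
    moreover have "opd (Suc k) (\<lambda>e. ?M * Q e)"
      by (rule opd_left[OF Mf_commute[OF _ anchor_Cinf[OF PE(2) f]] Suc.prems])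
    ultimately have "opd (Suc k) (\<lambda>e. ?w * (Q (f \<bullet>\<^sub>M e) - Mf f * Q e) + ?M * Q e)" by (rule opd_add)
    moreover have "?w * (Q (f \<bullet>\<^sub>M e) - Mf f * Q e) + ?M * Q e = ?w * Q (f \<bullet>\<^sub>M e) - Mf f * (?w * Q e)" for e
      by (simp add: right_diff_distrib mult.assoc[symmetric] conn_Mf[OF n f] distrib_right)
    ultimately show "opd (Suc k) (\<lambda>e. ?w * Q (f \<bullet>\<^sub>M e) - Mf f * (?w * Q e))" by simp
  qed
qed

text \<open>Order one is exactly the linearity over smooth functions of the defect recorded in
  \<open>nlc\<close>.\<close>

lemma opd_conn: "nlc nab \<Longrightarrow> opd 1 (lift_conn nab)"
proof -
  assume n: "nlc nab"
  show ?thesis unfolding One_nat_def opd.simps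
  proof (intro ballI endo_eqI)
    fix f h e v assume f: "f \<in> Cinf A" and h: "h \<in> Cinf A" and e: "e \<in> S"
    note s = EB.sections_fscale[OF f e] EB.sections_fscale[OF h e] EB.sections_fscale[OF f EB.sections_fscale[OF h e]]
    show "app (lift_conn nab (f \<bullet>\<^sub>M h \<bullet>\<^sub>M e) - Mf f * lift_conn nab (h \<bullet>\<^sub>M e)) v =
        app (Mf h * (lift_conn nab (f \<bullet>\<^sub>M e) - Mf f * lift_conn nab e)) v"
      using nlc_order[OF n f h e PB(2)[of v]] s e f
      by (simp add: app_lift_conn[OF n] app_Mf PE PB nlc_section[OF n] sections_fscale subspace_diff[OF subspace_sections])
  qed
qed

lemma linear_opd_step: "linear Q \<Longrightarrow> linear (\<lambda>e. Q (f \<bullet>\<^sub>M e) - Mf f * Q e)"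
  by (intro linearI) (simp_all add: fscale_simps linear_add linear_scale algebra_simps)

text \<open>The defect of the bracket in its first argument consists of the \<alpha> term and an
  anchor term. Both are linear over smooth functions, so the order rises by at most one.\<close>

lemma opd_bracket_left:
  assumes y: "y \<in> S" shows "linear Q \<Longrightarrow> opd k Q \<Longrightarrow> opd (Suc k) (\<lambda>e. Q (br e y))"
proof (induction k arbitrary: Q)
  case (0 Q)
  show ?case unfolding opd.simps(2)
  proof
    fix f assume f: "f \<in> Cinf A"
    let ?K = "\<lambda>e p. \<alpha> p (differential A f p) (e p) (y p)"
    have "opd 0 (\<lambda>e. Q (?K e) - Q (anchor_deriv \<rho> y f \<bullet>\<^sub>M e))"
      by (intro opd_diff opd_comp[OF _ _ 0(2)] alpha_section alpha_tensorial f y EB.sections_fscale anchor_Cinf fscale_left_commute)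
    then show "opd 0 (\<lambda>e. Q (br (f \<bullet>\<^sub>M e) y) - Mf f * Q (br e y))"
    proof (rule opd_cong[rotated])
      fix e assume e: "e \<in> S"
      show "Q (?K e) - Q (anchor_deriv \<rho> y f \<bullet>\<^sub>M e) = Q (br (f \<bullet>\<^sub>M e) y) - Mf f * Q (br e y)"
        using 0(2) f br_section[OF e y] unfolding br_leibniz_left[OF f e y]
        by (simp only: linear_add[OF 0(1)] linear_diff[OF 0(1)]) simp
    qed
  qed
next
  case (Suc k)
  show ?case unfolding opd.simps(2)[of "Suc k"]
  proof
    fix f assume f: "f \<in> Cinf A"
    let ?K = "\<lambda>e p. \<alpha> p (differential A f p) (e p) (y p)"
    have "opd (Suc k) (\<lambda>e. Q (f \<bullet>\<^sub>M br e y) - Mf f * Q (br e y))"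
      using Suc.IH[OF linear_opd_step[OF Suc.prems(1)]] Suc.prems(2) f by simp
    moreover have "opd (Suc k) (\<lambda>e. Q (?K e) - Q (anchor_deriv \<rho> y f \<bullet>\<^sub>M e))"
      by (intro opd_diff opd_comp[OF _ _ Suc.prems(2)] alpha_section alpha_tensorial f y EB.sections_fscale anchor_Cinf fscale_left_commute)
    ultimately have "opd (Suc k) (\<lambda>e. (Q (f \<bullet>\<^sub>M br e y) - Mf f * Q (br e y)) + (Q (?K e) - Q (anchor_deriv \<rho> y f \<bullet>\<^sub>M e)))"
      by (rule opd_add)
    then show "opd (Suc k) (\<lambda>e. Q (br (f \<bullet>\<^sub>M e) y) - Mf f * Q (br e y))"
    proof (rule opd_cong[rotated])
      fix e assume e: "e \<in> S"
      show "(Q (f \<bullet>\<^sub>M br e y) - Mf f * Q (br e y)) + (Q (?K e) - Q (anchor_deriv \<rho> y f \<bullet>\<^sub>M e)) = Q (br (f \<bullet>\<^sub>M e) y) - Mf f * Q (br e y)"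
        unfolding br_leibniz_left[OF f e y] by (simp only: linear_add[OF Suc.prems(1)] linear_diff[OF Suc.prems(1)]) simp
    qed
  qed
qed

lemma opd_bracket_right:
  assumes y: "y \<in> S" shows "linear Q \<Longrightarrow> opd k Q \<Longrightarrow> opd (Suc k) (\<lambda>e. Q (br y e))"
proof (induction k arbitrary: Q)
  case (0 Q)
  show ?case unfolding opd.simps(2)
  proof
    fix f assume f: "f \<in> Cinf A"
    have "opd 0 (\<lambda>e. Q (anchor_deriv \<rho> y f \<bullet>\<^sub>M e))"
      by (intro opd_comp[OF _ _ 0(2)] f y EB.sections_fscale anchor_Cinf fscale_left_commute)
    then show "opd 0 (\<lambda>e. Q (br y (f \<bullet>\<^sub>M e)) - Mf f * Q (br y e))"
    proof (rule opd_cong[rotated])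
      fix e assume e: "e \<in> S"
      show "Q (anchor_deriv \<rho> y f \<bullet>\<^sub>M e) = Q (br y (f \<bullet>\<^sub>M e)) - Mf f * Q (br y e)"
        using 0(2) f br_section[OF y e] unfolding br_leibniz[OF f y e] by (simp only: linear_add[OF 0(1)]) simp
    qed
  qed
next
  case (Suc k)
  show ?case unfolding opd.simps(2)[of "Suc k"]
  proof
    fix f assume f: "f \<in> Cinf A"
    have "opd (Suc k) (\<lambda>e. Q (f \<bullet>\<^sub>M br y e) - Mf f * Q (br y e))"
      using Suc.IH[OF linear_opd_step[OF Suc.prems(1)]] Suc.prems(2) f by simp
    moreover have "opd (Suc k) (\<lambda>e. Q (anchor_deriv \<rho> y f \<bullet>\<^sub>M e))"
      by (intro opd_comp[OF _ _ Suc.prems(2)] f y EB.sections_fscale anchor_Cinf fscale_left_commute)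
    ultimately have "opd (Suc k) (\<lambda>e. (Q (f \<bullet>\<^sub>M br y e) - Mf f * Q (br y e)) + Q (anchor_deriv \<rho> y f \<bullet>\<^sub>M e))"
      by (rule opd_add)
    then show "opd (Suc k) (\<lambda>e. Q (br y (f \<bullet>\<^sub>M e)) - Mf f * Q (br y e))"
    proof (rule opd_cong[rotated])
      fix e assume e: "e \<in> S"
      show "(Q (f \<bullet>\<^sub>M br y e) - Mf f * Q (br y e)) + Q (anchor_deriv \<rho> y f \<bullet>\<^sub>M e) = Q (br y (f \<bullet>\<^sub>M e)) - Mf f * Q (br y e)"
        unfolding br_leibniz[OF f y e] by (simp only: linear_add[OF Suc.prems(1)]) simp
    qed
  qed
qed

section \<open>Cochains that are differential operators in every argument\<close>

definition adm :: "(('m \<Rightarrow> 'e) \<Rightarrow> ('m \<Rightarrow> 'b) endo) \<Rightarrow> bool" where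
  "adm Q \<longleftrightarrow> linear Q \<and> (\<forall>e. Q e \<in> Cm) \<and> (\<exists>n. opd n Q)"

lemma adm_zero: "adm (\<lambda>e. 0)"
  by (auto simp: adm_def linear_zero subspace_0[OF subspace_Cm] opd_zero)

lemma adm_add: assumes "adm Q" "adm Q'" shows "adm (\<lambda>e. Q e + Q' e)"
proof -
  obtain n n' where "opd n Q" "opd n' Q'" using assms by (auto simp: adm_def)
  then have "opd (max n n') (\<lambda>e. Q e + Q' e)" by (intro opd_add) (auto elim: opd_mono)
  then show ?thesis using assms unfolding adm_def
    by (auto intro!: linear_compose_add subspace_add[OF subspace_Cm])
qed

lemma adm_scaleR: "adm Q \<Longrightarrow> adm (\<lambda>e. c *\<^sub>R Q e)"
  unfolding adm_def using opd_scaleR by (blast intro: linear_compose_scale_right subspace_scale[OF subspace_Cm])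

lemma adm_mult:
  assumes "adm Q" "T \<in> Cm" shows "adm (\<lambda>e. T * Q e)" "adm (\<lambda>e. Q e * T)"
proof -
  obtain n where n: "opd n Q" "linear Q" "\<And>e. Q e \<in> Cm" using assms by (auto simp: adm_def)
  have "linear (\<lambda>e. T * Q e)" "linear (\<lambda>e. Q e * T)"
    using n(2) by (auto intro!: linearI simp: linear_add linear_scale algebra_simps)
  then show "adm (\<lambda>e. T * Q e)" "adm (\<lambda>e. Q e * T)"
    unfolding adm_def using opd_left[OF Mf_Cm[OF _ assms(2)] n(1)] opd_right[OF n(1)] n(3) assms(2) TA.Cm_mult by blast+
qed

text \<open>The condition concerns every position in lists of every length, so it matches
  inhomogeneous cochains and can be proved by recursion on lists.\<close>

definition good_fun :: "(('m \<Rightarrow> 'e) list \<Rightarrow> ('m \<Rightarrow> 'b) endo) \<Rightarrow> bool" where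
  "good_fun F \<longleftrightarrow> (\<forall>us vs. set us \<subseteq> S \<longrightarrow> set vs \<subseteq> S \<longrightarrow> adm (\<lambda>e. F (us @ e # vs)))"

definition good :: "(('m \<Rightarrow> 'e), ('m \<Rightarrow> 'b) endo) shuffle_cochain \<Rightarrow> bool" where
  "good X \<longleftrightarrow> TA.Cmv X \<and> good_fun (at_list X)"

lemma adm_shuf_left:
  "set vs \<subseteq> S \<Longrightarrow> (\<And>us. set us \<subseteq> S \<Longrightarrow> adm (\<lambda>e. F e us)) \<Longrightarrow> (\<And>us. G us \<in> Cm) \<Longrightarrow> adm (\<lambda>e. shuf (F e) G vs)"
proof (induction vs arbitrary: F G)
  case Nil
  then show ?case by (simp add: adm_mult)
next
  case (Cons z vs)
  have "adm (\<lambda>e. shuf (contr z (F e)) G vs)"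
    using Cons.prems by (intro Cons.IH) (auto simp: contr_def)
  moreover have "adm (\<lambda>e. shuf (grade_inv (F e)) (contr z G) vs)"
    using Cons.prems by (intro Cons.IH) (auto simp: contr_def grade_inv_def intro: adm_scaleR)
  ultimately show ?case by (simp add: adm_add)
qed

lemma adm_shuf_right:
  "set vs \<subseteq> S \<Longrightarrow> (\<And>us. set us \<subseteq> S \<Longrightarrow> adm (\<lambda>e. G e us)) \<Longrightarrow> (\<And>us. F us \<in> Cm) \<Longrightarrow> adm (\<lambda>e. shuf F (G e) vs)"
proof (induction vs arbitrary: F G)
  case Nil
  then show ?case by (simp add: adm_mult)
next
  case (Cons z vs)
  have "adm (\<lambda>e. shuf (contr z F) (G e) vs)"
    using Cons.prems by (intro Cons.IH) (auto simp: contr_def)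
  moreover have "adm (\<lambda>e. shuf (grade_inv F) (contr z (G e)) vs)"
    using Cons.prems by (intro Cons.IH) (auto simp: contr_def grade_inv_def intro: subspace_scale[OF subspace_Cm])
  ultimately show ?case by (simp add: adm_add)
qed

text \<open>Induction on the entries before the varying one. Once the varying entry is at the head,
  it lands in one of the two factors and the remaining entries are shuffled around it.\<close>

lemma good_fun_shuf:
  assumes "good_fun F" "good_fun G" "\<And>us. F us \<in> Cm" "\<And>us. G us \<in> Cm"
  shows "good_fun (shuf F G)"
  unfolding good_fun_def
proof (intro allI impI)
  fix us vs assume "set us \<subseteq> S" and vs: "set vs \<subseteq> S"
  then show "adm (\<lambda>e. shuf F G (us @ e # vs))"
    using assms
  proof (induction us arbitrary: F G)
    case Nil
    have F: "adm (\<lambda>e. contr e F ws)" "adm (\<lambda>e. contr e G ws)" if "set ws \<subseteq> S" for ws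
      using Nil.prems(3,4)[unfolded good_fun_def, rule_format, of "[]" ws] that by (simp_all add: contr_def)
    have "grade_inv F ws \<in> Cm" for ws using Nil.prems(5) by (simp add: grade_inv_def subspace_scale[OF subspace_Cm])
    then show ?case
      using adm_shuf_left[OF vs F(1) Nil.prems(6)] adm_shuf_right[OF vs F(2)] by (simp add: adm_add)
  next
    case (Cons z us)
    have c: "good_fun (contr z H)" if "good_fun H" for H
      unfolding good_fun_def contr_def
    proof (intro allI impI)
      fix us vs assume "set us \<subseteq> S" "set vs \<subseteq> S"
      then show "adm (\<lambda>e. H (z # us @ e # vs))"
        using that[unfolded good_fun_def, rule_format, of "z # us" vs] Cons.prems(1) by simp
    qed
    have g: "good_fun (grade_inv F)"
      unfolding good_fun_def
    proof (intro allI impI)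
      fix us vs assume "set us \<subseteq> S" "set vs \<subseteq> S"
      then have "adm (\<lambda>e. (- 1) ^ Suc (length us + length vs) *\<^sub>R F (us @ e # vs))"
        by (intro adm_scaleR Cons.prems(3)[unfolded good_fun_def, rule_format])
      then show "adm (\<lambda>e. grade_inv F (us @ e # vs))" by (simp add: grade_inv_def)
    qed
    have Cm': "contr z F ws \<in> Cm" "contr z G ws \<in> Cm" "grade_inv F ws \<in> Cm" for ws
      using Cons.prems(5,6) by (auto simp: contr_def grade_inv_def subspace_scale[OF subspace_Cm])
    have "set us \<subseteq> S" using Cons.prems(1) by simp
    note IH = Cons.IH[OF this vs]
    have "adm (\<lambda>e. shuf (contr z F) G (us @ e # vs))"
      by (intro IH c Cm' Cons.prems)
    moreover have "adm (\<lambda>e. shuf (grade_inv F) (contr z G) (us @ e # vs))"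
      by (intro IH c g Cm' Cons.prems)
    ultimately show ?case by (simp add: adm_add)
  qed
qed

lemma good_mult: "good X \<Longrightarrow> good Y \<Longrightarrow> good (X * Y)"
  unfolding good_def using TA.Cmv_mult good_fun_shuf by (auto simp: at_list_mult TA.Cmv_def)

lemma good_add: "good X \<Longrightarrow> good Y \<Longrightarrow> good (X + Y)"
  unfolding good_def good_fun_def using TA.Cmv_add adm_add by simp

lemma good_scaleR: "good X \<Longrightarrow> good (c *\<^sub>R X)"
  unfolding good_def good_fun_def using TA.Cmv_scale adm_scaleR by simp

lemma good_zero: "good 0"
  unfolding good_def good_fun_def using TA.Cmv_zero adm_zero by simp

lemma good_one: "good 1"
  unfolding good_def good_fun_def using TA.Cmv_one adm_zero by (simp add: unit_cochain_def)

lemma good_power: "good X \<Longrightarrow> good (X ^ n)"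
  by (induction n) (simp_all add: good_one good_mult)

lemma good_sum: "(\<And>i. i \<in> I \<Longrightarrow> good (X i)) \<Longrightarrow> good (\<Sum>i\<in>I. X i)"
  by (induction I rule: infinite_finite_induct) (auto intro: good_add good_zero)

lemma good_quad: "(\<And>t. good (X t)) \<Longrightarrow> good (quad n X)"
  unfolding quad_def by (intro good_sum good_scaleR)

lemma good_form:
  assumes "nlc nab0" "nlc nab1" shows "good (conn_cochain nab1 - conn_cochain nab0)"
proof -
  let ?a = "\<lambda>x. lift_conn nab1 x - lift_conn nab0 x"
  have eq: "at_list (conn_cochain nab1 - conn_cochain nab0) es = (case es of [x] \<Rightarrow> ?a x | _ \<Rightarrow> 0)" for es
    by (auto simp: one_cochain_def split: list.splits)
  have C: "TA.Cmv (conn_cochain nab1 - conn_cochain nab0)" by (rule TA.Cmv_form[OF is_form_diff[OF assms]])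
  have "?a x \<in> Cm" for x using C[unfolded TA.Cmv_def, rule_format, of "[x]"] by simp
  then have a: "adm ?a"
    unfolding adm_def using opd_diff[OF opd_conn[OF assms(2)] opd_conn[OF assms(1)]]
    by (blast intro: linear_compose_sub linear_lift_conn assms)
  have v: "at_list (conn_cochain nab1 - conn_cochain nab0) (us @ e # vs) =
      (if us = [] \<and> vs = [] then ?a else (\<lambda>e. 0)) e" for us vs e
    unfolding eq by (cases us; cases vs) (auto split: list.splits)
  have "adm (\<lambda>e. at_list (conn_cochain nab1 - conn_cochain nab0) (us @ e # vs))" for us vs
    unfolding v using a adm_zero by (cases "us = [] \<and> vs = []") simp_all
  then show ?thesis unfolding good_def good_fun_def using C by blast
qed

text \<open>The curvature has order at most two in each argument: products of two connection
  operators contribute one more than the order of a connection, and so do brackets.\<close>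

lemma good_curv:
  assumes n: "nlc nab" shows "good (curv brP (conn_cochain nab))"
proof -
  let ?w = "lift_conn nab" and ?R = "at_list (curv brP (conn_cochain nab))"
  have C: "TA.Cmv (curv brP (conn_cochain nab))" by (rule curvature_Cm[OF n])
  note lw = linear_lift_conn[OF n]
  have lb: "linear (\<lambda>e. brP e y)" "linear (brP y)" for y
    by (auto intro!: linearI simp: brP_def linear_add[OF PE(1)] linear_scale[OF PE(1)] br_add br_scaleR PE)
  have lin: "linear (\<lambda>e. ?R [e, y])" "linear (\<lambda>e. ?R [y, e])" for y
    unfolding at_list_curv
    by (auto intro!: linearI simp: linear_add[OF lw] linear_scale[OF lw] linear_add[OF lb(1)] linear_scale[OF lb(1)]
        linear_add[OF lb(2)] linear_scale[OF lb(2)] algebra_simps)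
  have o: "opd 2 (\<lambda>e. ?w e * ?w y)" "opd 2 (\<lambda>e. ?w y * ?w e)" for y
    using opd_mono[OF opd_right[OF opd_conn[OF n]], of 2] opd_conn_left[OF n opd_conn[OF n]] by (simp_all add: numeral_2_eq_2 del: opd.simps)
  have ob: "opd 2 (\<lambda>e. ?w (brP e y))" "opd 2 (\<lambda>e. ?w (brP y e))" for y
  proof -
    have "opd 2 (\<lambda>e. ?w (br e (PE y)))" "opd 2 (\<lambda>e. ?w (br (PE y) e))"
      using opd_bracket_left[OF PE(2) lw opd_conn[OF n], of y] opd_bracket_right[OF PE(2) lw opd_conn[OF n], of y]
      by (simp_all add: numeral_2_eq_2 del: opd.simps)
    note o = this
    show "opd 2 (\<lambda>e. ?w (brP e y))" by (rule opd_cong[OF _ o(1)]) (simp add: brP_def PE)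
    show "opd 2 (\<lambda>e. ?w (brP y e))" by (rule opd_cong[OF _ o(2)]) (simp add: brP_def PE)
  qed
  have "opd 2 (\<lambda>e. ?R [e, y])" "opd 2 (\<lambda>e. ?R [y, e])" for y
    unfolding at_list_curv by (intro opd_diff o ob)+
  then have a: "adm (\<lambda>e. ?R [e, y])" "adm (\<lambda>e. ?R [y, e])" for y
    using lin C unfolding adm_def TA.Cmv_def by blast+
  have "adm (\<lambda>e. ?R (us @ e # vs))" for us vs
  proof (cases us)
    case Nil
    then show ?thesis using a adm_zero by (cases vs rule: remdups_adj.cases) (auto simp: at_list_curv(1,2,4))
  next
    case (Cons x us')
    have "?R (x # y # zs @ e # vs) = 0" for y zs e by (cases zs) (simp_all add: at_list_curv(4))
    then show ?thesis using Cons a adm_zero by (cases us'; cases vs) (auto simp: at_list_curv(4))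
  qed
  then show ?thesis unfolding good_def good_fun_def using C by blast
qed

lemma diff_op_trace:
  "opd n Q \<Longrightarrow> (\<And>e. Q e \<in> Cm) \<Longrightarrow> diff_op_le n A E (\<lambda>e. tr (Q e))"
proof (induction n arbitrary: Q)
  case 0
  then show ?case by (simp add: tr_Mf)
next
  case (Suc n)
  have "diff_op_le n A E (\<lambda>e. tr (Q (f \<bullet>\<^sub>M e)) - f * tr (Q e))" if f: "f \<in> Cinf A" for f
  proof -
    have "diff_op_le n A E (\<lambda>e. tr (Q (f \<bullet>\<^sub>M e) - Mf f * Q e))"
      using Suc.prems f by (intro Suc.IH subspace_diff[OF subspace_Cm] Mf_mult_Cm) auto
    then show ?thesis using tr_Mf[OF f Suc.prems(2)] by (simp add: linear_diff[OF linear_tr])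
  qed
  then show ?case by simp
qed

lemma good_cochain:
  assumes "good X" shows "TA.trl X \<in> cochains A E k"
  unfolding cochains_def
proof (intro CollectI ballI conjI allI impI)
  have C: "at_list X es \<in> Cm" for es using assms by (simp add: good_def TA.Cmv_def)
  have smooth: "tr T \<in> Cinf A" if "T \<in> Cm" for T
    unfolding tr_Cm[OF that] by (rule trace_End_smooth[OF Cm_bundle_End[OF that]])
  fix es assume es: "es \<in> tuples k S"
  show "TA.trl X es \<in> Cinf A" unfolding TA.trl_def by (rule smooth[OF C])
  fix i assume i: "i < k"
  let ?Q = "\<lambda>e. at_list X (take i es @ e # drop (Suc i) es)"
  have u: "TA.trl X (es[i := e]) = tr (?Q e)" for e
    using es i by (simp add: TA.trl_def tuples_def upd_conv_take_nth_drop)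
  have "adm ?Q"
    using assms es set_take_subset[of i es] set_drop_subset[of "Suc i" es]
    unfolding good_def good_fun_def tuples_def by blast
  then obtain n where Q: "linear ?Q" "opd n ?Q" by (auto simp: adm_def)
  show "linear_between S (Cinf A) (\<lambda>e. TA.trl X (es[i := e]))"
    unfolding u linear_between_def using smooth[OF C] linear_add[OF Q(1)] linear_scale[OF Q(1)]
    by (simp add: linear_add[OF linear_tr] linear_scale[OF linear_tr])
  show "\<exists>n. diff_op_le n A E (\<lambda>e. TA.trl X (es[i := e]))"
    unfolding u using diff_op_trace[OF Q(2) C] by blast
qed

end

section \<open>Duality of connections and curvatures\<close>

context loday_setup
begin

lemma
  assumes e: "e \<in> S" and f: "f \<in> Cinf A"
  shows anchor_scaleR: "anchor_deriv \<rho> e (c *\<^sub>R f) = c *\<^sub>R anchor_deriv \<rho> e f"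
    and anchor_derivation:
      "h \<in> Cinf A \<Longrightarrow> anchor_deriv \<rho> e (f + h) = anchor_deriv \<rho> e f + anchor_deriv \<rho> e h"
      "h \<in> Cinf A \<Longrightarrow> anchor_deriv \<rho> e (f - h) = anchor_deriv \<rho> e f - anchor_deriv \<rho> e h"
      "h \<in> Cinf A \<Longrightarrow> anchor_deriv \<rho> e (f * h) = f * anchor_deriv \<rho> e h + h * anchor_deriv \<rho> e f"
proof -
  have T: "linear_between (Cinf A) UNIV (\<lambda>f. anchor_deriv \<rho> e f x)" for x
    using anchor_tangent[OF e, of x] unfolding tangent_space_def by simp
  show "anchor_deriv \<rho> e (f * h) = f * anchor_deriv \<rho> e h + h * anchor_deriv \<rho> e f" if "h \<in> Cinf A"
    using anchor_tangent[OF e] f that unfolding tangent_space_def by (simp add: fun_eq_iff)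
  have add: "anchor_deriv \<rho> e (f + h) = anchor_deriv \<rho> e f + anchor_deriv \<rho> e h" if "h \<in> Cinf A" for h
    using T f that by (simp add: linear_between_def fun_eq_iff)
  have scale: "anchor_deriv \<rho> e (c *\<^sub>R f) = c *\<^sub>R anchor_deriv \<rho> e f" if "f \<in> Cinf A" for f c
    using T that by (simp add: linear_between_def fun_eq_iff scaleR_fun_def)
  show "anchor_deriv \<rho> e (f + h) = anchor_deriv \<rho> e f + anchor_deriv \<rho> e h" if "h \<in> Cinf A" by (rule add[OF that])
  show "anchor_deriv \<rho> e (c *\<^sub>R f) = c *\<^sub>R anchor_deriv \<rho> e f" by (rule scale[OF f])
  show "anchor_deriv \<rho> e (f - h) = anchor_deriv \<rho> e f - anchor_deriv \<rho> e h" if h: "h \<in> Cinf A"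
    using add[OF subspace_scale[OF subspace_Cinf[OF manifold] h], of "-1"] scale[OF h, of "-1"] by simp
qed

section \<open>The pairing of sections and dual connections\<close>

definition pairing :: "('m \<Rightarrow> 'b) \<Rightarrow> ('m \<Rightarrow> 'b) \<Rightarrow> 'm \<Rightarrow> real" where
  "pairing s t = (\<lambda>x. g x (s x) (t x))"

lemmas section_closed = subspace_add[OF subspace_sections] subspace_diff[OF subspace_sections]
  subspace_scale[OF subspace_sections] sections_fscale

lemma pairing_simps:
  assumes "s \<in> \<Gamma>" "t \<in> \<Gamma>" "u \<in> \<Gamma>"
  shows "pairing (s + t) u = pairing s u + pairing t u" "pairing u (s + t) = pairing u s + pairing u t"
    "pairing (s - t) u = pairing s u - pairing t u" "pairing u (s - t) = pairing u s - pairing u t"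
    "pairing (c *\<^sub>R s) u = c *\<^sub>R pairing s u" "pairing u (c *\<^sub>R s) = c *\<^sub>R pairing u s"
    "pairing (f \<bullet>\<^sub>M s) u = f * pairing s u" "pairing u (f \<bullet>\<^sub>M s) = f * pairing u s"
  using assms[THEN sections_fibre] g_simps(3,4)[OF assms(3,1,1)[THEN sections_fibre]]
  by (auto simp: pairing_def fun_eq_iff g_simps fscale_def scaleR_fun_def)

lemma pairing_sym: "s \<in> \<Gamma> \<Longrightarrow> t \<in> \<Gamma> \<Longrightarrow> pairing s t = pairing t s"
  using sections_fibre g_sym by (auto simp: pairing_def fun_eq_iff)

lemma pairing_Cinf: "s \<in> \<Gamma> \<Longrightarrow> t \<in> \<Gamma> \<Longrightarrow> pairing s t \<in> Cinf A"
  unfolding pairing_def by (rule g_smooth)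

lemma pairing_eqI:
  "c \<in> \<Gamma> \<Longrightarrow> c' \<in> \<Gamma> \<Longrightarrow> (\<And>t. t \<in> \<Gamma> \<Longrightarrow> pairing c t = pairing c' t) \<Longrightarrow> c = c'"
  unfolding pairing_def by (rule section_eqI)

text \<open>Conjugation as a relation that constrains values on sections only. In this form it is
  symmetric on connections and passes to interpolations.\<close>

definition dual_conn :: "('m, 'e, 'b) conn \<Rightarrow> ('m, 'e, 'b) conn \<Rightarrow> bool" where
  "dual_conn nab nab' \<longleftrightarrow> (\<forall>e\<in>S. \<forall>s\<in>\<Gamma>. nab' e s \<in> \<Gamma> \<and>
     (\<forall>t\<in>\<Gamma>. pairing (nab' e s) t = anchor_deriv \<rho> e (pairing s t) - pairing s (nab e t)))"

lemma dual_connD: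
  assumes "dual_conn nab nab'" "e \<in> S" "s \<in> \<Gamma>"
  shows "nab' e s \<in> \<Gamma>" "t \<in> \<Gamma> \<Longrightarrow> pairing (nab' e s) t = anchor_deriv \<rho> e (pairing s t) - pairing s (nab e t)"
  using assms unfolding dual_conn_def by blast+

text \<open>Each axiom is checked by pairing with a test section, which suffices because g is
  nondegenerate.\<close>

lemma nlc_dual:
  assumes n: "nlc nab" and d: "dual_conn nab nab'" shows "nlc nab'"
proof -
  note sec = dual_connD(1)[OF d]
  note ss = dual_connD[OF d] pairing_simps section_closed pairing_Cinf nlc_section[OF n] nlc_add[OF n] nlc_scaleR[OF n]
    anchor_derivation anchor_scaleR EB.sections_fscale subspace_add[OF EB.subspace_sections] subspace_scale[OF EB.subspace_sections]
  have 1: "nab' e (s + s') = nab' e s + nab' e s'" if "e \<in> S" "s \<in> \<Gamma>" "s' \<in> \<Gamma>" for e s s'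
    by (rule pairing_eqI) (use that in \<open>simp_all add: ss algebra_simps\<close>)
  have 2: "nab' e (c *\<^sub>R s) = c *\<^sub>R nab' e s" if "e \<in> S" "s \<in> \<Gamma>" for e s c
    by (rule pairing_eqI) (use that in \<open>simp_all add: ss algebra_simps\<close>)
  have 3: "nab' (e + e') s = nab' e s + nab' e' s" if "e \<in> S" "e' \<in> S" "s \<in> \<Gamma>" for e e' s
    by (rule pairing_eqI) (use that in \<open>simp_all add: ss anchor_add algebra_simps\<close>)
  have 4: "nab' (c *\<^sub>R e) s = c *\<^sub>R nab' e s" if "e \<in> S" "s \<in> \<Gamma>" for e s c
  proof -
    have "anchor_deriv \<rho> (c *\<^sub>R e) f = c *\<^sub>R anchor_deriv \<rho> e f" for f
      using anchor_linear EB.sections_fibre[OF that(1)]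
      by (auto simp: anchor_deriv_def linear_between_def fun_eq_iff scaleR_fun_def)
    then show ?thesis
      by (intro pairing_eqI) (use that in \<open>simp_all add: ss algebra_simps\<close>)
  qed
  have 5: "nab' e (f \<bullet>\<^sub>M s) = f \<bullet>\<^sub>M nab' e s + anchor_deriv \<rho> e f \<bullet>\<^sub>M s" if "f \<in> Cinf A" "e \<in> S" "s \<in> \<Gamma>" for f e s
    by (rule pairing_eqI) (use that in \<open>simp_all add: ss anchor_Cinf algebra_simps\<close>)
  have 6: "nab' (f \<bullet>\<^sub>M h \<bullet>\<^sub>M e) s - f \<bullet>\<^sub>M nab' (h \<bullet>\<^sub>M e) s = h \<bullet>\<^sub>M (nab' (f \<bullet>\<^sub>M e) s - f \<bullet>\<^sub>M nab' e s)"
    if f: "f \<in> Cinf A" and h: "h \<in> Cinf A" and e: "e \<in> S" and s: "s \<in> \<Gamma>" for f h e s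
  proof (rule pairing_eqI)
    fix t assume t: "t \<in> \<Gamma>"
    note m = f h e s t EB.sections_fscale[OF f e] EB.sections_fscale[OF h e] EB.sections_fscale[OF f EB.sections_fscale[OF h e]]
    have "nab (f \<bullet>\<^sub>M h \<bullet>\<^sub>M e) t = h \<bullet>\<^sub>M (nab (f \<bullet>\<^sub>M e) t - f \<bullet>\<^sub>M nab e t) + f \<bullet>\<^sub>M nab (h \<bullet>\<^sub>M e) t"
      using nlc_order[OF n f h e t] by (simp add: algebra_simps)
    then show "pairing (nab' (f \<bullet>\<^sub>M h \<bullet>\<^sub>M e) s - f \<bullet>\<^sub>M nab' (h \<bullet>\<^sub>M e) s) t =
        pairing (h \<bullet>\<^sub>M (nab' (f \<bullet>\<^sub>M e) s - f \<bullet>\<^sub>M nab' e s)) t"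
      using m by (simp add: ss anchor_fscale algebra_simps)
  qed (use f h e s in \<open>simp_all add: ss\<close>)
  show ?thesis
    unfolding nlc_def bilinear_on_sections_def linear_between_def using sec 1 2 3 4 5 6 by simp
qed

lemma dual_conjugate:
  assumes n: "nlc nab" shows "dual_conn nab (Defs.conjugate A \<rho> B g nab)"
  unfolding dual_conn_def
proof (intro ballI)
  fix e s assume e: "e \<in> S" and s: "s \<in> \<Gamma>"
  have c: "Defs.conjugate A \<rho> B g nab e s = conj_op (anchor_deriv \<rho> e) (nab e) s"
    by (simp add: Defs.conjugate_def conj_op_def)
  note sp = conj_op_spec[OF nlc_covariant[OF n e] s]
  show "Defs.conjugate A \<rho> B g nab e s \<in> \<Gamma> \<and> (\<forall>t\<in>\<Gamma>. pairing (Defs.conjugate A \<rho> B g nab e s) t =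
      anchor_deriv \<rho> e (pairing s t) - pairing s (nab e t))"
    unfolding c using sp by (simp add: pairing_def)
qed

lemma dual_conn_sym:
  assumes n: "nlc nab" and d: "dual_conn nab nab'" shows "dual_conn nab' nab"
  unfolding dual_conn_def
proof (intro ballI conjI)
  fix e s assume e: "e \<in> S" and s: "s \<in> \<Gamma>"
  show "nab e s \<in> \<Gamma>" by (rule nlc_section[OF n e s])
  fix t assume t: "t \<in> \<Gamma>"
  show "pairing (nab e s) t = anchor_deriv \<rho> e (pairing s t) - pairing s (nab' e t)"
    using dual_connD[OF d e t] s pairing_sym[OF s t] pairing_sym[OF s dual_connD(1)[OF d e t]]
      pairing_sym[OF t nlc_section[OF n e s]] by simp
qed

text \<open>Expanding the pairings leaves second derivatives of the pairing of s and t along the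
  anchor, and these cancel by \<open>anchor_bracket\<close>.\<close>

lemma dual_curvature:
  assumes n: "nlc nab" and d: "dual_conn nab nab'" and x: "x \<in> S" and y: "y \<in> S" and s: "s \<in> \<Gamma>" and t: "t \<in> \<Gamma>"
  shows "pairing (curvature br nab' x y s) t = - pairing s (curvature br nab x y t)"
proof -
  note ss = dual_connD[OF d] pairing_simps section_closed pairing_Cinf nlc_section[OF n] anchor_derivation anchor_Cinf
    br_section anchor_bracket
  show ?thesis unfolding curvature_def using x y s t by (simp add: ss algebra_simps)
qed

lemma flat_dual:
  assumes n: "nlc nab" and d: "dual_conn nab nab'" and f: "flat A E br B nab"
  shows "flat A E br B nab'"
  unfolding flat_def
proof (intro ballI)
  fix x y s assume x: "x \<in> S" and y: "y \<in> S" and s: "s \<in> \<Gamma>"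
  note sec = nlc_section[OF nlc_dual[OF n d]]
  show "curvature br nab' x y s = 0"
  proof (rule pairing_eqI)
    show "curvature br nab' x y s \<in> \<Gamma>" unfolding curvature_def
      by (intro section_closed sec br_section x y s)
    show "0 \<in> \<Gamma>" by (rule subspace_0[OF subspace_sections])
    fix t assume t: "t \<in> \<Gamma>"
    have "pairing s 0 = 0" "pairing 0 t = 0"
      using pairing_simps(5,6)[OF t t s, of 0] pairing_simps(5,6)[OF s s t, of 0] by simp_all
    then show "pairing (curvature br nab' x y s) t = pairing 0 t"
      using dual_curvature[OF n d x y s t] f x y t unfolding flat_def by simp
  qed
qed

section \<open>Adjoint endomorphisms and adjoint cochains\<close>

definition adj :: "('m \<Rightarrow> 'b) endo \<Rightarrow> ('m \<Rightarrow> 'b) endo \<Rightarrow> bool" where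
  "adj T U \<longleftrightarrow> T \<in> Cm \<and> U \<in> Cm \<and> (\<forall>s\<in>\<Gamma>. \<forall>t\<in>\<Gamma>. pairing (app T s) t = pairing s (app U t))"

lemma adj_add: "adj T U \<Longrightarrow> adj T' U' \<Longrightarrow> adj (T + T') (U + U')"
  unfolding adj_def by (simp add: pairing_simps Cm_section subspace_add[OF subspace_Cm])

lemma adj_scaleR: "adj T U \<Longrightarrow> adj (c *\<^sub>R T) (c *\<^sub>R U)"
  unfolding adj_def by (simp add: pairing_simps Cm_section subspace_scale[OF subspace_Cm])

lemma adj_mult: "adj T U \<Longrightarrow> adj T' U' \<Longrightarrow> adj (T * T') (U' * U)"
  unfolding adj_def by (simp add: Cm_section TA.Cm_mult)

lemma adj_zero: "adj 0 0"
  using subspace_0[OF subspace_Cm] pairing_simps(5,6)[of _ _ _ 0] by (simp add: adj_def)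

lemma adj_tr: "adj T U \<Longrightarrow> tr T = tr U"
  unfolding adj_def using trace_adjoint[OF Cm_bundle_End Cm_bundle_End, of T U]
  by (simp add: tr_Cm adjoint_pair_def pairing_def fun_eq_iff)

definition adjc ::
  "('m \<Rightarrow> 'e, ('m \<Rightarrow> 'b) endo) shuffle_cochain \<Rightarrow> ('m \<Rightarrow> 'e, ('m \<Rightarrow> 'b) endo) shuffle_cochain \<Rightarrow> bool" where
  "adjc X Y \<longleftrightarrow> (\<forall>es. adj (at_list X es) (at_list Y es))"

lemma adjc_trl: "adjc X Y \<Longrightarrow> TA.trl X es = TA.trl Y es"
  unfolding adjc_def TA.trl_def using adj_tr by blast

text \<open>Adjoints reverse compositions of values, and reversing the arguments of a shuffle
  product costs the Koszul sign; both are \<open>shuf_swap\<close> for the relation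
  \<open>adj\<close>.\<close>

lemma adjc_mult:
  assumes "adjc X X'" "adjc Y Y'" "grade X = (-1) ^ p *\<^sub>R X" "grade X' = (-1) ^ p *\<^sub>R X'"
    "grade Y = (-1) ^ q *\<^sub>R Y" "grade Y' = (-1) ^ q *\<^sub>R Y'"
  shows "adjc (X * Y) ((-1) ^ (p * q) *\<^sub>R (Y' * X'))"
proof -
  have g: "grade_inv (at_list Z) = (\<lambda>es. (-1) ^ r *\<^sub>R at_list Z es)" if "grade Z = (-1) ^ r *\<^sub>R Z"
    for Z :: "('m \<Rightarrow> 'e, ('m \<Rightarrow> 'b) endo) shuffle_cochain" and r
    using arg_cong[OF that, of at_list] by (simp add: at_list_eta at_list_grade fun_eq_iff)
  show ?thesis unfolding adjc_def
  proof
    fix es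
    have "adj (shuf (at_list X) (at_list Y) es) ((-1) ^ (p * q) *\<^sub>R shuf (at_list Y') (at_list X') es)"
      by (rule shuf_swap[where Q = adj, OF adj_add adj_scaleR _ g g g g])
        (use assms in \<open>auto simp: adjc_def intro: adj_mult\<close>)
    then show "adj (at_list (X * Y) es) (at_list ((-1) ^ (p * q) *\<^sub>R (Y' * X')) es)" by (simp add: at_list_mult)
  qed
qed

lemma adjc_power:
  assumes "adjc X X'" "grade X = X" "grade X' = X'" shows "adjc (X ^ n) (X' ^ n)"
proof (induction n)
  case 0
  have "adj 1 1" by (simp add: adj_def TA.Cm_one)
  then show ?case using adj_zero by (simp add: adjc_def unit_cochain_def)
next
  case (Suc n)
  have "adjc (X * X ^ n) ((-1) ^ (0 * 0) *\<^sub>R (X' ^ n * X'))"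
    by (rule adjc_mult[OF assms(1) Suc]) (simp_all add: assms TA.grade_power)
  then show ?case by (simp add: power_commutes)
qed

lemma adjc_curv:
  assumes n: "nlc nab" and d: "dual_conn nab nab'"
  shows "adjc (curv brP (conn_cochain nab')) (- curv brP (conn_cochain nab))"
  unfolding adjc_def
proof
  fix es
  note n' = nlc_dual[OF n d]
  have C: "at_list (curv brP (conn_cochain nab)) us \<in> Cm" "at_list (curv brP (conn_cochain nab')) us \<in> Cm" for us
    using curvature_Cm[OF n] curvature_Cm[OF n'] by (auto simp: TA.Cmv_def)
  have C': "at_list (- curv brP (conn_cochain nab)) us \<in> Cm" for us
    using subspace_scale[OF subspace_Cm C(1), of "-1"] by simp
  have two: "adj (at_list (curv brP (conn_cochain nab')) [x, y]) (at_list (- curv brP (conn_cochain nab)) [x, y])" for x y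
  proof -
    have "pairing (app (at_list (curv brP (conn_cochain nab')) [x, y]) s) t =
        pairing s (app (at_list (- curv brP (conn_cochain nab)) [x, y]) t)" if s: "s \<in> \<Gamma>" and t: "t \<in> \<Gamma>" for s t
    proof -
      have K: "curvature br nab (PE x) (PE y) t \<in> \<Gamma>"
        using Cm_section[OF C(1) t, of "[x, y]"] unfolding curvature_value[OF n] PB(3)[OF t] .
      have "app (at_list (- curv brP (conn_cochain nab)) [x, y]) t = (-1) *\<^sub>R curvature br nab (PE x) (PE y) t"
        using curvature_value[OF n, of x y t] PB(3)[OF t] by simp
      then show ?thesis
        using dual_curvature[OF n d PE(2) PE(2) s t, of x y] pairing_simps(6)[OF K K s, of "-1"]
        unfolding curvature_value[OF n'] PB(3)[OF s] by simp
    qed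
    then show ?thesis unfolding adj_def using C(2) C' by blast
  qed
  show "adj (at_list (curv brP (conn_cochain nab')) es) (at_list (- curv brP (conn_cochain nab)) es)"
    using two adj_zero by (cases es rule: remdups_adj.cases; cases "tl (tl es)") (auto simp: at_list_curv)
qed

lemma adjc_form:
  assumes n: "nlc nab0" "nlc nab1" and d: "dual_conn nab0 nab0'" "dual_conn nab1 nab1'"
  shows "adjc (conn_cochain nab1' - conn_cochain nab0') (- (conn_cochain nab1 - conn_cochain nab0))"
  unfolding adjc_def
proof
  fix es
  note n' = nlc_dual[OF n(1) d(1)] nlc_dual[OF n(2) d(2)]
  let ?a = "conn_cochain nab1 - conn_cochain nab0" and ?b = "conn_cochain nab1' - conn_cochain nab0'"
  have C: "at_list ?a us \<in> Cm" "at_list ?b us \<in> Cm" for us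
    using TA.Cmv_form[OF is_form_diff[OF n]] TA.Cmv_form[OF is_form_diff[OF n']] by (auto simp: TA.Cmv_def)
  have C': "at_list (- ?a) us \<in> Cm" for us using subspace_scale[OF subspace_Cm C(1), of "-1"] by simp
  have one: "adj (at_list ?b [x]) (at_list (- ?a) [x])" for x
  proof -
    have "pairing (app (at_list ?b [x]) s) t = pairing s (app (at_list (- ?a) [x]) t)"
      if s: "s \<in> \<Gamma>" and t: "t \<in> \<Gamma>" for s t
      using s t PE(2)[of x]
      by (simp add: app_lift_conn n n' PB dual_connD[OF d(1)] dual_connD[OF d(2)] pairing_simps section_closed nlc_section[OF n(1)] nlc_section[OF n(2)])
    then show ?thesis unfolding adj_def using C(2) C' by blast
  qed
  show "adj (at_list ?b es) (at_list (- ?a) es)"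
    using one adj_zero by (cases es rule: remdups_adj.cases) (simp_all add: at_list_one_cochain)
qed

lemma trl_dual_power:
  assumes n: "nlc nab" and d: "dual_conn nab nab'"
  shows "TA.trl (curv brP (conn_cochain nab') ^ m) es = (-1) ^ m *\<^sub>R TA.trl (curv brP (conn_cochain nab) ^ m) es"
proof -
  let ?F = "curv brP (conn_cochain nab)"
  have g: "grade ?F = ?F" "grade (curv brP (conn_cochain nab')) = curv brP (conn_cochain nab')"
    by (intro TA.grade_curv is_conn n nlc_dual[OF n d])+
  have p: "(- ?F) ^ m = (-1) ^ m *\<^sub>R ?F ^ m" by (induction m) simp_all
  have "adjc (curv brP (conn_cochain nab') ^ m) ((- ?F) ^ m)"
    by (rule adjc_power[OF adjc_curv[OF n d]]) (simp_all add: g grade_simps)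
  then show ?thesis unfolding p by (simp add: adjc_trl TA.trl_scale)
qed

text \<open>The form passes to minus its adjoint and each curvature factor to minus its adjoint,
  giving the sign (-1)^(m+1). Reversal adds no sign since curvature powers are even, and cyclicity
  brings the form back to the front.\<close>

lemma trl_dual_form:
  assumes n: "nlc nab0" "nlc nab1" "nlc nab" and d: "dual_conn nab0 nab0'" "dual_conn nab1 nab1'" "dual_conn nab nab'"
  shows "TA.trl ((conn_cochain nab1' - conn_cochain nab0') * curv brP (conn_cochain nab') ^ m) es =
    (-1) ^ Suc m *\<^sub>R TA.trl ((conn_cochain nab1 - conn_cochain nab0) * curv brP (conn_cochain nab) ^ m) es"
proof -
  define a where "a = conn_cochain nab1 - conn_cochain nab0"
  define b where "b = conn_cochain nab1' - conn_cochain nab0'"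
  define F where "F = curv brP (conn_cochain nab)"
  define F' where "F' = curv brP (conn_cochain nab')"
  note n' = nlc_dual[OF n(1) d(1)] nlc_dual[OF n(2) d(2)]
  have g: "grade F = F" "grade F' = F'"
    unfolding F_def F'_def by (intro TA.grade_curv is_conn n nlc_dual[OF n(3) d(3)])+
  have ga: "grade a = - a" "grade b = - b"
    unfolding a_def b_def by (intro TA.grade_form is_form_diff n n')+
  have p: "(- F) ^ m = (-1) ^ m *\<^sub>R F ^ m" by (induction m) simp_all
  have "adjc F' (- F)" unfolding F_def F'_def by (rule adjc_curv[OF n(3) d(3)])
  then have "adjc (F' ^ m) ((- F) ^ m)" by (rule adjc_power) (simp_all add: g grade_simps)
  moreover have "adjc b (- a)" unfolding a_def b_def by (intro adjc_form n d)
  ultimately have "adjc (b * F' ^ m) ((-1) ^ (1 * 0) *\<^sub>R ((- F) ^ m * (- a)))"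
    by (intro adjc_mult) (simp_all add: ga grade_simps TA.grade_power g)
  then have "TA.trl (b * F' ^ m) es = TA.trl ((-1) ^ Suc m *\<^sub>R (F ^ m * a * F ^ 0)) es"
    unfolding p by (simp add: adjc_trl)
  also have "\<dots> = (-1) ^ Suc m *\<^sub>R TA.trl (F ^ m * a * F ^ 0) es" by (rule TA.trl_scale)
  also have "TA.trl (F ^ m * a * F ^ 0) es = TA.trl (a * F ^ m) es"
    using TA.trl_cycle_power[OF is_conn[OF n(3)] TA.Cmv_form[OF is_form_diff[OF n(1,2)]], of 1 m 0 es] ga(1)
    by (simp add: a_def F_def)
  finally show ?thesis unfolding a_def b_def F_def F'_def .
qed

end

section \<open>Chern--Simons cochains as traces\<close>

lemma integral_reflect_unit:
  fixes f :: "real \<Rightarrow> real"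
  assumes "continuous_on UNIV f" shows "integral {0..1} (\<lambda>t. f (1 - t)) = integral {0..1} f"
proof -
  have "(f has_integral integral {0..1} f) (cbox 0 1)"
    using integrable_integral[OF integrable_continuous_real[OF continuous_on_subset[OF assms]], of 0 1] by simp
  from has_integral_affinity[OF this, of "-1" 1]
  have "((\<lambda>t. f (1 - t)) has_integral integral {0..1} f) ((\<lambda>x. 1 - x) ` {0..1})" by (simp add: algebra_simps)
  moreover have "(\<lambda>x::real. 1 - x) ` {0..1} = {0..1}" by simp
  ultimately show ?thesis by (simp add: integral_unique)
qed

lemma integral_half_symmetric:
  fixes f :: "real \<Rightarrow> real"
  assumes c: "continuous_on UNIV f" and s: "\<And>t. f (1 - t) = f t"
  shows "integral {0..1} (\<lambda>t. f (t / 2)) = integral {0..1} f"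
proof -
  have i: "(f has_integral integral {a..b} f) {a..b}" for a b
    using integrable_integral[OF integrable_continuous_real[OF continuous_on_subset[OF c]]] by simp
  have "((\<lambda>t. f (t / 2)) has_integral 2 * integral {0..1/2} f) {0..1}"
    using has_integral_affinity'[of f "integral {0..1/2} f" 0 "1/2" "1/2" 0] i[of 0 "1/2"] by simp
  then have "integral {0..1} (\<lambda>t. f (t / 2)) = 2 * integral {0..1/2} f" by (rule integral_unique)
  moreover have "integral {1/2..1} f = integral {0..1/2} f"
  proof -
    have "((\<lambda>t. f (1 - t)) has_integral integral {0..1/2} f) ((\<lambda>x. 1 - x) ` {0..1/2})"
      using has_integral_affinity[of f _ 0 "1/2" "-1" 1] i[of 0 "1/2"] by (simp add: algebra_simps)
    moreover have "(\<lambda>x::real. 1 - x) ` {0..1/2} = {1/2..1}" by simp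
    ultimately show ?thesis by (simp add: s integral_unique)
  qed
  moreover have "integral {0..1/2} f + integral {1/2..1} f = integral {0..1} f"
    by (rule Henstock_Kurzweil_Integration.integral_combine)
      (auto intro: integrable_continuous_real continuous_on_subset[OF c])
  ultimately show ?thesis by simp
qed

text \<open>Up to the copies of y, a permuted list is determined by the new position of x.\<close>

lemma permuted_distinguished_list:
  assumes t: "\<tau> permutes {..<Suc n}"
  shows "inv_into UNIV \<tau> 0 \<le> n"
    "map (\<lambda>i. (x # replicate n y) ! \<tau> i) [0..<Suc n] = replicate (inv_into UNIV \<tau> 0) y @ x # replicate (n - inv_into UNIV \<tau> 0) y"
proof -
  let ?k = "inv_into UNIV \<tau> 0"
  have k: "?k \<in> {..<Suc n}" using permutes_in_image[OF permutes_inv[OF t], of 0] by simp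
  then show kn: "?k \<le> n" by simp
  have inv: "\<tau> i = 0 \<longleftrightarrow> i = ?k" for i using permutes_inverses[OF t] by metis
  have lt: "\<tau> i < Suc n" if "i < Suc n" for i using permutes_in_image[OF t, of i] that by simp
  show "map (\<lambda>i. (x # replicate n y) ! \<tau> i) [0..<Suc n] = replicate ?k y @ x # replicate (n - ?k) y"
  proof (rule nth_equalityI)
    show "length (map (\<lambda>i. (x # replicate n y) ! \<tau> i) [0..<Suc n]) = length (replicate ?k y @ x # replicate (n - ?k) y)"
      using kn by simp
    fix i assume "i < length (map (\<lambda>i. (x # replicate n y) ! \<tau> i) [0..<Suc n])"
    then have i: "i < Suc n" by simp
    have "i \<noteq> ?k \<Longrightarrow> \<tau> i - Suc 0 < n" using lt[OF i] inv[of i] by (cases "\<tau> i") auto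
    then have "map (\<lambda>i. (x # replicate n y) ! \<tau> i) [0..<Suc n] ! i = (if i = ?k then x else y)"
      using lt[OF i] inv[of i] i by (simp add: nth_Cons' del: upt_Suc)
    also have "\<dots> = (replicate ?k y @ x # replicate (n - ?k) y) ! i"
      using i kn by (auto simp: nth_append nth_Cons')
    finally show "map (\<lambda>i. (x # replicate n y) ! \<tau> i) [0..<Suc n] ! i = (replicate ?k y @ x # replicate (n - ?k) y) ! i" .
  qed
qed

lemma fst_diamonds: "fst (diamonds Ds) = sum_list (map fst Ds)"
  by (induction Ds) (simp_all add: diamonds_def diamond_def split_beta)

lemma list_all2_replicateI: "P x y \<Longrightarrow> list_all2 P (replicate n x) (replicate n y)"
  by (induction n) simp_all

text \<open>At most one entry has odd degree, so every inversion involves an even degree.\<close>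

lemma koszul_sign_one:
  assumes t: "\<tau> permutes {..<n}" and e: "\<And>i. i \<noteq> 0 \<Longrightarrow> i < n \<Longrightarrow> even (deg i)"
  shows "koszul_sign deg n \<tau> = 1"
  unfolding koszul_sign_def
proof (intro prod.neutral ballI)
  fix ij assume "ij \<in> {(i, j). i < j \<and> j < n \<and> \<tau> j < \<tau> i}"
  then obtain i j where ij: "ij = (i, j)" "i < j" "j < n" "\<tau> j < \<tau> i" by blast
  then have "even (deg (\<tau> i))" using permutes_in_image[OF t, of i] by (intro e) auto
  then show "(case ij of (i, j) \<Rightarrow> (- 1) ^ (deg (\<tau> i) * deg (\<tau> j))) = (1 :: real)" by (simp add: ij)
qed

lemma interpolate_apply: "interpolate \<nu> \<nu>' t e b = (1 - t) *\<^sub>R \<nu> e b + t *\<^sub>R \<nu>' e b"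
  by (simp add: interpolate_def scaleR_fun_def[of _ \<nu>] scaleR_fun_def[of _ \<nu>'] scaleR_fun_def[of _ "\<nu> e"] scaleR_fun_def[of _ "\<nu>' e"])

context loday_setup
begin

lemma represents_difference:
  assumes n: "nlc nab0" "nlc nab1"
  shows "represents S \<Gamma> (1, \<lambda>es. (nab1 - nab0) (es ! 0)) (conn_cochain nab1 - conn_cochain nab0)"
  unfolding represents_def fst_conv snd_conv
proof (intro conjI allI impI ballI)
  show "at_list (conn_cochain nab1 - conn_cochain nab0) es = 0" if "length es \<noteq> 1" for es
    using that by (cases es rule: remdups_adj.cases) (simp_all add: at_list_one_cochain)
  fix es b assume "es \<in> tuples 1 S" and b: "b \<in> \<Gamma>"
  then obtain x where x: "es = [x]" "x \<in> S" by (auto simp: tuples_def length_Suc_conv)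
  show "(nab1 - nab0) (es ! 0) b = app (at_list (conn_cochain nab1 - conn_cochain nab0) es) b"
    "(nab1 - nab0) (es ! 0) b \<in> \<Gamma>"
    using x b by (simp_all add: app_lift_conn n PB PE nlc_section[OF n(1)] nlc_section[OF n(2)] section_closed)
qed

lemma represents_curvature:
  assumes n: "nlc nab"
  shows "represents S \<Gamma> (2, \<lambda>es. curvature br nab (es ! 0) (es ! 1)) (curv brP (conn_cochain nab))"
  unfolding represents_def fst_conv snd_conv
proof (intro conjI allI impI ballI)
  show "at_list (curv brP (conn_cochain nab)) es = 0" if "length es \<noteq> 2" for es
    using that by (cases es rule: remdups_adj.cases; cases "tl (tl es)") (auto simp: at_list_curv)
  fix es b assume "es \<in> tuples 2 S" and b: "b \<in> \<Gamma>"
  then obtain x y where x: "es = [x, y]" "x \<in> S" "y \<in> S"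
    by (auto simp: tuples_def numeral_2_eq_2 length_Suc_conv)
  show "curvature br nab (es ! 0) (es ! 1) b = app (at_list (curv brP (conn_cochain nab)) es) b"
    using x b by (simp add: curvature_value[OF n] PE PB)
  show "curvature br nab (es ! 0) (es ! 1) b \<in> \<Gamma>"
    using x b unfolding curvature_def by (simp add: nlc_section[OF n] section_closed br_section)
qed

text \<open>All (m + 1)! terms of the symmetrisation have Koszul sign 1, and cyclicity moves the
  form to the front in each of them, so they have the same trace.\<close>

lemma trace_odot:
  assumes n: "nlc nab0" "nlc nab1" "nlc nab" and es: "es \<in> tuples (2 * m + 1) S"
  shows "trace_End A B (odot ((1, \<lambda>es. (nab1 - nab0) (es ! 0)) #
      replicate m (2, \<lambda>es. curvature br nab (es ! 0) (es ! 1))) es) =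
    fact (Suc m) *\<^sub>R TA.trl ((conn_cochain nab1 - conn_cochain nab0) * curv brP (conn_cochain nab) ^ m) es"
proof -
  define a where "a = conn_cochain nab1 - conn_cochain nab0"
  define F where "F = curv brP (conn_cochain nab)"
  define D1 where "D1 = (1::nat, \<lambda>es. (nab1 - nab0) (es ! 0))"
  define D2 where "D2 = (2::nat, \<lambda>es. curvature br nab (es ! 0) (es ! 1))"
  let ?P = "{\<tau>. \<tau> permutes {..<Suc m}}"
  let ?X = "\<lambda>\<tau>. F ^ inv_into UNIV \<tau> 0 * a * F ^ (m - inv_into UNIV \<tau> 0)"
  have CF: "TA.Cmv F" and Ca: "TA.Cmv a" and ga: "grade a = (-1) ^ 1 *\<^sub>R a"
    unfolding a_def F_def using curvature_Cm[OF n(3)] TA.Cmv_form[OF is_form_diff[OF n(1,2)]]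
      TA.grade_form[OF is_form_diff[OF n(1,2)]] by simp_all
  have CX: "TA.Cmv (?X \<tau>)" for \<tau> by (intro TA.Cmv_mult TA.Cmv_power CF Ca)
  have diam: "snd (diamonds (map (\<lambda>i. (D1 # replicate m D2) ! \<tau> i) [0..<Suc m])) es b = app (at_list (?X \<tau>) es) b"
    if \<tau>: "\<tau> permutes {..<Suc m}" and b: "b \<in> \<Gamma>" for \<tau> b
  proof -
    note kl = permuted_distinguished_list[OF \<tau>]
    let ?Ds = "replicate (inv_into UNIV \<tau> 0) D2 @ D1 # replicate (m - inv_into UNIV \<tau> 0) D2"
    have "list_all2 (represents S \<Gamma>) ?Ds (replicate (inv_into UNIV \<tau> 0) F @ a # replicate (m - inv_into UNIV \<tau> 0) F)"
      unfolding D1_def D2_def a_def F_def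
      by (intro list_all2_appendI list_all2_replicateI list.rel_intros represents_difference represents_curvature n)
    from represents_diamonds[OF subspace_sections this]
    have R: "represents S \<Gamma> (diamonds ?Ds) (?X \<tau>)" by (simp add: mult.assoc)
    have "fst (diamonds ?Ds) = 2 * m + 1"
      using kl(1) by (simp add: fst_diamonds D1_def D2_def sum_list_replicate)
    then show ?thesis using R es b unfolding represents_def kl(2) by metis
  qed
  have od: "odot (D1 # replicate m D2) es b = app (at_list (\<Sum>\<tau>\<in>?P. ?X \<tau>) es) b" if b: "b \<in> \<Gamma>" for b
  proof -
    have k: "koszul_sign (\<lambda>i. fst ((D1 # replicate m D2) ! i)) (Suc m) \<tau> = 1" if "\<tau> \<in> ?P" for \<tau>
      by (rule koszul_sign_one) (use that in \<open>auto simp: nth_Cons' D2_def\<close>)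
    have "odot (D1 # replicate m D2) es b =
        (\<Sum>\<tau>\<in>?P. snd (diamonds (map (\<lambda>i. (D1 # replicate m D2) ! \<tau> i) [0..<Suc m])) es b)"
      unfolding odot_def list.size(4) length_replicate add_Suc_right add_0_right sum_apply[of _ _ b]
      using k by (intro sum.cong) (simp_all add: scaleR_fun_def del: upt_Suc)
    also have "\<dots> = (\<Sum>\<tau>\<in>?P. app (at_list (?X \<tau>) es) b)" using diam b by (intro sum.cong) simp_all
    also have "\<dots> = app (at_list (\<Sum>\<tau>\<in>?P. ?X \<tau>) es) b"
    proof -
      have "linear (\<lambda>X. app (at_list X es) b)" by (intro linearI) simp_all
      then show ?thesis by (rule linear_sum[symmetric])
    qed
    finally show ?thesis .
  qed
  have inC: "at_list (\<Sum>\<tau>\<in>?P. ?X \<tau>) es \<in> Cm"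
    unfolding at_list_sum by (intro subspace_sum[OF subspace_Cm] CX[unfolded TA.Cmv_def, rule_format])
  have "trace_End A B (odot (D1 # replicate m D2) es) = TA.trl (\<Sum>\<tau>\<in>?P. ?X \<tau>) es"
    unfolding TA.trl_def tr_Cm[OF inC] by (rule trace_End_cong) (rule od)
  also have "\<dots> = (\<Sum>\<tau>\<in>?P. TA.trl (?X \<tau>) es)" by (rule TA.trl_sum)
  also have "\<dots> = (\<Sum>\<tau>\<in>?P. TA.trl (a * F ^ m) es)"
    using TA.trl_cycle_power[OF is_conn[OF n(3)] Ca ga] permuted_distinguished_list(1)
    by (intro sum.cong) (simp_all add: F_def)
  also have "\<dots> = fact (Suc m) *\<^sub>R TA.trl (a * F ^ m) es"
    by (simp only: sum_constant_scaleR card_permutations[OF card_lessThan finite_lessThan] of_nat_fact)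
  finally show ?thesis unfolding a_def F_def D1_def D2_def .
qed

lemma nlc_interpolate:
  assumes n: "nlc nab0" "nlc nab1" shows "nlc (interpolate nab0 nab1 t)"
proof -
  note ss = nlc_section[OF n(1)] nlc_section[OF n(2)] nlc_add[OF n(1)] nlc_add[OF n(2)] nlc_scaleR[OF n(1)] nlc_scaleR[OF n(2)]
    nlc_leibniz[OF n(1)] nlc_leibniz[OF n(2)] section_closed EB.sections_fscale
  note i = interpolate_apply[of nab0 nab1 t]
  have "interpolate nab0 nab1 t (f \<bullet>\<^sub>M h \<bullet>\<^sub>M e) b - f \<bullet>\<^sub>M interpolate nab0 nab1 t (h \<bullet>\<^sub>M e) b =
      h \<bullet>\<^sub>M (interpolate nab0 nab1 t (f \<bullet>\<^sub>M e) b - f \<bullet>\<^sub>M interpolate nab0 nab1 t e b)"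
    if "f \<in> Cinf A" "h \<in> Cinf A" "e \<in> S" "b \<in> \<Gamma>" for f h e b
  proof -
    have "interpolate nab0 nab1 t (f \<bullet>\<^sub>M h \<bullet>\<^sub>M e) b - f \<bullet>\<^sub>M interpolate nab0 nab1 t (h \<bullet>\<^sub>M e) b =
      (1 - t) *\<^sub>R (nab0 (f \<bullet>\<^sub>M h \<bullet>\<^sub>M e) b - f \<bullet>\<^sub>M nab0 (h \<bullet>\<^sub>M e) b) + t *\<^sub>R (nab1 (f \<bullet>\<^sub>M h \<bullet>\<^sub>M e) b - f \<bullet>\<^sub>M nab1 (h \<bullet>\<^sub>M e) b)"
      by (simp add: i fscale_simps scaleR_diff_right)
    then show ?thesis unfolding nlc_order[OF n(1) that] nlc_order[OF n(2) that] by (simp add: i fscale_simps scaleR_diff_right)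
  qed
  moreover have "interpolate nab0 nab1 t e (f \<bullet>\<^sub>M b) = f \<bullet>\<^sub>M interpolate nab0 nab1 t e b + anchor_deriv \<rho> e f \<bullet>\<^sub>M b"
    if "f \<in> Cinf A" "e \<in> S" "b \<in> \<Gamma>" for f e b
  proof -
    show ?thesis
      unfolding i nlc_leibniz[OF n(1) that] nlc_leibniz[OF n(2) that]
      by (simp add: fun_eq_iff fscale_def scaleR_fun_def algebra_simps)
  qed
  moreover have "bilinear_on_sections S \<Gamma> (interpolate nab0 nab1 t)"
    unfolding bilinear_on_sections_def linear_between_def by (simp add: i ss scaleR_add_right mult.commute)
  ultimately show ?thesis unfolding nlc_def by blast
qed

lemma conn_cochain_interpolate:
  assumes n: "nlc nab0" "nlc nab1"
  shows "conn_cochain (interpolate nab0 nab1 t) = conn_cochain nab0 + t *\<^sub>R (conn_cochain nab1 - conn_cochain nab0)"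
proof (rule cochain_eqI)
  fix es
  have "lift_conn (interpolate nab0 nab1 t) x = lift_conn nab0 x + t *\<^sub>R (lift_conn nab1 x - lift_conn nab0 x)" for x
    by (rule endo_eqI) (simp add: app_lift_conn n nlc_interpolate interpolate_apply fun_eq_iff scaleR_fun_def algebra_simps)
  then show "at_list (conn_cochain (interpolate nab0 nab1 t)) es =
      at_list (conn_cochain nab0 + t *\<^sub>R (conn_cochain nab1 - conn_cochain nab0)) es"
    by (cases es rule: remdups_adj.cases) (simp_all add: at_list_one_cochain)
qed

lemma dual_interpolate:
  assumes n: "nlc nab0" "nlc nab1" and d: "dual_conn nab0 nab0'" "dual_conn nab1 nab1'"
  shows "dual_conn (interpolate nab0 nab1 t) (interpolate nab0' nab1' t)"
  unfolding dual_conn_def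
proof (intro ballI conjI)
  fix e s assume e: "e \<in> S" and s: "s \<in> \<Gamma>"
  note i = interpolate_apply
  note ss = dual_connD[OF d(1) e] dual_connD[OF d(2) e] section_closed nlc_section[OF n(1) e] nlc_section[OF n(2) e] pairing_simps
  show "interpolate nab0' nab1' t e s \<in> \<Gamma>" unfolding i using s by (simp add: ss)
  fix u assume u: "u \<in> \<Gamma>"
  show "pairing (interpolate nab0' nab1' t e s) u =
      anchor_deriv \<rho> e (pairing s u) - pairing s (interpolate nab0 nab1 t e u)"
    unfolding i using s u by (simp add: ss) (simp add: algebra_simps)
qed

lemma linear_point: "linear (\<lambda>f :: 'm \<Rightarrow> real. f x)"
  by (intro linearI) (simp_all add: scaleR_fun_def)

lemma cs_eq_trl:
  assumes n: "nlc nab0" "nlc nab1" and es: "es \<in> tuples (2 * m + 1) S" and N: "N \<ge> 3 * m + 1"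
  shows "cs A br B (Suc m) nab0 nab1 es =
    fact (Suc m) *\<^sub>R TA.trl (TA.cs_cochain N m (conn_cochain nab0) (conn_cochain nab1 - conn_cochain nab0)) es"
proof
  fix x
  show "cs A br B (Suc m) nab0 nab1 es x =
    (fact (Suc m) *\<^sub>R TA.trl (TA.cs_cochain N m (conn_cochain nab0) (conn_cochain nab1 - conn_cochain nab0)) es) x"
    unfolding cs_def diff_Suc_1 trace_odot[OF n nlc_interpolate[OF n] es] conn_cochain_interpolate[OF n]
    by (simp add: scaleR_fun_def TA.cs_integral[OF linear_point is_conn[OF n(1)] is_form_diff[OF n] N] del: fact_Suc)
qed

end

section \<open>Cochains and coboundaries\<close>

lemma bder_eq_sum: "bder br x es F = (\<Sum>j<length es. F (es[j := br x (es ! j)]))"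
  by (induction es arbitrary: F) (simp_all add: sum.lessThan_Suc_shift contr_def del: sum.lessThan_Suc)

lemma sum_greaterThanLessThan_Suc: "(\<Sum>j\<in>{Suc i<..<Suc n}. h j) = (\<Sum>j\<in>{i<..<n}. h (Suc j))"
  by (rule sum.reindex_bij_witness[of _ Suc "\<lambda>j. j - 1"]) auto

lemma sum_greaterThanLessThan_0: "(\<Sum>j\<in>{0<..<Suc n}. h j) = (\<Sum>j<n. h (Suc j))"
  by (rule sum.reindex_bij_witness[of _ Suc "\<lambda>j. j - 1"]) auto

lemma omit_Cons: "omit 0 (x # xs) = xs" "omit (Suc i) (x # xs) = x # omit i xs"
  by (simp_all add: omit_def)

text \<open>Splitting off the terms with i = 0 from the two sums leaves the anchor term and the Lie
  derivative; the rest is minus the differential of the contraction.\<close>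

lemma loday_d_eq_sdiff: "loday_d br \<rho> c es = sdiff br (anchor_deriv \<rho>) es c"
proof (induction es arbitrary: c)
  case Nil
  show ?case by (simp add: loday_d_def)
next
  case (Cons x es)
  have "loday_d br \<rho> c (x # es) = anchor_deriv \<rho> x (c es) - bder br x es c - loday_d br \<rho> (contr x c) es"
    unfolding loday_d_def bder_eq_sum
    by (simp add: sum.lessThan_Suc_shift sum_greaterThanLessThan_Suc sum_greaterThanLessThan_0 omit_Cons contr_def
        sum_negf del: sum.lessThan_Suc)
  then show ?case by (simp add: Cons.IH)
qed

lemma omit_tuples: "es \<in> tuples (Suc k) T \<Longrightarrow> i < Suc k \<Longrightarrow> omit i es \<in> tuples k T"
  using set_take_subset[of i es] set_drop_subset[of "Suc i" es] by (auto simp: omit_def tuples_def)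

context loday_setup
begin

lemma loday_d_trl:
  assumes n: "nlc nab" and X: "TA.Cmv X" and es: "set es \<subseteq> S"
  shows "loday_d br \<rho> (TA.trl X) es = TA.trl (covd brP (conn_cochain nab) X) es"
proof -
  have b: "set es \<subseteq> S \<Longrightarrow> x \<in> S \<Longrightarrow> bder br x es F = bder brP x es F" for x es and F :: "('m \<Rightarrow> 'e) list \<Rightarrow> 'm \<Rightarrow> real"
    by (induction es arbitrary: F) (simp_all add: brP_def PE)
  have "sdiff br (anchor_deriv \<rho>) es c = sdiff brP rhoP es c" for c
    using es by (induction es arbitrary: c) (simp_all add: b rhoP_def PE)
  then show ?thesis unfolding loday_d_eq_sdiff using TA.sdiff_trl[OF is_conn[OF n] X] by simp
qed

lemma update_tuples: "es \<in> tuples k S \<Longrightarrow> i < k \<Longrightarrow> j < k \<Longrightarrow> es[j := br (es ! i) (es ! j)] \<in> tuples k S"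
  using set_update_subset_insert[of es j] br_section[OF nth_mem[THEN subsetD[rotated]] nth_mem[THEN subsetD[rotated]]]
  unfolding tuples_def by (auto dest!: set_update_subset_insert[THEN subsetD])

lemma loday_d_cong:
  assumes "\<And>es. es \<in> tuples k S \<Longrightarrow> c es = c' es" "es \<in> tuples (Suc k) S"
  shows "loday_d br \<rho> c es = loday_d br \<rho> c' es"
proof -
  have l: "length es = Suc k" using assms(2) by (simp add: tuples_def)
  show ?thesis unfolding loday_d_def l using assms
    by (intro arg_cong2[where f = "(+)"] sum.cong refl) (simp_all add: omit_tuples update_tuples)
qed

section \<open>Linearity of cochains, coboundaries and cohomology classes\<close>

lemma diff_op_le_cong: "(\<And>e. e \<in> S \<Longrightarrow> P e = P' e) \<Longrightarrow> diff_op_le n A E P \<Longrightarrow> diff_op_le n A E P'"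
proof (induction n arbitrary: P P')
  case 0
  then show ?case by (simp add: EB.sections_fscale)
next
  case (Suc n)
  show ?case unfolding diff_op_le.simps
  proof
    fix f assume f: "f \<in> Cinf A"
    show "diff_op_le n A E (\<lambda>e. P' (f \<bullet>\<^sub>M e) - f * P' e)"
    proof (rule Suc.IH)
      show "diff_op_le n A E (\<lambda>e. P (f \<bullet>\<^sub>M e) - f * P e)" using Suc.prems(2) f unfolding diff_op_le.simps by blast
      show "P (f \<bullet>\<^sub>M e) - f * P e = P' (f \<bullet>\<^sub>M e) - f * P' e" if "e \<in> S" for e
        unfolding Suc.prems(1)[OF that] Suc.prems(1)[OF EB.sections_fscale[OF f that]] ..
    qed
  qed
qed

lemma diff_op_le_add: "diff_op_le n A E P \<Longrightarrow> diff_op_le n A E P' \<Longrightarrow> diff_op_le n A E (\<lambda>e. P e + P' e)"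
proof (induction n arbitrary: P P')
  case 0
  then show ?case by (simp add: fun_eq_iff distrib_left)
next
  case (Suc n)
  show ?case unfolding diff_op_le.simps
  proof
    fix f assume f: "f \<in> Cinf A"
    have "diff_op_le n A E (\<lambda>e. (P (f \<bullet>\<^sub>M e) - f * P e) + (P' (f \<bullet>\<^sub>M e) - f * P' e))"
      using Suc.prems f unfolding diff_op_le.simps by (intro Suc.IH) blast+
    moreover have "(P (f \<bullet>\<^sub>M e) - f * P e) + (P' (f \<bullet>\<^sub>M e) - f * P' e) = (P (f \<bullet>\<^sub>M e) + P' (f \<bullet>\<^sub>M e)) - f * (P e + P' e)" for e
      by (simp add: algebra_simps)
    ultimately show "diff_op_le n A E (\<lambda>e. (P (f \<bullet>\<^sub>M e) + P' (f \<bullet>\<^sub>M e)) - f * (P e + P' e))" by (simp only:)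
  qed
qed

lemma diff_op_le_scaleR: "diff_op_le n A E P \<Longrightarrow> diff_op_le n A E (\<lambda>e. c *\<^sub>R P e)"
proof (induction n arbitrary: P)
  case 0
  then show ?case by (simp add: scaleR_fun_def fun_eq_iff)
next
  case (Suc n)
  show ?case unfolding diff_op_le.simps
  proof
    fix f assume f: "f \<in> Cinf A"
    have "diff_op_le n A E (\<lambda>e. c *\<^sub>R (P (f \<bullet>\<^sub>M e) - f * P e))"
      using Suc.prems f unfolding diff_op_le.simps by (intro Suc.IH) blast
    moreover have "c *\<^sub>R (P (f \<bullet>\<^sub>M e) - f * P e) = c *\<^sub>R P (f \<bullet>\<^sub>M e) - f * (c *\<^sub>R P e)" for e
      by (simp add: scaleR_fun_def fun_eq_iff algebra_simps)
    ultimately show "diff_op_le n A E (\<lambda>e. c *\<^sub>R P (f \<bullet>\<^sub>M e) - f * (c *\<^sub>R P e))" by (simp only:)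
  qed
qed

lemma diff_op_le_Suc: "diff_op_le n A E P \<Longrightarrow> diff_op_le (Suc n) A E P"
proof (induction n arbitrary: P)
  case 0
  then show ?case by (auto simp: EB.sections_fscale)
qed auto

lemma diff_op_le_mono: "diff_op_le n A E P \<Longrightarrow> n \<le> m \<Longrightarrow> diff_op_le m A E P"
  by (induction m) (auto simp: le_Suc_eq intro: diff_op_le_Suc simp del: diff_op_le.simps)

lemma diff_op_le_zero: "diff_op_le n A E (\<lambda>e. 0)"
proof (induction n)
  case (Suc n)
  have "0 - f * 0 = (0 :: 'm \<Rightarrow> real)" for f by simp
  then show ?case using Suc unfolding diff_op_le.simps by (simp only:) blast
qed (simp add: fun_eq_iff)

lemmas subspace_functions = subspace_Cinf[OF manifold]

lemma subspace_cochains: "subspace (cochains A E k)"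
  unfolding subspace_def
proof (intro conjI ballI allI)
  show "0 \<in> cochains A E k"
    using subspace_0[OF subspace_functions] diff_op_le_zero by (auto simp: cochains_def linear_between_def)
next
  fix D D' :: "('m \<Rightarrow> 'e) list \<Rightarrow> 'm \<Rightarrow> real" assume D: "D \<in> cochains A E k" and D': "D' \<in> cochains A E k"
  show "D + D' \<in> cochains A E k" unfolding cochains_def
  proof (intro CollectI ballI conjI allI impI)
    fix es assume es: "es \<in> tuples k S"
    show "(D + D') es \<in> Cinf A" using D D' es by (simp add: cochains_def subspace_add[OF subspace_functions])
    fix i assume i: "i < k"
    let ?P = "\<lambda>e. D (es[i := e])" and ?P' = "\<lambda>e. D' (es[i := e])"
    have l: "linear_between S (Cinf A) ?P" "linear_between S (Cinf A) ?P'"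
      and "\<exists>n. diff_op_le n A E ?P" "\<exists>n. diff_op_le n A E ?P'"
      using D D' es i unfolding cochains_def by blast+
    then obtain n n' where "diff_op_le n A E ?P" "diff_op_le n' A E ?P'" by blast
    then have "diff_op_le (max n n') A E (\<lambda>e. ?P e + ?P' e)"
      by (intro diff_op_le_add) (auto elim: diff_op_le_mono)
    then show "\<exists>n. diff_op_le n A E (\<lambda>e. (D + D') (es[i := e]))" by auto
    show "linear_between S (Cinf A) (\<lambda>e. (D + D') (es[i := e]))"
      using l unfolding linear_between_def by (simp add: subspace_add[OF subspace_functions] scaleR_add_right)
  qed
next
  fix D :: "('m \<Rightarrow> 'e) list \<Rightarrow> 'm \<Rightarrow> real" and c :: real assume D: "D \<in> cochains A E k"
  have v: "(c *\<^sub>R D) us = c *\<^sub>R D us" for us by (simp add: scaleR_fun_def[of c D])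
  show "c *\<^sub>R D \<in> cochains A E k" unfolding cochains_def v
  proof (intro CollectI ballI conjI allI impI)
    fix es assume es: "es \<in> tuples k S"
    show "c *\<^sub>R D es \<in> Cinf A" using D es by (simp add: cochains_def subspace_scale[OF subspace_functions])
    fix i assume i: "i < k"
    let ?P = "\<lambda>e. D (es[i := e])"
    have l: "linear_between S (Cinf A) ?P" and "\<exists>n. diff_op_le n A E ?P"
      using D es i unfolding cochains_def by blast+
    then show "\<exists>n. diff_op_le n A E (\<lambda>e. c *\<^sub>R ?P e)" using diff_op_le_scaleR by blast
    show "linear_between S (Cinf A) (\<lambda>e. c *\<^sub>R ?P e)"
      using l unfolding linear_between_def by (simp add: subspace_scale[OF subspace_functions] scaleR_add_right mult.commute)
  qed
qed

lemma cochains_cong: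
  assumes "\<And>es. es \<in> tuples k S \<Longrightarrow> D es = D' es" "D \<in> cochains A E k" shows "D' \<in> cochains A E k"
  unfolding cochains_def
proof (intro CollectI ballI conjI allI impI)
  fix es assume es: "es \<in> tuples k S"
  show "D' es \<in> Cinf A" using assms es by (simp add: cochains_def)
  fix i assume i: "i < k"
  have eq: "D (es[i := e]) = D' (es[i := e])" if "e \<in> S" for e
    using assms(1)[of "es[i := e]"] es that set_update_subset_insert[of es i e] by (auto simp: tuples_def)
  have l: "linear_between S (Cinf A) (\<lambda>e. D (es[i := e]))" "\<exists>n. diff_op_le n A E (\<lambda>e. D (es[i := e]))"
    using assms(2) es i unfolding cochains_def by blast+
  show "linear_between S (Cinf A) (\<lambda>e. D' (es[i := e]))"
    using l(1) eq subspace_add[OF EB.subspace_sections] subspace_scale[OF EB.subspace_sections]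
    unfolding linear_between_def by simp
  show "\<exists>n. diff_op_le n A E (\<lambda>e. D' (es[i := e]))" using l(2) diff_op_le_cong[of "\<lambda>e. D (es[i := e])" "\<lambda>e. D' (es[i := e])", OF eq] by blast
qed

lemma loday_d_add:
  assumes "C \<in> cochains A E k" "C' \<in> cochains A E k" "es \<in> tuples (Suc k) S"
  shows "loday_d br \<rho> (C + C') es = loday_d br \<rho> C es + loday_d br \<rho> C' es"
proof -
  have l: "length es = Suc k" using assms(3) by (simp add: tuples_def)
  have "anchor_deriv \<rho> (es ! i) (C (omit i es) + C' (omit i es)) =
      anchor_deriv \<rho> (es ! i) (C (omit i es)) + anchor_deriv \<rho> (es ! i) (C' (omit i es))" if "i < Suc k" for i
    using assms that omit_tuples[OF assms(3) that]
    by (intro anchor_derivation) (auto simp: cochains_def tuples_def dest: nth_mem)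
  then show ?thesis unfolding loday_d_def l
    by (simp add: scaleR_add_right sum.distrib sum_subtractf sum_negf del: sum.lessThan_Suc)
qed

lemma loday_d_scaleR:
  assumes "C \<in> cochains A E k" "es \<in> tuples (Suc k) S"
  shows "loday_d br \<rho> (c *\<^sub>R C) es = c *\<^sub>R loday_d br \<rho> C es"
proof -
  have l: "length es = Suc k" using assms(2) by (simp add: tuples_def)
  have v: "(c *\<^sub>R C) us = c *\<^sub>R C us" for us by (simp add: scaleR_fun_def[of c C])
  have "anchor_deriv \<rho> (es ! i) (c *\<^sub>R C (omit i es)) = c *\<^sub>R anchor_deriv \<rho> (es ! i) (C (omit i es))" if "i < Suc k" for i
    using assms that omit_tuples[OF assms(2) that]
    by (intro anchor_scaleR) (auto simp: cochains_def tuples_def dest: nth_mem)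
  then show ?thesis unfolding loday_d_def l v
    by (simp add: scaleR_add_right scaleR_sum_right mult.commute del: sum.lessThan_Suc)
qed

lemma coboundaries_Suc:
  "D \<in> coboundaries A E br \<rho> (Suc k) \<longleftrightarrow> (\<exists>C\<in>cochains A E k. \<forall>es\<in>tuples (Suc k) S. D es = loday_d br \<rho> C es)"
  by (simp add: coboundaries_def)

lemma coboundaries_cong:
  "(\<And>es. es \<in> tuples (Suc k) S \<Longrightarrow> D es = D' es) \<Longrightarrow>
    D \<in> coboundaries A E br \<rho> (Suc k) \<longleftrightarrow> D' \<in> coboundaries A E br \<rho> (Suc k)"
  by (simp add: coboundaries_Suc)

lemma subspace_coboundaries: "subspace (coboundaries A E br \<rho> (Suc k))"
  unfolding subspace_def
proof (intro conjI ballI allI)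
  have "loday_d br \<rho> 0 es = 0" if "es \<in> tuples (Suc k) S" for es
    using loday_d_scaleR[OF subspace_0[OF subspace_cochains] that, of 0] by simp
  then show "0 \<in> coboundaries A E br \<rho> (Suc k)"
    unfolding coboundaries_Suc using subspace_0[OF subspace_cochains] by auto
next
  fix D D' assume "D \<in> coboundaries A E br \<rho> (Suc k)" "D' \<in> coboundaries A E br \<rho> (Suc k)"
  then obtain C C' where C: "C \<in> cochains A E k" "\<And>es. es \<in> tuples (Suc k) S \<Longrightarrow> D es = loday_d br \<rho> C es"
    and C': "C' \<in> cochains A E k" "\<And>es. es \<in> tuples (Suc k) S \<Longrightarrow> D' es = loday_d br \<rho> C' es"
    unfolding coboundaries_Suc by blast
  show "D + D' \<in> coboundaries A E br \<rho> (Suc k)" unfolding coboundaries_Suc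
    using C C' loday_d_add[OF C(1) C'(1)] by (intro bexI[of _ "C + C'"] ballI) (simp_all add: subspace_add[OF subspace_cochains])
next
  fix D and c :: real assume "D \<in> coboundaries A E br \<rho> (Suc k)"
  then obtain C where C: "C \<in> cochains A E k" "\<And>es. es \<in> tuples (Suc k) S \<Longrightarrow> D es = loday_d br \<rho> C es"
    unfolding coboundaries_Suc by blast
  have v: "(c *\<^sub>R D) es = c *\<^sub>R D es" for es by (simp add: scaleR_fun_def[of c D])
  show "c *\<^sub>R D \<in> coboundaries A E br \<rho> (Suc k)" unfolding coboundaries_Suc v
    using C loday_d_scaleR[OF C(1), of _ c] subspace_scale[OF subspace_cochains C(1), of c]
    by (intro bexI[of _ "c *\<^sub>R C"] ballI) (simp_all only:)
qed

lemma coh_class_cong: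
  assumes "D - D' \<in> coboundaries A E br \<rho> (Suc k)"
  shows "coh_class A E br \<rho> (Suc k) D = coh_class A E br \<rho> (Suc k) D'"
proof -
  have "X - D \<in> coboundaries A E br \<rho> (Suc k) \<longleftrightarrow> X - D' \<in> coboundaries A E br \<rho> (Suc k)" for X
    using subspace_add[OF subspace_coboundaries[of k], of "X - D" "D - D'"] assms
      subspace_diff[OF subspace_coboundaries[of k], of "X - D'" "D - D'"] by auto
  then show ?thesis by (simp add: coh_class_def)
qed

text \<open>The cosets in the union are all equal, and the union is not empty because a cocycle lies
  in its own class.\<close>

lemma coh_scale_coh_class:
  assumes "D \<in> cocycles A E br \<rho> (Suc k)"
  shows "coh_scale A E br \<rho> (Suc k) c (coh_class A E br \<rho> (Suc k) D) = coh_class A E br \<rho> (Suc k) (c *\<^sub>R D)"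
proof -
  have "coh_class A E br \<rho> (Suc k) (c *\<^sub>R D') = coh_class A E br \<rho> (Suc k) (c *\<^sub>R D)"
    if "D' \<in> coh_class A E br \<rho> (Suc k) D" for D'
    using that subspace_scale[OF subspace_coboundaries[of k], of "D' - D" c]
    by (intro coh_class_cong) (simp add: coh_class_def scaleR_diff_right)
  moreover have "D \<in> coh_class A E br \<rho> (Suc k) D"
    using assms subspace_0[OF subspace_coboundaries] by (simp add: coh_class_def)
  ultimately show ?thesis unfolding coh_scale_def by blast
qed

end

section \<open>Secondary classes of flat and metric connections\<close>

lemma interpolate_swap: "interpolate nab' nab t = interpolate nab nab' (1 - t)"
  by (simp add: interpolate_def)

context loday_setup
begin

text \<open>Conjugation exchanges the ends of the segment and sends the connection at t to the one
  at 1 - t. Duality gives (-1)^(m+1), and reversing the direction of the segment gives one more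
  sign.\<close>

lemma trl_reflect:
  fixes nab nab' :: "('m, 'e, 'b) conn" and m :: nat and es :: "('m \<Rightarrow> 'e) list"
  assumes n: "nlc nab" and d: "dual_conn nab nab'"
  defines "f \<equiv> \<lambda>t. TA.trl ((conn_cochain nab' - conn_cochain nab) *
    curv brP (conn_cochain nab + t *\<^sub>R (conn_cochain nab' - conn_cochain nab)) ^ m) es"
  shows "f (1 - t) = (-1) ^ m *\<^sub>R f t"
proof -
  note n' = nlc_dual[OF n d] and d' = dual_conn_sym[OF n d]
  define G where "G = curv brP (conn_cochain nab + (1 - t) *\<^sub>R (conn_cochain nab' - conn_cochain nab)) ^ m"
  have "TA.trl ((conn_cochain nab - conn_cochain nab') * curv brP (conn_cochain (interpolate nab' nab t)) ^ m) es =
    (-1) ^ Suc m *\<^sub>R TA.trl ((conn_cochain nab' - conn_cochain nab) * curv brP (conn_cochain (interpolate nab nab' t)) ^ m) es"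
    by (rule trl_dual_form[OF n n' nlc_interpolate[OF n n'] d d' dual_interpolate[OF n n' d d']])
  then have "TA.trl ((conn_cochain nab - conn_cochain nab') * G) es = (-1) ^ Suc m *\<^sub>R f t"
    unfolding interpolate_swap[of nab' nab] conn_cochain_interpolate[OF n n'] f_def G_def .
  moreover have "(conn_cochain nab - conn_cochain nab') * G = (-1) *\<^sub>R ((conn_cochain nab' - conn_cochain nab) * G)"
    by (simp add: left_diff_distrib)
  ultimately have "(-1) *\<^sub>R f (1 - t) = (-1) ^ Suc m *\<^sub>R f t"
    unfolding f_def G_def by (simp only: TA.trl_scale)
  then show ?thesis by simp
qed

lemma good_cs_cochain:
  assumes n: "nlc nab0" "nlc nab1"
  shows "good (TA.cs_cochain N m (conn_cochain nab0) (conn_cochain nab1 - conn_cochain nab0))"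
  unfolding TA.cs_cochain_def conn_cochain_interpolate[OF n, symmetric]
  by (intro good_quad good_mult good_form good_power good_curv nlc_interpolate n)

lemma good_Cmv: "good X \<Longrightarrow> TA.Cmv X"
  by (simp add: good_def)

lemma flat_curv_zero:
  assumes n: "nlc nab" and f: "flat A E br B nab"
  shows "curv brP (conn_cochain nab) = 0"
proof (rule cochain_eqI)
  fix es
  have "at_list (curv brP (conn_cochain nab)) [x, y] = 0" for x y
    by (rule endo_eqI) (use f PE(2) PB(2) in \<open>simp add: curvature_value[OF n] flat_def\<close>)
  then show "at_list (curv brP (conn_cochain nab)) es = at_list 0 es"
    by (cases es rule: remdups_adj.cases; cases "tl (tl es)") (auto simp: at_list_curv)
qed

text \<open>The curvature of a metric connection is skew-adjoint, so an odd power has a trace equal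
  to its own negative.\<close>

lemma trl_metric_power:
  assumes n: "nlc nab" "dual_conn nab nab" and m: "odd m"
  shows "TA.trl (curv brP (conn_cochain nab) ^ m) es = 0"
  using trl_dual_power[OF n, of m es] m by (simp add: eq_minus_self_zero)

text \<open>Transgression leaves the power traces at the two ends. At \<open>nab\<close> the
  curvature is zero; at \<open>nabm\<close> the exponent \<open>Suc m\<close> is odd and
  skew-adjointness applies.\<close>

lemma cs_metric_cocycle:
  assumes n: "nlc nab" "nlc nabm" and f: "flat A E br B nab" and d: "dual_conn nabm nabm" and m: "even m"
  shows "cs A br B (Suc m) nab nabm \<in> cocycles A E br \<rho> (2 * m + 1)"
proof -
  let ?W = "conn_cochain nab" and ?a = "conn_cochain nabm - conn_cochain nab"
  define K where "K = TA.cs_cochain (3 * m + 4) m ?W ?a"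
  define X where "X = fact (Suc m) *\<^sub>R K"
  have gX: "good X" unfolding X_def K_def by (intro good_scaleR good_cs_cochain n)
  have cs: "TA.trl X es = cs A br B (Suc m) nab nabm es" if "es \<in> tuples (2 * m + 1) S" for es
    unfolding X_def K_def TA.trl_scale by (rule cs_eq_trl[OF n that, symmetric]) simp
  have zero: "TA.trl (covd brP ?W K) es = 0" for es
  proof
    fix x
    have "real (Suc m) * TA.trl (covd brP ?W K) es x =
        TA.trl (curv brP (?W + ?a) ^ Suc m) es x - TA.trl (curv brP ?W ^ Suc m) es x"
      unfolding K_def by (rule TA.trl_covd_cs[OF linear_point is_conn[OF n(1)] is_form_diff[OF n]]) simp
    also have "\<dots> = 0"
      using trl_metric_power[OF n(2) d, of "Suc m"] m by (simp add: flat_curv_zero[OF n(1) f] TA.trl_zero)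
    finally show "TA.trl (covd brP ?W K) es x = 0 x" by simp
  qed
  have "loday_d br \<rho> (cs A br B (Suc m) nab nabm) es = 0" if es: "es \<in> tuples (Suc (2 * m + 1)) S" for es
  proof -
    have "loday_d br \<rho> (cs A br B (Suc m) nab nabm) es = loday_d br \<rho> (TA.trl X) es"
      by (rule loday_d_cong[OF cs[symmetric] es])
    also have "\<dots> = TA.trl (covd brP ?W X) es"
      using es by (intro loday_d_trl[OF n(1) good_Cmv[OF gX]]) (simp add: tuples_def)
    also have "\<dots> = 0"
      unfolding X_def linear_scale[OF TA.linear_covd] TA.trl_scale zero by simp
    finally show ?thesis .
  qed
  then show ?thesis
    unfolding cocycles_def using cochains_cong[OF cs good_cochain[OF gX]] by simp
qed

text \<open>Here p is \<open>Suc m\<close> and even. The integrand is odd about 1/2, so the cochain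
  itself vanishes on sections and not only its class.\<close>

lemma cs_conjugate_even:
  assumes n: "nlc nab" and d: "dual_conn nab nab'" and m: "odd m" and es: "es \<in> tuples (2 * m + 1) S"
  shows "cs A br B (Suc m) nab nab' es = 0"
proof
  fix x
  note n' = nlc_dual[OF n d]
  define f where "f t = TA.trl ((conn_cochain nab' - conn_cochain nab) *
    curv brP (conn_cochain nab + t *\<^sub>R (conn_cochain nab' - conn_cochain nab)) ^ m) es x" for t
  have c: "continuous_on UNIV f"
    unfolding f_def by (rule TA.continuous_cs_integrand[OF linear_point is_conn[OF n] is_form_diff[OF n n']])
  have "f (1 - t) = - f t" for t
    unfolding f_def trl_reflect[OF n d] using m by simp
  then have "integral {0..1} f = - integral {0..1} f"
    using integral_reflect_unit[OF c] by simp
  then have "TA.trl (TA.cs_cochain (3 * m + 1) m (conn_cochain nab) (conn_cochain nab' - conn_cochain nab)) es x = 0"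
    unfolding TA.cs_integral[OF linear_point is_conn[OF n] is_form_diff[OF n n'] order_refl] f_def by simp
  then show "cs A br B (Suc m) nab nab' es x = 0 x"
    unfolding cs_eq_trl[OF n n' es order_refl] by (simp add: scaleR_fun_def)
qed

text \<open>The midpoint h of \<open>nab\<close> and its conjugate is metric, and
  \<open>homotopy_cochain\<close> for the move of the endpoint from h to \<open>nabm\<close>
  provides the primitive.\<close>

lemma cs_conjugate_odd:
  assumes n: "nlc nab" "nlc nabm" and d: "dual_conn nab nab'" "dual_conn nabm nabm" and m: "even m"
  shows "cs A br B (Suc m) nab nab' - 2 *\<^sub>R cs A br B (Suc m) nab nabm \<in> coboundaries A E br \<rho> (Suc (2 * m))"
proof -
  note n' = nlc_dual[OF n(1) d(1)] and d' = dual_conn_sym[OF n(1) d(1)]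
  define N where "N = 3 * m + 3"
  define h where "h = interpolate nab nab' (1/2)"
  let ?W = "conn_cochain nab" and ?a = "conn_cochain nab' - conn_cochain nab" and ?am = "conn_cochain nabm - conn_cochain nab"
  define C where "C = (1/2 :: real) *\<^sub>R ?a"
  define D where "D = conn_cochain nabm - conn_cochain h"
  have nh: "nlc h" unfolding h_def by (rule nlc_interpolate[OF n(1) n'])
  have dh: "dual_conn h h"
    \<comment> \<open>Conjugation exchanges the ends of the segment, and the midpoint is fixed by
      the exchange.\<close>
    using dual_interpolate[OF n(1) n' d(1) d', of "1/2"] unfolding h_def by (simp add: interpolate_swap[of nab' nab])
  have Wh: "conn_cochain h = ?W + C" unfolding h_def C_def by (rule conn_cochain_interpolate[OF n(1) n'])
  have CD: "C + D = ?am" unfolding D_def Wh by simp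
  have nk: "nlc (interpolate h nabm s)" and dk: "dual_conn (interpolate h nabm s) (interpolate h nabm s)"
    and Wk: "conn_cochain (interpolate h nabm s) = ?W + (C + s *\<^sub>R D)" for s
    using nlc_interpolate[OF nh n(2)] dual_interpolate[OF nh n(2) dh d(2)] conn_cochain_interpolate[OF nh n(2)]
    by (simp_all add: Wh D_def)
  have fC: "TA.is_form C" and fD: "TA.is_form D"
    unfolding C_def D_def by (intro TA.form_scale is_form_diff n nh n')+
  define K where "K = TA.homotopy_cochain N m ?W C D"
  \<comment> \<open>Every member of the two-parameter family is an interpolation of connections, so
    the regularity of curvatures carries over to the primitive.\<close>
  have gF: "good (curv brP (TA.form_family ?W C D s t))" for s t
  proof -
    have "TA.form_family ?W C D s t = conn_cochain (interpolate nab (interpolate h nabm s) t)"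
      unfolding conn_cochain_interpolate[OF n(1) nk] TA.form_family_def Wk by simp
    then show ?thesis using good_curv[OF nlc_interpolate[OF n(1) nk]] by simp
  qed
  have gK: "good K"
    unfolding K_def TA.homotopy_cochain_def
    by (intro good_quad good_scaleR good_sum good_mult good_power gF good_add)
      (auto simp: C_def D_def intro!: good_scaleR good_form n nh n')
  have key: "TA.trl (covd brP ?W K) es = TA.trl (TA.cs_cochain N m ?W ?am) es - (1/2) *\<^sub>R TA.trl (TA.cs_cochain N m ?W ?a) es" for es
  proof
    fix x
    \<comment> \<open>Direction and connection are both self-dual here and m is even, so duality
      gives the sign -1.\<close>
    have "TA.trl (D * curv brP (?W + (C + s *\<^sub>R D)) ^ m) es = 0" for s
    proof -
      have "TA.trl (D * curv brP (?W + (C + s *\<^sub>R D)) ^ m) es = - TA.trl (D * curv brP (?W + (C + s *\<^sub>R D)) ^ m) es"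
        using trl_dual_form[OF nh n(2) nk dh d(2) dk, of s m es] m unfolding Wk D_def by simp
      then show ?thesis by (rule eq_minus_self_zero)
    qed
    then have hom: "TA.trl (covd brP ?W K) es x =
        TA.trl (TA.cs_cochain N m ?W ?am) es x - TA.trl (TA.cs_cochain N m ?W C) es x"
      using TA.cs_homotopy[OF linear_point[of x] is_conn[OF n(1)] fC fD, of m N es]
      unfolding K_def CD by (simp add: N_def quad_def)
    define f where "f t = TA.trl (?a * curv brP (?W + t *\<^sub>R ?a) ^ m) es x" for t
    have c: "continuous_on UNIV f"
      unfolding f_def by (rule TA.continuous_cs_integrand[OF linear_point is_conn[OF n(1)] is_form_diff[OF n(1) n']])
    have sym: "f (1 - t) = f t" for t unfolding f_def trl_reflect[OF n(1) d(1)] using m by simp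
    \<comment> \<open>The segment to the midpoint is the first half of the segment to the conjugate.
      By the symmetry of f about 1/2 it contributes half of the full integral.\<close>
    have half: "TA.trl (C * curv brP (?W + t *\<^sub>R C) ^ m) es x = f (t / 2) / 2" for t
    proof -
      have "C * curv brP (?W + t *\<^sub>R C) ^ m = (1/2 :: real) *\<^sub>R (?a * curv brP (?W + (t / 2) *\<^sub>R ?a) ^ m)"
        unfolding C_def by simp
      then show ?thesis unfolding f_def by (simp only: TA.trl_scale scaleR_fun_def) simp
    qed
    have "TA.trl (TA.cs_cochain N m ?W C) es x = integral {0..1} (\<lambda>t. TA.trl (C * curv brP (?W + t *\<^sub>R C) ^ m) es x)"
      by (rule TA.cs_integral[OF linear_point is_conn[OF n(1)] fC]) (simp add: N_def)
    also have "\<dots> = integral {0..1} (\<lambda>t. f (t / 2) / 2)" by (simp only: half)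
    also have "\<dots> = integral {0..1} f / 2" using integral_half_symmetric[OF c sym] by simp
    also have "integral {0..1} f = TA.trl (TA.cs_cochain N m ?W ?a) es x"
      unfolding f_def by (rule TA.cs_integral[OF linear_point is_conn[OF n(1)] is_form_diff[OF n(1) n'], symmetric]) (simp add: N_def)
    finally show "TA.trl (covd brP ?W K) es x =
        (TA.trl (TA.cs_cochain N m ?W ?am) es - (1/2) *\<^sub>R TA.trl (TA.cs_cochain N m ?W ?a) es) x"
      unfolding hom by (simp add: scaleR_fun_def)
  qed
  \<comment> \<open>The homotopy yields the cochain for \<open>nabm\<close> minus half the one for
    the conjugate; -2 clears the half and the order of the difference, and the factorial restores
    the normalisation of \<open>cs\<close>.\<close>
  define c :: real where "c = - 2 * fact (Suc m)"
  have gX: "good (c *\<^sub>R K)" by (rule good_scaleR[OF gK])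
  have "(cs A br B (Suc m) nab nab' - 2 *\<^sub>R cs A br B (Suc m) nab nabm) es = loday_d br \<rho> (TA.trl (c *\<^sub>R K)) es"
    if es: "es \<in> tuples (Suc (2 * m)) S" for es
  proof -
    have es': "es \<in> tuples (2 * m + 1) S" using es by simp
    have N: "3 * m + 1 \<le> N" by (simp add: N_def)
    have "loday_d br \<rho> (TA.trl (c *\<^sub>R K)) es = TA.trl (covd brP ?W (c *\<^sub>R K)) es"
      using es by (intro loday_d_trl[OF n(1) good_Cmv[OF gX]]) (simp add: tuples_def)
    also have "\<dots> = c *\<^sub>R TA.trl (covd brP ?W K) es"
      unfolding linear_scale[OF TA.linear_covd] TA.trl_scale ..
    also have "\<dots> = fact (Suc m) *\<^sub>R TA.trl (TA.cs_cochain N m ?W ?a) es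
        - 2 *\<^sub>R (fact (Suc m) *\<^sub>R TA.trl (TA.cs_cochain N m ?W ?am) es)"
      unfolding key c_def by (simp add: scaleR_diff_right del: fact_Suc)
    also have "\<dots> = cs A br B (Suc m) nab nab' es - 2 *\<^sub>R cs A br B (Suc m) nab nabm es"
      unfolding cs_eq_trl[OF n(1) n' es' N] cs_eq_trl[OF n es' N] ..
    finally show ?thesis by (simp add: scaleR_fun_def[of 2 "cs A br B (Suc m) nab nabm"])
  qed
  then show ?thesis unfolding coboundaries_Suc using good_cochain[OF gX] by blast
qed

end

hide_const (open) Conjugate.conjugate

theorem theorem4p26:
  fixes A :: "('m::{t2_space,second_countable_topology}, 'd::real_inner) chart set"
    and E :: "('m, 'e::real_vector) vbundle"
    and br :: "('m \<Rightarrow> 'e) \<Rightarrow> ('m \<Rightarrow> 'e) \<Rightarrow> ('m \<Rightarrow> 'e)"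
    and \<rho> :: "'m \<Rightarrow> 'e \<Rightarrow> 'm tangent"
    and \<alpha> :: "'m \<Rightarrow> 'm cotangent \<Rightarrow> 'e \<Rightarrow> 'e \<Rightarrow> 'e"
    and B :: "('m, 'b::real_vector) vbundle"
    and g :: "'m \<Rightarrow> 'b \<Rightarrow> 'b \<Rightarrow> real"
    and nab nabm :: "('m, 'e, 'b) conn"
    and p :: nat
  assumes "smooth_manifold A"
    and "loday_algebroid A E br \<rho> \<alpha>"
    and "smooth_vector_bundle A B"
    and "bundle_metric A B g"
    and "nonlinear_connection A E \<rho> B nab"
    and "flat A E br B nab"
    and "nonlinear_connection A E \<rho> B nabm"
    and "\<And>e b. e \<in> sections A E \<Longrightarrow> b \<in> sections A B \<Longrightarrow> conjugate A \<rho> B g nabm e b = nabm e b"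
    and "p \<ge> 1"
  shows "flat A E br B (conjugate A \<rho> B g nab) \<and>
    (even p \<longrightarrow> secondary_class A E br \<rho> B g nab p = coh_class A E br \<rho> (2 * p - 1) 0) \<and>
    (odd p \<longrightarrow>
       cs A br B p nab nabm \<in> cocycles A E br \<rho> (2 * p - 1) \<and>
       secondary_class A E br \<rho> B g nab p =
         coh_scale A E br \<rho> (2 * p - 1) 2 (coh_class A E br \<rho> (2 * p - 1) (cs A br B p nab nabm)))"
proof -
  interpret loday_setup A B g E br \<rho> \<alpha>
    using assms by unfold_locales
  let ?nab' = "conjugate A \<rho> B g nab"
  obtain m where p: "p = Suc m" using assms(9) by (cases p) auto
  have deg: "2 * p - 1 = Suc (2 * m)" by (simp add: p)
  have n: "nlc nab" "nlc nabm" using assms nonlinear_connection_nlc by blast+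
  have d: "dual_conn nab ?nab'" by (rule dual_conjugate[OF n(1)])
  \<comment> \<open>The metric condition is given on sections only, and those are the arguments that
    \<open>dual_conn\<close> tests.\<close>
  have dm: "dual_conn nabm nabm"
    using dual_conjugate[OF n(2)] assms(8) unfolding dual_conn_def by simp
  have "coh_class A E br \<rho> (Suc (2 * m)) (cs A br B p nab ?nab') = coh_class A E br \<rho> (Suc (2 * m)) 0" if "even p"
  proof (rule coh_class_cong)
    have "cs A br B (Suc m) nab ?nab' es = 0" if "es \<in> tuples (Suc (2 * m)) S" for es
      using cs_conjugate_even[OF n(1) d, of m es] \<open>even p\<close> that by (simp add: p)
    then have "cs A br B (Suc m) nab ?nab' - 0 \<in> coboundaries A E br \<rho> (Suc (2 * m)) \<longleftrightarrow>
        0 \<in> coboundaries A E br \<rho> (Suc (2 * m))"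
      by (intro coboundaries_cong) simp
    then show "cs A br B p nab ?nab' - 0 \<in> coboundaries A E br \<rho> (Suc (2 * m))"
      unfolding p using subspace_0[OF subspace_coboundaries] by blast
  qed
  moreover have "cs A br B p nab nabm \<in> cocycles A E br \<rho> (Suc (2 * m)) \<and>
      coh_class A E br \<rho> (Suc (2 * m)) (cs A br B p nab ?nab') =
      coh_scale A E br \<rho> (Suc (2 * m)) 2 (coh_class A E br \<rho> (Suc (2 * m)) (cs A br B p nab nabm))" if "odd p"
  proof -
    have m: "even m" using that by (simp add: p)
    have z: "cs A br B p nab nabm \<in> cocycles A E br \<rho> (Suc (2 * m))"
      using cs_metric_cocycle[OF n assms(6) dm m] by (simp add: p)
    then show ?thesis
      unfolding coh_scale_coh_class[OF z] using coh_class_cong[OF cs_conjugate_odd[OF n d dm m]] by (simp add: p)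
  qed
  ultimately show ?thesis
    unfolding secondary_class_def deg using flat_dual[OF n(1) d assms(6)] by blast
qed

end
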